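(* Let $\mathfrak{g}$ be a Lie algebra over $\mathbb{K}$. There is a one-to-one correspondence between the structures of $\mathcal{PSB}$-algebra on $\mathfrak{g}$ (whose underlying Lie bracket is the given one) and the structures of $D$-bialgebra on the universal enveloping algebra $\mathcal{U}(\mathfrak{g})$ (equipped with its standard filtration and its standard bialgebra structure).
   Context: Conventions. $\mathbb{K}$ is a field of characteristic zero. Operads are symmetric operads in $\mathbb{K}$-vector spaces, concentrated in arities $n\ge 1$, given by partial compositions $\circ_i:\mathcal{O}(m)\otimes\mathcal{O}(n)\to\mathcal{O}(m+n-1)$, $1\le i\le m$. An $\mathcal{O}$-algebra is a vector space $V$ with an operad morphism $\mathcal{O}\to\operatorname{End}_V$, $\operatorname{End}_V(n)=\operatorname{Hom}(V^{\otimes n},V)$. Sweedler notation $\Delta(X)=X_{(1)}\otimes X_{(2)}$ is used. $D$-bialgebras. A $D$-bialgebra is a bialgebra $(D,\cdot,1,\Delta,\epsilon)$ with a non-associative product $\triangleright:D\otimes D\to D$ and an exhaustive increasing filtration $\mathbb{K}\cdot1=D^0\subset D^1\subset D^2\subset\cdots$ with $D^i\cdot D^j\subset D^{i+j}$, such that: (D1) $1\triangleright X=X$ and $X\triangleright1=\epsilon(X)1$ for all $X\in D$; (D2) $D_1:=\ker(\epsilon)\cap D^1$ equals $\operatorname{Prim}(D)=\{x\in D:\Delta x=x\otimes1+1\otimes x\}$ and generates $(D,\cdot)$; (D3) $\Delta(X\triangleright Y)=(X_{(1)}\triangleright Y_{(1)})\otimes(X_{(2)}\triangleright Y_{(2)})$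 for all $X,Y\in D$; (D4) $X\triangleright(Y\cdot Z)=(X_{(1)}\triangleright Y)\cdot(X_{(2)}\triangleright Z)$ for all $X,Y,Z\in D$; (D5) $(x\cdot X)\triangleright y=x\triangleright(X\triangleright y)-(x\triangleright X)\triangleright y$ for all $x,y\in D_1$, $X\in D$; (D6) $D_1$ is closed under the commutator of $\cdot$. A structure of $D$-bialgebra on $\mathcal{U}(\mathfrak{g})$ is thus a product $\triangleright$ on $\mathcal{U}(\mathfrak{g})$ satisfying these axioms for the standard filtration and bialgebra structure. Trees. A planar rooted tree is an isomorphism class of contractible graphs embedded in the plane with a distinguished root vertex carrying a root half-edge. Trees are drawn with the root at the bottom; edges are oriented toward the root; incoming edges of a vertex are ordered left to right. For a non-root vertex $v$, its $\prec$-successor $v^+$ is the target of its outgoing edge. A partially labeled tree with $n$ labels is a planar rooted tree $T$ with a subset $U$ of its vertices and a bijection $U\to\{1,\dots,n\}$; it is fully labeled if $U$ consists of all the vertices. $\mathcal{PT}_p(n)$ is the vector space with basis the partially labeled trees with $n$ labels, with $\mathbb{S}_n$ permuting labels. For $T\in\mathcal{PT}_p(m)$, $R\in\mathcal{PT}_p(n)$ trees and $1\le i\le m$, let $In(i)$ be the ordered set of incoming edges of the vertex of $T$ labeled $i$. For a map $\phi$ from $In(i)$ to the set of labeled vertices of $R$, $T\circ_i^\phi R$ is obtained by replacing the vertex $i$ by $R$ (identifying the outgoing edge of $i$ with the root-edge of $R$) and grafting, for each labeled vertex $w$ of $R$, the edges of $\phi^{-1}(w)$ onto $w$, in their order, to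 the left of all incoming edges $w$ has in $R$ (i.e. in the minimal angle of $w$); labels $<i$ of $T$ are kept, labels of $R$ are shifted by $i-1$, labels $>i$ of $T$ are shifted by $n-1$. Set $T\circ_i R=\sum_\phi T\circ_i^\phi R$. The operad $\mathcal{LW}$. $\mathcal{L}(n)$ is spanned by the fully labeled trees with $n$ vertices. For $n\ge2$, $\mathcal{W}(n)\subset\mathcal{PT}_p(n)$ is spanned by the partially labeled trees such that: (a) the root is unlabeled; (b) if a non-root vertex is unlabeled, so is its $\prec$-successor; (c) each unlabeled vertex has exactly two incoming edges. $\mathcal{LW}(1)=\mathcal{L}(1)$, $\mathcal{LW}(n)=\mathcal{L}(n)\oplus\mathcal{W}(n)$ for $n\ge2$. For a tree $R\in\mathcal{W}(n)$ with set of unlabeled vertices $V_{unl}(R)$ and $\sigma=(\sigma_v)_v\in\mathbb{S}_2^{V_{unl}(R)}$, $R_\sigma$ is obtained from $R$ by exchanging, at every unlabeled vertex $v$ with $\sigma_v\ne id$, the two maximal subtrees sitting above $v$ (labels move along with the vertices), and $\epsilon(\sigma)=\prod_v \mathrm{sign}(\sigma_v)$. $Con(R)$ is $R$ with all edges joining two unlabeled vertices contracted. For an unlabeled non-root vertex $r$, $Con_r$ contracts the edge from $r$ to $r^+$, the merged vertex keeping the label of $r^+$, if any. Partial compositions of $\mathcal{LW}$: for $T\in\mathcal{LW}(m)$ and $S\in\mathcal{L}(n)$, $T\circ_iS$ is as in $\mathcal{PT}_p$. For a tree $T\in\mathcal{LW}(m)$ and a tree $R\in\mathcal{W}(n)$,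 with $v$ the vertex of $T$ labeled $i$: if $v$ has a $\prec$-successor and it is labeled, the composition is $\sum_{\sigma\in\mathbb{S}_2^{V_{unl}(R)}}\epsilon(\sigma)\,Con_r(T\circ_iCon(R_\sigma))$, where $r$ is the root of $Con(R_\sigma)$ seen inside $T\circ_iCon(R_\sigma)$; otherwise it is $T\circ_iR$ as in $\mathcal{PT}_p$. With these compositions $\mathcal{LW}$ is an operad. The operad $\mathcal{PSB}$. Write $C(\bullet;A,B)$ for the tree with unlabeled root and left and right subtrees $A$, $B$. $\mathcal{I}$ is the operadic ideal of $\mathcal{LW}$ generated by $C(\bullet;1,2)+C(\bullet;2,1)$ and $C(\bullet;1,C(\bullet;2,3))-C(\bullet;C(\bullet;1,2),3)-C(\bullet;2,C(\bullet;1,3))$. Then $\mathcal{PSB}:=\mathcal{LW}/\mathcal{I}$. The underlying Lie bracket of a $\mathcal{PSB}$-algebra is the operation corresponding to the class of $C(\bullet;1,2)$. *)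

theory Defs
  imports
    "HOL-Combinatorics.Permutations"
    "HOL-Library.Poly_Mapping"
    "HOL-Algebra.QuotRing"
    "HOL-Algebra.Module"
    "HOL-Algebra.Subrings"
begin

section \<open>Vector spaces and algebras with a carrier\<close>

text \<open>
  Scalars form a type \<open>'k\<close> of class \<open>field\<close>. A vector space with a carrier is a \<open>module\<close> record
  over the record \<open>scalars\<close>; when the record is used only as a vector space, its fields
  \<open>mult\<close> and \<open>one\<close> are irrelevant and left \<open>undefined\<close>.
\<close>

definition scalars :: "('k::field, 'k) module" where
  "scalars = \<lparr>carrier = UNIV, mult = (*), one = 1, zero = 0, add = (+), smult = (*)\<rparr>"

definition linear_maps ::
  "('k, 'a, 'm) module_scheme \<Rightarrow> ('k, 'b, 'n) module_scheme \<Rightarrow> ('a \<Rightarrow> 'b) set" where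
  "linear_maps M N = {f \<in> carrier M \<rightarrow> carrier N.
     (\<forall>x\<in>carrier M. \<forall>y\<in>carrier M. f (x \<oplus>\<^bsub>M\<^esub> y) = f x \<oplus>\<^bsub>N\<^esub> f y) \<and>
     (\<forall>c. \<forall>x\<in>carrier M. f (c \<odot>\<^bsub>M\<^esub> x) = c \<odot>\<^bsub>N\<^esub> f x)}"

definition linear_subspace :: "('k, 'a, 'm) module_scheme \<Rightarrow> 'a set \<Rightarrow> bool" where
  "linear_subspace M S \<longleftrightarrow> S \<subseteq> carrier M \<and> \<zero>\<^bsub>M\<^esub> \<in> S \<and>
     (\<forall>x\<in>S. \<forall>y\<in>S. x \<oplus>\<^bsub>M\<^esub> y \<in> S) \<and> (\<forall>c. \<forall>x\<in>S. c \<odot>\<^bsub>M\<^esub> x \<in> S)"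

definition unital_algebra :: "('k::field, 'a, 'm) module_scheme \<Rightarrow> bool" where
  "unital_algebra A \<longleftrightarrow> ring A \<and> module scalars A \<and>
     (\<forall>c. \<forall>x\<in>carrier A. \<forall>y\<in>carrier A.
        (c \<odot>\<^bsub>A\<^esub> x) \<otimes>\<^bsub>A\<^esub> y = c \<odot>\<^bsub>A\<^esub> (x \<otimes>\<^bsub>A\<^esub> y) \<and>
        x \<otimes>\<^bsub>A\<^esub> (c \<odot>\<^bsub>A\<^esub> y) = c \<odot>\<^bsub>A\<^esub> (x \<otimes>\<^bsub>A\<^esub> y))"

definition algebra_homs ::
  "('k, 'a, 'm) module_scheme \<Rightarrow> ('k, 'b, 'n) module_scheme \<Rightarrow> ('a \<Rightarrow> 'b) set" where
  "algebra_homs A B = ring_hom A B \<inter> linear_maps A B"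

text \<open>Quotient of a vector space by a subspace, or of an algebra by a two-sided ideal. The scalar
  multiplication of cosets is defined in the style of \<open>rcoset_mult\<close>.\<close>

definition quotient :: "('k, 'a, 'm) module_scheme \<Rightarrow> 'a set \<Rightarrow> ('k, 'a set) module" where
  "quotient M I = ring.extend (M Quot I)
     (module.fields (\<lambda>c X. \<Union>x\<in>X. I +>\<^bsub>M\<^esub> (c \<odot>\<^bsub>M\<^esub> x)))"

definition pm_scale :: "'k::field \<Rightarrow> ('b \<Rightarrow>\<^sub>0 'k) \<Rightarrow> ('b \<Rightarrow>\<^sub>0 'k)" where
  "pm_scale c = Poly_Mapping.map ((*) c)"

text \<open>Linear extension of a map defined on a basis.\<close>

definition pm_lin :: "('b \<Rightarrow> ('c \<Rightarrow>\<^sub>0 'k::field)) \<Rightarrow> ('b \<Rightarrow>\<^sub>0 'k) \<Rightarrow> ('c \<Rightarrow>\<^sub>0 'k)" where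
  "pm_lin f x = (\<Sum>b\<in>Poly_Mapping.keys x. pm_scale (Poly_Mapping.lookup x b) (f b))"

definition free_space :: "'b set \<Rightarrow> ('k::field, 'b \<Rightarrow>\<^sub>0 'k) module" where
  "free_space B = \<lparr>carrier = {x. Poly_Mapping.keys x \<subseteq> B}, mult = undefined, one = undefined,
     zero = 0, add = (+), smult = pm_scale\<rparr>"

definition monoid_algebra :: "('b, 'm) monoid_scheme \<Rightarrow> ('k::field, 'b \<Rightarrow>\<^sub>0 'k) module" where
  "monoid_algebra G = (free_space (carrier G))
     \<lparr>mult := (\<lambda>x y. pm_lin (\<lambda>a. pm_lin (\<lambda>b. Poly_Mapping.single (a \<otimes>\<^bsub>G\<^esub> b) 1) y) x),
      one := Poly_Mapping.single \<one>\<^bsub>G\<^esub> 1\<rparr>"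

section \<open>Tensor products\<close>

text \<open>
  The tensor product of two algebras is the free vector space on the pairs modulo the
  bilinearity relations; the componentwise product of pairs induces its multiplication.
\<close>

definition tensor_relations ::
  "('k::field, 'a, 'm) module_scheme \<Rightarrow> ('k, 'b, 'n) module_scheme \<Rightarrow> ('a \<times> 'b \<Rightarrow>\<^sub>0 'k) set" where
  "tensor_relations A B = Modules.module.span pm_scale
     ({Poly_Mapping.single (a \<oplus>\<^bsub>A\<^esub> a', b) 1 - Poly_Mapping.single (a, b) 1
         - Poly_Mapping.single (a', b) 1 | a a' b.
         a \<in> carrier A \<and> a' \<in> carrier A \<and> b \<in> carrier B} \<union>
      {Poly_Mapping.single (a, b \<oplus>\<^bsub>B\<^esub> b') 1 - Poly_Mapping.single (a, b) 1
         - Poly_Mapping.single (a, b') 1 | a b b'.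
         a \<in> carrier A \<and> b \<in> carrier B \<and> b' \<in> carrier B} \<union>
      {Poly_Mapping.single (c \<odot>\<^bsub>A\<^esub> a, b) 1 - Poly_Mapping.single (a, b) c | c a b.
         a \<in> carrier A \<and> b \<in> carrier B} \<union>
      {Poly_Mapping.single (a, c \<odot>\<^bsub>B\<^esub> b) 1 - Poly_Mapping.single (a, b) c | c a b.
         a \<in> carrier A \<and> b \<in> carrier B})"

definition tensor_product ::
  "('k::field, 'a, 'm) module_scheme \<Rightarrow> ('k, 'b, 'n) module_scheme
     \<Rightarrow> ('k, ('a \<times> 'b \<Rightarrow>\<^sub>0 'k) set) module" where
  "tensor_product A B = quotient (monoid_algebra (A \<times>\<times> B)) (tensor_relations A B)"

definition pure_tensor ::
  "('k::field, 'a, 'm) module_scheme \<Rightarrow> ('k, 'b, 'n) module_scheme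
     \<Rightarrow> 'a \<Rightarrow> 'b \<Rightarrow> ('a \<times> 'b \<Rightarrow>\<^sub>0 'k) set" where
  "pure_tensor A B a b =
     tensor_relations A B
       +>\<^bsub>(monoid_algebra (A \<times>\<times> B) :: ('k, 'a \<times> 'b \<Rightarrow>\<^sub>0 'k) module)\<^esub>
     Poly_Mapping.single (a, b) 1"

text \<open>The linear map from a tensor product to \<open>M\<close> induced by a bilinear map \<open>h\<close>.\<close>

definition tensor_lift ::
  "('k::field, 'c, 'm) module_scheme \<Rightarrow> ('a \<Rightarrow> 'b \<Rightarrow> 'c) \<Rightarrow> ('a \<times> 'b \<Rightarrow>\<^sub>0 'k) set \<Rightarrow> 'c" where
  "tensor_lift M h X = the_elem
     ((\<lambda>t. \<Oplus>\<^bsub>M\<^esub>p\<in>Poly_Mapping.keys t. Poly_Mapping.lookup t p \<odot>\<^bsub>M\<^esub> h (fst p) (snd p)) ` X)"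

section \<open>Bialgebras and D-bialgebras\<close>

record (overloaded) ('k, 'a) bialg = "('k::zero, 'a) module" +
  comult :: "'a \<Rightarrow> ('a \<times> 'a \<Rightarrow>\<^sub>0 'k) set"
  counit :: "'a \<Rightarrow> 'k"

text \<open>\<open>sweedler D M h X\<close> is the element \<open>h X\<^sub>1 X\<^sub>2\<close> of \<open>M\<close> in Sweedler notation.\<close>

definition sweedler ::
  "('k::field, 'a, 'm) bialg_scheme \<Rightarrow> ('k, 'c, 'n) module_scheme \<Rightarrow> ('a \<Rightarrow> 'a \<Rightarrow> 'c) \<Rightarrow> 'a \<Rightarrow> 'c"
  where "sweedler D M h X = tensor_lift M h (comult D X)"

definition bialgebra :: "('k::field, 'a, 'm) bialg_scheme \<Rightarrow> bool" where
  "bialgebra D \<longleftrightarrow>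
     unital_algebra D \<and>
     comult D \<in> algebra_homs D (tensor_product D D) \<and>
     counit D \<in> algebra_homs D scalars \<and>
     (\<forall>X\<in>carrier D.
        sweedler D (tensor_product D (tensor_product D D))
          (\<lambda>a b. pure_tensor D (tensor_product D D) a (comult D b)) X =
        sweedler D (tensor_product D (tensor_product D D))
          (\<lambda>a b. sweedler D (tensor_product D (tensor_product D D))
             (\<lambda>a1 a2. pure_tensor D (tensor_product D D) a1 (pure_tensor D D a2 b)) a) X) \<and>
     (\<forall>X\<in>carrier D. sweedler D D (\<lambda>a b. counit D a \<odot>\<^bsub>D\<^esub> b) X = X) \<and>
     (\<forall>X\<in>carrier D. sweedler D D (\<lambda>a b. counit D b \<odot>\<^bsub>D\<^esub> a) X = X)"

definition primitives :: "('k::field, 'a, 'm) bialg_scheme \<Rightarrow> 'a set" where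
  "primitives D = {x \<in> carrier D. comult D x =
     pure_tensor D D x \<one>\<^bsub>D\<^esub> \<oplus>\<^bsub>tensor_product D D\<^esub> pure_tensor D D \<one>\<^bsub>D\<^esub> x}"

definition generates_algebra :: "('k, 'a, 'm) module_scheme \<Rightarrow> 'a set \<Rightarrow> bool" where
  "generates_algebra A S \<longleftrightarrow>
     \<Inter>{H. subring H A \<and> linear_subspace A H \<and> S \<subseteq> H} = carrier A"

definition degree_one :: "('k::field, 'a, 'm) bialg_scheme \<Rightarrow> (nat \<Rightarrow> 'a set) \<Rightarrow> 'a set" where
  "degree_one D F = {x \<in> F 1. counit D x = 0}"

definition algebra_filtration :: "('k, 'a, 'm) module_scheme \<Rightarrow> (nat \<Rightarrow> 'a set) \<Rightarrow> bool" where
  "algebra_filtration A F \<longleftrightarrow>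
     (\<forall>i. linear_subspace A (F i)) \<and>
     (\<forall>i. F i \<subseteq> F (Suc i)) \<and>
     (\<Union>i. F i) = carrier A \<and>
     F 0 = {c \<odot>\<^bsub>A\<^esub> \<one>\<^bsub>A\<^esub> | c. True} \<and>
     (\<forall>i j. \<forall>X\<in>F i. \<forall>Y\<in>F j. X \<otimes>\<^bsub>A\<^esub> Y \<in> F (i + j))"

locale D_bialgebra =
  fixes D :: "('k::field, 'a, 'm) bialg_scheme" (structure)
    and F :: "nat \<Rightarrow> 'a set"
    and tri :: "'a \<Rightarrow> 'a \<Rightarrow> 'a" (infixr \<open>\<triangleright>\<close> 71)
  assumes bialgebra: "bialgebra D"
    and filtration: "algebra_filtration D F"
    and tri_linear_right: "X \<in> carrier D \<Longrightarrow> (\<lambda>Y. X \<triangleright> Y) \<in> linear_maps D D"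
    and tri_linear_left: "Y \<in> carrier D \<Longrightarrow> (\<lambda>X. X \<triangleright> Y) \<in> linear_maps D D"
    and one_tri: "X \<in> carrier D \<Longrightarrow> \<one> \<triangleright> X = X"
    and tri_one: "X \<in> carrier D \<Longrightarrow> X \<triangleright> \<one> = counit D X \<odot> \<one>"
    and degree_one_primitives: "degree_one D F = primitives D"
    and degree_one_generates: "generates_algebra D (degree_one D F)"
    and comult_tri: "X \<in> carrier D \<Longrightarrow> Y \<in> carrier D \<Longrightarrow>
      comult D (X \<triangleright> Y) =
        sweedler D (tensor_product D D) (\<lambda>x1 x2. sweedler D (tensor_product D D)
          (\<lambda>y1 y2. pure_tensor D D (x1 \<triangleright> y1) (x2 \<triangleright> y2)) Y) X"
    and tri_mult: "X \<in> carrier D \<Longrightarrow> Y \<in> carrier D \<Longrightarrow> Z \<in> carrier D \<Longrightarrow>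
      X \<triangleright> (Y \<otimes> Z) = sweedler D D (\<lambda>x1 x2. (x1 \<triangleright> Y) \<otimes> (x2 \<triangleright> Z)) X"
    and mult_tri: "x \<in> degree_one D F \<Longrightarrow> y \<in> degree_one D F \<Longrightarrow> X \<in> carrier D \<Longrightarrow>
      (x \<otimes> X) \<triangleright> y = (x \<triangleright> (X \<triangleright> y)) \<ominus> ((x \<triangleright> X) \<triangleright> y)"
    and commutator_closed: "x \<in> degree_one D F \<Longrightarrow> y \<in> degree_one D F \<Longrightarrow>
      (x \<otimes> y) \<ominus> (y \<otimes> x) \<in> degree_one D F"

section \<open>Lie algebras and their universal enveloping algebras\<close>

locale lie_algebra = vector_space scale
  for scale :: "'k::field \<Rightarrow> 'g::ab_group_add \<Rightarrow> 'g" +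
  fixes bracket :: "'g \<Rightarrow> 'g \<Rightarrow> 'g"
  assumes bracket_linear_right: "Vector_Spaces.linear scale scale (\<lambda>y. bracket x y)"
    and bracket_linear_left: "Vector_Spaces.linear scale scale (\<lambda>x. bracket x y)"
    and bracket_alternating: "bracket x x = 0"
    and jacobi: "bracket x (bracket y z) + bracket y (bracket z x) + bracket z (bracket x y) = 0"

text \<open>
  \<open>U(g)\<close> is presented as the free associative algebra on the set \<open>g\<close>, modulo linearity of the
  generators (which gives the tensor algebra of \<open>g\<close>) and the relations \<open>x y - y x = [x, y]\<close>.
\<close>

definition free_algebra :: "('k::field, 'g list \<Rightarrow>\<^sub>0 'k) module" where
  "free_algebra = monoid_algebra \<lparr>carrier = UNIV, mult = (@), one = []\<rparr>"

definition uea_ideal ::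
  "('k::field \<Rightarrow> 'g::ab_group_add \<Rightarrow> 'g) \<Rightarrow> ('g \<Rightarrow> 'g \<Rightarrow> 'g) \<Rightarrow> ('g list \<Rightarrow>\<^sub>0 'k) set" where
  "uea_ideal scale bracket = genideal free_algebra
     ({Poly_Mapping.single [x + y] 1 - Poly_Mapping.single [x] 1 - Poly_Mapping.single [y] 1
         | x y. True} \<union>
      {Poly_Mapping.single [scale c x] 1 - Poly_Mapping.single [x] c | c x. True} \<union>
      {Poly_Mapping.single [x, y] 1 - Poly_Mapping.single [y, x] 1
         - Poly_Mapping.single [bracket x y] 1 | x y. True})"

definition uea_algebra ::
  "('k::field \<Rightarrow> 'g::ab_group_add \<Rightarrow> 'g) \<Rightarrow> ('g \<Rightarrow> 'g \<Rightarrow> 'g)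
     \<Rightarrow> ('k, ('g list \<Rightarrow>\<^sub>0 'k) set) module" where
  "uea_algebra scale bracket = quotient free_algebra (uea_ideal scale bracket)"

definition uea_class ::
  "('k::field \<Rightarrow> 'g::ab_group_add \<Rightarrow> 'g) \<Rightarrow> ('g \<Rightarrow> 'g \<Rightarrow> 'g)
     \<Rightarrow> ('g list \<Rightarrow>\<^sub>0 'k) \<Rightarrow> ('g list \<Rightarrow>\<^sub>0 'k) set" where
  "uea_class scale bracket x =
     uea_ideal scale bracket +>\<^bsub>(free_algebra :: ('k, 'g list \<Rightarrow>\<^sub>0 'k) module)\<^esub> x"

definition uea_incl ::
  "('k::field \<Rightarrow> 'g::ab_group_add \<Rightarrow> 'g) \<Rightarrow> ('g \<Rightarrow> 'g \<Rightarrow> 'g) \<Rightarrow> 'g \<Rightarrow> ('g list \<Rightarrow>\<^sub>0 'k) set" where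
  "uea_incl scale bracket x = uea_class scale bracket (Poly_Mapping.single [x] 1)"

text \<open>The algebra morphism from \<open>U(g)\<close> to \<open>A\<close> induced by a map \<open>\<phi>\<close> of Lie algebras from \<open>g\<close> to \<open>A\<close>.\<close>

definition uea_lift ::
  "('k::field, 'a, 'm) module_scheme \<Rightarrow> ('g \<Rightarrow> 'a) \<Rightarrow> ('g list \<Rightarrow>\<^sub>0 'k) set \<Rightarrow> 'a" where
  "uea_lift A \<phi> X = the_elem
     ((\<lambda>t. \<Oplus>\<^bsub>A\<^esub>w\<in>Poly_Mapping.keys t.
         Poly_Mapping.lookup t w \<odot>\<^bsub>A\<^esub> foldr (\<lambda>x u. \<phi> x \<otimes>\<^bsub>A\<^esub> u) w \<one>\<^bsub>A\<^esub>) ` X)"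

definition uea ::
  "('k::field \<Rightarrow> 'g::ab_group_add \<Rightarrow> 'g) \<Rightarrow> ('g \<Rightarrow> 'g \<Rightarrow> 'g)
     \<Rightarrow> ('k, ('g list \<Rightarrow>\<^sub>0 'k) set) bialg" where
  "uea scale bracket =
     (let U = uea_algebra scale bracket;
          \<iota> = uea_incl scale bracket
      in module.extend U (bialg.fields
           (uea_lift (tensor_product U U)
              (\<lambda>x. pure_tensor U U (\<iota> x) \<one>\<^bsub>U\<^esub> \<oplus>\<^bsub>tensor_product U U\<^esub> pure_tensor U U \<one>\<^bsub>U\<^esub> (\<iota> x)))
           (uea_lift scalars (\<lambda>x. 0))))"

definition uea_filtration ::
  "('k::field \<Rightarrow> 'g::ab_group_add \<Rightarrow> 'g) \<Rightarrow> ('g \<Rightarrow> 'g \<Rightarrow> 'g)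
     \<Rightarrow> nat \<Rightarrow> ('g list \<Rightarrow>\<^sub>0 'k) set set" where
  "uea_filtration scale bracket n =
     uea_class scale bracket ` {x. \<forall>w\<in>Poly_Mapping.keys x. length w \<le> n}"

text \<open>Products on the carrier are represented by extensional functions, so that they are
  determined by their values on the carrier.\<close>

definition D_bialgebra_structures_uea ::
  "('k::field \<Rightarrow> 'g::ab_group_add \<Rightarrow> 'g) \<Rightarrow> ('g \<Rightarrow> 'g \<Rightarrow> 'g)
     \<Rightarrow> (('g list \<Rightarrow>\<^sub>0 'k) set \<Rightarrow> ('g list \<Rightarrow>\<^sub>0 'k) set \<Rightarrow> ('g list \<Rightarrow>\<^sub>0 'k) set) set" where
  "D_bialgebra_structures_uea scale bracket =
     {tri. tri \<in> carrier (uea scale bracket) \<rightarrow>\<^sub>E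
               (carrier (uea scale bracket) \<rightarrow>\<^sub>E carrier (uea scale bracket)) \<and>
           D_bialgebra (uea scale bracket) (uea_filtration scale bracket) tri}"

section \<open>Operads\<close>

text \<open>
  Only arities \<open>n \<ge> 1\<close> are meaningful. \<open>op_comp P m n i x y\<close> is the partial composition of \<open>x\<close>
  (of arity \<open>m\<close>) with \<open>y\<close> (of arity \<open>n\<close>) at the input \<open>i\<close> in \<open>{1..m}\<close>; \<open>op_act P n \<sigma>\<close> is a left
  action of the permutations of \<open>{1..n}\<close>.
\<close>

record ('k, 'a) operad =
  op_space :: "nat \<Rightarrow> ('k, 'a) module"
  op_act :: "nat \<Rightarrow> (nat \<Rightarrow> nat) \<Rightarrow> 'a \<Rightarrow> 'a"
  op_unit :: 'a
  op_comp :: "nat \<Rightarrow> nat \<Rightarrow> nat \<Rightarrow> 'a \<Rightarrow> 'a \<Rightarrow> 'a"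

definition operad_homs :: "('k, 'a) operad \<Rightarrow> ('k, 'b) operad \<Rightarrow> (nat \<Rightarrow> 'a \<Rightarrow> 'b) set" where
  "operad_homs P Q = {f \<in> extensional {1..}.
     (\<forall>n\<ge>1. f n \<in> extensional (carrier (op_space P n)) \<inter>
              linear_maps (op_space P n) (op_space Q n)) \<and>
     (\<forall>n\<ge>1. \<forall>\<sigma> x. \<sigma> permutes {1..n} \<longrightarrow> x \<in> carrier (op_space P n) \<longrightarrow>
        f n (op_act P n \<sigma> x) = op_act Q n \<sigma> (f n x)) \<and>
     f 1 (op_unit P) = op_unit Q \<and>
     (\<forall>m\<ge>1. \<forall>n\<ge>1. \<forall>i\<in>{1..m}. \<forall>x\<in>carrier (op_space P m). \<forall>y\<in>carrier (op_space P n).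
        f (m + n - 1) (op_comp P m n i x y) = op_comp Q m n i (f m x) (f n y))}"

definition operad_ideal :: "('k, 'a) operad \<Rightarrow> (nat \<Rightarrow> 'a set) \<Rightarrow> bool" where
  "operad_ideal P I \<longleftrightarrow>
     (\<forall>n\<ge>1. linear_subspace (op_space P n) (I n)) \<and>
     (\<forall>n\<ge>1. \<forall>\<sigma> x. \<sigma> permutes {1..n} \<longrightarrow> x \<in> I n \<longrightarrow> op_act P n \<sigma> x \<in> I n) \<and>
     (\<forall>m\<ge>1. \<forall>n\<ge>1. \<forall>i\<in>{1..m}. \<forall>x\<in>carrier (op_space P m). \<forall>y\<in>carrier (op_space P n).
        x \<in> I m \<or> y \<in> I n \<longrightarrow> op_comp P m n i x y \<in> I (m + n - 1))"

definition generated_operad_ideal :: "('k, 'a) operad \<Rightarrow> (nat \<Rightarrow> 'a set) \<Rightarrow> nat \<Rightarrow> 'a set" where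
  "generated_operad_ideal P S n = \<Inter>{I n | I. operad_ideal P I \<and> (\<forall>k\<ge>1. S k \<subseteq> I k)}"

definition quotient_operad :: "('k, 'a) operad \<Rightarrow> (nat \<Rightarrow> 'a set) \<Rightarrow> ('k, 'a set) operad" where
  "quotient_operad P I =
     \<lparr>op_space = (\<lambda>n. quotient (op_space P n) (I n)),
      op_act = (\<lambda>n \<sigma> X. \<Union>x\<in>X. I n +>\<^bsub>op_space P n\<^esub> op_act P n \<sigma> x),
      op_unit = I 1 +>\<^bsub>op_space P 1\<^esub> op_unit P,
      op_comp = (\<lambda>m n i X Y. \<Union>x\<in>X. \<Union>y\<in>Y.
        I (m + n - 1) +>\<^bsub>op_space P (m + n - 1)\<^esub> op_comp P m n i x y)\<rparr>"

text \<open>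
  Linear maps from \<open>V\<^sup>\<otimes>\<^sup>n\<close> to \<open>V\<close> are represented by multilinear maps on lists of length \<open>n\<close>,
  extended by \<open>0\<close> to the other lists. The action is \<open>(\<sigma> f)(v\<^sub>1, \<dots>) = f (v\<^bsub>\<sigma> 1\<^esub>, \<dots>)\<close>, which
  corresponds to replacing the label \<open>j\<close> by \<open>\<sigma> j\<close> in a tree.
\<close>

definition end_operad ::
  "('k::field \<Rightarrow> 'v::ab_group_add \<Rightarrow> 'v) \<Rightarrow> ('k, 'v list \<Rightarrow> 'v) operad" where
  "end_operad scale =
     \<lparr>op_space = (\<lambda>n.
        \<lparr>carrier = {f. (\<forall>vs. length vs \<noteq> n \<longrightarrow> f vs = 0) \<and>
           (\<forall>vs j. length vs = n \<longrightarrow> j < n \<longrightarrow>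
              Vector_Spaces.linear scale scale (\<lambda>v. f (vs[j := v])))},
         mult = undefined, one = undefined,
         zero = (\<lambda>vs. 0), add = (\<lambda>f g vs. f vs + g vs), smult = (\<lambda>c f vs. scale c (f vs))\<rparr>),
      op_act = (\<lambda>n \<sigma> f vs.
        if length vs = n then f (map (\<lambda>j. vs ! (\<sigma> j - 1)) [1..<n + 1]) else 0),
      op_unit = (\<lambda>vs. if length vs = 1 then hd vs else 0),
      op_comp = (\<lambda>m n i f g vs.
        if length vs = m + n - 1
        then f (take (i - 1) vs @ [g (take n (drop (i - 1) vs))] @ drop (i - 1 + n) vs)
        else 0)\<rparr>"

section \<open>Partially labeled planar rooted trees\<close>

text \<open>
  A vertex carries an optional label and the list, from left to right, of the subtrees above it.
  A vertex of a tree is identified with its address: the root is \<open>[]\<close>, and the address of a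
  non-root vertex is that of its successor followed by its index among the incoming edges.
\<close>

datatype 'l ptree = Node (lab: "'l option") (kids: "'l ptree list")

fun subtree :: "'l ptree \<Rightarrow> nat list \<Rightarrow> 'l ptree" where
  "subtree t [] = t"
| "subtree t (j # p) = subtree (kids t ! j) p"

lemma size_nth_less [termination_simp]:
  "j < length us \<Longrightarrow> size (us ! j) < Suc (k + size_list size us)"
  using size_list_estimation'[of "us ! j" us "size (us ! j)" size] by simp

fun verts :: "'l ptree \<Rightarrow> nat list set" where
  "verts (Node l us) = insert [] (\<Union>j\<in>{..<length us}. (#) j ` verts (us ! j))"

definition unlabeled :: "'l ptree \<Rightarrow> nat list set" where
  "unlabeled t = {p \<in> verts t. lab (subtree t p) = None}"

definition partially_labeled :: "nat \<Rightarrow> nat ptree set" where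
  "partially_labeled n =
     {t. bij_betw (\<lambda>p. the (lab (subtree t p))) (verts t - unlabeled t) {1..n}}"

definition vertex :: "nat ptree \<Rightarrow> nat \<Rightarrow> nat list" where
  "vertex t i = (THE p. p \<in> verts t \<and> lab (subtree t p) = Some i)"

text \<open>\<open>graft gs R\<close>: for every pair \<open>(w, u)\<close> in the list \<open>gs\<close>, the tree \<open>u\<close> is grafted onto the
  vertex of \<open>R\<close> labeled \<open>w\<close>, to the left of the edges of \<open>R\<close>, keeping the order of \<open>gs\<close>.\<close>

primrec graft :: "('l \<times> 'l ptree) list \<Rightarrow> 'l ptree \<Rightarrow> 'l ptree" where
  "graft gs (Node l us) = Node l (map snd (filter (\<lambda>(w, u). l = Some w) gs) @ map (graft gs) us)"

text \<open>\<open>replace_vertex i f T\<close> replaces the vertex labeled \<open>i\<close>, together with the list \<open>us\<close> of the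
  subtrees above it, by \<open>f us\<close>.\<close>

fun replace_vertex :: "'l \<Rightarrow> ('l ptree list \<Rightarrow> 'l ptree) \<Rightarrow> 'l ptree \<Rightarrow> 'l ptree" where
  "replace_vertex i f (Node l us) =
     (if l = Some i then f us else Node l (map (replace_vertex i f) us))"

text \<open>
  The sum runs over the maps \<open>\<phi>\<close> from the incoming edges of the vertex \<open>i\<close> of \<open>T\<close> to the labeled
  vertices of \<open>R\<close>; \<open>\<phi>\<close> is given by the list of the (shifted) labels of its values.
\<close>

definition pt_comp :: "nat \<Rightarrow> nat \<Rightarrow> nat ptree \<Rightarrow> nat ptree \<Rightarrow> (nat ptree \<Rightarrow>\<^sub>0 'k::field)" where
  "pt_comp n i T R =
     (let T' = map_ptree (\<lambda>j. if i < j then j + n - 1 else j) T;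
          R' = map_ptree (\<lambda>j. j + i - 1) R
      in \<Sum>\<phi> | length \<phi> = length (kids (subtree T (vertex T i))) \<and> set \<phi> \<subseteq> set_ptree R'.
           Poly_Mapping.single (replace_vertex i (\<lambda>us. graft (zip \<phi> us) R') T') 1)"

section \<open>The operads \<open>LW\<close> and \<open>PSB\<close>\<close>

definition L_trees :: "nat \<Rightarrow> nat ptree set" where
  "L_trees n = {t \<in> partially_labeled n. unlabeled t = {}}"

definition W_trees :: "nat \<Rightarrow> nat ptree set" where
  "W_trees n = {t \<in> partially_labeled n.
     [] \<in> unlabeled t \<and>
     (\<forall>p\<in>unlabeled t. p \<noteq> [] \<longrightarrow> butlast p \<in> unlabeled t) \<and>
     (\<forall>p\<in>unlabeled t. length (kids (subtree t p)) = 2)}"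

definition LW_trees :: "nat \<Rightarrow> nat ptree set" where
  "LW_trees n = L_trees n \<union> (if 2 \<le> n then W_trees n else {})"

text \<open>A family \<open>\<sigma>\<close> of elements of \<open>\<S>\<^sub>2\<close> indexed by the unlabeled vertices of \<open>R\<close> is given by the set
  \<open>A\<close> of the vertices at which \<open>\<sigma>\<close> is not the identity; its sign is \<open>(-1) ^ card A\<close>.\<close>

primrec swap_at :: "'l ptree \<Rightarrow> nat list set \<Rightarrow> 'l ptree" where
  "swap_at (Node l us) = (\<lambda>A.
     let vs = map (\<lambda>(j, s). s {p. j # p \<in> A}) (List.enumerate 0 (map swap_at us))
     in Node l (if [] \<in> A then rev vs else vs))"

primrec con :: "'l ptree \<Rightarrow> 'l ptree" where
  "con (Node l us) = Node l (concat (map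
     (\<lambda>v. if l = None \<and> lab v = None then kids v else [v]) (map con us)))"

text \<open>\<open>contract_at p t\<close> contracts the edge from the non-root vertex \<open>p\<close> to its successor.\<close>

fun contract_at :: "nat list \<Rightarrow> 'l ptree \<Rightarrow> 'l ptree" where
  "contract_at [] t = t"
| "contract_at [j] (Node l us) = Node l (take j us @ kids (us ! j) @ drop (Suc j) us)"
| "contract_at (j # k # p) (Node l us) = Node l (us[j := contract_at (k # p) (us ! j)])"

text \<open>In the first case, the vertex \<open>i\<close> of \<open>T\<close> and the root of the tree inserted at \<open>i\<close> have the
  same address, so that the edge to be contracted starts at \<open>vertex T i\<close>.\<close>

definition LW_tree_comp ::
  "nat \<Rightarrow> nat \<Rightarrow> nat ptree \<Rightarrow> nat ptree \<Rightarrow> (nat ptree \<Rightarrow>\<^sub>0 'k::field)" where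
  "LW_tree_comp n i T R =
     (let p = vertex T i in
      if R \<in> W_trees n \<and> p \<noteq> [] \<and> butlast p \<notin> unlabeled T
      then \<Sum>A\<in>Pow (unlabeled R). pm_scale ((-1) ^ card A)
             (pm_lin (\<lambda>t. Poly_Mapping.single (contract_at p t) 1)
                (pt_comp n i T (con (swap_at R A))))
      else pt_comp n i T R)"

definition LW :: "('k::field, nat ptree \<Rightarrow>\<^sub>0 'k) operad" where
  "LW =
     \<lparr>op_space = (\<lambda>n. free_space (LW_trees n)),
      op_act = (\<lambda>n \<sigma>. pm_lin (\<lambda>t. Poly_Mapping.single (map_ptree \<sigma> t) 1)),
      op_unit = Poly_Mapping.single (Node (Some 1) []) 1,
      op_comp = (\<lambda>m n i x y. pm_lin (\<lambda>T. pm_lin (\<lambda>R. LW_tree_comp n i T R) y) x)\<rparr>"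

abbreviation leaf :: "nat \<Rightarrow> nat ptree" where
  "leaf i \<equiv> Node (Some i) []"

abbreviation cherry :: "nat ptree \<Rightarrow> nat ptree \<Rightarrow> nat ptree" where
  "cherry A B \<equiv> Node None [A, B]"

definition PSB_relations :: "nat \<Rightarrow> (nat ptree \<Rightarrow>\<^sub>0 'k::field) set" where
  "PSB_relations n =
     (if n = 2 then
        {Poly_Mapping.single (cherry (leaf 1) (leaf 2)) 1
           + Poly_Mapping.single (cherry (leaf 2) (leaf 1)) 1}
      else if n = 3 then
        {Poly_Mapping.single (cherry (leaf 1) (cherry (leaf 2) (leaf 3))) 1
           - Poly_Mapping.single (cherry (cherry (leaf 1) (leaf 2)) (leaf 3)) 1
           - Poly_Mapping.single (cherry (leaf 2) (cherry (leaf 1) (leaf 3))) 1}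
      else {})"

definition PSB_ideal :: "nat \<Rightarrow> (nat ptree \<Rightarrow>\<^sub>0 'k::field) set" where
  "PSB_ideal = generated_operad_ideal LW PSB_relations"

definition PSB :: "('k::field, (nat ptree \<Rightarrow>\<^sub>0 'k) set) operad" where
  "PSB = quotient_operad LW PSB_ideal"

definition PSB_class :: "nat \<Rightarrow> nat ptree \<Rightarrow> (nat ptree \<Rightarrow>\<^sub>0 'k::field) set" where
  "PSB_class n t =
     PSB_ideal n +>\<^bsub>op_space (LW :: ('k, nat ptree \<Rightarrow>\<^sub>0 'k) operad) n\<^esub> Poly_Mapping.single t 1"

definition PSB_structures ::
  "('k::field \<Rightarrow> 'g::ab_group_add \<Rightarrow> 'g) \<Rightarrow> ('g \<Rightarrow> 'g \<Rightarrow> 'g)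
     \<Rightarrow> (nat \<Rightarrow> (nat ptree \<Rightarrow>\<^sub>0 'k) set \<Rightarrow> 'g list \<Rightarrow> 'g) set" where
  "PSB_structures scale bracket =
     {\<gamma> \<in> operad_homs PSB (end_operad scale).
        \<forall>x y. \<gamma> 2 (PSB_class 2 (cherry (leaf 1) (leaf 2))) [x, y] = bracket x y}"

text \<open>The corolla with root \<open>1\<close> and leaves \<open>2, \<dots>, n + 1\<close> from left to right.\<close>

definition corolla :: "nat \<Rightarrow> nat ptree" where
  "corolla n = Node (Some 1) (map leaf [2..<n + 2])"

text \<open>
  A \<open>PSB\<close>-algebra structure \<open>\<gamma>\<close> on \<open>g\<close> and a product on \<open>U(g)\<close> correspond to each other if
  \<open>(x\<^sub>1 \<cdot> \<dots> \<cdot> x\<^sub>n) \<triangleright> y\<close> is the value of the corolla with \<open>y\<close> at the root and \<open>x\<^sub>1, \<dots>, x\<^sub>n\<close> at the leaves.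
\<close>

definition corresponds ::
  "('k::field \<Rightarrow> 'g::ab_group_add \<Rightarrow> 'g) \<Rightarrow> ('g \<Rightarrow> 'g \<Rightarrow> 'g)
     \<Rightarrow> (nat \<Rightarrow> (nat ptree \<Rightarrow>\<^sub>0 'k) set \<Rightarrow> 'g list \<Rightarrow> 'g)
     \<Rightarrow> (('g list \<Rightarrow>\<^sub>0 'k) set \<Rightarrow> ('g list \<Rightarrow>\<^sub>0 'k) set \<Rightarrow> ('g list \<Rightarrow>\<^sub>0 'k) set) \<Rightarrow> bool" where
  "corresponds scale bracket \<gamma> tri \<longleftrightarrow>
     (let U = uea scale bracket; \<iota> = uea_incl scale bracket in
      \<forall>xs y. tri (foldr (\<lambda>x u. \<iota> x \<otimes>\<^bsub>U\<^esub> u) xs \<one>\<^bsub>U\<^esub>) (\<iota> y) =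
             \<iota> (\<gamma> (length xs + 1) (PSB_class (length xs + 1) (corolla (length xs))) (y # xs)))"

end

(*
  The algebras over PSB are the post-Lie algebras: Lie algebras with a product p such that every
  p x is a derivation of the bracket and p (bracket x y) is the commutator of p x and p y,
  corrected by p (p y x) - p (p x y). Given p, the Guin-Oudom recursion
    (x x1 ... xn) |> y = x |> ((x1 ... xn) |> y) - sum_i (x1 ... (p x xi) ... xn) |> y
  respects the relations of U(g) and defines the product |> on U(g). Conversely, (D3)-(D5)
  determine |> from its restriction to g, which is a post-Lie product.

  A tree is evaluated in a post-Lie algebra by the same recursion, applied at each labeled vertex
  to the values of the subtrees above it. That this respects the partial compositions of LW is the
  Leibniz rule for p x on the value of a tree and, for the contracted compositions, the following
  fact: a function of words that sends the commutator of two neighbouring letters to their bracket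
  turns the signed sum over the swaps of a binary tree into the iterated bracket. In the other
  direction, every tree is obtained from corollas and the cherry by compositions with a single
  term, and composing the corolla on two vertices with a larger corolla forces the recursion.
*)
theory Submission
  imports Defs "HOL-Library.Multiset"
begin

text \<open>Two facts about \<open>\<iota>\<close> carry both directions. Its range is the set of
  primitive elements of U(g): this gives (D2), and with (D3) it forces |> to send pairs of elements
  of g into g. Here characteristic zero enters: the map X -> X_(1) X_(2) multiplies the n-th power
  of an element of g by 2^n, such powers span U(g) by polarization, and a primitive element has
  eigenvalue 2. Moreover \<open>\<iota>\<close> is injective, so that equations in U(g) can be read
  in g; this comes from a representation of g on polynomials in a basis, in which x sends 1 to x.
  The obstacle in the construction of |> is that the recursion runs on words while U(g) is a
  quotient. On the free algebra, linearity in x and the post-Lie identities fail, since the letter x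
  + y differs from the sum of the letters x and y; they hold modulo the ideal. A linear projection
  \<open>pi\<close> whose kernel is the ideal turns them into equations, so that one lemma on words
  acting by the recursion serves g and U(g) alike.\<close>

abbreviation unit_vec :: "'b \<Rightarrow> ('b \<Rightarrow>\<^sub>0 'k::field)" where
  "unit_vec b \<equiv> Poly_Mapping.single b 1"

abbreviation is_linear :: "('k::field \<Rightarrow> 'v::ab_group_add \<Rightarrow> 'v) \<Rightarrow> ('k \<Rightarrow> 'w::ab_group_add \<Rightarrow> 'w) \<Rightarrow> ('v \<Rightarrow> 'w) \<Rightarrow> bool"
  where "is_linear \<equiv> Vector_Spaces.linear"

subsection \<open>Linear maps between vector spaces\<close>

lemma lookup_pm_scale [simp]: "Poly_Mapping.lookup (pm_scale c t) b = c * Poly_Mapping.lookup t b"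
  by (simp add: pm_scale_def Poly_Mapping.map.rep_eq when_def)

lemma vector_space_pm_scale: "vector_space (pm_scale :: 'k::field \<Rightarrow> ('b \<Rightarrow>\<^sub>0 'k) \<Rightarrow> _)"
  by unfold_locales (auto intro!: poly_mapping_eqI simp: lookup_add algebra_simps)

global_interpretation pm: vector_space "pm_scale :: 'k::field \<Rightarrow> ('b \<Rightarrow>\<^sub>0 'k) \<Rightarrow> _"
  by (rule vector_space_pm_scale)

lemma pm_scale_single [simp]: "pm_scale c (Poly_Mapping.single b a) = Poly_Mapping.single b (c * a)"
  by (auto intro!: poly_mapping_eqI simp: lookup_single when_def)

lemma single_eq_pm_scale: "Poly_Mapping.single b a = pm_scale a (unit_vec b)"
  by simp

lemma keys_pm_scale: "Poly_Mapping.keys (pm_scale c t) \<subseteq> Poly_Mapping.keys t"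
  by (auto simp: in_keys_iff)

lemma linI:
  assumes "vector_space s" "vector_space s'"
    and "\<And>x y. f (x + y) = f x + f y" "\<And>c x. f (s c x) = s' c (f x)"
  shows "is_linear s s' f"
  using assms by (simp add: Vector_Spaces.linear_iff)

lemma
  assumes "is_linear s s' f"
  shows lin_vs1: "vector_space s" and lin_vs2: "vector_space s'"
    and lin_add: "f (x + y) = f x + f y" and lin_scale: "f (s c x) = s' c (f x)"
  using assms by (auto simp: Vector_Spaces.linear_iff)

lemma
  assumes "is_linear s s' f"
  shows lin_0: "f 0 = 0" and lin_minus: "f (- x) = - f x" and lin_diff: "f (x - y) = f x - f y"
    and lin_sum: "f (sum g A) = (\<Sum>a\<in>A. f (g a))"
proof -
  interpret module_hom s s' f using assms by (simp add: module_hom_eq_linear)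
  show "f 0 = 0" "f (- x) = - f x" "f (x - y) = f x - f y" "f (sum g A) = (\<Sum>a\<in>A. f (g a))"
    by (simp_all add: zero neg diff sum)
qed

lemma
  assumes "vector_space s"
  shows vs_add_right: "s a (x + y) = s a x + s a y"
    and vs_add_left: "s (a + b) x = s a x + s b x"
    and vs_scale_scale: "s a (s b x) = s (a * b) x"
    and vs_one: "s 1 x = x"
    and vs_zero_left: "s 0 x = 0" and vs_zero_right: "s a 0 = 0"
    and vs_minus_right: "s a (- x) = - s a x"
    and vs_diff_right: "s a (x - y) = s a x - s a y"
    and vs_sum_right: "s a (sum g A) = (\<Sum>i\<in>A. s a (g i))"
proof -
  interpret vector_space s by fact
  show "s a (x + y) = s a x + s a y" "s (a + b) x = s a x + s b x" "s a (s b x) = s (a * b) x"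
    "s 1 x = x" "s 0 x = 0" "s a 0 = 0" "s a (- x) = - s a x"
    "s a (x - y) = s a x - s a y" "s a (sum g A) = (\<Sum>i\<in>A. s a (g i))"
    by (simp_all add: scale_right_distrib scale_left_distrib scale_minus_left scale_right_diff_distrib
        scale_sum_right)
qed

lemma lin_zero_fun: "vector_space s \<Longrightarrow> vector_space s' \<Longrightarrow> is_linear s s' (\<lambda>x. 0)"
  by (rule linI) (simp_all add: vs_zero_right)

lemma lin_id_fun: "vector_space s \<Longrightarrow> is_linear s s (\<lambda>x. x)"
  by (rule linI) simp_all

lemma lin_plus: "is_linear s s' f \<Longrightarrow> is_linear s s' g \<Longrightarrow> is_linear s s' (\<lambda>x. f x + g x)"
  by (auto simp: Vector_Spaces.linear_iff vs_add_right)

lemma lin_minus_fun: "is_linear s s' f \<Longrightarrow> is_linear s s' g \<Longrightarrow> is_linear s s' (\<lambda>x. f x - g x)"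
  by (auto simp: Vector_Spaces.linear_iff vs_diff_right)

lemma lin_sum_fun:
  assumes "vector_space s" "vector_space s'" "\<And>i. i \<in> A \<Longrightarrow> is_linear s s' (f i)"
  shows "is_linear s s' (\<lambda>x. \<Sum>i\<in>A. f i x)"
  using assms(3)
  by (induction A rule: infinite_finite_induct) (auto intro: lin_plus lin_zero_fun assms(1,2))

lemma lin_comp: "is_linear s s' f \<Longrightarrow> is_linear s' s'' g \<Longrightarrow> is_linear s s'' (\<lambda>x. g (f x))"
  by (auto simp: Vector_Spaces.linear_iff)

lemma lin_scale_fun: "is_linear s s' f \<Longrightarrow> is_linear s s' (\<lambda>x. s' c (f x))"
  by (auto simp: Vector_Spaces.linear_iff vs_add_right vs_scale_scale mult.commute)

subsection \<open>Linear extension of maps defined on a basis\<close>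

text \<open>\<open>pm_lin\<close> with values in an arbitrary vector space; its scalar
  multiplication \<open>s\<close> is an argument because \<open>'g\<close> carries no canonical
  one.\<close>

definition lin_ext :: "('k::field \<Rightarrow> 'v::ab_group_add \<Rightarrow> 'v) \<Rightarrow> ('b \<Rightarrow> 'v) \<Rightarrow> ('b \<Rightarrow>\<^sub>0 'k) \<Rightarrow> 'v" where
  "lin_ext s f t = (\<Sum>b\<in>Poly_Mapping.keys t. s (Poly_Mapping.lookup t b) (f b))"

lemma pm_lin_eq: "pm_lin = lin_ext pm_scale"
  by (simp add: fun_eq_iff pm_lin_def lin_ext_def)

lemma lin_ext_superset:
  assumes "vector_space s" "finite A" "Poly_Mapping.keys t \<subseteq> A"
  shows "lin_ext s f t = (\<Sum>b\<in>A. s (Poly_Mapping.lookup t b) (f b))"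
  unfolding lin_ext_def
  by (rule sum.mono_neutral_left) (use assms in \<open>auto simp: in_keys_iff vs_zero_left\<close>)

lemma linear_lin_ext:
  assumes vs: "vector_space s"
  shows "is_linear pm_scale s (lin_ext s (f :: 'b \<Rightarrow> _))"
proof (rule linI[OF vector_space_pm_scale vs])
  fix x y :: "'b \<Rightarrow>\<^sub>0 'a" and c
  let ?A = "Poly_Mapping.keys x \<union> Poly_Mapping.keys y"
  have "lin_ext s f (x + y) = (\<Sum>b\<in>?A. s (Poly_Mapping.lookup (x + y) b) (f b))"
    using keys_add[of x y] by (intro lin_ext_superset vs) auto
  then show "lin_ext s f (x + y) = lin_ext s f x + lin_ext s f y"
    by (simp add: lin_ext_superset[OF vs, of ?A] lookup_add vs_add_left[OF vs] sum.distrib)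
  have "lin_ext s f (pm_scale c x) = (\<Sum>b\<in>?A. s (Poly_Mapping.lookup (pm_scale c x) b) (f b))"
    using keys_pm_scale[of c x] by (intro lin_ext_superset vs) auto
  then show "lin_ext s f (pm_scale c x) = s c (lin_ext s f x)"
    by (simp add: lin_ext_superset[OF vs, of ?A] vs_scale_scale[OF vs] vs_sum_right[OF vs])
qed

lemma lin_ext_single: "vector_space s \<Longrightarrow> lin_ext s f (Poly_Mapping.single b a) = s a (f b)"
  by (cases "a = 0") (simp_all add: lin_ext_def vs_zero_left)

lemma lin_ext_unit [simp]: "vector_space s \<Longrightarrow> lin_ext s f (unit_vec b) = f b"
  by (simp add: lin_ext_single vs_one)

lemma pm_as_sum: "t = (\<Sum>b\<in>Poly_Mapping.keys t. pm_scale (Poly_Mapping.lookup t b) (unit_vec b))"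
proof (rule poly_mapping_eqI)
  fix k
  show "Poly_Mapping.lookup t k = Poly_Mapping.lookup (\<Sum>b\<in>Poly_Mapping.keys t. pm_scale (Poly_Mapping.lookup t b) (unit_vec b)) k"
    by (cases "k \<in> Poly_Mapping.keys t")
      (auto simp: lookup_sum lookup_single when_def in_keys_iff)
qed

lemma linear_eq_lin_ext:
  assumes "is_linear pm_scale s F"
  shows "F t = lin_ext s (\<lambda>b. F (unit_vec b)) t"
  by (subst pm_as_sum[of t]) (simp only: lin_sum[OF assms] lin_scale[OF assms] lin_ext_def)

text \<open>Equality is tested on the support of \<open>t\<close> alone, so identities that hold
  just for some basis vectors, such as words over a carrier or monomials in a basis, extend linearly
  as well.\<close>

lemma linear_pm_eqI:
  assumes "is_linear pm_scale s F" "is_linear pm_scale s G"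
    and "\<And>b. b \<in> Poly_Mapping.keys t \<Longrightarrow> F (unit_vec b) = G (unit_vec b)"
  shows "F t = G t"
  by (simp add: linear_eq_lin_ext[OF assms(1), of t] linear_eq_lin_ext[OF assms(2), of t] lin_ext_def assms(3))

lemma linear_lin_ext_comp:
  assumes "is_linear s s' g"
  shows "g (lin_ext s f t) = lin_ext s' (\<lambda>b. g (f b)) t"
  by (simp add: lin_ext_def lin_sum[OF assms] lin_scale[OF assms])

lemma lin_ext_cong:
  "(\<And>b. b \<in> Poly_Mapping.keys t \<Longrightarrow> f b = g b) \<Longrightarrow> lin_ext s f t = lin_ext s g t"
  by (simp add: lin_ext_def)

lemma lin_ext_plus:
  "vector_space s \<Longrightarrow> lin_ext s (\<lambda>b. f b + g b) t = lin_ext s f t + lin_ext s g t"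
  by (simp add: lin_ext_def vs_add_right sum.distrib)

lemma lin_ext_unit_vec: "lin_ext pm_scale unit_vec t = t"
  using pm_as_sum[of t] by (simp add: lin_ext_def)

lemma linear_lin_ext_param:
  assumes "vector_space s" "vector_space s'" "\<And>b. is_linear s s' (\<lambda>x. f x b)"
  shows "is_linear s s' (\<lambda>x. lin_ext s' (f x) t)"
  unfolding lin_ext_def by (intro lin_sum_fun lin_scale_fun assms)

lemmas linear_pm_lin = linear_lin_ext[OF vector_space_pm_scale, folded pm_lin_eq]
  and pm_lin_single = lin_ext_single[OF vector_space_pm_scale, folded pm_lin_eq]
  and pm_lin_unit = lin_ext_unit[OF vector_space_pm_scale, folded pm_lin_eq]

lemma lin_ext_pm_lin:
  "vector_space s \<Longrightarrow> lin_ext s f (pm_lin g t) = lin_ext s (\<lambda>b. lin_ext s f (g b)) t"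
  unfolding pm_lin_eq by (rule linear_lin_ext_comp) (rule linear_lin_ext)

subsection \<open>Subspaces\<close>

definition subspace_of :: "('k::field \<Rightarrow> 'v::ab_group_add \<Rightarrow> 'v) \<Rightarrow> 'v set \<Rightarrow> bool" where
  "subspace_of s S \<longleftrightarrow> 0 \<in> S \<and> (\<forall>x\<in>S. \<forall>y\<in>S. x + y \<in> S) \<and> (\<forall>c. \<forall>x\<in>S. s c x \<in> S)"

lemma
  assumes "vector_space s" "subspace_of s S"
  shows subsp_0: "0 \<in> S" and subsp_add: "x \<in> S \<Longrightarrow> y \<in> S \<Longrightarrow> x + y \<in> S"
    and subsp_scale: "x \<in> S \<Longrightarrow> s c x \<in> S"
    and subsp_minus: "x \<in> S \<Longrightarrow> - x \<in> S" and subsp_diff: "x \<in> S \<Longrightarrow> y \<in> S \<Longrightarrow> x - y \<in> S"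
    and subsp_sum: "(\<And>i. i \<in> A \<Longrightarrow> f i \<in> S) \<Longrightarrow> sum f A \<in> S"
proof -
  interpret vector_space s by fact
  have S: "0 \<in> S" "\<And>x y. x \<in> S \<Longrightarrow> y \<in> S \<Longrightarrow> x + y \<in> S" "\<And>c x. x \<in> S \<Longrightarrow> s c x \<in> S"
    using assms(2) by (auto simp: subspace_of_def)
  show "0 \<in> S" "x \<in> S \<Longrightarrow> y \<in> S \<Longrightarrow> x + y \<in> S" "x \<in> S \<Longrightarrow> s c x \<in> S" by (fact S)+
  have m: "- x \<in> S" if "x \<in> S" for x using S(3)[OF that, of "-1"] by (simp add: scale_minus_left)
  then show "x \<in> S \<Longrightarrow> - x \<in> S" .
  show "x \<in> S \<Longrightarrow> y \<in> S \<Longrightarrow> x - y \<in> S" using S(2)[of x "-y"] m[of y] by simp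
  show "(\<And>i. i \<in> A \<Longrightarrow> f i \<in> S) \<Longrightarrow> sum f A \<in> S"
    by (induction A rule: infinite_finite_induct) (auto intro: S)
qed

lemma lin_ext_in_subspace:
  assumes "vector_space s" "subspace_of s S" "\<And>b. b \<in> Poly_Mapping.keys t \<Longrightarrow> f b \<in> S"
  shows "lin_ext s f t \<in> S"
  unfolding lin_ext_def by (intro subsp_sum[OF assms(1,2)] subsp_scale[OF assms(1,2)] assms(3))

lemma subspace_vimage:
  assumes "is_linear s s' f" "subspace_of s' S"
  shows "subspace_of s {x. f x \<in> S}"
  using assms by (auto simp: subspace_of_def lin_0[OF assms(1)] lin_add[OF assms(1)] lin_scale[OF assms(1)])

lemma subspace_zero: "vector_space s \<Longrightarrow> subspace_of s {0}"
  by (simp add: subspace_of_def vs_zero_right)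

lemma span_subset_subspace:
  assumes "subspace_of pm_scale S" "X \<subseteq> S"
  shows "pm.span X \<subseteq> S"
  using assms by (intro pm.span_minimal) (auto simp: subspace_of_def pm.subspace_def)

lemma subsp_span: "subspace_of pm_scale (pm.span X)"
  by (auto simp: subspace_of_def pm.span_zero pm.span_add pm.span_scale)

subsection \<open>Vector spaces with a carrier\<close>

lemma scalars_simps [simp]:
  "carrier scalars = UNIV" "mult scalars = (*)" "one scalars = 1" "zero scalars = 0" "add scalars = (+)"
  "smult scalars = (*)"
  by (simp_all add: scalars_def)

lemma cring_scalars: "cring (scalars :: ('k::field, 'k) module)"
proof (rule cringI)
  show "abelian_group (scalars :: ('k, 'k) module)"
    by (rule abelian_groupI) (auto simp: algebra_simps intro: exI[of _ "- _"] add.right_inverse left_minus)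
  show "comm_monoid (scalars :: ('k, 'k) module)"
    by (rule comm_monoidI) (auto simp: algebra_simps)
qed (auto simp: algebra_simps)

locale carrier_space =
  fixes M :: "('k::field, 'a, 'm) module_scheme" (structure)
  assumes module: "module scalars M"
begin

sublocale abelian_group M by (rule module.axioms(2)[OF module])
sublocale sc: module scalars M by (rule module)

lemma smult_zero_left: "x \<in> carrier M \<Longrightarrow> 0 \<odot> x = \<zero>"
  using sc.smult_l_null by simp

lemma smult_add_left: "x \<in> carrier M \<Longrightarrow> (a + b) \<odot> x = a \<odot> x \<oplus> b \<odot> x"
  using sc.smult_l_distr[of a b x] by simp

lemma smult_add_right: "x \<in> carrier M \<Longrightarrow> y \<in> carrier M \<Longrightarrow> a \<odot> (x \<oplus> y) = a \<odot> x \<oplus> a \<odot> y"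
  using sc.smult_r_distr[of a x y] by simp

lemma smult_mult: "x \<in> carrier M \<Longrightarrow> (a * b) \<odot> x = a \<odot> (b \<odot> x)"
  using sc.smult_assoc1[of a b x] by simp

lemma smult_1: "x \<in> carrier M \<Longrightarrow> 1 \<odot> x = x"
  using sc.smult_one[of x] by simp

text \<open>Counterpart of \<open>lin_ext\<close> for a target given by a record with a carrier,
  where sums are \<open>finsum\<close> instead of \<open>sum\<close>.\<close>

definition flin :: "('b \<Rightarrow> 'a) \<Rightarrow> ('b \<Rightarrow>\<^sub>0 'k) \<Rightarrow> 'a" where
  "flin f t = (\<Oplus>p\<in>Poly_Mapping.keys t. Poly_Mapping.lookup t p \<odot> f p)"

lemma finsum_smult:
  assumes "f \<in> A \<rightarrow> carrier M"
  shows "c \<odot> (\<Oplus>i\<in>A. f i) = (\<Oplus>i\<in>A. c \<odot> f i)"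
  using assms
proof (induction A rule: infinite_finite_induct)
  case (insert a A)
  then show ?case by (simp add: finsum_insert smult_add_right Pi_def)
qed (simp_all add: sc.smult_r_null)

lemma flin_superset:
  assumes "finite A" "Poly_Mapping.keys t \<subseteq> A" "\<And>p. f p \<in> carrier M"
  shows "flin f t = (\<Oplus>p\<in>A. Poly_Mapping.lookup t p \<odot> f p)"
  unfolding flin_def
  by (rule add.finprod_mono_neutral_cong_left)
    (use assms in \<open>auto simp: in_keys_iff smult_zero_left\<close>)

lemma flin_closed [simp]: "(\<And>p. f p \<in> carrier M) \<Longrightarrow> flin f t \<in> carrier M"
  unfolding flin_def by (auto intro: finsum_closed)

lemma flin_add:
  assumes "\<And>p. f p \<in> carrier M"
  shows "flin f (x + y) = flin f x \<oplus> flin f y"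
proof -
  let ?A = "Poly_Mapping.keys x \<union> Poly_Mapping.keys y"
  have "flin f (x + y) = (\<Oplus>p\<in>?A. Poly_Mapping.lookup (x + y) p \<odot> f p)"
    using keys_add[of x y] by (intro flin_superset assms) auto
  then show ?thesis
    by (simp add: flin_superset[of ?A] assms lookup_add smult_add_left finsum_addf)
qed

lemma flin_scale:
  assumes "\<And>p. f p \<in> carrier M"
  shows "flin f (pm_scale c x) = c \<odot> flin f x"
proof -
  let ?A = "Poly_Mapping.keys x"
  have "flin f (pm_scale c x) = (\<Oplus>p\<in>?A. Poly_Mapping.lookup (pm_scale c x) p \<odot> f p)"
    using keys_pm_scale[of c x] by (intro flin_superset assms) auto
  then show ?thesis
    by (simp add: flin_superset[of ?A] assms smult_mult finsum_smult)
qed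

lemma flin_zero [simp]: "flin f 0 = \<zero>"
  by (simp add: flin_def)

lemma flin_single: "(\<And>p. f p \<in> carrier M) \<Longrightarrow> flin f (Poly_Mapping.single b c) = c \<odot> f b"
  by (cases "c = 0") (simp_all add: flin_def smult_zero_left)

lemma flin_unit [simp]: "(\<And>p. f p \<in> carrier M) \<Longrightarrow> flin f (unit_vec b) = f b"
  by (simp add: flin_single smult_1)

lemma flin_minus:
  assumes f: "\<And>p. f p \<in> carrier M"
  shows "flin f (x - y) = flin f x \<ominus>\<^bsub>M\<^esub> flin f y"
proof -
  have "flin f x = flin f (x - y) \<oplus> flin f y" using flin_add[where f=f and x="x - y" and y=y] f by simp
  then show ?thesis using f by (simp add: minus_eq a_assoc r_neg)
qed

text \<open>The target is a record, so linearity of \<open>F\<close> is stated by equations.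
  Identifies a composite of linear maps by its values on basis vectors.\<close>

lemma flin_unique:
  assumes F: "\<And>x y. F (x + y) = F x \<oplus> F y" "\<And>c x. F (pm_scale c x) = c \<odot> F x" "\<And>x. F x \<in> carrier M"
  shows "F t = flin (\<lambda>b. F (unit_vec b)) t"
proof -
  have F0: "F 0 = \<zero>" using F(2)[of 0 0] F(3) by (simp add: smult_zero_left)
  have "F (\<Sum>b\<in>A. pm_scale (c b) (unit_vec b)) = (\<Oplus>b\<in>A. c b \<odot> F (unit_vec b))" for A c
  proof (induction A rule: infinite_finite_induct)
    case (insert a A)
    then have "(\<Oplus>b\<in>insert a A. c b \<odot> F (unit_vec b)) = c a \<odot> F (unit_vec a) \<oplus> (\<Oplus>b\<in>A. c b \<odot> F (unit_vec b))"
      by (intro finsum_insert) (auto simp: F(3))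
    moreover have "F (\<Sum>b\<in>insert a A. pm_scale (c b) (unit_vec b))
        = c a \<odot> F (unit_vec a) \<oplus> F (\<Sum>b\<in>A. pm_scale (c b) (unit_vec b))"
      by (simp only: sum.insert[OF insert.hyps] F(1,2))
    ultimately show ?case by (simp only: insert.IH)
  qed (simp_all add: F0)
  from this[of "Poly_Mapping.lookup t" "Poly_Mapping.keys t"] show ?thesis
    unfolding flin_def by (simp only: pm_as_sum[symmetric])
qed

lemma flin_pm_lin:
  assumes "\<And>p. f p \<in> carrier M"
  shows "flin f (pm_lin g t) = flin (\<lambda>b. flin f (g b)) t"
proof -
  note lg = linear_pm_lin[of g]
  have "flin f (pm_lin g t) = flin (\<lambda>b. flin f (pm_lin g (unit_vec b))) t"
    by (rule flin_unique) (simp_all add: lin_add[OF lg] lin_scale[OF lg] flin_add flin_scale assms)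
  then show ?thesis by (simp add: pm_lin_unit)
qed

lemma flin_cong: "(\<And>b. b \<in> Poly_Mapping.keys t \<Longrightarrow> f b = g b) \<Longrightarrow> (\<And>p. g p \<in> carrier M) \<Longrightarrow> flin f t = flin g t"
  unfolding flin_def by (rule finsum_cong') auto

lemma flin_plus:
  assumes "\<And>p. f p \<in> carrier M" "\<And>p. g p \<in> carrier M"
  shows "flin (\<lambda>b. f b \<oplus> g b) t = flin f t \<oplus> flin g t"
  by (simp add: flin_def assms smult_add_right finsum_addf)

lemma flin_smult:
  assumes "\<And>p. f p \<in> carrier M"
  shows "flin (\<lambda>b. c \<odot> f b) t = c \<odot> flin f t"
  by (simp add: flin_def assms finsum_smult Pi_def smult_mult[symmetric] mult.commute)

end

lemma flin_linear_maps:
  assumes M: "module scalars M" and N: "module scalars N"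
    and g: "g \<in> linear_maps M N" and f: "\<And>b. f b \<in> carrier M"
  shows "g (carrier_space.flin M f t) = carrier_space.flin N (\<lambda>b. g (f b)) t"
proof -
  interpret M: carrier_space M by (rule carrier_space.intro[OF M])
  interpret N: carrier_space N by (rule carrier_space.intro[OF N])
  have "g (M.flin f t) = N.flin (\<lambda>b. g (M.flin f (unit_vec b))) t"
    using g by (intro N.flin_unique) (auto simp: linear_maps_def M.flin_add M.flin_scale f)
  then show ?thesis by (simp add: f)
qed

subsection \<open>Quotients\<close>

lemma quotient_simps:
  "carrier (quotient M I) = a_rcosets\<^bsub>M\<^esub> I"
  "mult (quotient M I) = rcoset_mult M I"
  "one (quotient M I) = I +>\<^bsub>M\<^esub> \<one>\<^bsub>M\<^esub>"
  "zero (quotient M I) = I"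
  "add (quotient M I) = set_add M"
  "smult (quotient M I) = (\<lambda>c X. \<Union>x\<in>X. I +>\<^bsub>M\<^esub> (c \<odot>\<^bsub>M\<^esub> x))"
  by (simp_all add: quotient_def ring.extend_def module.fields_def FactRing_def)

text \<open>U(g), the tensor products and the arities of \<open>PSB\<close> are all quotients of
  spaces of finitely supported functions; the arithmetic of their cosets is done once here.\<close>

locale pm_quotient =
  fixes M :: "('k::field, 'b \<Rightarrow>\<^sub>0 'k, 'm) module_scheme" and I :: "('b \<Rightarrow>\<^sub>0 'k) set"
  assumes add: "add M = (+)" and zero: "zero M = 0" and smult: "smult M = pm_scale"
    and carrier: "subspace_of pm_scale (carrier M)"
    and I: "subspace_of pm_scale I" and I_carrier: "I \<subseteq> carrier M"
begin

abbreviation coset :: "('b \<Rightarrow>\<^sub>0 'k) \<Rightarrow> ('b \<Rightarrow>\<^sub>0 'k) set" where "coset x \<equiv> I +>\<^bsub>M\<^esub> x"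
abbreviation Q :: "('k, ('b \<Rightarrow>\<^sub>0 'k) set) module" where "Q \<equiv> quotient M I"

lemmas I_closed = subsp_0[OF vector_space_pm_scale I] subsp_add[OF vector_space_pm_scale I]
  subsp_scale[OF vector_space_pm_scale I] subsp_minus[OF vector_space_pm_scale I]
  subsp_diff[OF vector_space_pm_scale I]

lemmas M_closed = subsp_0[OF vector_space_pm_scale carrier] subsp_add[OF vector_space_pm_scale carrier]
  subsp_scale[OF vector_space_pm_scale carrier] subsp_minus[OF vector_space_pm_scale carrier]
  subsp_diff[OF vector_space_pm_scale carrier]

lemma mem_coset: "y \<in> coset x \<longleftrightarrow> y - x \<in> I"
proof
  assume "y - x \<in> I"
  then show "y \<in> coset x" by (force simp: a_r_coset_def' add intro: bexI[of _ "y - x"])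
qed (auto simp: a_r_coset_def' add)

lemma self_mem_coset: "x \<in> coset x"
  by (simp add: mem_coset I_closed)

lemma coset_eq_iff: "coset x = coset y \<longleftrightarrow> x - y \<in> I"
proof
  assume "x - y \<in> I"
  then have "z - x \<in> I \<longleftrightarrow> z - y \<in> I" for z
    using I_closed(2)[of "z - x" "x - y"] I_closed(5)[of "z - y" "x - y"] by auto
  then show "coset x = coset y" by (auto simp: mem_coset)
qed (use self_mem_coset mem_coset in blast)

lemma I_eq_coset: "I = coset 0"
  by (auto simp: mem_coset)

lemma carrier_Q: "carrier Q = coset ` carrier M"
  by (auto simp: quotient_simps A_RCOSETS_def')

lemma coset_in_Q [simp]: "x \<in> carrier M \<Longrightarrow> coset x \<in> carrier Q"
  by (simp add: carrier_Q)

lemma add_Q: "coset x \<oplus>\<^bsub>Q\<^esub> coset y = coset (x + y)"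
proof -
  have "\<exists>a b. a - x \<in> I \<and> b - y \<in> I \<and> z = a + b" if "z - (x + y) \<in> I" for z
    using that I_closed(1) by (intro exI[of _ "z - y"] exI[of _ y]) (auto simp: algebra_simps)
  moreover have "a + b - (x + y) \<in> I" if "a - x \<in> I" "b - y \<in> I" for a b
    using I_closed(2)[OF that] by (simp add: algebra_simps)
  ultimately show ?thesis
    unfolding set_eq_iff quotient_simps set_add_def' add UN_iff mem_coset Bex_def by blast
qed

text \<open>The scalar multiple is a union over representatives; closure of \<open>I\<close> under
  scaling makes all its members the same coset.\<close>

lemma smult_Q: "c \<odot>\<^bsub>Q\<^esub> coset x = coset (pm_scale c x)"
proof -
  have "coset (pm_scale c y) = coset (pm_scale c x)" if "y \<in> coset x" for y
    using I_closed(3)[of "y - x" c] that by (simp add: mem_coset coset_eq_iff pm.scale_right_diff_distrib)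
  then have "(\<Union>y\<in>coset x. coset (pm_scale c y)) = (\<Union>y\<in>coset x. coset (pm_scale c x))" by simp
  then show ?thesis using self_mem_coset[of x] by (auto simp: quotient_simps smult)
qed

lemma zero_Q: "\<zero>\<^bsub>Q\<^esub> = coset 0"
  by (simp add: quotient_simps I_eq_coset[symmetric])

lemma Q_E: assumes "X \<in> carrier Q" obtains x where "x \<in> carrier M" "X = coset x"
  using assms by (auto simp: carrier_Q)

lemma module_Q: "module scalars Q"
proof (rule moduleI[OF cring_scalars])
  show "abelian_group Q"
  proof (rule abelian_groupI)
    fix X assume "X \<in> carrier Q"
    then obtain x where "x \<in> carrier M" "X = coset x" by (rule Q_E)
    then show "\<exists>Y\<in>carrier Q. Y \<oplus>\<^bsub>Q\<^esub> X = \<zero>\<^bsub>Q\<^esub>"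
      by (intro bexI[of _ "coset (- x)"]) (auto simp: add_Q zero_Q M_closed)
  qed (auto simp: carrier_Q add_Q zero_Q M_closed algebra_simps)
qed (auto simp: carrier_Q add_Q smult_Q M_closed vs_add_right[OF vector_space_pm_scale]
    vs_add_left[OF vector_space_pm_scale] vs_scale_scale[OF vector_space_pm_scale] vs_one[OF vector_space_pm_scale])

text \<open>\<open>tensor_lift\<close> and \<open>uea_lift\<close> take the single element of the
  image of a coset; this reduces their evaluation to invariance under \<open>I\<close>.\<close>

lemma the_elem_image_coset:
  assumes "\<And>h. h \<in> I \<Longrightarrow> F (h + x) = F x"
  shows "the_elem (F ` coset x) = F x"
proof -
  have "F ` coset x = {F x}"
    using assms self_mem_coset[of x] by (auto simp: a_r_coset_def' add)
  then show ?thesis by simp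
qed

end

lemma quotient_mult:
  assumes "ideal I M" "x \<in> carrier M" "y \<in> carrier M"
  shows "(I +>\<^bsub>M\<^esub> x) \<otimes>\<^bsub>quotient M I\<^esub> (I +>\<^bsub>M\<^esub> y) = I +>\<^bsub>M\<^esub> (x \<otimes>\<^bsub>M\<^esub> y)"
  using ideal.rcoset_mult_add[OF assms] by (simp add: quotient_simps)

locale unit_alg =
  fixes A :: "('k::field, 'a, 'm) module_scheme" (structure)
  assumes unital: "unital_algebra A"
begin

sublocale ring A using unital by (simp add: unital_algebra_def)
sublocale carrier_space A using unital by (intro carrier_space.intro) (simp add: unital_algebra_def)

lemma smult_mult_left: "x \<in> carrier A \<Longrightarrow> y \<in> carrier A \<Longrightarrow> (c \<odot> x) \<otimes> y = c \<odot> (x \<otimes> y)"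
  and smult_mult_right: "x \<in> carrier A \<Longrightarrow> y \<in> carrier A \<Longrightarrow> x \<otimes> (c \<odot> y) = c \<odot> (x \<otimes> y)"
  using unital by (auto simp: unital_algebra_def)

end

lemma unital_algebra_quotient:
  assumes M: "unital_algebra M" and idl: "ideal I M" and pm: "pm_quotient M I"
  shows "unital_algebra (quotient M I)"
proof -
  interpret pm_quotient M I by fact
  interpret M: unit_alg M by (rule unit_alg.intro[OF M])
  have one: "\<one>\<^bsub>Q\<^esub> = coset \<one>\<^bsub>M\<^esub>" by (simp add: quotient_simps)
  note mult = quotient_mult[OF idl]
  have module: "module scalars Q" by (rule module_Q)
  have "ring Q"
  proof (rule ringI)
    show "abelian_group Q" using module by (rule module.axioms(2))
    show "Group.monoid Q"
      by (rule monoidI) (auto simp: carrier_Q one mult M.m_assoc)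
  qed (auto simp: carrier_Q mult add_Q M_closed M.l_distr[unfolded add] M.r_distr[unfolded add])
  moreover have "(c \<odot>\<^bsub>Q\<^esub> X) \<otimes>\<^bsub>Q\<^esub> Y = c \<odot>\<^bsub>Q\<^esub> (X \<otimes>\<^bsub>Q\<^esub> Y) \<and> X \<otimes>\<^bsub>Q\<^esub> (c \<odot>\<^bsub>Q\<^esub> Y) = c \<odot>\<^bsub>Q\<^esub> (X \<otimes>\<^bsub>Q\<^esub> Y)"
    if XY: "X \<in> carrier Q" "Y \<in> carrier Q" for c X Y
  proof -
    obtain x y where "x \<in> carrier M" "X = coset x" "y \<in> carrier M" "Y = coset y"
      using XY by (auto simp: carrier_Q)
    then show ?thesis
      using M.smult_mult_left[of x y c] M.smult_mult_right[of x y c]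
      by (simp add: mult smult_Q M_closed smult)
  qed
  ultimately show ?thesis using module by (simp add: unital_algebra_def)
qed

subsection \<open>Free spaces and monoid algebras\<close>

lemma free_space_simps [simp]:
  "carrier (free_space B) = {x. Poly_Mapping.keys x \<subseteq> B}" "zero (free_space B) = 0"
  "add (free_space B) = (+)" "smult (free_space B) = pm_scale"
  by (simp_all add: free_space_def)

lemma subspace_keys: "subspace_of pm_scale {x. Poly_Mapping.keys x \<subseteq> B}"
  unfolding subspace_of_def by (auto dest!: keys_add[THEN subsetD] keys_pm_scale[THEN subsetD])

lemma linear_subspace_free_space_iff:
  "linear_subspace (free_space B) S \<longleftrightarrow> subspace_of pm_scale S \<and> S \<subseteq> {x. Poly_Mapping.keys x \<subseteq> B}"
  by (auto simp: linear_subspace_def subspace_of_def)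

lemma pm_quotient_free_space:
  "linear_subspace (free_space B) S \<Longrightarrow> pm_quotient (free_space B) S"
  by unfold_locales (auto simp: linear_subspace_free_space_iff subspace_keys)

text \<open>Product of a monoid algebra for the multiplication \<open>f\<close> of the basis;
  \<open>f = (@)\<close> gives the free algebra.\<close>

definition conv :: "('b \<Rightarrow> 'b \<Rightarrow> 'b) \<Rightarrow> ('b \<Rightarrow>\<^sub>0 'k::field) \<Rightarrow> ('b \<Rightarrow>\<^sub>0 'k) \<Rightarrow> ('b \<Rightarrow>\<^sub>0 'k)" where
  "conv f x y = pm_lin (\<lambda>a. pm_lin (\<lambda>b. unit_vec (f a b)) y) x"

lemma conv_unit [simp]: "conv f (unit_vec a) (unit_vec b) = unit_vec (f a b)"
  by (simp add: conv_def pm_lin_unit)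

lemma linear_conv_left: "is_linear pm_scale pm_scale (\<lambda>x. conv f x y)"
  unfolding conv_def by (rule linear_pm_lin)

lemma linear_conv_right: "is_linear pm_scale pm_scale (\<lambda>y. conv f x y)"
  unfolding conv_def pm_lin_eq
  by (rule linear_lin_ext_param) (auto intro: vector_space_pm_scale linear_lin_ext)

text \<open>Associativity of \<open>f\<close> is asked on the supports, since the multiplication of
  a monoid record is associative on its carrier.\<close>

lemma conv_assoc:
  assumes "\<And>a b c. a \<in> Poly_Mapping.keys x \<Longrightarrow> b \<in> Poly_Mapping.keys y \<Longrightarrow> c \<in> Poly_Mapping.keys z \<Longrightarrow> f (f a b) c = f a (f b c)"
  shows "conv f (conv f x y) z = conv f x (conv f y z)"
proof (rule linear_pm_eqI[where F="\<lambda>x. conv f (conv f x y) z"])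
  fix a assume a: "a \<in> Poly_Mapping.keys x"
  show "conv f (conv f (unit_vec a) y) z = conv f (unit_vec a) (conv f y z)"
  proof (rule linear_pm_eqI[where F="\<lambda>y. conv f (conv f (unit_vec a) y) z"])
    fix b assume b: "b \<in> Poly_Mapping.keys y"
    show "conv f (conv f (unit_vec a) (unit_vec b)) z = conv f (unit_vec a) (conv f (unit_vec b) z)"
      unfolding conv_unit
      by (rule linear_pm_eqI[where F="\<lambda>z. conv f (unit_vec (f a b)) z"])
        (auto intro: linear_conv_right lin_comp[OF linear_conv_right linear_conv_right] simp: assms a b)
  qed (rule lin_comp[OF linear_conv_right linear_conv_left] lin_comp[OF linear_conv_left linear_conv_right])+
qed (rule lin_comp[OF linear_conv_left linear_conv_left] linear_conv_left)+

lemma conv_unit_left: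
  assumes "\<And>b. b \<in> Poly_Mapping.keys y \<Longrightarrow> f e b = b"
  shows "conv f (unit_vec e) y = y"
  by (rule linear_pm_eqI[OF linear_conv_right lin_id_fun[OF vector_space_pm_scale]]) (simp add: assms)

lemma conv_unit_right:
  assumes "\<And>b. b \<in> Poly_Mapping.keys x \<Longrightarrow> f b e = b"
  shows "conv f x (unit_vec e) = x"
  by (rule linear_pm_eqI[OF linear_conv_left lin_id_fun[OF vector_space_pm_scale]]) (simp add: assms)

lemma conv_in_subspace:
  assumes S: "subspace_of pm_scale S"
    and "\<And>a b. a \<in> Poly_Mapping.keys x \<Longrightarrow> b \<in> Poly_Mapping.keys y \<Longrightarrow> unit_vec (f a b) \<in> S"
  shows "conv f x y \<in> S"
  unfolding conv_def pm_lin_eq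
  by (intro lin_ext_in_subspace vector_space_pm_scale S assms)

lemma monoid_algebra_simps:
  "carrier (monoid_algebra G) = {x. Poly_Mapping.keys x \<subseteq> carrier G}" "zero (monoid_algebra G) = 0"
  "add (monoid_algebra G) = (+)" "smult (monoid_algebra G) = pm_scale"
  "mult (monoid_algebra G) = conv (mult G)" "one (monoid_algebra G) = unit_vec \<one>\<^bsub>G\<^esub>"
  by (simp_all add: monoid_algebra_def free_space_def conv_def fun_eq_iff)

lemma unital_algebra_monoid_algebra:
  assumes "Group.monoid G"
  shows "unital_algebra (monoid_algebra G :: ('k::field, _) module)"
proof -
  interpret monoid G by fact
  let ?A = "monoid_algebra G :: ('k::field, _) module"
  have keys: "Poly_Mapping.keys (conv (mult G) x y) \<subseteq> carrier G"
    if "Poly_Mapping.keys x \<subseteq> carrier G" "Poly_Mapping.keys y \<subseteq> carrier G" for x y :: "_ \<Rightarrow>\<^sub>0 'k"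
    using conv_in_subspace[OF subspace_keys[of "carrier G"], of x y "mult G"] that by auto
  have mod: "module scalars ?A"
  proof (rule moduleI[OF cring_scalars])
    show "abelian_group ?A"
    proof (rule abelian_groupI)
      fix x assume "x \<in> carrier ?A"
      then show "\<exists>y\<in>carrier ?A. y \<oplus>\<^bsub>?A\<^esub> x = \<zero>\<^bsub>?A\<^esub>"
        by (intro bexI[of _ "- x"]) (auto simp: monoid_algebra_simps in_keys_iff)
    qed (use keys_add in \<open>fastforce simp: monoid_algebra_simps algebra_simps\<close>)+
  next
    fix a :: 'k and x assume "x \<in> carrier ?A"
    then show "a \<odot>\<^bsub>?A\<^esub> x \<in> carrier ?A"
      using keys_pm_scale[of a x] by (auto simp: monoid_algebra_simps)
  qed (auto simp: monoid_algebra_simps vs_add_right[OF vector_space_pm_scale]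
    vs_add_left[OF vector_space_pm_scale] vs_scale_scale[OF vector_space_pm_scale] vs_one[OF vector_space_pm_scale])
  have "ring ?A"
  proof (rule ringI)
    show "abelian_group ?A" using mod by (rule module.axioms(2))
    show "Group.monoid ?A"
    proof (rule monoidI)
      fix x y z assume "x \<in> carrier ?A" "y \<in> carrier ?A" "z \<in> carrier ?A"
      then show "x \<otimes>\<^bsub>?A\<^esub> y \<otimes>\<^bsub>?A\<^esub> z = x \<otimes>\<^bsub>?A\<^esub> (y \<otimes>\<^bsub>?A\<^esub> z)"
        unfolding monoid_algebra_simps by (intro conv_assoc m_assoc) auto
    next
      fix x assume "x \<in> carrier ?A"
      then show "\<one>\<^bsub>?A\<^esub> \<otimes>\<^bsub>?A\<^esub> x = x" "x \<otimes>\<^bsub>?A\<^esub> \<one>\<^bsub>?A\<^esub> = x"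
        unfolding monoid_algebra_simps by (intro conv_unit_left conv_unit_right; auto)+
    qed (auto simp: monoid_algebra_simps keys[THEN subsetD])
  qed (auto simp: monoid_algebra_simps lin_add[OF linear_conv_left] lin_add[OF linear_conv_right])
  then show ?thesis
    by (auto simp: unital_algebra_def mod monoid_algebra_simps lin_scale[OF linear_conv_left] lin_scale[OF linear_conv_right])
qed

lemma pm_quotient_monoid_algebra:
  assumes "subspace_of pm_scale I" "I \<subseteq> {x. Poly_Mapping.keys x \<subseteq> carrier G}"
  shows "pm_quotient (monoid_algebra G) I"
  by unfold_locales (use assms in \<open>auto simp: monoid_algebra_simps subspace_keys\<close>)

text \<open>By bilinearity, closure under products with basis elements extends to closure under all
  products.\<close>

lemma monoid_algebra_idealI:
  fixes I :: "('b \<Rightarrow>\<^sub>0 'k::field) set"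
  assumes G: "Group.monoid G" and I: "subspace_of pm_scale I" "I \<subseteq> {x. Poly_Mapping.keys x \<subseteq> carrier G}"
    and l: "\<And>g x. g \<in> carrier G \<Longrightarrow> x \<in> I \<Longrightarrow> conv (mult G) (unit_vec g) x \<in> I"
    and r: "\<And>g x. g \<in> carrier G \<Longrightarrow> x \<in> I \<Longrightarrow> conv (mult G) x (unit_vec g) \<in> I"
  shows "ideal I (monoid_algebra G)"
proof -
  let ?A = "monoid_algebra G :: ('k, _) module"
  interpret A: unit_alg ?A by unfold_locales (rule unital_algebra_monoid_algebra[OF G])
  note Ic = subsp_0[OF vector_space_pm_scale I(1)] subsp_add[OF vector_space_pm_scale I(1)]
    subsp_minus[OF vector_space_pm_scale I(1)]
  have inv: "\<ominus>\<^bsub>?A\<^esub> x = - x" if "x \<in> carrier ?A" for x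
  proof -
    have "- x \<in> carrier ?A" using that by (auto simp: monoid_algebra_simps in_keys_iff)
    then show ?thesis using that A.minus_equality[of "- x" x] by (simp add: monoid_algebra_simps)
  qed
  show ?thesis
  proof (rule idealI)
    show "ring ?A" by (rule A.ring_axioms)
    have "inv\<^bsub>add_monoid ?A\<^esub> x \<in> I" if "x \<in> I" for x
      using that inv[of x, unfolded a_inv_def] Ic(3)[of x] I(2) by (auto simp: monoid_algebra_simps(1))
    then show "subgroup I (add_monoid ?A)"
      by (intro subgroup.intro) (use I(2) Ic in \<open>auto simp: monoid_algebra_simps\<close>)
  next
    fix x a assume a: "a \<in> I" and x: "x \<in> carrier ?A"
    have "pm_lin (\<lambda>b. conv (mult G) (unit_vec b) a) x \<in> I"
      unfolding pm_lin_eq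
      by (rule lin_ext_in_subspace[OF vector_space_pm_scale I(1)]) (use x a l in \<open>auto simp: monoid_algebra_simps\<close>)
    then show "x \<otimes>\<^bsub>?A\<^esub> a \<in> I"
      by (simp add: monoid_algebra_simps pm_lin_eq linear_eq_lin_ext[OF linear_conv_left, symmetric])
    have "pm_lin (\<lambda>b. conv (mult G) a (unit_vec b)) x \<in> I"
      unfolding pm_lin_eq
      by (rule lin_ext_in_subspace[OF vector_space_pm_scale I(1)]) (use x a r in \<open>auto simp: monoid_algebra_simps\<close>)
    then show "a \<otimes>\<^bsub>?A\<^esub> x \<in> I"
      by (simp add: monoid_algebra_simps pm_lin_eq linear_eq_lin_ext[OF linear_conv_right, symmetric])
  qed
qed

subsection \<open>Tensor products\<close>

definition bilin ::
  "('k::field, 'a, 'm) module_scheme \<Rightarrow> ('k, 'b, 'n) module_scheme \<Rightarrow> ('k, 'c, 'l) module_scheme \<Rightarrow> ('a \<Rightarrow> 'b \<Rightarrow> 'c) \<Rightarrow> bool"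
  where "bilin A B M h \<longleftrightarrow>
    (\<forall>a\<in>carrier A. h a \<in> linear_maps B M) \<and> (\<forall>b\<in>carrier B. (\<lambda>a. h a b) \<in> linear_maps A M)"

lemma bilinD:
  assumes "bilin A B M h" "a \<in> carrier A" "b \<in> carrier B"
  shows "h a b \<in> carrier M"
    and "a' \<in> carrier A \<Longrightarrow> h (a \<oplus>\<^bsub>A\<^esub> a') b = h a b \<oplus>\<^bsub>M\<^esub> h a' b"
    and "b' \<in> carrier B \<Longrightarrow> h a (b \<oplus>\<^bsub>B\<^esub> b') = h a b \<oplus>\<^bsub>M\<^esub> h a b'"
    and "h (c \<odot>\<^bsub>A\<^esub> a) b = c \<odot>\<^bsub>M\<^esub> h a b"
    and "h a (c \<odot>\<^bsub>B\<^esub> b) = c \<odot>\<^bsub>M\<^esub> h a b"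
  using assms by (auto simp: bilin_def linear_maps_def)

lemma bilinI:
  assumes "\<And>a b. a \<in> carrier A \<Longrightarrow> b \<in> carrier B \<Longrightarrow> h a b \<in> carrier M"
    and "\<And>a a' b. a \<in> carrier A \<Longrightarrow> a' \<in> carrier A \<Longrightarrow> b \<in> carrier B \<Longrightarrow> h (a \<oplus>\<^bsub>A\<^esub> a') b = h a b \<oplus>\<^bsub>M\<^esub> h a' b"
    and "\<And>a b b'. a \<in> carrier A \<Longrightarrow> b \<in> carrier B \<Longrightarrow> b' \<in> carrier B \<Longrightarrow> h a (b \<oplus>\<^bsub>B\<^esub> b') = h a b \<oplus>\<^bsub>M\<^esub> h a b'"
    and "\<And>c a b. a \<in> carrier A \<Longrightarrow> b \<in> carrier B \<Longrightarrow> h (c \<odot>\<^bsub>A\<^esub> a) b = c \<odot>\<^bsub>M\<^esub> h a b"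
    and "\<And>c a b. a \<in> carrier A \<Longrightarrow> b \<in> carrier B \<Longrightarrow> h a (c \<odot>\<^bsub>B\<^esub> b) = c \<odot>\<^bsub>M\<^esub> h a b"
  shows "bilin A B M h"
  using assms by (auto simp: bilin_def linear_maps_def)

definition tensor_gens ::
  "('k::field, 'a, 'm) module_scheme \<Rightarrow> ('k, 'b, 'n) module_scheme \<Rightarrow> ('a \<times> 'b \<Rightarrow>\<^sub>0 'k) set" where
  "tensor_gens A B =
     {unit_vec (a \<oplus>\<^bsub>A\<^esub> a', b) - unit_vec (a, b) - unit_vec (a', b) | a a' b.
         a \<in> carrier A \<and> a' \<in> carrier A \<and> b \<in> carrier B} \<union>
     {unit_vec (a, b \<oplus>\<^bsub>B\<^esub> b') - unit_vec (a, b) - unit_vec (a, b') | a b b'.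
         a \<in> carrier A \<and> b \<in> carrier B \<and> b' \<in> carrier B} \<union>
     {unit_vec (c \<odot>\<^bsub>A\<^esub> a, b) - Poly_Mapping.single (a, b) c | c a b. a \<in> carrier A \<and> b \<in> carrier B} \<union>
     {unit_vec (a, c \<odot>\<^bsub>B\<^esub> b) - Poly_Mapping.single (a, b) c | c a b. a \<in> carrier A \<and> b \<in> carrier B}"

lemma tensor_relations_eq: "tensor_relations A B = pm.span (tensor_gens A B)"
  by (simp add: tensor_relations_def tensor_gens_def)

lemma tensor_gens_cases:
  assumes "x \<in> tensor_gens A B"
    and "\<And>a a' b. a \<in> carrier A \<Longrightarrow> a' \<in> carrier A \<Longrightarrow> b \<in> carrier B \<Longrightarrow>
      P (unit_vec (a \<oplus>\<^bsub>A\<^esub> a', b) - unit_vec (a, b) - unit_vec (a', b))"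
    and "\<And>a b b'. a \<in> carrier A \<Longrightarrow> b \<in> carrier B \<Longrightarrow> b' \<in> carrier B \<Longrightarrow>
      P (unit_vec (a, b \<oplus>\<^bsub>B\<^esub> b') - unit_vec (a, b) - unit_vec (a, b'))"
    and "\<And>c a b. a \<in> carrier A \<Longrightarrow> b \<in> carrier B \<Longrightarrow> P (unit_vec (c \<odot>\<^bsub>A\<^esub> a, b) - Poly_Mapping.single (a, b) c)"
    and "\<And>c a b. a \<in> carrier A \<Longrightarrow> b \<in> carrier B \<Longrightarrow> P (unit_vec (a, c \<odot>\<^bsub>B\<^esub> b) - Poly_Mapping.single (a, b) c)"
  shows "P x"
  using assms(1) unfolding tensor_gens_def by (elim UnE CollectE exE conjE) (use assms(2-) in simp)+

lemma tensor_gensI: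
  "a \<in> carrier A \<Longrightarrow> a' \<in> carrier A \<Longrightarrow> b \<in> carrier B \<Longrightarrow>
    unit_vec (a \<oplus>\<^bsub>A\<^esub> a', b) - unit_vec (a, b) - unit_vec (a', b) \<in> tensor_gens A B"
  "a \<in> carrier A \<Longrightarrow> b \<in> carrier B \<Longrightarrow> b' \<in> carrier B \<Longrightarrow>
    unit_vec (a, b \<oplus>\<^bsub>B\<^esub> b') - unit_vec (a, b) - unit_vec (a, b') \<in> tensor_gens A B"
  "a \<in> carrier A \<Longrightarrow> b \<in> carrier B \<Longrightarrow> unit_vec (c \<odot>\<^bsub>A\<^esub> a, b) - Poly_Mapping.single (a, b) c \<in> tensor_gens A B"
  "a \<in> carrier A \<Longrightarrow> b \<in> carrier B \<Longrightarrow> unit_vec (a, c \<odot>\<^bsub>B\<^esub> b) - Poly_Mapping.single (a, b) c \<in> tensor_gens A B"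
  unfolding tensor_gens_def by blast+

locale tensor_algebras = A: unit_alg A + B: unit_alg B
  for A :: "('k::field, 'a, 'm) module_scheme" and B :: "('k, 'b, 'n) module_scheme"
begin

abbreviation MA :: "('k, 'a \<times> 'b \<Rightarrow>\<^sub>0 'k) module" where "MA \<equiv> monoid_algebra (A \<times>\<times> B)"
abbreviation rel :: "('a \<times> 'b \<Rightarrow>\<^sub>0 'k) set" where "rel \<equiv> tensor_relations A B"
abbreviation TP :: "('k, ('a \<times> 'b \<Rightarrow>\<^sub>0 'k) set) module" where "TP \<equiv> tensor_product A B"
abbreviation pure :: "'a \<Rightarrow> 'b \<Rightarrow> ('a \<times> 'b \<Rightarrow>\<^sub>0 'k) set" where "pure \<equiv> pure_tensor A B"

lemma monoid_DirProd: "Group.monoid (A \<times>\<times> B)"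
  by (rule DirProd_monoid) (rule A.monoid_axioms B.monoid_axioms)+

lemma rel_carrier: "rel \<subseteq> {x. Poly_Mapping.keys x \<subseteq> carrier (A \<times>\<times> B)}"
  unfolding tensor_relations_eq
proof (rule span_subset_subspace[OF subspace_keys], rule subsetI)
  let ?S = "{x :: 'a \<times> 'b \<Rightarrow>\<^sub>0 'k. Poly_Mapping.keys x \<subseteq> carrier (A \<times>\<times> B)}"
  note S = subsp_diff[OF vector_space_pm_scale subspace_keys]
  fix x assume "x \<in> tensor_gens A B"
  then show "x \<in> ?S"
    by (rule tensor_gens_cases; intro S) (auto split: if_splits)
qed

lemma rel_subspace: "subspace_of pm_scale rel"
  by (simp add: tensor_relations_eq subsp_span)

sublocale pm_quotient MA rel
  by (rule pm_quotient_monoid_algebra[OF rel_subspace rel_carrier])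

lemma TP_eq: "TP = quotient MA rel"
  by (simp add: tensor_product_def)

text \<open>A bilinearity relation multiplied by a pair \<open>(u, v)\<close> is again a bilinearity
  relation of the same type, so the span of the relations is a two-sided ideal.\<close>

lemma conv_rel:
  assumes "g \<in> carrier (A \<times>\<times> B)" "x \<in> rel"
  shows "conv (mult (A \<times>\<times> B)) (unit_vec g) x \<in> rel" "conv (mult (A \<times>\<times> B)) x (unit_vec g) \<in> rel"
proof -
  let ?l = "conv (mult (A \<times>\<times> B)) (unit_vec g)" and ?r = "\<lambda>x. conv (mult (A \<times>\<times> B)) x (unit_vec g)"
  obtain u v where g: "g = (u, v)" "u \<in> carrier A" "v \<in> carrier B" using assms(1) by auto
  note ll = linear_conv_right[of "mult (A \<times>\<times> B)" "unit_vec g"] and lr = linear_conv_left[of "mult (A \<times>\<times> B)" "unit_vec g"]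
  have gens: "?l x \<in> rel \<and> ?r x \<in> rel" if "x \<in> tensor_gens A B" for x
    using that
  proof (rule tensor_gens_cases)
    fix c a b assume ab: "a \<in> carrier A" "b \<in> carrier B"
    show "?l (unit_vec (c \<odot>\<^bsub>A\<^esub> a, b) - Poly_Mapping.single (a, b) c) \<in> rel \<and>
      ?r (unit_vec (c \<odot>\<^bsub>A\<^esub> a, b) - Poly_Mapping.single (a, b) c) \<in> rel"
      unfolding single_eq_pm_scale[of "(a, b)" c] lin_diff[OF ll] lin_diff[OF lr] lin_scale[OF ll] lin_scale[OF lr]
      using ab g tensor_gensI(3)[of "u \<otimes>\<^bsub>A\<^esub> a" A "v \<otimes>\<^bsub>B\<^esub> b" B c] tensor_gensI(3)[of "a \<otimes>\<^bsub>A\<^esub> u" A "b \<otimes>\<^bsub>B\<^esub> v" B c]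
      by (auto simp: tensor_relations_eq DirProd_def A.smult_mult_left A.smult_mult_right intro: pm.span_base)
    show "?l (unit_vec (a, c \<odot>\<^bsub>B\<^esub> b) - Poly_Mapping.single (a, b) c) \<in> rel \<and>
      ?r (unit_vec (a, c \<odot>\<^bsub>B\<^esub> b) - Poly_Mapping.single (a, b) c) \<in> rel"
      unfolding single_eq_pm_scale[of "(a, b)" c] lin_diff[OF ll] lin_diff[OF lr] lin_scale[OF ll] lin_scale[OF lr]
      using ab g tensor_gensI(4)[of "u \<otimes>\<^bsub>A\<^esub> a" A "v \<otimes>\<^bsub>B\<^esub> b" B c] tensor_gensI(4)[of "a \<otimes>\<^bsub>A\<^esub> u" A "b \<otimes>\<^bsub>B\<^esub> v" B c]
      by (auto simp: tensor_relations_eq DirProd_def B.smult_mult_left B.smult_mult_right intro: pm.span_base)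
  qed (use g in \<open>auto simp only: lin_diff[OF ll[unfolded g(1)]] lin_diff[OF lr[unfolded g(1)]] tensor_relations_eq conv_unit mult_DirProd
      A.l_distr A.r_distr B.l_distr B.r_distr intro!: pm.span_base tensor_gensI A.m_closed B.m_closed\<close>)
  have "tensor_gens A B \<subseteq> {x. ?l x \<in> rel}" "tensor_gens A B \<subseteq> {x. ?r x \<in> rel}"
    using gens by blast+
  note span_subset_subspace[OF subspace_vimage[OF ll rel_subspace] this(1), folded tensor_relations_eq]
    span_subset_subspace[OF subspace_vimage[OF lr rel_subspace] this(2), folded tensor_relations_eq]
  then show "?l x \<in> rel" "?r x \<in> rel" using assms(2) by blast+
qed

lemma ideal_rel: "ideal rel MA"
  by (rule monoid_algebra_idealI[OF monoid_DirProd rel_subspace rel_carrier conv_rel])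

lemma unital_TP: "unital_algebra TP"
  unfolding TP_eq
  by (rule unital_algebra_quotient[OF unital_algebra_monoid_algebra[OF monoid_DirProd] ideal_rel pm_quotient_axioms])

sublocale TP: unit_alg TP by (rule unit_alg.intro[OF unital_TP])

lemma pure_eq: "pure a b = coset (unit_vec (a, b))"
  by (simp add: pure_tensor_def)

lemma unit_vec_in_MA: "a \<in> carrier A \<Longrightarrow> b \<in> carrier B \<Longrightarrow> unit_vec (a, b) \<in> carrier MA"
  by (auto simp: monoid_algebra_simps)

lemma pure_closed [simp]: "a \<in> carrier A \<Longrightarrow> b \<in> carrier B \<Longrightarrow> pure a b \<in> carrier TP"
  unfolding pure_eq TP_eq by (intro coset_in_Q unit_vec_in_MA)

lemma rel_base: "x \<in> tensor_gens A B \<Longrightarrow> x \<in> rel"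
  by (simp add: tensor_relations_eq pm.span_base)

lemma bilin_pure: "bilin A B TP pure"
proof (rule bilinI)
  fix a a' b assume "a \<in> carrier A" "a' \<in> carrier A" "b \<in> carrier B"
  from rel_base[OF tensor_gensI(1)[OF this]] show "pure (a \<oplus>\<^bsub>A\<^esub> a') b = pure a b \<oplus>\<^bsub>TP\<^esub> pure a' b"
    unfolding pure_eq TP_eq add_Q coset_eq_iff diff_diff_eq .
next
  fix a b b' assume "a \<in> carrier A" "b \<in> carrier B" "b' \<in> carrier B"
  from rel_base[OF tensor_gensI(2)[OF this]] show "pure a (b \<oplus>\<^bsub>B\<^esub> b') = pure a b \<oplus>\<^bsub>TP\<^esub> pure a b'"
    unfolding pure_eq TP_eq add_Q coset_eq_iff diff_diff_eq .
next
  fix c a b assume "a \<in> carrier A" "b \<in> carrier B"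
  then show "pure (c \<odot>\<^bsub>A\<^esub> a) b = c \<odot>\<^bsub>TP\<^esub> pure a b" "pure a (c \<odot>\<^bsub>B\<^esub> b) = c \<odot>\<^bsub>TP\<^esub> pure a b"
    unfolding pure_eq TP_eq smult_Q coset_eq_iff pm_scale_single mult_1_right
    by (blast intro: rel_base tensor_gensI)+
qed simp

lemma pure_mult:
  "a \<in> carrier A \<Longrightarrow> b \<in> carrier B \<Longrightarrow> a' \<in> carrier A \<Longrightarrow> b' \<in> carrier B \<Longrightarrow>
    pure a b \<otimes>\<^bsub>TP\<^esub> pure a' b' = pure (a \<otimes>\<^bsub>A\<^esub> a') (b \<otimes>\<^bsub>B\<^esub> b')"
  unfolding pure_eq TP_eq
  by (subst quotient_mult[OF ideal_rel]) (auto intro: unit_vec_in_MA simp: monoid_algebra_simps DirProd_def)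

lemma pure_one: "\<one>\<^bsub>TP\<^esub> = pure \<one>\<^bsub>A\<^esub> \<one>\<^bsub>B\<^esub>"
  by (simp add: pure_eq TP_eq quotient_simps monoid_algebra_simps DirProd_def)

end

locale tensor_target = tensor_algebras A B + M: carrier_space M
  for A :: "('k::field, 'a, 'm) module_scheme" and B :: "('k, 'b, 'n) module_scheme"
    and M :: "('k, 'c, 'l) module_scheme"
begin

text \<open>The lemmas on \<open>flin\<close> ask for values in the carrier at every argument,
  whereas a bilinear \<open>h\<close> is controlled on the carriers; elsewhere it is replaced by
  zero.\<close>

definition guarded :: "('a \<Rightarrow> 'b \<Rightarrow> 'c) \<Rightarrow> 'a \<times> 'b \<Rightarrow> 'c" where
  "guarded h p = (if p \<in> carrier (A \<times>\<times> B) then h (fst p) (snd p) else \<zero>\<^bsub>M\<^esub>)"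

lemma guarded_closed: "bilin A B M h \<Longrightarrow> guarded h p \<in> carrier M"
  by (auto simp: guarded_def bilinD)

lemma flin_guarded_rel:
  assumes h: "bilin A B M h" and x: "x \<in> rel"
  shows "M.flin (guarded h) x = \<zero>\<^bsub>M\<^esub>"
proof -
  let ?F = "M.flin (guarded h)"
  note cl = guarded_closed[OF h]
  have zero: "a \<oplus>\<^bsub>M\<^esub> (b \<oplus>\<^bsub>M\<^esub> (\<ominus>\<^bsub>M\<^esub> a \<oplus>\<^bsub>M\<^esub> \<ominus>\<^bsub>M\<^esub> b)) = \<zero>\<^bsub>M\<^esub>" if "a \<in> carrier M" "b \<in> carrier M" for a b
    using that M.r_neg[of "a \<oplus>\<^bsub>M\<^esub> b"] by (simp add: M.minus_add M.a_assoc)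
  have "subspace_of pm_scale {x. ?F x = \<zero>\<^bsub>M\<^esub>}"
    by (auto simp: subspace_of_def M.flin_add M.flin_scale cl M.sc.smult_r_null)
  moreover have "tensor_gens A B \<subseteq> {x. ?F x = \<zero>\<^bsub>M\<^esub>}"
  proof
    fix x assume "x \<in> tensor_gens A B"
    then show "x \<in> {x. ?F x = \<zero>\<^bsub>M\<^esub>}"
      by (rule tensor_gens_cases)
        (auto simp: M.flin_minus M.flin_single M.smult_1 cl, auto simp: guarded_def bilinD[OF h] M.minus_eq M.r_neg M.a_assoc zero)
  qed
  ultimately have "rel \<subseteq> {x. ?F x = \<zero>\<^bsub>M\<^esub>}"
    unfolding tensor_relations_eq by (rule span_subset_subspace)
  then show ?thesis using x by auto
qed

lemma tensor_lift_coset: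
  assumes h: "bilin A B M h" and t: "t \<in> carrier MA"
  shows "tensor_lift M h (coset t) = M.flin (guarded h) t"
proof -
  note cl = guarded_closed[OF h]
  \<comment> \<open>Representatives of the coset have their support in the carrier, where
    \<open>h\<close> and \<open>guarded h\<close> agree.\<close>
  have *: "(\<Oplus>\<^bsub>M\<^esub>p\<in>Poly_Mapping.keys x. Poly_Mapping.lookup x p \<odot>\<^bsub>M\<^esub> h (fst p) (snd p)) = M.flin (guarded h) x"
    if "x \<in> coset t" for x
  proof -
    have "x - t \<in> carrier MA" using that I_carrier by (auto simp: mem_coset)
    then have "Poly_Mapping.keys x \<subseteq> carrier (A \<times>\<times> B)"
      using M_closed(2)[OF _ t, of "x - t"] by (simp add: monoid_algebra_simps)
    then show ?thesis
      unfolding M.flin_def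
      by (intro M.finsum_cong') (auto simp: cl guarded_def bilinD[OF h])
  qed
  have "tensor_lift M h (coset t) = the_elem (M.flin (guarded h) ` coset t)"
    unfolding tensor_lift_def using * by (metis (no_types, lifting) image_cong)
  also have "\<dots> = M.flin (guarded h) t"
    by (rule the_elem_image_coset) (simp add: M.flin_add cl flin_guarded_rel[OF h])
  finally show ?thesis .
qed

lemma tensor_lift_linear:
  assumes h: "bilin A B M h"
  shows "tensor_lift M h \<in> linear_maps TP M"
proof -
  note cl = guarded_closed[OF h]
  show ?thesis
    unfolding linear_maps_def TP_eq carrier_Q
    by (auto simp: add_Q smult_Q M_closed tensor_lift_coset[OF h] M.flin_add M.flin_scale cl)
qed

lemma tensor_lift_pure:
  assumes h: "bilin A B M h" and "a \<in> carrier A" "b \<in> carrier B"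
  shows "tensor_lift M h (pure a b) = h a b"
  unfolding pure_eq
  by (subst tensor_lift_coset[OF h unit_vec_in_MA[OF assms(2,3)]])
    (simp add: guarded_closed[OF h], simp add: guarded_def assms)

end

subsection \<open>Unshuffles\<close>

text \<open>Sum of \<open>G u v\<close> over the splittings of the word into a subsequence
  \<open>u\<close> and the complementary subsequence \<open>v\<close>: the Sweedler sum of a product
  of primitive elements.\<close>

primrec ssum :: "'x list \<Rightarrow> ('x list \<Rightarrow> 'x list \<Rightarrow> 'v) \<Rightarrow> 'v::ab_group_add" where
  "ssum [] = (\<lambda>G. G [] [])"
| "ssum (x # xs) = (\<lambda>G. ssum xs (\<lambda>u v. G (x # u) v) + ssum xs (\<lambda>u v. G u (x # v)))"

lemma ssum_linear:
  assumes "is_linear s s' f"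
  shows "f (ssum xs G) = ssum xs (\<lambda>u v. f (G u v))"
  by (induction xs arbitrary: G) (simp_all add: lin_add[OF assms])

lemma ssum_add: "ssum xs (\<lambda>u v. G u v + H u v) = ssum xs G + ssum xs H"
  by (induction xs arbitrary: G H) (simp_all add: algebra_simps)

lemma ssum_zero [simp]: "ssum xs (\<lambda>u v. 0) = 0"
  by (induction xs) simp_all

lemma ssum_coassoc:
  "ssum xs (\<lambda>u v. ssum v (\<lambda>v1 v2. G u v1 v2)) = ssum xs (\<lambda>u v. ssum u (\<lambda>u1 u2. G u1 u2 v))"
  by (induction xs arbitrary: G) (simp_all add: ssum_add add.assoc)

lemma ssum_left_Nil: "ssum xs (\<lambda>u v. if u = [] then G v else 0) = G xs"
  by (induction xs arbitrary: G) simp_all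

lemma ssum_right_Nil: "ssum xs (\<lambda>u v. if v = [] then G u else 0) = G xs"
  by (induction xs arbitrary: G) simp_all

text \<open>The unshuffle coproduct of the free algebra; on classes it becomes the coproduct of
  U(g), see \<open>comult_cls\<close>.\<close>

definition delta :: "('x list \<Rightarrow>\<^sub>0 'k::field) \<Rightarrow> ('x list \<times> 'x list \<Rightarrow>\<^sub>0 'k)" where
  "delta = pm_lin (\<lambda>w. ssum w (\<lambda>u v. unit_vec (u, v)))"

lemma linear_delta: "is_linear pm_scale pm_scale delta"
  unfolding delta_def by (rule linear_pm_lin)

lemma delta_unit: "delta (unit_vec w) = ssum w (\<lambda>u v. unit_vec (u, v))"
  by (simp add: delta_def pm_lin_unit)

lemma lin_ext_delta_unit:
  assumes "vector_space s"
  shows "lin_ext s f (delta (unit_vec w)) = ssum w (\<lambda>u v. f (u, v))"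
  by (simp add: delta_unit ssum_linear[OF linear_lin_ext[OF assms]] assms)

lemmas pm_lin_delta_unit = lin_ext_delta_unit[OF vector_space_pm_scale, folded pm_lin_eq]

lemma delta_coassoc:
  "pm_lin (\<lambda>p. pm_lin (\<lambda>p'. unit_vec (fst p, fst p', snd p')) (delta (unit_vec (snd p)))) (delta t) =
   pm_lin (\<lambda>p. pm_lin (\<lambda>p'. unit_vec (fst p', snd p', snd p)) (delta (unit_vec (fst p)))) (delta t)"
  by (rule linear_pm_eqI[where t=t, OF lin_comp[OF linear_delta linear_pm_lin] lin_comp[OF linear_delta linear_pm_lin]])
    (simp add: pm_lin_delta_unit ssum_coassoc[where G="\<lambda>a b c. unit_vec (a, b, c)"])

text \<open>Transfers the algebra axioms from the algebra U(g) to the bialgebra record, which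
  extends it by a coproduct and a counit.\<close>

lemma unital_algebra_cong:
  assumes A: "unital_algebra A"
    and eq: "carrier B = carrier A" "mult B = mult A" "one B = one A" "zero B = zero A" "add B = add A" "smult B = smult A"
  shows "unital_algebra B"
proof -
  interpret unit_alg A by (rule unit_alg.intro[OF A])
  have ab: "abelian_group B"
    by (rule abelian_groupI) (use l_neg a_inv_closed in \<open>auto simp: eq a_ac\<close>)
  have "ring B"
    by (rule ringI[OF ab], rule monoidI) (auto simp: eq m_assoc l_distr r_distr)
  moreover have "module scalars B"
    by (rule moduleI[OF cring_scalars ab]) (auto simp: eq smult_add_left smult_add_right smult_mult smult_1)
  ultimately show ?thesis by (auto simp: unital_algebra_def eq smult_mult_left smult_mult_right)
qed

subsection \<open>The universal enveloping algebra\<close>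

abbreviation tmul :: "('x list \<Rightarrow>\<^sub>0 'k::field) \<Rightarrow> ('x list \<Rightarrow>\<^sub>0 'k) \<Rightarrow> ('x list \<Rightarrow>\<^sub>0 'k)"
  where "tmul \<equiv> conv (@)"

lemma free_algebra_simps [simp]:
  "carrier free_algebra = UNIV" "zero free_algebra = 0" "add free_algebra = (+)" "smult free_algebra = pm_scale"
  "mult free_algebra = tmul" "one free_algebra = unit_vec []"
  by (simp_all add: free_algebra_def monoid_algebra_simps)

lemma monoid_words: "Group.monoid \<lparr>carrier = UNIV, mult = (@), one = []\<rparr>"
  by (rule monoidI) auto

lemma unital_free_algebra: "unital_algebra free_algebra"
  unfolding free_algebra_def by (rule unital_algebra_monoid_algebra[OF monoid_words])

lemma tmul_unit_Nil [simp]: "tmul (unit_vec []) x = x" "tmul x (unit_vec []) = x"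
  by (rule conv_unit_left conv_unit_right; simp)+

lemma tmul_assoc: "tmul (tmul x y) z = tmul x (tmul y z)"
  by (rule conv_assoc) simp

lemma unital_scalars: "unital_algebra (scalars :: ('k::field, 'k) module)"
proof -
  interpret cring "scalars :: ('k, 'k) module" by (rule cring_scalars)
  have "module scalars (scalars :: ('k, 'k) module)"
    by (rule moduleI) (auto simp: cring_axioms abelian_group_axioms algebra_simps)
  then show ?thesis using ring_axioms by (auto simp: unital_algebra_def)
qed

context lie_algebra
begin

abbreviation J :: "('g list \<Rightarrow>\<^sub>0 'k) set" where "J \<equiv> uea_ideal scale bracket"
abbreviation D :: "('k, ('g list \<Rightarrow>\<^sub>0 'k) set) bialg" where "D \<equiv> uea scale bracket"
abbreviation cls :: "('g list \<Rightarrow>\<^sub>0 'k) \<Rightarrow> ('g list \<Rightarrow>\<^sub>0 'k) set" where "cls \<equiv> uea_class scale bracket"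
abbreviation wcls :: "'g list \<Rightarrow> ('g list \<Rightarrow>\<^sub>0 'k) set" where "wcls w \<equiv> cls (unit_vec w)"
abbreviation \<iota> :: "'g \<Rightarrow> ('g list \<Rightarrow>\<^sub>0 'k) set" where "\<iota> \<equiv> uea_incl scale bracket"
abbreviation U where "U \<equiv> uea_algebra scale bracket"

lemma vs: "vector_space scale"
  by (rule vector_space_axioms)

lemma
  shows bracket_add_left: "bracket (x + y) z = bracket x z + bracket y z"
    and bracket_add_right: "bracket x (y + z) = bracket x y + bracket x z"
  by (simp_all add: lin_add[OF bracket_linear_left] lin_add[OF bracket_linear_right])

lemma bracket_antisym: "bracket y x = - bracket x y"
proof -
  have "bracket (x + y) (x + y) = 0" by (rule bracket_alternating)
  then have "bracket x x + bracket y x + (bracket x y + bracket y y) = 0"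
    by (simp only: bracket_add_left bracket_add_right)
  then have "bracket x y + bracket y x = 0"
    by (simp add: bracket_alternating add.commute)
  then show ?thesis by (simp add: eq_neg_iff_add_eq_0 add.commute)
qed

definition uea_gens :: "('g list \<Rightarrow>\<^sub>0 'k) set" where
  "uea_gens = {unit_vec [x + y] - unit_vec [x] - unit_vec [y] | x y. True} \<union>
      {unit_vec [scale c x] - Poly_Mapping.single [x] c | c x. True} \<union>
      {unit_vec [x, y] - unit_vec [y, x] - unit_vec [bracket x y] | x y. True}"

lemma J_eq: "J = genideal free_algebra uea_gens"
  by (simp add: uea_ideal_def uea_gens_def)

lemma ideal_J: "ideal J free_algebra"
proof -
  interpret unit_alg "free_algebra :: ('k, 'g list \<Rightarrow>\<^sub>0 'k) module" by unfold_locales (rule unital_free_algebra)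
  show ?thesis unfolding J_eq by (rule genideal_ideal) simp
qed

lemma J_mult: "x \<in> J \<Longrightarrow> tmul y x \<in> J" "x \<in> J \<Longrightarrow> tmul x y \<in> J"
  using ideal.I_l_closed[OF ideal_J, of x y] ideal.I_r_closed[OF ideal_J, of x y] by simp_all

lemma subspace_J: "subspace_of pm_scale J"
proof -
  interpret ideal J free_algebra by (rule ideal_J)
  have "pm_scale c x \<in> J" if "x \<in> J" for c x
    using J_mult(1)[OF that, of "pm_scale c (unit_vec [])"] lin_scale[OF linear_conv_left, of "(@)" c "unit_vec []" x]
    by simp
  then show ?thesis
    using additive_subgroup.zero_closed[OF additive_subgroup_axioms] additive_subgroup.a_closed[OF additive_subgroup_axioms]
    by (simp add: subspace_of_def)
qed

sublocale uea: pm_quotient "free_algebra :: ('k, 'g list \<Rightarrow>\<^sub>0 'k) module" J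
  using subspace_J by unfold_locales (auto simp: subspace_of_def)

lemmas J_closed = uea.I_closed

lemma gens_J:
  "unit_vec [x + y] - unit_vec [x] - unit_vec [y] \<in> J"
  "unit_vec [scale c x] - Poly_Mapping.single [x] c \<in> J"
  "unit_vec [x, y] - unit_vec [y, x] - unit_vec [bracket x y] \<in> J"
proof -
  interpret unit_alg "free_algebra :: ('k, 'g list \<Rightarrow>\<^sub>0 'k) module" by unfold_locales (rule unital_free_algebra)
  have "uea_gens \<subseteq> J" unfolding J_eq by (rule genideal_self) simp
  then show "unit_vec [x + y] - unit_vec [x] - unit_vec [y] \<in> J"
    "unit_vec [scale c x] - Poly_Mapping.single [x] c \<in> J"
    "unit_vec [x, y] - unit_vec [y, x] - unit_vec [bracket x y] \<in> J"
    unfolding uea_gens_def by blast+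
qed

text \<open>Membership of the defining relations placed inside arbitrary words suffices, so
  inclusions of \<open>J\<close> are checked letter by letter.\<close>

lemma J_subset:
  assumes K: "subspace_of pm_scale K"
    and "\<And>u v x y. unit_vec (u @ (x + y) # v) - unit_vec (u @ x # v) - unit_vec (u @ y # v) \<in> K"
    and "\<And>u v c x. unit_vec (u @ scale c x # v) - pm_scale c (unit_vec (u @ x # v)) \<in> K"
    and "\<And>u v x y. unit_vec (u @ x # y # v) - unit_vec (u @ y # x # v) - unit_vec (u @ bracket x y # v) \<in> K"
  shows "J \<subseteq> K"
proof -
  interpret unit_alg "free_algebra :: ('k, 'g list \<Rightarrow>\<^sub>0 'k) module" by unfold_locales (rule unital_free_algebra)
  define F where "F u v x = tmul (unit_vec u) (tmul x (unit_vec v))" for u v and x :: "'g list \<Rightarrow>\<^sub>0 'k"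
  \<comment> \<open>The largest two-sided ideal contained in \<open>K\<close>; it contains the
    generators by assumption, hence \<open>J\<close>.\<close>
  define K' where "K' = {x. \<forall>u v. F u v x \<in> K}"
  have F: "is_linear pm_scale pm_scale (F u v)" for u v
    unfolding F_def by (rule lin_comp[OF linear_conv_left linear_conv_right])
  have F_unit: "F u v (unit_vec w) = unit_vec (u @ w @ v)" for u v w
    by (simp add: F_def)
  have "K' = (\<Inter>u. \<Inter>v. {x. F u v x \<in> K})" by (auto simp: K'_def)
  then have K'_sub: "subspace_of pm_scale K'"
    using subspace_vimage[OF F K] unfolding subspace_of_def by auto
  have Fl: "F u v (tmul (unit_vec g) x) = F (u @ g) v x" for u v g x
    by (simp add: F_def tmul_assoc[symmetric])
  have Fr: "F u v (tmul x (unit_vec g)) = F u (g @ v) x" for u v g x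
    by (simp add: F_def tmul_assoc)
  have "ideal K' free_algebra"
    unfolding free_algebra_def
    by (rule monoid_algebra_idealI[OF monoid_words K'_sub]) (auto simp: K'_def Fl Fr)
  moreover have "uea_gens \<subseteq> K'"
  proof
    have single: "F u v (Poly_Mapping.single [x] c) = pm_scale c (unit_vec (u @ x # v))" for u v x c
      using lin_scale[OF F, of u v c "unit_vec [x]"] by (simp add: F_unit)
    fix x assume "x \<in> uea_gens"
    then show "x \<in> K'"
      unfolding uea_gens_def K'_def
      using assms(2-) by (elim UnE CollectE exE conjE) (simp_all add: lin_diff[OF F] F_unit single del: pm_scale_single)
  qed
  ultimately have "J \<subseteq> K'"
    unfolding J_eq by (rule genideal_minimal)
  moreover have "x \<in> K" if "x \<in> K'" for x
    using that spec[of "\<lambda>u. \<forall>v. F u v x \<in> K" "[]"] by (auto simp: K'_def F_def dest!: spec[of _ "[]"])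
  ultimately show ?thesis by blast
qed

lemma U_eq: "U = quotient free_algebra J"
  by (simp add: uea_algebra_def)

lemma unital_U: "unital_algebra U"
  unfolding U_eq by (rule unital_algebra_quotient[OF unital_free_algebra ideal_J uea.pm_quotient_axioms])

lemma D_simps:
  "carrier D = carrier U" "mult D = mult U" "one D = one U" "zero D = zero U" "add D = add U" "smult D = smult U"
  "comult D = uea_lift (tensor_product U U) (\<lambda>x. pure_tensor U U (\<iota> x) \<one>\<^bsub>U\<^esub> \<oplus>\<^bsub>tensor_product U U\<^esub> pure_tensor U U \<one>\<^bsub>U\<^esub> (\<iota> x))"
  "counit D = uea_lift scalars (\<lambda>x. 0)"
  by (simp_all add: uea_def Let_def module.extend_def bialg.fields_def)

lemma unital_D: "unital_algebra D"
  by (rule unital_algebra_cong[OF unital_U]) (simp_all add: D_simps)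

sublocale U: unit_alg D
  by (rule unit_alg.intro[OF unital_D])

lemma cls_eq: "cls x = uea.coset x"
  by (simp add: uea_class_def)

lemma carrier_D: "carrier D = range cls"
  by (auto simp: D_simps U_eq uea.carrier_Q cls_eq)

lemma cls_in_D [simp]: "cls x \<in> carrier D"
  by (simp add: carrier_D)

lemma D_E: assumes "X \<in> carrier D" obtains t where "X = cls t"
  using assms by (auto simp: carrier_D)

lemma cls_eq_iff: "cls x = cls y \<longleftrightarrow> x - y \<in> J"
  by (simp add: cls_eq uea.coset_eq_iff)

lemma cls_add: "cls (x + y) = cls x \<oplus>\<^bsub>D\<^esub> cls y"
  by (simp add: cls_eq D_simps U_eq uea.add_Q)

lemma cls_scale: "cls (pm_scale c x) = c \<odot>\<^bsub>D\<^esub> cls x"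
  by (simp add: cls_eq D_simps U_eq uea.smult_Q)

lemma cls_mult: "cls (tmul x y) = cls x \<otimes>\<^bsub>D\<^esub> cls y"
  using quotient_mult[OF ideal_J, of x y] by (simp add: cls_eq D_simps U_eq)

lemma cls_one: "cls (unit_vec []) = \<one>\<^bsub>D\<^esub>"
  by (simp add: cls_eq D_simps U_eq quotient_simps)

lemma cls_zero: "cls 0 = \<zero>\<^bsub>D\<^esub>"
  by (simp add: cls_eq D_simps U_eq uea.zero_Q)

lemma cls_diff: "cls (x - y) = cls x \<ominus>\<^bsub>D\<^esub> cls y"
proof -
  have "cls (x - y) \<oplus>\<^bsub>D\<^esub> cls y = cls x" by (simp flip: cls_add)
  then show ?thesis
    by (metis U.add.m_assoc U.minus_eq U.r_neg U.r_zero cls_in_D U.a_inv_closed)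
qed

lemma wcls_append: "wcls (u @ v) = wcls u \<otimes>\<^bsub>D\<^esub> wcls v"
  by (simp flip: cls_mult)

lemma iota_eq: "\<iota> x = wcls [x]"
  by (simp add: uea_incl_def)

lemma wcls_Cons: "wcls (x # v) = \<iota> x \<otimes>\<^bsub>D\<^esub> wcls v"
  using wcls_append[of "[x]" v] by (simp add: iota_eq)

lemma iota_in_D [simp]: "\<iota> x \<in> carrier D"
  by (simp add: iota_eq)

lemma foldr_iota: "foldr (\<lambda>x u. \<iota> x \<otimes>\<^bsub>D\<^esub> u) xs \<one>\<^bsub>D\<^esub> = wcls xs"
  by (induction xs) (simp_all add: cls_one wcls_Cons)

lemma iota_add: "\<iota> (x + y) = \<iota> x \<oplus>\<^bsub>D\<^esub> \<iota> y"
  using gens_J(1)[of x y] by (simp add: iota_eq cls_eq_iff diff_diff_eq flip: cls_add)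

lemma iota_scale: "\<iota> (scale c x) = c \<odot>\<^bsub>D\<^esub> \<iota> x"
  using gens_J(2)[of c x] by (simp add: iota_eq cls_eq_iff flip: cls_scale)

lemma iota_bracket: "\<iota> (bracket x y) = \<iota> x \<otimes>\<^bsub>D\<^esub> \<iota> y \<ominus>\<^bsub>D\<^esub> \<iota> y \<otimes>\<^bsub>D\<^esub> \<iota> x"
proof -
  have "unit_vec [bracket x y] - (unit_vec [x, y] - unit_vec [y, x]) \<in> J"
    using J_closed(4)[OF gens_J(3)[of x y]] by (simp add: algebra_simps)
  then show ?thesis
    by (simp add: iota_eq cls_eq_iff flip: cls_mult cls_diff)
qed

lemma cls_flin: "cls t = U.flin wcls t"
  by (rule U.flin_unique) (simp_all add: cls_add cls_scale)

lemma flin_cls: "U.flin (\<lambda>p. cls (g p)) z = cls (pm_lin g z)"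
  using U.flin_pm_lin[of wcls g z] by (simp flip: cls_flin)

end

text \<open>Universal property of U(g): \<open>\<phi>\<close> is a morphism of Lie algebras to
  \<open>A\<close> with its commutator. The last axiom moves the negative term across, so no
  subtraction in \<open>A\<close> occurs.\<close>

locale uea_target = lie_algebra scale bracket + A: unit_alg A
  for scale :: "'k::field \<Rightarrow> 'g::ab_group_add \<Rightarrow> 'g" and bracket
    and A :: "('k, 'a, 'm) module_scheme" +
  fixes \<phi> :: "'g \<Rightarrow> 'a"
  assumes \<phi>: "\<phi> x \<in> carrier A" "\<phi> (x + y) = \<phi> x \<oplus>\<^bsub>A\<^esub> \<phi> y" "\<phi> (scale c x) = c \<odot>\<^bsub>A\<^esub> \<phi> x"
    "\<phi> x \<otimes>\<^bsub>A\<^esub> \<phi> y = \<phi> y \<otimes>\<^bsub>A\<^esub> \<phi> x \<oplus>\<^bsub>A\<^esub> \<phi> (bracket x y)"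
begin

definition word_val :: "'g list \<Rightarrow> 'a" where
  "word_val w = foldr (\<lambda>x u. \<phi> x \<otimes>\<^bsub>A\<^esub> u) w \<one>\<^bsub>A\<^esub>"

lemma word_val_closed [simp]: "word_val w \<in> carrier A"
  unfolding word_val_def by (induction w) (simp_all add: \<phi>(1))

lemma word_val_simps: "word_val [] = \<one>\<^bsub>A\<^esub>" "word_val (x # w) = \<phi> x \<otimes>\<^bsub>A\<^esub> word_val w"
  by (simp_all add: word_val_def)

lemma word_val_append: "word_val (u @ v) = word_val u \<otimes>\<^bsub>A\<^esub> word_val v"
  by (induction u) (simp_all add: word_val_simps A.m_assoc \<phi>(1))

lemma flin_word_val_J:
  assumes "x \<in> J"
  shows "A.flin word_val x = \<zero>\<^bsub>A\<^esub>"
proof -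
  let ?F = "A.flin word_val"
  have minus: "a \<ominus>\<^bsub>A\<^esub> a = \<zero>\<^bsub>A\<^esub>" "(a \<oplus>\<^bsub>A\<^esub> b) \<ominus>\<^bsub>A\<^esub> a \<ominus>\<^bsub>A\<^esub> b = \<zero>\<^bsub>A\<^esub>" if "a \<in> carrier A" "b \<in> carrier A" for a b
    using that A.r_neg[of "a \<oplus>\<^bsub>A\<^esub> b"] by (simp_all add: A.minus_eq A.r_neg A.minus_add A.a_assoc)
  have "J \<subseteq> {x. ?F x = \<zero>\<^bsub>A\<^esub>}"
  proof (rule J_subset)
    show "subspace_of pm_scale {x. ?F x = \<zero>\<^bsub>A\<^esub>}"
      by (auto simp: subspace_of_def A.flin_add A.flin_scale A.sc.smult_r_null)
  next
    fix u v x y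
    have "word_val (u @ (x + y) # v) = word_val (u @ x # v) \<oplus>\<^bsub>A\<^esub> word_val (u @ y # v)"
      by (simp add: word_val_append word_val_simps \<phi> A.l_distr A.r_distr)
    then show "unit_vec (u @ (x + y) # v) - unit_vec (u @ x # v) - unit_vec (u @ y # v) \<in> {x. ?F x = \<zero>\<^bsub>A\<^esub>}"
      by (simp add: A.flin_minus minus)
  next
    fix u v x c
    have "word_val (u @ scale c x # v) = c \<odot>\<^bsub>A\<^esub> word_val (u @ x # v)"
      by (simp add: word_val_append word_val_simps \<phi> A.smult_mult_left A.smult_mult_right)
    then show "unit_vec (u @ scale c x # v) - pm_scale c (unit_vec (u @ x # v)) \<in> {x. ?F x = \<zero>\<^bsub>A\<^esub>}"
      by (simp add: A.flin_minus A.flin_single minus A.smult_1)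
  next
    fix u v x y
    have "\<phi> x \<otimes>\<^bsub>A\<^esub> (\<phi> y \<otimes>\<^bsub>A\<^esub> word_val v) = \<phi> y \<otimes>\<^bsub>A\<^esub> (\<phi> x \<otimes>\<^bsub>A\<^esub> word_val v) \<oplus>\<^bsub>A\<^esub> \<phi> (bracket x y) \<otimes>\<^bsub>A\<^esub> word_val v"
      by (subst (1 2) A.m_assoc[symmetric]) (simp_all add: \<phi>(1) \<phi>(4)[of x y] A.l_distr)
    then have "word_val (u @ x # y # v) = word_val (u @ y # x # v) \<oplus>\<^bsub>A\<^esub> word_val (u @ bracket x y # v)"
      by (simp add: word_val_append word_val_simps \<phi>(1) A.r_distr)
    then show "unit_vec (u @ x # y # v) - unit_vec (u @ y # x # v) - unit_vec (u @ bracket x y # v) \<in> {x. ?F x = \<zero>\<^bsub>A\<^esub>}"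
      by (simp add: A.flin_minus minus)
  qed
  then show ?thesis using assms by auto
qed

lemma uea_lift_cls: "uea_lift A \<phi> (cls t) = A.flin word_val t"
proof -
  have "uea_lift A \<phi> (cls t) = the_elem (A.flin word_val ` cls t)"
    unfolding uea_lift_def A.flin_def word_val_def ..
  also have "\<dots> = A.flin word_val t"
    unfolding cls_eq by (rule uea.the_elem_image_coset) (simp add: A.flin_add flin_word_val_J)
  finally show ?thesis .
qed

lemma flin_word_val_mult: "A.flin word_val (tmul x y) = A.flin word_val x \<otimes>\<^bsub>A\<^esub> A.flin word_val y"
proof -
  let ?F = "A.flin word_val"
  have 1: "?F (tmul (unit_vec a) y) = word_val a \<otimes>\<^bsub>A\<^esub> ?F y" for a
  proof -
    have "?F (tmul (unit_vec a) y) = A.flin (\<lambda>b. ?F (tmul (unit_vec a) (unit_vec b))) y"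
      by (rule A.flin_unique[where F="\<lambda>y. ?F (tmul (unit_vec a) y)"])
        (simp_all add: lin_add[OF linear_conv_right] lin_scale[OF linear_conv_right] A.flin_add A.flin_scale)
    also have "\<dots> = A.flin (\<lambda>b. word_val a \<otimes>\<^bsub>A\<^esub> ?F (unit_vec b)) y"
      by (simp add: word_val_append)
    also have "\<dots> = word_val a \<otimes>\<^bsub>A\<^esub> ?F y"
      by (rule A.flin_unique[where F="\<lambda>y. word_val a \<otimes>\<^bsub>A\<^esub> ?F y", symmetric])
        (simp_all add: A.flin_add A.flin_scale A.r_distr A.smult_mult_right)
    finally show ?thesis .
  qed
  have "?F (tmul x y) = A.flin (\<lambda>a. ?F (tmul (unit_vec a) y)) x"
    by (rule A.flin_unique[where F="\<lambda>x. ?F (tmul x y)"])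
      (simp_all add: lin_add[OF linear_conv_left] lin_scale[OF linear_conv_left] A.flin_add A.flin_scale)
  also have "\<dots> = A.flin (\<lambda>a. ?F (unit_vec a) \<otimes>\<^bsub>A\<^esub> ?F y) x"
    by (simp add: 1)
  also have "\<dots> = ?F x \<otimes>\<^bsub>A\<^esub> ?F y"
    by (rule A.flin_unique[where F="\<lambda>x. ?F x \<otimes>\<^bsub>A\<^esub> ?F y", symmetric])
      (simp_all add: A.flin_add A.flin_scale A.l_distr A.smult_mult_left)
  finally show ?thesis .
qed

lemma uea_lift_hom: "uea_lift A \<phi> \<in> algebra_homs D A"
  unfolding algebra_homs_def linear_maps_def ring_hom_def
  by (auto simp: carrier_D uea_lift_cls A.flin_add A.flin_scale flin_word_val_mult word_val_simps
      simp flip: cls_add cls_scale cls_mult cls_one)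

end

subsection \<open>The bialgebra structure\<close>

lemma linear_maps_comp: "f \<in> linear_maps M N \<Longrightarrow> g \<in> linear_maps N P \<Longrightarrow> (\<lambda>x. g (f x)) \<in> linear_maps M P"
  by (auto simp: linear_maps_def Pi_def)

context lie_algebra
begin

text \<open>\<open>comult\<close> is defined over the algebra record and the axioms are stated over
  the bialgebra record; tensor products depend on their common fields.\<close>

lemma tensor_product_cong: "tensor_product U U = tensor_product D D"
  by (simp add: tensor_product_def tensor_relations_eq tensor_gens_def D_simps DirProd_def)

lemma pure_tensor_cong: "pure_tensor U U = pure_tensor D D"
  by (simp add: fun_eq_iff pure_tensor_def tensor_relations_eq tensor_gens_def D_simps DirProd_def)

sublocale DD: tensor_algebras D D by unfold_locales

sublocale DDM: tensor_target D D D by unfold_locales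
sublocale DDT: tensor_target D D DD.TP by unfold_locales

definition primitive_form :: "'g \<Rightarrow> (('g list \<Rightarrow>\<^sub>0 'k) set \<times> ('g list \<Rightarrow>\<^sub>0 'k) set \<Rightarrow>\<^sub>0 'k) set" where
  "primitive_form x = DD.pure (\<iota> x) \<one>\<^bsub>D\<^esub> \<oplus>\<^bsub>DD.TP\<^esub> DD.pure \<one>\<^bsub>D\<^esub> (\<iota> x)"

lemma comult_D: "comult D = uea_lift DD.TP primitive_form"
  unfolding D_simps(7) tensor_product_cong pure_tensor_cong primitive_form_def by (simp only: D_simps(3))

lemmas pure_bilin = bilinD[OF DD.bilin_pure]

text \<open>Elements a tensor 1 and 1 tensor b commute, so the commutator of two such sums is
  computed in each factor separately.\<close>

lemma primitive_form_bracket: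
  "primitive_form x \<otimes>\<^bsub>DD.TP\<^esub> primitive_form y =
    primitive_form y \<otimes>\<^bsub>DD.TP\<^esub> primitive_form x \<oplus>\<^bsub>DD.TP\<^esub> primitive_form (bracket x y)"
proof -
  have br: "\<iota> x \<otimes>\<^bsub>D\<^esub> \<iota> y = \<iota> y \<otimes>\<^bsub>D\<^esub> \<iota> x \<oplus>\<^bsub>D\<^esub> \<iota> (bracket x y)"
    by (simp add: iota_bracket U.minus_eq U.a_ac U.r_neg1 U.r_neg2 U.r_neg)
  show ?thesis
    unfolding primitive_form_def
    by (simp add: DD.TP.l_distr DD.TP.r_distr DD.pure_mult br pure_bilin(2,3) DD.TP.a_ac)
qed

sublocale comult: uea_target scale bracket DD.TP primitive_form
proof unfold_locales
  fix x y c
  show "primitive_form x \<in> carrier DD.TP" by (simp add: primitive_form_def)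
  show "primitive_form (x + y) = primitive_form x \<oplus>\<^bsub>DD.TP\<^esub> primitive_form y"
    by (simp add: primitive_form_def iota_add pure_bilin DD.TP.a_ac)
  show "primitive_form (scale c x) = c \<odot>\<^bsub>DD.TP\<^esub> primitive_form x"
    by (simp add: primitive_form_def iota_scale pure_bilin DD.TP.smult_add_right)
qed (rule primitive_form_bracket)

sublocale scal: unit_alg "scalars :: ('k, 'k) module" by unfold_locales (rule unital_scalars)

sublocale counit: uea_target scale bracket "scalars :: ('k, 'k) module" "\<lambda>x. 0"
  by unfold_locales simp_all

text \<open>Sends combinations of pairs of words to the tensor square of U(g), so that computations
  with coproducts take place on words.\<close>

definition tcls :: "('g list \<times> 'g list \<Rightarrow>\<^sub>0 'k) \<Rightarrow> (('g list \<Rightarrow>\<^sub>0 'k) set \<times> ('g list \<Rightarrow>\<^sub>0 'k) set \<Rightarrow>\<^sub>0 'k) set" where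
  "tcls = DD.TP.flin (\<lambda>p. DD.pure (wcls (fst p)) (wcls (snd p)))"

lemma tcls_closed [simp]: "tcls z \<in> carrier DD.TP"
  by (simp add: tcls_def)

lemma tcls_add: "tcls (x + y) = tcls x \<oplus>\<^bsub>DD.TP\<^esub> tcls y"
  by (simp add: tcls_def DD.TP.flin_add)

lemma tcls_unit: "tcls (unit_vec (u, v)) = DD.pure (wcls u) (wcls v)"
  by (simp add: tcls_def)

lemma flin_tcls: "DD.TP.flin (\<lambda>p. tcls (g p)) z = tcls (pm_lin g z)"
  by (simp add: tcls_def DD.TP.flin_pm_lin)

text \<open>Left multiplication by the image of a letter \<open>x\<close> puts \<open>x\<close> in
  front of the left or of the right word, which is the recursion of \<open>ssum\<close>.\<close>

lemma word_val_comult: "comult.word_val w = tcls (delta (unit_vec w))"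
proof (induction w)
  case Nil
  then show ?case by (simp add: comult.word_val_simps DD.pure_one delta_unit tcls_unit cls_one)
next
  case (Cons x w)
  define S :: "_ \<Rightarrow> ('g list \<times> 'g list \<Rightarrow>\<^sub>0 'k)"
    where "S f = pm_lin (\<lambda>p. unit_vec (f p)) (delta (unit_vec w))" for f :: "'g list \<times> 'g list \<Rightarrow> 'g list \<times> 'g list"
  have S: "delta (unit_vec (x # w)) = S (\<lambda>(u, v). (x # u, v)) + S (\<lambda>(u, v). (u, x # v))"
    unfolding S_def by (subst delta_unit) (simp add: pm_lin_delta_unit case_prod_beta)
  have "primitive_form x \<otimes>\<^bsub>DD.TP\<^esub> tcls z =
    tcls (pm_lin (\<lambda>p. unit_vec (x # fst p, snd p)) z + pm_lin (\<lambda>p. unit_vec (fst p, x # snd p)) z)" (is "?l z = ?r z") for z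
  proof -
    have "?l z = DD.TP.flin (\<lambda>p. ?l (unit_vec p)) z"
      by (rule DD.TP.flin_unique)
        (simp_all add: tcls_add DD.TP.r_distr comult.\<phi>(1), simp add: tcls_def DD.TP.flin_scale DD.TP.smult_mult_right comult.\<phi>(1))
    also have "\<dots> = DD.TP.flin (\<lambda>p. tcls (unit_vec (x # fst p, snd p) + unit_vec (fst p, x # snd p))) z"
    proof (rule DD.TP.flin_cong)
      fix p :: "'g list \<times> 'g list"
      show "?l (unit_vec p) = tcls (unit_vec (x # fst p, snd p) + unit_vec (fst p, x # snd p))"
        by (cases p) (simp add: tcls_add tcls_unit primitive_form_def DD.TP.l_distr DD.pure_mult wcls_Cons)
    qed simp
    also have "\<dots> = ?r z"
      by (simp add: flin_tcls pm_lin_eq lin_ext_plus[OF vector_space_pm_scale])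
    finally show ?thesis .
  qed
  then show ?case
    by (simp add: comult.word_val_simps Cons.IH S) (simp add: S_def case_prod_beta)
qed

lemma comult_cls: "comult D (cls t) = tcls (delta t)"
proof -
  have "comult.word_val = (\<lambda>w. tcls (delta (unit_vec w)))" by (simp add: fun_eq_iff word_val_comult)
  then show ?thesis
    unfolding comult_D comult.uea_lift_cls by (simp add: flin_tcls delta_def pm_lin_unit)
qed

lemma counit_cls: "counit D (cls t) = Poly_Mapping.lookup t []"
proof -
  have "counit D (cls t) = scal.flin counit.word_val t"
    unfolding D_simps(8) by (rule counit.uea_lift_cls)
  also have "\<dots> = scal.flin (\<lambda>w. Poly_Mapping.lookup (unit_vec w) []) t"
    by (rule scal.flin_cong) (auto simp: counit.word_val_def lookup_single when_def neq_Nil_conv)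
  also have "\<dots> = Poly_Mapping.lookup t []"
    by (rule scal.flin_unique[symmetric]) (simp_all add: lookup_add)
  finally show ?thesis .
qed

lemma comult_hom: "comult D \<in> algebra_homs D DD.TP"
  unfolding comult_D by (rule comult.uea_lift_hom)

lemma counit_hom: "counit D \<in> algebra_homs D scalars"
  unfolding D_simps(8) by (rule counit.uea_lift_hom)

lemma comult_linear: "comult D \<in> linear_maps D DD.TP"
  using comult_hom by (simp add: algebra_homs_def)

lemma counit_linear: "counit D \<in> linear_maps D scalars"
  using counit_hom by (simp add: algebra_homs_def)

text \<open>Sweedler notation on U(g) becomes a sum over unshuffles of words; this is how the axioms
  with a coproduct are checked.\<close>

lemma sweedler_cls:
  assumes M: "module scalars M" and h: "bilin D D M h"
  shows "sweedler D M h (cls t) = carrier_space.flin M (\<lambda>p. h (wcls (fst p)) (wcls (snd p))) (delta t)"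
proof -
  interpret carrier_space M by (rule carrier_space.intro[OF M])
  interpret DDX: tensor_target D D M by unfold_locales
  have "sweedler D M h (cls t) = tensor_lift M h (tcls (delta t))"
    by (simp add: sweedler_def comult_cls)
  also have "\<dots> = flin (\<lambda>p. tensor_lift M h (DD.pure (wcls (fst p)) (wcls (snd p)))) (delta t)"
    unfolding tcls_def by (rule flin_linear_maps) (simp_all add: DD.TP.module M DDX.tensor_lift_linear[OF h])
  finally show ?thesis by (simp add: DDX.tensor_lift_pure[OF h])
qed

lemma sweedler_linear:
  assumes M: "module scalars M" and h: "bilin D D M h"
  shows "sweedler D M h \<in> linear_maps D M"
proof -
  interpret carrier_space M by (rule carrier_space.intro[OF M])
  interpret DDX: tensor_target D D M by unfold_locales
  show ?thesis
    unfolding sweedler_def[abs_def] by (rule linear_maps_comp[OF comult_linear DDX.tensor_lift_linear[OF h]])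
qed

lemma bilin_comp_left:
  assumes "bilin A B M h" "f \<in> linear_maps A' A"
  shows "bilin A' B M (\<lambda>a b. h (f a) b)"
proof -
  have "f a \<in> carrier A" if "a \<in> carrier A'" for a using assms(2) that by (auto simp: linear_maps_def)
  then show ?thesis using assms unfolding bilin_def by (auto intro: linear_maps_comp[of f])
qed

lemma bilin_comp_right:
  assumes "bilin A B M h" "f \<in> linear_maps B' B"
  shows "bilin A B' M (\<lambda>a b. h a (f b))"
proof -
  have "f b \<in> carrier B" if "b \<in> carrier B'" for b using assms(2) that by (auto simp: linear_maps_def)
  then show ?thesis using assms unfolding bilin_def by (auto intro: linear_maps_comp[of f])
qed

lemma bilin_sweedler_left:
  assumes M: "module scalars M" and h: "\<And>b. b \<in> carrier D \<Longrightarrow> bilin D D M (h b)"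
    and l: "\<And>x y. x \<in> carrier D \<Longrightarrow> y \<in> carrier D \<Longrightarrow> (\<lambda>b. h b x y) \<in> linear_maps D M"
  shows "bilin D D M (\<lambda>a b. sweedler D M (h b) a)"
proof -
  interpret carrier_space M by (rule carrier_space.intro[OF M])
  have closed: "h b x y \<in> carrier M" if "b \<in> carrier D" "x \<in> carrier D" "y \<in> carrier D" for b x y
    using l[OF that(2,3)] that by (auto simp: linear_maps_def)
  have "(\<lambda>b. sweedler D M (h b) (cls t)) \<in> linear_maps D M" for t
    unfolding linear_maps_def
    by (auto simp: sweedler_cls[OF M h] closed flin_plus[symmetric] flin_smult[symmetric]
        intro!: flin_cong) (use l in \<open>auto simp: linear_maps_def closed\<close>)
  then show ?thesis
    using sweedler_linear[OF M h] by (auto simp: bilin_def carrier_D)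
qed

lemma bilin_mult: "bilin D D D (mult D)"
  by (rule bilinI) (simp_all add: U.l_distr U.r_distr U.smult_mult_left U.smult_mult_right)

sublocale DT: tensor_algebras D DD.TP by unfold_locales

lemma coassociative:
  assumes "X \<in> carrier D"
  shows "sweedler D DT.TP (\<lambda>a b. DT.pure a (comult D b)) X =
    sweedler D DT.TP (\<lambda>a b. sweedler D DT.TP (\<lambda>a1 a2. DT.pure a1 (DD.pure a2 b)) a) X"
proof -
  obtain t where X: "X = cls t" using assms by (rule D_E)
  define Q where "Q p = DT.pure (wcls (fst p)) (DD.pure (wcls (fst (snd p))) (wcls (snd (snd p))))" for p
  have Q: "Q p \<in> carrier DT.TP" for p by (simp add: Q_def)
  note pb = DT.bilin_pure DD.bilin_pure
  have b1: "bilin D D DT.TP (\<lambda>a b. DT.pure a (comult D b))"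
    by (rule bilin_comp_right[OF pb(1) comult_linear])
  have b2: "bilin D D DT.TP (\<lambda>a1 a2. DT.pure a1 (DD.pure a2 b))" if "b \<in> carrier D" for b
    by (rule bilin_comp_right[OF pb(1)]) (use pb(2) that in \<open>auto simp: bilin_def\<close>)
  have b3: "bilin D D DT.TP (\<lambda>a b. sweedler D DT.TP (\<lambda>a1 a2. DT.pure a1 (DD.pure a2 b)) a)"
  proof (rule bilin_sweedler_left[OF DT.TP.module b2])
    fix x y assume "x \<in> carrier D" "y \<in> carrier D"
    then have "DD.pure y \<in> linear_maps D DD.TP" "DT.pure x \<in> linear_maps DD.TP DT.TP"
      using pb by (auto simp: bilin_def)
    then show "(\<lambda>b. DT.pure x (DD.pure y b)) \<in> linear_maps D DT.TP"
      by (rule linear_maps_comp)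
  qed
  have l: "DT.pure (wcls u) (tcls z) = DT.TP.flin (\<lambda>p. Q (u, p)) z" for u z
    unfolding tcls_def
    by (subst flin_linear_maps[OF DD.TP.module DT.TP.module])
      (use pb(1) in \<open>auto simp: bilin_def Q_def\<close>)
  have "sweedler D DT.TP (\<lambda>a b. DT.pure a (comult D b)) X =
    DT.TP.flin (\<lambda>p. DT.TP.flin Q (pm_lin (\<lambda>p'. unit_vec (fst p, fst p', snd p')) (delta (unit_vec (snd p))))) (delta t)"
    by (simp add: X sweedler_cls[OF DT.TP.module b1] comult_cls l DT.TP.flin_pm_lin Q)
  also have "\<dots> = DT.TP.flin Q (pm_lin (\<lambda>p. pm_lin (\<lambda>p'. unit_vec (fst p, fst p', snd p')) (delta (unit_vec (snd p)))) (delta t))"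
    by (simp add: DT.TP.flin_pm_lin Q)
  also have "\<dots> = DT.TP.flin Q (pm_lin (\<lambda>p. pm_lin (\<lambda>p'. unit_vec (fst p', snd p', snd p)) (delta (unit_vec (fst p)))) (delta t))"
    by (simp only: delta_coassoc)
  also have "\<dots> = DT.TP.flin (\<lambda>p. DT.TP.flin (\<lambda>p'. Q (fst p', snd p', snd p)) (delta (unit_vec (fst p)))) (delta t)"
    by (simp add: DT.TP.flin_pm_lin Q)
  also have "\<dots> = sweedler D DT.TP (\<lambda>a b. sweedler D DT.TP (\<lambda>a1 a2. DT.pure a1 (DD.pure a2 b)) a) X"
    by (simp add: X sweedler_cls[OF DT.TP.module b3] sweedler_cls[OF DT.TP.module b2] Q_def)
  finally show ?thesis .
qed

lemma sweedler_D:
  assumes "bilin D D D h" "\<And>u v. h (wcls u) (wcls v) = cls (g u v)"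
  shows "sweedler D D h (cls t) = cls (pm_lin (\<lambda>p. g (fst p) (snd p)) (delta t))"
  by (simp add: sweedler_cls[OF U.module assms(1)] assms(2) flin_cls)

lemma counital:
  assumes "X \<in> carrier D"
  shows "sweedler D D (\<lambda>a b. counit D a \<odot>\<^bsub>D\<^esub> b) X = X" "sweedler D D (\<lambda>a b. counit D b \<odot>\<^bsub>D\<^esub> a) X = X"
proof -
  obtain t where X: "X = cls t" using assms by (rule D_E)
  have c: "counit D (x \<oplus>\<^bsub>D\<^esub> y) = counit D x + counit D y" "counit D (c \<odot>\<^bsub>D\<^esub> x) = c * counit D x"
    if "x \<in> carrier D" "y \<in> carrier D" for x y c
    using counit_linear that by (auto simp: linear_maps_def)
  have b: "bilin D D D (\<lambda>a b. counit D a \<odot>\<^bsub>D\<^esub> b)" "bilin D D D (\<lambda>a b. counit D b \<odot>\<^bsub>D\<^esub> a)"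
    by (rule bilinI; simp add: c U.smult_add_left U.smult_add_right U.smult_mult[symmetric] mult.commute)+
  have "pm_lin (\<lambda>p. pm_scale (Poly_Mapping.lookup (unit_vec (fst p)) []) (unit_vec (snd p))) (delta t) = t"
    by (rule linear_pm_eqI[where t=t, OF lin_comp[OF linear_delta linear_pm_lin] lin_id_fun[OF vector_space_pm_scale]])
      (simp add: pm_lin_delta_unit lookup_single when_def if_distrib[where f="\<lambda>c. Poly_Mapping.single _ c"]
        ssum_left_Nil[where G=unit_vec] cong: if_cong)
  then show "sweedler D D (\<lambda>a b. counit D a \<odot>\<^bsub>D\<^esub> b) X = X"
    unfolding X
    by (subst sweedler_D[OF b(1), where g="\<lambda>u v. pm_scale (Poly_Mapping.lookup (unit_vec u) []) (unit_vec v)"])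
      (simp_all only: counit_cls cls_scale)
  have "pm_lin (\<lambda>p. pm_scale (Poly_Mapping.lookup (unit_vec (snd p)) []) (unit_vec (fst p))) (delta t) = t"
    by (rule linear_pm_eqI[where t=t, OF lin_comp[OF linear_delta linear_pm_lin] lin_id_fun[OF vector_space_pm_scale]])
      (simp add: pm_lin_delta_unit lookup_single when_def if_distrib[where f="\<lambda>c. Poly_Mapping.single _ c"]
        ssum_right_Nil[where G=unit_vec] cong: if_cong)
  then show "sweedler D D (\<lambda>a b. counit D b \<odot>\<^bsub>D\<^esub> a) X = X"
    unfolding X
    by (subst sweedler_D[OF b(2), where g="\<lambda>u v. pm_scale (Poly_Mapping.lookup (unit_vec v) []) (unit_vec u)"])
      (simp_all only: counit_cls cls_scale)
qed

lemma bialgebra_D: "bialgebra D"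
  unfolding bialgebra_def
  using unital_D comult_hom counit_hom coassociative counital by blast

end

subsection \<open>The standard filtration\<close>

text \<open>Substituting 2 t for t and subtracting \<open>b\<close> times the original; with
  \<open>b = 2 ^ m\<close> the m-th term vanishes. This is the elimination step of two Vandermonde
  arguments below.\<close>

lemma scale_power_diff:
  "pm_scale ((2 * t) ^ i) x - pm_scale b (pm_scale (t ^ i) x) = pm_scale (t ^ i) (pm_scale (2 ^ i - b) x)"
  by (rule poly_mapping_eqI) (simp add: lookup_minus power_mult_distrib algebra_simps)

context lie_algebra
begin

abbreviation Flt :: "nat \<Rightarrow> ('g list \<Rightarrow>\<^sub>0 'k) set set" where "Flt \<equiv> uea_filtration scale bracket"

lemma Flt_eq: "Flt n = cls ` {t. Poly_Mapping.keys t \<subseteq> {w. length w \<le> n}}"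
  by (auto simp: uea_filtration_def)

lemma linear_subspace_cls_image:
  assumes "subspace_of pm_scale S"
  shows "linear_subspace D (cls ` S)"
  using assms unfolding linear_subspace_def subspace_of_def
  by (auto simp flip: cls_zero cls_add cls_scale)

lemma wcls_closed_under_subspace:
  assumes S: "linear_subspace D S" and w: "\<And>w. w \<in> Poly_Mapping.keys t \<Longrightarrow> wcls w \<in> S"
  shows "cls t \<in> S"
proof -
  have "subspace_of pm_scale {t. cls t \<in> S}"
    using S unfolding linear_subspace_def subspace_of_def by (auto simp: cls_zero cls_add cls_scale)
  then have "lin_ext pm_scale unit_vec t \<in> {t. cls t \<in> S}"
    by (rule lin_ext_in_subspace[OF vector_space_pm_scale]) (use w in auto)
  then show ?thesis by (simp add: lin_ext_unit_vec)
qed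

lemma linear_subspace_range_iota: "linear_subspace D (range \<iota>)"
proof -
  have "\<iota> 0 = \<zero>\<^bsub>D\<^esub>" using iota_scale[of 0 0] by (simp add: U.smult_zero_left)
  then show ?thesis
    unfolding linear_subspace_def
    by (auto simp flip: iota_add iota_scale intro: rev_image_eqI[of 0])
qed

lemma filtration_D: "algebra_filtration D Flt"
  unfolding algebra_filtration_def
proof (intro conjI allI ballI)
  show "linear_subspace D (Flt i)" for i
    unfolding Flt_eq by (rule linear_subspace_cls_image[OF subspace_keys])
  show "Flt i \<subseteq> Flt (Suc i)" for i
    by (auto simp: Flt_eq intro!: imageI)
  have "cls t \<in> (\<Union>i. Flt i)" for t
  proof -
    have "length w \<le> Max (length ` Poly_Mapping.keys t)" if "w \<in> Poly_Mapping.keys t" for w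
      using that by (intro Max_ge) auto
    then have "cls t \<in> Flt (Max (length ` Poly_Mapping.keys t))"
      unfolding Flt_eq by (intro imageI) auto
    then show ?thesis by blast
  qed
  then show "(\<Union>i. Flt i) = carrier D"
    by (auto simp: Flt_eq carrier_D)
  have "t = pm_scale (Poly_Mapping.lookup t []) (unit_vec [])" if "Poly_Mapping.keys t \<subseteq> {[]}" for t :: "'g list \<Rightarrow>\<^sub>0 'k"
    by (rule poly_mapping_eqI) (use that in \<open>auto simp: lookup_single when_def in_keys_iff\<close>)
  then have "cls t = Poly_Mapping.lookup t [] \<odot>\<^bsub>D\<^esub> \<one>\<^bsub>D\<^esub>" if "Poly_Mapping.keys t \<subseteq> {[]}" for t
    using that unfolding cls_one[symmetric] cls_scale[symmetric] by metis
  then have "Flt 0 \<subseteq> {c \<odot>\<^bsub>D\<^esub> \<one>\<^bsub>D\<^esub> | c. True}"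
    by (auto simp: Flt_eq)
  moreover have "{c \<odot>\<^bsub>D\<^esub> \<one>\<^bsub>D\<^esub> | c. True} \<subseteq> Flt 0"
    by (auto simp: Flt_eq simp flip: cls_one cls_scale split: if_splits intro!: imageI)
  ultimately show "Flt 0 = {c \<odot>\<^bsub>D\<^esub> \<one>\<^bsub>D\<^esub> | c. True}" by blast
  show "X \<otimes>\<^bsub>D\<^esub> Y \<in> Flt (i + j)" if "X \<in> Flt i" "Y \<in> Flt j" for i j X Y
  proof -
    obtain x y where xy: "X = cls x" "Y = cls y" "Poly_Mapping.keys x \<subseteq> {w. length w \<le> i}" "Poly_Mapping.keys y \<subseteq> {w. length w \<le> j}"
      using \<open>X \<in> Flt i\<close> \<open>Y \<in> Flt j\<close> by (auto simp: Flt_eq)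
    have "tmul x y \<in> {t. Poly_Mapping.keys t \<subseteq> {w. length w \<le> i + j}}"
      by (rule conv_in_subspace[OF subspace_keys]) (use xy in force)
    then show ?thesis by (auto simp: xy Flt_eq simp flip: cls_mult)
  qed
qed

lemma degree_one_D: "degree_one D Flt = range \<iota>"
proof
  show "degree_one D Flt \<subseteq> range \<iota>"
  proof
    fix X assume "X \<in> degree_one D Flt"
    then obtain t where t: "X = cls t" "Poly_Mapping.keys t \<subseteq> {w. length w \<le> 1}" "Poly_Mapping.lookup t [] = 0"
      by (auto simp: degree_one_def Flt_eq counit_cls)
    have "wcls w \<in> range \<iota>" if "w \<in> Poly_Mapping.keys t" for w
    proof -
      have "w \<noteq> []" "length w \<le> 1" using t that by (auto simp: in_keys_iff)
      then obtain x where "w = [x]" by (cases w) auto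
      then show ?thesis by (auto simp: iota_eq)
    qed
    then show "X \<in> range \<iota>"
      unfolding t(1) by (rule wcls_closed_under_subspace[OF linear_subspace_range_iota])
  qed
  show "range \<iota> \<subseteq> degree_one D Flt"
    by (auto simp: degree_one_def Flt_eq iota_eq counit_cls lookup_single intro!: imageI)
qed

lemma generates_D: "generates_algebra D (range \<iota>)"
  unfolding generates_algebra_def
proof
  show "carrier D \<subseteq> \<Inter>{H. subring H D \<and> linear_subspace D H \<and> range \<iota> \<subseteq> H}"
  proof (rule subsetI, rule InterI)
    fix X H assume "X \<in> carrier D" and "H \<in> {H. subring H D \<and> linear_subspace D H \<and> range \<iota> \<subseteq> H}"
    then have H: "subring H D" "linear_subspace D H" "range \<iota> \<subseteq> H" by auto
    obtain t where t: "X = cls t" using \<open>X \<in> carrier D\<close> by (rule D_E)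
    have wH: "wcls w \<in> H" for w
    proof (induction w)
      case Nil
      show ?case unfolding cls_one by (rule subringE(3)[OF H(1)])
    next
      case (Cons x w)
      have "\<iota> x \<in> H" using H(3) by auto
      then show ?case unfolding wcls_Cons by (rule subringE(6)[OF H(1) _ Cons])
    qed
    show "X \<in> H" unfolding t by (rule wcls_closed_under_subspace[OF H(2)]) (rule wH)
  qed
  have "subring (carrier D) D" by (rule U.carrier_is_subring)
  then show "\<Inter>{H. subring H D \<and> linear_subspace D H \<and> range \<iota> \<subseteq> H} \<subseteq> carrier D"
    by (intro Inter_lower CollectI conjI) (simp_all add: linear_subspace_def image_subsetI)
qed

lemma iota_primitive: "\<iota> x \<in> primitives D"
proof -
  have "comult D (\<iota> x) = DD.pure (\<iota> x) \<one>\<^bsub>D\<^esub> \<oplus>\<^bsub>DD.TP\<^esub> DD.pure \<one>\<^bsub>D\<^esub> (\<iota> x)"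
    by (simp add: iota_eq comult_cls delta_unit tcls_add tcls_unit cls_one)
  then show ?thesis by (simp add: primitives_def)
qed

subsection \<open>Primitive elements\<close>

text \<open>Lift to words of the convolution square of the identity, X -> X_(1) X_(2). It doubles
  primitive elements and multiplies an n-th power of an element of g by 2^n.\<close>

definition psi :: "('g list \<Rightarrow>\<^sub>0 'k) \<Rightarrow> ('g list \<Rightarrow>\<^sub>0 'k)" where
  "psi t = pm_lin (\<lambda>p. unit_vec (fst p @ snd p)) (delta t)"

lemma linear_psi: "is_linear pm_scale pm_scale psi"
  unfolding psi_def by (rule lin_comp[OF linear_delta linear_pm_lin])

lemma cls_psi: "cls (psi t) = sweedler D D (mult D) (cls t)"
  unfolding psi_def by (rule sweedler_D[OF bilin_mult, symmetric]) (rule wcls_append[symmetric])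

text \<open>On classes \<open>psi\<close> is given by the coproduct and the product of U(g), hence
  the class of its value depends on the class of the argument alone.\<close>

lemma psi_J: "t \<in> J \<Longrightarrow> psi t \<in> J"
proof -
  assume "t \<in> J"
  then have "cls t = cls 0" by (simp add: cls_eq_iff)
  then have "cls (psi t) = cls (psi 0)" by (simp only: cls_psi)
  then show ?thesis by (simp add: cls_eq_iff lin_0[OF linear_psi])
qed

lemma ssum_replicate:
  assumes "\<And>i j. i + j = n \<Longrightarrow> G (replicate i x) (replicate j x) = g"
  shows "ssum (replicate n x) G = pm_scale (2 ^ n) (g :: 'b \<Rightarrow>\<^sub>0 'k)"
  using assms
proof (induction n arbitrary: G)
  case (Suc n)
  have "ssum (replicate n x) (\<lambda>u v. G (x # u) v) = pm_scale (2 ^ n) g"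
    by (rule Suc.IH) (use Suc.prems[of "Suc _"] in simp)
  moreover have "ssum (replicate n x) (\<lambda>u v. G u (x # v)) = pm_scale (2 ^ n) g"
    by (rule Suc.IH) (use Suc.prems[of _ "Suc _"] in simp)
  ultimately show ?case by (simp add: vs_add_left[OF vector_space_pm_scale, symmetric])
qed (simp add: vs_one[OF vector_space_pm_scale])

lemma psi_power: "psi (unit_vec (replicate n x)) = pm_scale (2 ^ n) (unit_vec (replicate n x))"
  unfolding psi_def pm_lin_delta_unit by (rule ssum_replicate) (simp add: replicate_add[symmetric])

definition powers :: "nat \<Rightarrow> ('g list \<Rightarrow>\<^sub>0 'k) set" where
  "powers n = pm.span (range (\<lambda>x. unit_vec (replicate n x)))"

lemma subspace_powers: "subspace_of pm_scale (powers n)"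
  unfolding powers_def by (rule subsp_span)

lemma psi_powers:
  assumes "t \<in> powers n"
  shows "psi t = pm_scale (2 ^ n) t"
proof -
  have "is_linear pm_scale pm_scale (\<lambda>t. psi t - pm_scale (2 ^ n) t)"
    by (intro lin_minus_fun linear_psi lin_scale_fun lin_id_fun vector_space_pm_scale)
  from subspace_vimage[OF this subspace_zero[OF vector_space_pm_scale]]
  have "powers n \<subseteq> {t. psi t - pm_scale (2 ^ n) t \<in> {0}}"
    unfolding powers_def by (rule span_subset_subspace) (auto simp: psi_power)
  then show ?thesis using assms by auto
qed

text \<open>Elements congruent modulo \<open>J\<close> to a combination of powers of degree at most
  \<open>n\<close>. The component \<open>f k\<close> of each degree is kept apart because
  \<open>psi\<close> has eigenvalue 2^k on it.\<close>

definition power_sums :: "nat \<Rightarrow> ('g list \<Rightarrow>\<^sub>0 'k) set" where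
  "power_sums n = {j + (\<Sum>k\<le>n. f k) | j f. j \<in> J \<and> (\<forall>k. f k \<in> powers k)}"

lemma powers_closed: "0 \<in> powers k" "x \<in> powers k \<Longrightarrow> y \<in> powers k \<Longrightarrow> x + y \<in> powers k" "x \<in> powers k \<Longrightarrow> pm_scale c x \<in> powers k"
  using subspace_powers[of k] by (auto simp: subspace_of_def)

lemma subspace_power_sums: "subspace_of pm_scale (power_sums n)"
  unfolding subspace_of_def
proof (intro conjI ballI allI)
  show "0 \<in> power_sums n"
    unfolding power_sums_def by (rule CollectI, rule exI[of _ 0], rule exI[of _ "\<lambda>_. 0"]) (simp add: J_closed powers_closed)
next
  fix x y assume "x \<in> power_sums n" "y \<in> power_sums n"
  then obtain j f j' f' where "x = j + (\<Sum>k\<le>n. f k)" "y = j' + (\<Sum>k\<le>n. f' k)" "j \<in> J" "j' \<in> J"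
    "\<forall>k. f k \<in> powers k" "\<forall>k. f' k \<in> powers k"
    unfolding power_sums_def by blast
  then show "x + y \<in> power_sums n"
    unfolding power_sums_def
    by (intro CollectI exI[of _ "j + j'"] exI[of _ "\<lambda>k. f k + f' k"]) (simp add: J_closed powers_closed sum.distrib algebra_simps)
next
  fix c x assume "x \<in> power_sums n"
  then obtain j f where "x = j + (\<Sum>k\<le>n. f k)" "j \<in> J" "\<forall>k. f k \<in> powers k"
    unfolding power_sums_def by blast
  then show "pm_scale c x \<in> power_sums n"
    unfolding power_sums_def
    by (intro CollectI exI[of _ "pm_scale c j"] exI[of _ "\<lambda>k. pm_scale c (f k)"])
      (simp add: J_closed powers_closed vs_add_right[OF vector_space_pm_scale] vs_sum_right[OF vector_space_pm_scale])
qed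

lemma J_power_sums: "j \<in> J \<Longrightarrow> j \<in> power_sums n"
  unfolding power_sums_def by (intro CollectI exI[of _ j] exI[of _ "\<lambda>_. 0"]) (simp add: powers_closed)

lemma powers_power_sums: "k \<le> n \<Longrightarrow> t \<in> powers k \<Longrightarrow> t \<in> power_sums n"
  unfolding power_sums_def
  by (intro CollectI exI[of _ 0] exI[of _ "\<lambda>i. if i = k then t else 0"]) (auto simp: J_closed powers_closed)

lemma replicate_power_sums: "k \<le> n \<Longrightarrow> unit_vec (replicate k x) \<in> power_sums n"
  by (rule powers_power_sums) (auto simp: powers_def intro: pm.span_base)

lemma power_sums_mono: "m \<le> n \<Longrightarrow> power_sums m \<subseteq> power_sums n"
proof
  fix t assume "m \<le> n" "t \<in> power_sums m"
  then obtain j f where "t = j + (\<Sum>k\<le>m. f k)" "j \<in> J" "\<forall>k. f k \<in> powers k"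
    unfolding power_sums_def by blast
  then show "t \<in> power_sums n"
    using \<open>m \<le> n\<close> powers_power_sums[of _ n "f _"] J_power_sums[of j n]
    by (auto intro!: subsp_add[OF vector_space_pm_scale subspace_power_sums, of j n]
      subsp_sum[OF vector_space_pm_scale subspace_power_sums] intro: powers_power_sums[OF order.trans])
qed

end

section \<open>Polarization and the eigenvectors of \<open>psi\<close>\<close>

locale lie_algebra_char_0 = lie_algebra scale bracket
  for scale :: "'k::field_char_0 \<Rightarrow> 'g::ab_group_add \<Rightarrow> 'g" and bracket
begin

text \<open>Vandermonde argument by induction: replacing t by 2 t and subtracting 2^(m + 1) times
  the original removes the top coefficient and multiplies the i-th one by 2^i - 2^(m + 1), which is
  nonzero in characteristic zero.\<close>

lemma coefficients_in_subspace:
  fixes c :: "nat \<Rightarrow> ('b \<Rightarrow>\<^sub>0 'k)"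
  assumes W: "subspace_of pm_scale W" and "\<And>t :: 'k. (\<Sum>i\<le>m. pm_scale (t ^ i) (c i)) \<in> W" "i \<le> m"
  shows "c i \<in> W"
  using assms(2,3)
proof (induction m arbitrary: c i)
  case 0
  from 0(1)[of 0] 0(2) show ?case by (simp add: vs_one[OF vector_space_pm_scale])
next
  case (Suc m)
  note Wc = subsp_diff[OF vector_space_pm_scale W] subsp_scale[OF vector_space_pm_scale W]
  have ne: "(2 :: 'k) ^ j - 2 ^ Suc m \<noteq> 0" if "j \<le> m" for j
  proof -
    have "(2 :: nat) ^ j \<noteq> 2 ^ Suc m" using that by (simp del: power_Suc)
    then have "(of_nat (2 ^ j) :: 'k) \<noteq> of_nat (2 ^ Suc m)" by (simp only: of_nat_eq_iff) simp
    then show ?thesis by simp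
  qed
  have low: "c j \<in> W" if "j \<le> m" for j
  proof -
    have "(\<Sum>i\<le>m. pm_scale (t ^ i) (pm_scale (2 ^ i - 2 ^ Suc m) (c i))) \<in> W" for t :: 'k
    proof -
      have "(\<Sum>i\<le>Suc m. pm_scale ((2 * t) ^ i) (c i)) - pm_scale (2 ^ Suc m) (\<Sum>i\<le>Suc m. pm_scale (t ^ i) (c i)) \<in> W"
        by (intro Wc Suc.prems)
      also have "(\<Sum>i\<le>Suc m. pm_scale ((2 * t) ^ i) (c i)) - pm_scale (2 ^ Suc m) (\<Sum>i\<le>Suc m. pm_scale (t ^ i) (c i))
        = (\<Sum>i\<le>Suc m. pm_scale (t ^ i) (pm_scale (2 ^ i - 2 ^ Suc m) (c i)))"
        by (simp only: vs_sum_right[OF vector_space_pm_scale] sum_subtractf[symmetric] scale_power_diff)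
      finally show ?thesis by (simp add: vs_zero_left[OF vector_space_pm_scale] vs_zero_right[OF vector_space_pm_scale])
    qed
    from Suc.IH[OF this that]
    have "pm_scale (inverse (2 ^ j - 2 ^ Suc m)) (pm_scale (2 ^ j - 2 ^ Suc m) (c j)) \<in> W" by (rule Wc(2))
    then show ?thesis
      using ne[OF that] by (simp add: vs_scale_scale[OF vector_space_pm_scale] vs_one[OF vector_space_pm_scale] del: power_Suc)
  qed
  show ?case
  proof (cases "i \<le> m")
    case False
    have "(\<Sum>i\<le>Suc m. pm_scale (1 ^ i) (c i)) - (\<Sum>i\<le>m. c i) \<in> W"
      by (intro Wc(1) Suc.prems(1) subsp_sum[OF vector_space_pm_scale W] low) auto
    then show ?thesis using False Suc.prems(2) by (simp add: vs_one[OF vector_space_pm_scale] le_Suc_eq)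
  qed (rule low)
qed

text \<open>The coefficients of the expansion of \<open>(x + t y)\<^sup>m\<close> in powers of \<open>t\<close>.\<close>

primrec binom_coeff :: "'g \<Rightarrow> 'g \<Rightarrow> nat \<Rightarrow> nat \<Rightarrow> ('g list \<Rightarrow>\<^sub>0 'k)" where
  "binom_coeff x y 0 = (\<lambda>i. if i = 0 then unit_vec [] else 0)"
| "binom_coeff x y (Suc m) = (\<lambda>i. tmul (unit_vec [x]) (binom_coeff x y m i) +
     (if i = 0 then 0 else tmul (unit_vec [y]) (binom_coeff x y m (i - 1))))"

lemma binom_coeff_0: "binom_coeff x y m 0 = unit_vec (replicate m x)"
  by (induction m) simp_all

lemma binom_coeff_1: "binom_coeff x y m 1 = (\<Sum>i<m. unit_vec (replicate i x @ y # replicate (m - 1 - i) x))"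
proof (induction m)
  case (Suc m)
  have "tmul (unit_vec [x]) (unit_vec (replicate i x @ y # replicate (m - 1 - i) x)) =
    (unit_vec (replicate (Suc i) x @ y # replicate (m - Suc i) x) :: 'g list \<Rightarrow>\<^sub>0 'k)" for i
    by simp
  then show ?case
    by (simp add: Suc[unfolded One_nat_def] binom_coeff_0 lin_sum[OF linear_conv_right] sum.lessThan_Suc_shift del: sum.lessThan_Suc)
qed simp

lemma binom_coeff_zero: "m < i \<Longrightarrow> binom_coeff x y m i = 0"
  by (induction m arbitrary: i) (simp_all add: lin_0[OF linear_conv_right])

lemma unit_vec_Cons_J:
  "unit_vec ((x + scale t y) # w) - (unit_vec (x # w) + pm_scale t (unit_vec (y # w))) \<in> J"
proof -
  have "unit_vec [x + scale t y] - unit_vec [x] - unit_vec [scale t y] + (unit_vec [scale t y] - Poly_Mapping.single [y] t) \<in> J"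
    by (intro J_closed gens_J)
  then have "tmul (unit_vec [x + scale t y] - (unit_vec [x] + pm_scale t (unit_vec [y]))) (unit_vec w) \<in> J"
    by (intro J_mult) (simp add: algebra_simps)
  then show ?thesis
    by (simp add: lin_diff[OF linear_conv_left] lin_add[OF linear_conv_left] lin_scale[OF linear_conv_left] del: pm_scale_single)
qed

text \<open>Linearity of single letters holds modulo \<open>J\<close>; applied to one factor after
  the other, it gives the noncommutative binomial expansion.\<close>

lemma power_expansion:
  "unit_vec (replicate m (x + scale t y)) - (\<Sum>i\<le>m. pm_scale (t ^ i) (binom_coeff x y m i)) \<in> J"
proof (induction m)
  case (Suc m)
  let ?w = "replicate m (x + scale t y)" and ?B = "binom_coeff x y m"
  let ?S = "\<Sum>i\<le>m. pm_scale (t ^ i) (?B i)"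
  let ?l = "\<lambda>z. tmul (unit_vec [x]) z + pm_scale t (tmul (unit_vec [y]) z)"
  note lr = linear_conv_right[of "(@)"]
  have "?l (unit_vec ?w - ?S) \<in> J"
    by (intro J_closed J_mult Suc)
  then have 1: "(unit_vec (x # ?w) + pm_scale t (unit_vec (y # ?w))) - ?l ?S \<in> J"
    by (simp add: lin_diff[OF lr] vs_diff_right[OF vector_space_pm_scale] algebra_simps del: pm_scale_single)
  have "(\<Sum>i\<le>Suc m. pm_scale (t ^ i) (binom_coeff x y (Suc m) i)) =
      (\<Sum>i\<le>Suc m. pm_scale (t ^ i) (tmul (unit_vec [x]) (?B i)))
      + (\<Sum>i\<le>Suc m. pm_scale (t ^ i) (if i = 0 then 0 else tmul (unit_vec [y]) (?B (i - 1))))"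
    by (simp add: vs_add_right[OF vector_space_pm_scale] sum.distrib del: sum.atMost_Suc)
  also have "(\<Sum>i\<le>Suc m. pm_scale (t ^ i) (tmul (unit_vec [x]) (?B i))) = tmul (unit_vec [x]) ?S"
    by (simp add: binom_coeff_zero lin_0[OF lr] vs_zero_right[OF vector_space_pm_scale] lin_sum[OF lr] lin_scale[OF lr])
  also have "(\<Sum>i\<le>Suc m. pm_scale (t ^ i) (if i = 0 then 0 else tmul (unit_vec [y]) (?B (i - 1)))) = pm_scale t (tmul (unit_vec [y]) ?S)"
    by (subst sum.atMost_Suc_shift)
      (simp add: lin_sum[OF lr] lin_scale[OF lr] vs_zero_right[OF vector_space_pm_scale] vs_sum_right[OF vector_space_pm_scale] vs_scale_scale[OF vector_space_pm_scale])
  finally have 2: "?l ?S = (\<Sum>i\<le>Suc m. pm_scale (t ^ i) (binom_coeff x y (Suc m) i))" by simp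
  show ?case
    using J_closed(2)[OF unit_vec_Cons_J[of x t y ?w] 1] unfolding 2 by (simp add: algebra_simps)
qed (simp add: J_closed vs_one[OF vector_space_pm_scale])

text \<open>Moving \<open>y\<close> past one \<open>x\<close> costs a bracket, that is, a word one
  letter shorter, which lies in \<open>V\<close> by assumption.\<close>

lemma move_letter:
  assumes V: "subspace_of pm_scale V" "J \<subseteq> V" and short: "\<And>w. length w = length u + j \<Longrightarrow> unit_vec w \<in> V"
  shows "unit_vec (u @ y # replicate j x) - unit_vec (u @ replicate j x @ [y]) \<in> V"
  using short
proof (induction j arbitrary: u)
  case 0
  then show ?case using subsp_0[OF vector_space_pm_scale V(1)] by simp
next
  case (Suc j)
  note Vc = subsp_add[OF vector_space_pm_scale V(1)]
  let ?r = "replicate j x"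
  have "tmul (unit_vec u) (tmul (unit_vec [y, x] - unit_vec [x, y] - unit_vec [bracket y x]) (unit_vec ?r)) \<in> J"
    by (intro J_mult gens_J)
  then have 1: "unit_vec (u @ y # x # ?r) - unit_vec (u @ x # y # ?r) - unit_vec (u @ bracket y x # ?r) \<in> V"
    using V(2) by (auto simp: lin_diff[OF linear_conv_left] lin_diff[OF linear_conv_right])
  have 2: "unit_vec (u @ bracket y x # ?r) \<in> V" by (rule Suc.prems) simp
  have 3: "unit_vec ((u @ [x]) @ y # ?r) - unit_vec ((u @ [x]) @ ?r @ [y]) \<in> V"
    by (rule Suc.IH) (simp add: Suc.prems)
  show ?case using Vc[OF Vc[OF 1 2] 3] by simp
qed

text \<open>The coefficient of t in (x + t y)^(k + 1) is the sum of the k + 1 words with one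
  \<open>y\<close> among \<open>k\<close> letters \<open>x\<close>. Modulo shorter words each of
  them equals x^k y, so k + 1 times this word is reached, and the factor is inverted.\<close>

lemma replicate_snoc_power_sums:
  assumes short: "\<And>w. length w \<le> k \<Longrightarrow> unit_vec w \<in> power_sums k"
  shows "unit_vec (replicate k x @ [y]) \<in> power_sums (Suc k)"
proof -
  let ?V = "power_sums (Suc k)"
  note V = subspace_power_sums[of "Suc k"]
  let ?w = "\<lambda>i. unit_vec (replicate i x @ y # replicate (k - i) x) :: 'g list \<Rightarrow>\<^sub>0 'k"
  let ?z = "unit_vec (replicate k x @ [y]) :: 'g list \<Rightarrow>\<^sub>0 'k"
  have "(\<Sum>i\<le>Suc k. pm_scale (t ^ i) (binom_coeff x y (Suc k) i)) \<in> ?V" for t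
    using subsp_diff[OF vector_space_pm_scale V, OF replicate_power_sums[of "Suc k" "Suc k" "x + scale t y"] J_power_sums[OF power_expansion[of "Suc k" x t y]]]
    by (simp only: diff_diff_eq2 add_diff_cancel_left')
  from coefficients_in_subspace[OF V this, of 1] have A: "(\<Sum>i<Suc k. ?w i) \<in> ?V"
    unfolding binom_coeff_1 by simp
  have B: "?w i - ?z \<in> ?V" if "i < Suc k" for i
  proof -
    have "unit_vec (replicate i x @ y # replicate (k - i) x) - unit_vec (replicate i x @ replicate (k - i) x @ [y]) \<in> ?V"
    proof (rule move_letter[OF V])
      show "J \<subseteq> ?V" by (auto intro: J_power_sums)
      fix w :: "'g list" assume "length w = length (replicate i x) + (k - i)"
      then have "length w \<le> k" using that by simp
      then show "unit_vec w \<in> ?V" using short power_sums_mono[of k "Suc k"] by auto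
    qed
    moreover have "replicate i x @ replicate (k - i) x @ [y] = replicate k x @ [y]"
      using that by (simp add: replicate_add[symmetric] flip: append_assoc)
    ultimately show ?thesis by simp
  qed
  have "(\<Sum>i<Suc k. ?w i) - (\<Sum>i<Suc k. ?w i - ?z) \<in> ?V"
    by (intro subsp_diff[OF vector_space_pm_scale V] A subsp_sum[OF vector_space_pm_scale V] B) simp
  also have "(\<Sum>i<Suc k. ?w i) - (\<Sum>i<Suc k. ?w i - ?z) = (\<Sum>i<Suc k. ?z)"
    by (simp only: sum_subtractf) simp
  also have "\<dots> = pm_scale (of_nat (Suc k)) ?z"
    by (rule poly_mapping_eqI) (simp only: lookup_sum sum_constant card_lessThan lookup_pm_scale)
  finally have "pm_scale (inverse (of_nat (Suc k))) (pm_scale (of_nat (Suc k)) ?z) \<in> ?V"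
    by (rule subsp_scale[OF vector_space_pm_scale V])
  then show ?thesis
    by (simp only: vs_scale_scale[OF vector_space_pm_scale] left_inverse[OF of_nat_neq_0] vs_one[OF vector_space_pm_scale])
qed

text \<open>Spanning half of the symmetrization theorem: split off the last letter, write the rest
  as a sum of powers by induction, and treat each x^k y by polarization.\<close>

lemma word_in_power_sums: "length w \<le> n \<Longrightarrow> unit_vec w \<in> power_sums n"
proof (induction n arbitrary: w rule: less_induct)
  case (less n)
  show ?case
  proof (cases w rule: rev_cases)
    case Nil
    then show ?thesis using replicate_power_sums[of 0 n] by simp
  next
    case (snoc v y)
    then obtain m where m: "n = Suc m" "length v \<le> m" using less.prems by (cases n) auto
    let ?R = "\<lambda>t. tmul t (unit_vec [y])"
    have rep: "?R (unit_vec (replicate k x)) \<in> power_sums n" if "k \<le> m" for k x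
      using replicate_snoc_power_sums[of k x y] less.IH[of k] that power_sums_mono[of "Suc k" n] by (auto simp: m)
    have pow: "?R t \<in> power_sums n" if "k \<le> m" "t \<in> powers k" for k t
    proof -
      have "powers k \<subseteq> {t. ?R t \<in> power_sums n}"
        unfolding powers_def
        by (rule span_subset_subspace[OF subspace_vimage[OF linear_conv_left subspace_power_sums]]) (use rep that in auto)
      then show ?thesis using that by auto
    qed
    have "unit_vec v \<in> power_sums m" by (rule less.IH) (simp_all add: m)
    then obtain j f where jf: "unit_vec v = j + (\<Sum>k\<le>m. f k)" "j \<in> J" "\<forall>k. f k \<in> powers k"
      unfolding power_sums_def by blast
    have "?R (unit_vec v) \<in> power_sums n"
      unfolding jf(1) lin_add[OF linear_conv_left] lin_sum[OF linear_conv_left]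
      by (intro subsp_add[OF vector_space_pm_scale subspace_power_sums]
        subsp_sum[OF vector_space_pm_scale subspace_power_sums] J_power_sums J_mult jf(2) pow)
        (use jf(3) in auto)
    then show ?thesis by (simp add: snoc)
  qed
qed

text \<open>Eigenvectors for distinct eigenvalues are independent modulo \<open>J\<close>. Iterating
  \<open>psi\<close> gives the sums at t = 2^r, which admit the elimination of
  \<open>coefficients_in_subspace\<close>.\<close>

lemma eigenvectors_independent:
  assumes "\<And>k. psi (s k) = pm_scale (2 ^ k) (s k)" "(\<Sum>k\<le>n. s k) \<in> J" "k \<le> n"
  shows "s k \<in> J"
  using assms
proof -
  have "(\<Sum>i\<le>n. pm_scale ((2 ^ r) ^ i) (s i)) \<in> J" for r
  proof (induction r)
    case (Suc r)
    have "psi (\<Sum>i\<le>n. pm_scale ((2 ^ r) ^ i) (s i)) \<in> J" by (rule psi_J[OF Suc])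
    then show ?case
      by (simp add: lin_sum[OF linear_psi] lin_scale[OF linear_psi] assms(1) vs_scale_scale[OF vector_space_pm_scale]
        power_mult_distrib mult.commute)
  qed (use assms(2) in \<open>simp add: vs_one[OF vector_space_pm_scale]\<close>)
  then have "(\<Sum>i\<le>n. pm_scale ((2 ^ r) ^ i) (s i)) \<in> J" for r .
  note sums = this
  show ?thesis
    using assms(1) sums assms(3)
  proof (induction n arbitrary: s k)
    case 0
    from 0(2)[of 0] 0(3) show ?case by (simp add: vs_one[OF vector_space_pm_scale])
  next
    case (Suc n)
    have ne: "(2 :: 'k) ^ j - 2 ^ Suc n \<noteq> 0" if "j \<le> n" for j
    proof -
      have "(2 :: nat) ^ j \<noteq> 2 ^ Suc n" using that by (simp del: power_Suc)
      then have "(of_nat (2 ^ j) :: 'k) \<noteq> of_nat (2 ^ Suc n)" by (simp only: of_nat_eq_iff) simp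
      then show ?thesis by simp
    qed
    have low: "s j \<in> J" if "j \<le> n" for j
    proof -
      have "pm_scale (2 ^ j - 2 ^ Suc n) (s j) \<in> J"
      proof (rule Suc.IH[of "\<lambda>j. pm_scale (2 ^ j - 2 ^ Suc n) (s j)", OF _ _ that])
        fix r
        have "(\<Sum>i\<le>Suc n. pm_scale ((2 ^ Suc r) ^ i) (s i)) - pm_scale (2 ^ Suc n) (\<Sum>i\<le>Suc n. pm_scale ((2 ^ r) ^ i) (s i)) \<in> J"
          by (intro J_closed Suc.prems)
        also have "(\<Sum>i\<le>Suc n. pm_scale ((2 ^ Suc r) ^ i) (s i)) - pm_scale (2 ^ Suc n) (\<Sum>i\<le>Suc n. pm_scale ((2 ^ r) ^ i) (s i))
          = (\<Sum>i\<le>Suc n. pm_scale ((2 ^ r) ^ i) (pm_scale (2 ^ i - 2 ^ Suc n) (s i)))"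
          by (simp only: vs_sum_right[OF vector_space_pm_scale] sum_subtractf[symmetric] power_Suc[of 2 r] scale_power_diff)
        finally show "(\<Sum>i\<le>n. pm_scale ((2 ^ r) ^ i) (pm_scale (2 ^ i - 2 ^ Suc n) (s i))) \<in> J"
          by (simp add: vs_zero_left[OF vector_space_pm_scale] vs_zero_right[OF vector_space_pm_scale])
      qed (simp add: lin_scale[OF linear_psi] Suc.prems(1) vs_scale_scale[OF vector_space_pm_scale] mult.commute)
      from J_closed(3)[OF this, of "inverse (2 ^ j - 2 ^ Suc n)"] show ?thesis
        using ne[OF that] by (simp add: vs_scale_scale[OF vector_space_pm_scale] vs_one[OF vector_space_pm_scale] del: power_Suc)
    qed
    show ?case
    proof (cases "k \<le> n")
      case False
      have "(\<Sum>i\<le>Suc n. pm_scale ((2 ^ 0) ^ i) (s i)) - (\<Sum>i\<le>n. s i) \<in> J"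
        by (intro J_closed(5) Suc.prems(2) subsp_sum[OF vector_space_pm_scale subspace_J] low) auto
      then show ?thesis using False Suc.prems(3) by (simp add: vs_one[OF vector_space_pm_scale] le_Suc_eq)
    qed (rule low)
  qed
qed

text \<open>A primitive element has eigenvalue 2 under \<open>psi\<close>. Decomposed into powers,
  its component of degree k is multiplied by 2^k - 2 and lands in \<open>J\<close>, so the component
  of degree one alone survives.\<close>

lemma primitives_D: "primitives D = range \<iota>"
proof
  show "range \<iota> \<subseteq> primitives D" using iota_primitive by auto
  show "primitives D \<subseteq> range \<iota>"
  proof
    fix X assume X: "X \<in> primitives D"
    then obtain t where t: "X = cls t" by (auto simp: primitives_def elim: D_E)
    have "sweedler D D (mult D) X = X \<otimes>\<^bsub>D\<^esub> \<one>\<^bsub>D\<^esub> \<oplus>\<^bsub>D\<^esub> \<one>\<^bsub>D\<^esub> \<otimes>\<^bsub>D\<^esub> X"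
      using X DDM.tensor_lift_linear[OF bilin_mult]
      by (simp add: sweedler_def primitives_def DDM.tensor_lift_pure[OF bilin_mult] linear_maps_def)
    then have "cls (psi t) = cls (t + t)" by (simp add: t cls_psi cls_add)
    then have psi_t: "psi t - pm_scale 2 t \<in> J"
      using vs_add_left[OF vector_space_pm_scale, of 1 1 t] by (simp add: cls_eq_iff vs_one[OF vector_space_pm_scale])
    \<comment> \<open>The successor ensures n \<ge> 1, so that degree one occurs in the sum even if
      \<open>t\<close> is a constant.\<close>
    define n where "n = Suc (Max (length ` Poly_Mapping.keys t))"
    have "lin_ext pm_scale unit_vec t \<in> power_sums n"
      by (rule lin_ext_in_subspace[OF vector_space_pm_scale subspace_power_sums], rule word_in_power_sums)
        (auto simp: n_def intro!: le_SucI Max_ge)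
    then obtain j f where jf: "t = j + (\<Sum>k\<le>n. f k)" "j \<in> J" "\<And>k. f k \<in> powers k"
      unfolding lin_ext_unit_vec power_sums_def by blast
    define s where "s k = pm_scale (2 ^ k - 2) (f k)" for k
    have "(\<Sum>k\<le>n. s k) = psi t - pm_scale 2 t - (psi j - pm_scale 2 j)"
      unfolding jf(1) lin_add[OF linear_psi] lin_sum[OF linear_psi] psi_powers[OF jf(3)] s_def
        pm.scale_left_diff_distrib sum_subtractf vs_add_right[OF vector_space_pm_scale] vs_sum_right[OF vector_space_pm_scale]
      by simp
    also have "\<dots> \<in> J" by (intro J_closed psi_t psi_J jf(2))
    finally have "(\<Sum>k\<le>n. s k) \<in> J" .
    moreover have "psi (s k) = pm_scale (2 ^ k) (s k)" for k
      by (rule psi_powers) (simp add: s_def powers_closed jf(3))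
    ultimately have sJ: "s k \<in> J" if "k \<le> n" for k
      using eigenvectors_independent that by blast
    have fJ: "f k \<in> J" if "k \<le> n" "k \<noteq> 1" for k
    proof -
      have "(2 :: nat) ^ k \<noteq> 2 ^ 1" using that by (subst power_inject_exp) auto
      then have "(of_nat (2 ^ k) :: 'k) \<noteq> of_nat (2 ^ 1)" by (simp only: of_nat_eq_iff) simp
      then have "(2 :: 'k) ^ k - 2 \<noteq> 0" by simp
      then show ?thesis
        using J_closed(3)[OF sJ[OF that(1)], of "inverse (2 ^ k - 2)"]
        by (simp add: s_def vs_scale_scale[OF vector_space_pm_scale] vs_one[OF vector_space_pm_scale])
    qed
    have "t - f 1 = j + (\<Sum>k\<in>{..n} - {1}. f k)"
      unfolding jf(1) by (subst sum.remove[of _ 1]) (auto simp: n_def)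
    also have "\<dots> \<in> J"
      by (intro J_closed(2) jf(2) subsp_sum[OF vector_space_pm_scale subspace_J] fJ) auto
    finally have "X = cls (f 1)" by (simp add: t cls_eq_iff)
    moreover have "powers 1 \<subseteq> {t. cls t \<in> range \<iota>}"
      unfolding powers_def
    proof (rule span_subset_subspace)
      show "subspace_of pm_scale {t. cls t \<in> range \<iota>}"
        using linear_subspace_range_iota unfolding linear_subspace_def subspace_of_def
        by (auto simp: cls_zero cls_add cls_scale)
    qed (auto simp: iota_eq)
    ultimately show "X \<in> range \<iota>" using jf(3)[of 1] by auto
  qed
qed

end

subsection \<open>The enveloping algebra contains the Lie algebra\<close>

text \<open>Monomials will be multisets; the order \<open>r\<close> singles out the letter that
  stands first in a product.\<close>

locale pbw = lie_algebra scale bracket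
  for scale :: "'k::field \<Rightarrow> 'g::ab_group_add \<Rightarrow> 'g" and bracket +
  fixes B :: "'g set" and r :: "('g \<times> 'g) set"
  assumes indep: "independent B" and span_B: "span B = UNIV" and r: "linear_order r"
begin

abbreviation coord :: "'g \<Rightarrow> 'g \<Rightarrow> 'k" where "coord \<equiv> representation B"
abbreviation le (infix \<open>\<preceq>\<close> 50) where "x \<preceq> y \<equiv> (x, y) \<in> r"

text \<open>Linear extension from the basis \<open>B\<close>, as \<open>lin_ext\<close> is for a
  free space.\<close>

definition basis_lin :: "('g \<Rightarrow> 'v) \<Rightarrow> ('k \<Rightarrow> 'v \<Rightarrow> 'v) \<Rightarrow> 'g \<Rightarrow> 'v::ab_group_add" where
  "basis_lin f s x = (\<Sum>b | coord x b \<noteq> 0. s (coord x b) (f b))"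

lemma le_refl: "x \<preceq> x" and le_antisym: "x \<preceq> y \<Longrightarrow> y \<preceq> x \<Longrightarrow> x = y"
  and le_trans: "x \<preceq> y \<Longrightarrow> y \<preceq> z \<Longrightarrow> x \<preceq> z" and le_total: "x \<preceq> y \<or> y \<preceq> x"
proof -
  have 1: "refl r" "trans r" "antisym r" "total r"
    using r unfolding linear_order_on_def partial_order_on_def preorder_on_def by auto
  show refl: "x \<preceq> x" using 1(1) by (auto simp: refl_on_def)
  show "x \<preceq> y \<Longrightarrow> y \<preceq> x \<Longrightarrow> x = y" using 1(3) by (auto dest: antisymD)
  show "x \<preceq> y \<Longrightarrow> y \<preceq> z \<Longrightarrow> x \<preceq> z" using 1(2) by (auto dest: transD)
  show "x \<preceq> y \<or> y \<preceq> x" using 1(4) refl by (cases "x = y") (auto simp: total_on_def)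
qed

lemma linear_basis_lin:
  assumes "vector_space s"
  shows "is_linear scale s (basis_lin f s)"
proof (rule linI[OF vs assms])
  have ext: "basis_lin f s x = (\<Sum>b\<in>A. s (coord x b) (f b))" if "finite A" "{b. coord x b \<noteq> 0} \<subseteq> A" for x A
    unfolding basis_lin_def by (rule sum.mono_neutral_left) (use that in \<open>auto simp: vs_zero_left[OF assms]\<close>)
  fix x y c
  let ?A = "{b. coord x b \<noteq> 0} \<union> {b. coord y b \<noteq> 0}"
  have fin: "finite ?A" by (simp add: finite_representation)
  have add: "coord (x + y) b = coord x b + coord y b" and scale: "coord (scale c x) b = c * coord x b" for b
    by (simp_all add: representation_add[OF indep] representation_scale[OF indep] span_B)
  show "basis_lin f s (x + y) = basis_lin f s x + basis_lin f s y"
    using fin by (subst (1 2 3) ext[of ?A]) (auto simp: add vs_add_left[OF assms] sum.distrib)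
  show "basis_lin f s (scale c x) = s c (basis_lin f s x)"
    using fin by (subst (1 2) ext[of ?A]) (auto simp: scale vs_scale_scale[OF assms] vs_sum_right[OF assms])
qed

lemma basis_lin_basis:
  assumes "vector_space s" "b \<in> B"
  shows "basis_lin f s b = f b"
proof -
  have "coord b = (\<lambda>v. if v = b then 1 else 0)" using representation_basis[OF indep assms(2)] .
  then have "basis_lin f s b = (\<Sum>v\<in>{b}. s 1 (f v))" unfolding basis_lin_def by (intro sum.cong) (auto split: if_splits)
  then show ?thesis by (simp add: vs_one[OF assms(1)])
qed

lemma basis_expansion: "x = (\<Sum>b | coord x b \<noteq> 0. scale (coord x b) b)"
  using sum_nonzero_representation_eq[OF indep] span_B by auto

lemma basis_ext:
  assumes F: "is_linear scale s F" and G: "is_linear scale s G" and eq: "\<And>b. b \<in> B \<Longrightarrow> F b = G b"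
  shows "F x = G x"
proof -
  have "F b = G b" if "coord x b \<noteq> 0" for b
    using representation_ne_zero[OF that] eq by blast
  then show ?thesis
    by (subst (1 2) basis_expansion[of x]) (simp add: lin_sum[OF F] lin_sum[OF G] lin_scale[OF F] lin_scale[OF G])
qed

section \<open>A representation of g on commutative monomials\<close>

definition below :: "'g \<Rightarrow> 'g multiset \<Rightarrow> bool" where
  "below i M \<longleftrightarrow> (\<forall>j\<in>#M. i \<preceq> j)"

lemma least_exists:
  assumes "M \<noteq> {#}"
  shows "\<exists>j\<in>#M. below j M"
  using assms
proof (induction M)
  case (add x M)
  show ?case
  proof (cases "M = {#}")
    case False
    with add.IH obtain j where "j \<in># M" "below j M" by auto
    show ?thesis
    proof (cases "x \<preceq> j")
      case True
      then have "below x (add_mset x M)"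
        using \<open>below j M\<close> le_refl le_trans[OF True] by (auto simp: below_def)
      then show ?thesis by auto
    next
      case False
      then have "below j (add_mset x M)"
        using \<open>below j M\<close> le_total[of x j] by (auto simp: below_def)
      then show ?thesis using \<open>j \<in># M\<close> by auto
    qed
  qed (auto simp: below_def le_refl)
qed simp

definition least :: "'g multiset \<Rightarrow> 'g" where
  "least M = (SOME j. j \<in># M \<and> below j M)"

lemma least:
  assumes "M \<noteq> {#}"
  shows "least M \<in># M" "below (least M) M"
  using someI_ex[of "\<lambda>j. j \<in># M \<and> below j M"] least_exists[OF assms] unfolding least_def by blast+

lemma least_eqI: "j \<in># M \<Longrightarrow> below j M \<Longrightarrow> least M = j"
  using least[of M] le_antisym unfolding below_def by fastforce

text \<open>
  \<open>act_upto n i M\<close> is the action of the basis element \<open>i\<close> on the monomial \<open>M\<close> of degree at most \<open>n\<close>.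
  If \<open>j\<close> is the least element of \<open>M = j N\<close> and \<open>j < i\<close>, then \<open>i (j N) = j (i N) + [i, j] N\<close>, where
  \<open>i N\<close> is the monomial \<open>N + {i}\<close> up to terms of lower degree.
\<close>

primrec act_upto :: "nat \<Rightarrow> 'g \<Rightarrow> 'g multiset \<Rightarrow> ('g multiset \<Rightarrow>\<^sub>0 'k)" where
  "act_upto 0 = (\<lambda>i M. unit_vec {#i#})"
| "act_upto (Suc n) = (\<lambda>i M.
     if size M \<le> n then act_upto n i M
     else if below i M then unit_vec (add_mset i M)
     else let j = least M; N = M - {#j#} in
       unit_vec (add_mset i M) + pm_lin (act_upto n j) (act_upto n i N - unit_vec (add_mset i N))
         + basis_lin (\<lambda>k. act_upto n k N) pm_scale (bracket i j))"

definition act :: "'g \<Rightarrow> 'g multiset \<Rightarrow> ('g multiset \<Rightarrow>\<^sub>0 'k)" where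
  "act i M = act_upto (size M) i M"

definition rho :: "'g \<Rightarrow> ('g multiset \<Rightarrow>\<^sub>0 'k) \<Rightarrow> ('g multiset \<Rightarrow>\<^sub>0 'k)" where
  "rho x p = pm_lin (\<lambda>M. basis_lin (\<lambda>i. act i M) pm_scale x) p"

definition deg_le :: "nat \<Rightarrow> ('g multiset \<Rightarrow>\<^sub>0 'k) set" where
  "deg_le n = {p. Poly_Mapping.keys p \<subseteq> {M. size M \<le> n}}"

text \<open>The recursion runs on a bound for the degree; every bound that is large enough gives the
  same action.\<close>

lemma act_upto_eq_act: "size M \<le> n \<Longrightarrow> act_upto n i M = act i M"
proof (induction n)
  case 0
  then show ?case by (simp add: act_def)
next
  case (Suc n)
  show ?case
  proof (cases "size M \<le> n")
    case False
    then have "size M = Suc n" using Suc.prems by simp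
    then show ?thesis by (simp add: act_def del: act_upto.simps)
  qed (simp add: Suc.IH)
qed

lemma subspace_deg_le: "subspace_of pm_scale (deg_le n)"
  unfolding deg_le_def by (rule subspace_keys)

lemma deg_le_mono: "m \<le> n \<Longrightarrow> deg_le m \<subseteq> deg_le n"
  by (auto simp: deg_le_def)

lemma linear_rho: "is_linear pm_scale pm_scale (rho x)"
  unfolding rho_def[abs_def] by (rule linear_pm_lin)

lemma linear_rho_left: "is_linear scale pm_scale (\<lambda>x. rho x p)"
  unfolding rho_def pm_lin_eq
  by (intro linear_lin_ext_param vs vector_space_pm_scale linear_basis_lin)

lemma rho_unit: "rho x (unit_vec M) = basis_lin (\<lambda>i. act i M) pm_scale x"
  by (simp add: rho_def pm_lin_unit)

lemma rho_basis: "b \<in> B \<Longrightarrow> rho b (unit_vec M) = act b M"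
  by (simp add: rho_unit basis_lin_basis[OF vector_space_pm_scale])

lemma act_below: "below i M \<Longrightarrow> act i M = unit_vec (add_mset i M)"
  by (cases "size M") (auto simp: act_def)

text \<open>The leading term of the action is multiplication. The correction has at most the degree
  of \<open>M\<close>, which keeps the nested calls of \<open>act_upto\<close> within their
  bound.\<close>

lemma act_upto_deg:
  assumes "size M \<le> n"
  shows "act_upto n i M - unit_vec (add_mset i M) \<in> deg_le (size M)"
  using assms
proof (induction n arbitrary: i M)
  case 0
  then show ?case using subsp_0[OF vector_space_pm_scale subspace_deg_le] by simp
next
  case (Suc n)
  note cl = subsp_add[OF vector_space_pm_scale subspace_deg_le] subsp_diff[OF vector_space_pm_scale subspace_deg_le]
    subsp_scale[OF vector_space_pm_scale subspace_deg_le] subsp_sum[OF vector_space_pm_scale subspace_deg_le]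
    subsp_0[OF vector_space_pm_scale subspace_deg_le]
  have act_deg: "act_upto n k N \<in> deg_le (Suc n)" if "size N \<le> n" for k N
  proof -
    have "act_upto n k N - unit_vec (add_mset k N) \<in> deg_le (Suc n)"
      using Suc.IH[OF that, of k] deg_le_mono[of "size N" "Suc n"] that by auto
    from cl(1)[OF this, of "unit_vec (add_mset k N)"] show ?thesis
      using that by (simp add: deg_le_def)
  qed
  show ?case
  proof (cases "size M \<le> n \<or> below i M")
    case False
    define j N where "j = least M" and "N = M - {#j#}"
    have M: "size M = Suc n" "M \<noteq> {#}" using Suc.prems False by auto
    have N: "size N = n" using M least(1)[OF M(2)] by (simp add: N_def j_def size_Diff_singleton)
    have "pm_lin (act_upto n j) (act_upto n i N - unit_vec (add_mset i N)) \<in> deg_le (Suc n)"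
      unfolding pm_lin_eq
      by (rule lin_ext_in_subspace[OF vector_space_pm_scale subspace_deg_le], rule act_deg)
        (use Suc.IH[of N i] N in \<open>auto simp: deg_le_def\<close>)
    moreover have "basis_lin (\<lambda>k. act_upto n k N) pm_scale (bracket i j) \<in> deg_le (Suc n)"
      unfolding basis_lin_def by (intro cl act_deg) (simp add: N)
    ultimately show ?thesis
      using False M by (simp add: Let_def j_def[symmetric] N_def[symmetric] cl)
  qed (use Suc.IH[of M i] cl(5) in auto)
qed

lemma act_deg: "act i M - unit_vec (add_mset i M) \<in> deg_le (size M)"
  unfolding act_def by (rule act_upto_deg) simp

text \<open>The bracket relation holds by construction when the smaller element can stand in front:
  this is the recursion for \<open>i\<close> acting on j N, read backwards.\<close>

lemma act_swap:
  assumes j: "below j N" and ji: "j \<preceq> i" "i \<noteq> j" and B: "i \<in> B" "j \<in> B"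
  shows "rho i (rho j (unit_vec N)) = rho j (rho i (unit_vec N)) + rho (bracket i j) (unit_vec N)"
proof -
  let ?M = "add_mset j N"
  have least: "least ?M = j" by (rule least_eqI) (use j le_refl in \<open>auto simp: below_def\<close>)
  have nb: "\<not> below i ?M" using ji le_antisym by (auto simp: below_def)
  have deg: "act i N - unit_vec (add_mset i N) \<in> deg_le (size N)" by (rule act_deg)
  have "act i ?M = unit_vec (add_mset i ?M) + pm_lin (act_upto (size N) j) (act i N - unit_vec (add_mset i N))
         + basis_lin (\<lambda>k. act_upto (size N) k N) pm_scale (bracket i j)"
    unfolding act_def by (simp add: nb least)
  also have "pm_lin (act_upto (size N) j) (act i N - unit_vec (add_mset i N)) = rho j (act i N - unit_vec (add_mset i N))"
    unfolding rho_def pm_lin_eq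
    by (rule lin_ext_cong)
      (use deg B in \<open>auto simp: deg_le_def act_upto_eq_act basis_lin_basis[OF vector_space_pm_scale]\<close>)
  also have "basis_lin (\<lambda>k. act_upto (size N) k N) pm_scale (bracket i j) = rho (bracket i j) (unit_vec N)"
    by (simp add: rho_unit act_def)
  also have "unit_vec (add_mset i ?M) = rho j (unit_vec (add_mset i N))"
    using j ji(1) by (subst rho_basis[OF B(2)], subst act_below) (auto simp: below_def add_mset_commute)
  finally show ?thesis
    using j B by (simp add: rho_basis act_below lin_diff[OF linear_rho])
qed

text \<open>The induction below takes a letter out of a monomial and lets it act, so monomials have
  to stay inside \<open>B\<close>.\<close>

lemma act_in_span:
  assumes "Q \<in> Poly_Mapping.keys (act b P)" "b \<in> B" "set_mset P \<subseteq> B"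
  shows "set_mset Q \<subseteq> B"
proof -
  have "act_upto n b P \<in> {p. Poly_Mapping.keys p \<subseteq> {M. set_mset M \<subseteq> B}}" (is "_ \<in> ?K")
    if "b \<in> B" "set_mset P \<subseteq> B" for n b P
    using that
  proof (induction n arbitrary: b P)
    case (Suc n)
    note sub = subspace_keys[of "{M. set_mset M \<subseteq> B}"]
    note cl = subsp_add[OF vector_space_pm_scale sub] subsp_diff[OF vector_space_pm_scale sub]
      subsp_scale[OF vector_space_pm_scale sub] subsp_sum[OF vector_space_pm_scale sub]
    show ?case
    proof (cases "size P \<le> n \<or> below b P")
      case False
      let ?j = "least P" and ?N = "P - {#least P#}"
      have P: "P \<noteq> {#}" using False by (auto simp: below_def)
      have jB: "?j \<in> B" "set_mset ?N \<subseteq> B" using least(1)[OF P] Suc.prems(2) in_diffD by fastforce+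
      have "unit_vec (add_mset b P) \<in> ?K" "unit_vec (add_mset b ?N) \<in> ?K"
        using Suc.prems jB by auto
      moreover from this(2) have "pm_lin (act_upto n ?j) (act_upto n b ?N - unit_vec (add_mset b ?N)) \<in> ?K"
        unfolding pm_lin_eq
        by (intro lin_ext_in_subspace[OF vector_space_pm_scale sub] Suc.IH jB)
          (use cl(2)[OF Suc.IH[OF Suc.prems(1) jB(2)]] in blast)
      moreover have "basis_lin (\<lambda>k. act_upto n k ?N) pm_scale (bracket b ?j) \<in> ?K"
        unfolding basis_lin_def by (intro cl Suc.IH jB) (use representation_ne_zero in auto)
      moreover have "act_upto (Suc n) b P = unit_vec (add_mset b P) +
          pm_lin (act_upto n ?j) (act_upto n b ?N - unit_vec (add_mset b ?N)) +
          basis_lin (\<lambda>k. act_upto n k ?N) pm_scale (bracket b ?j)"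
        using False by (simp add: Let_def)
      ultimately show ?thesis by (simp only: cl)
    qed (use Suc in auto)
  qed auto
  from this[OF assms(2,3), of "size P"] assms(1) show ?thesis by (auto simp: act_def)
qed

text \<open>Both sides are linear in \<open>x\<close>, \<open>y\<close> and
  \<open>p\<close>.\<close>

lemma rho_bracket_extend:
  assumes "\<And>N i j. N \<in> Poly_Mapping.keys p \<Longrightarrow> i \<in> B \<Longrightarrow> j \<in> B \<Longrightarrow>
    rho i (rho j (unit_vec N)) - rho j (rho i (unit_vec N)) = rho (bracket i j) (unit_vec N)"
  shows "rho x (rho y p) - rho y (rho x p) = rho (bracket x y) p"
proof -
  note lr = linear_rho and ll = linear_rho_left
  have b: "rho i (rho j p) - rho j (rho i p) = rho (bracket i j) p" if "i \<in> B" "j \<in> B" for i j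
    by (rule linear_pm_eqI[where t=p and F="\<lambda>p. rho i (rho j p) - rho j (rho i p)",
        OF lin_minus_fun[OF lin_comp[OF lr lr] lin_comp[OF lr lr]] lr assms[OF _ that]])
  have b': "rho x (rho j p) - rho j (rho x p) = rho (bracket x j) p" if "j \<in> B" for x j
    by (rule basis_ext[where F="\<lambda>x. rho x (rho j p) - rho j (rho x p)",
        OF lin_minus_fun[OF ll lin_comp[OF ll lr]] lin_comp[OF bracket_linear_left ll] b[OF _ that]])
  show ?thesis
    by (rule basis_ext[where F="\<lambda>y. rho x (rho y p) - rho y (rho x p)",
        OF lin_minus_fun[OF lin_comp[OF ll lr] ll] lin_comp[OF bracket_linear_right ll] b'])
qed

text \<open>The overlap check of the Poincare-Birkhoff-Witt argument, by induction on the degree of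
  \<open>M\<close>. If \<open>i\<close> or \<open>j\<close> is below \<open>M\<close>, the smaller
  of the two is, and \<open>act_swap\<close> applies. Otherwise M = k N with \<open>k\<close> least;
  \<open>k\<close> is moved to the front on both sides and the Jacobi identity matches what
  remains.\<close>

lemma rho_bracket_basis:
  assumes "i \<in> B" "j \<in> B" "set_mset M \<subseteq> B"
  shows "rho i (rho j (unit_vec M)) - rho j (rho i (unit_vec M)) = rho (bracket i j) (unit_vec M)"
  using assms
proof (induction "size M" arbitrary: i j M rule: less_induct)
  case less
  note lr = linear_rho and ll = linear_rho_left
  have easy: "rho i (rho j (unit_vec M)) - rho j (rho i (unit_vec M)) = rho (bracket i j) (unit_vec M)"
    if "below j M" "j \<preceq> i" "i \<in> B" "j \<in> B" for i j M
  proof (cases "i = j")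
    case True
    then show ?thesis by (simp add: bracket_alternating lin_0[OF ll])
  qed (use act_swap[OF that(1,2) _ that(3,4)] in simp)
  have anti: "rho (bracket j i) p = - rho (bracket i j) p" for i j p
    by (subst bracket_antisym) (simp add: lin_minus[OF ll])
  \<comment> \<open>The induction hypothesis in linear form: the relation holds for all
    \<open>x\<close> and \<open>y\<close> on polynomials of lower degree.\<close>
  have key: "rho x (rho y p) - rho y (rho x p) = rho (bracket x y) p"
    if p: "p \<in> deg_le m" "\<And>N. N \<in> Poly_Mapping.keys p \<Longrightarrow> set_mset N \<subseteq> B" and m: "m < size M" for x y p m
  proof (rule rho_bracket_extend)
    fix N i j assume "N \<in> Poly_Mapping.keys p" and ij: "i \<in> B" "j \<in> B"
    then have "size N < size M" "set_mset N \<subseteq> B" using p m by (auto simp: deg_le_def)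
    then show "rho i (rho j (unit_vec N)) - rho j (rho i (unit_vec N)) = rho (bracket i j) (unit_vec N)"
      using ij by (intro less.hyps)
  qed
  show ?case
  proof (cases "below i M \<or> below j M")
    case True
    consider "below j M" "j \<preceq> i" | "below i M" "i \<preceq> j"
      using True le_total[of i j] le_trans unfolding below_def by blast
    then show ?thesis
    proof cases
      case 1
      then show ?thesis using easy less.prems by blast
    next
      case 2
      then have "rho j (rho i (unit_vec M)) - rho i (rho j (unit_vec M)) = rho (bracket j i) (unit_vec M)"
        using easy less.prems by blast
      then show ?thesis unfolding anti[of j i] by (simp add: algebra_simps)
    qed
  next
    case False
    then have ne: "M \<noteq> {#}" by (auto simp: below_def)
    define k N where "k = least M" and "N = M - {#k#}"
    have M: "M = add_mset k N" and kN: "below k N"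
      using least[OF ne] in_diffD[of _ M "{#k#}"] by (auto simp: k_def N_def below_def)
    have B: "k \<in> B" "set_mset N \<subseteq> B" "i \<in> B" "j \<in> B" using less.prems M by auto
    have lt: "size N < size M" by (simp add: M)
    have ki: "k \<preceq> i" "i \<noteq> k" and kj: "k \<preceq> j" "j \<noteq> k"
    proof -
      have "below k M" using kN le_refl by (auto simp: M below_def)
      then show "i \<noteq> k" "j \<noteq> k" using False by auto
      have "\<not> i \<preceq> k" "\<not> j \<preceq> k" using False \<open>below k M\<close> le_trans unfolding below_def by blast+
      then show "k \<preceq> i" "k \<preceq> j" using le_total by blast+
    qed
    have uM: "unit_vec M = rho k (unit_vec N)"
      using kN B by (simp add: M rho_basis act_below)
    have N_keys: "rho x (rho y (unit_vec N)) - rho y (rho x (unit_vec N)) = rho (bracket x y) (unit_vec N)" for x y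
      by (rule key[OF _ _ lt]) (use B in \<open>auto simp: deg_le_def\<close>)
    \<comment> \<open>The leading monomial of \<open>rho j (unit_vec N)\<close> has \<open>k\<close>
      below it and is covered by \<open>act_swap\<close>; the remainder has smaller degree than
      \<open>M\<close> and is covered by \<open>key\<close>.\<close>
    have push: "rho i (rho k (rho j (unit_vec N))) = rho k (rho i (rho j (unit_vec N))) + rho (bracket i k) (rho j (unit_vec N))"
      if ij: "i \<in> B" "j \<in> B" "k \<preceq> i" "i \<noteq> k" "k \<preceq> j" for i j
    proof -
      let ?w = "act j N - unit_vec (add_mset j N)"
      have keys: "set_mset Q \<subseteq> B" if "Q \<in> Poly_Mapping.keys ?w" for Q
        using that act_in_span[of Q j N] ij(2) B(2) by (cases "Q = add_mset j N") (auto simp: in_keys_iff lookup_minus lookup_single)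
      have "rho i (rho k ?w) - rho k (rho i ?w) = rho (bracket i k) ?w"
        by (rule key[OF act_deg keys lt])
      moreover have "rho i (rho k (unit_vec (add_mset j N))) =
          rho k (rho i (unit_vec (add_mset j N))) + rho (bracket i k) (unit_vec (add_mset j N))"
        by (rule act_swap) (use kN ij B in \<open>auto simp: below_def\<close>)
      moreover have "rho j (unit_vec N) = unit_vec (add_mset j N) + ?w" by (simp add: rho_basis ij)
      ultimately show ?thesis by (simp only: lin_add[OF lr]) (simp add: algebra_simps)
    qed
    \<comment> \<open>The two middle terms are exchanged when \<open>i\<close> and \<open>j\<close>
      are, so they cancel in the difference.\<close>
    have expand: "rho i (rho j (unit_vec M)) = rho k (rho i (rho j (unit_vec N))) + rho (bracket i k) (rho j (unit_vec N))
        + rho (bracket j k) (rho i (unit_vec N)) + rho (bracket i (bracket j k)) (unit_vec N)"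
      if ij: "i \<in> B" "j \<in> B" "k \<preceq> i" "i \<noteq> k" "k \<preceq> j" for i j
    proof -
      have "rho j (unit_vec M) = rho k (rho j (unit_vec N)) + rho (bracket j k) (unit_vec N)"
        unfolding uM using N_keys[of j k] by (simp add: algebra_simps)
      moreover have "rho i (rho (bracket j k) (unit_vec N)) = rho (bracket j k) (rho i (unit_vec N)) + rho (bracket i (bracket j k)) (unit_vec N)"
        using N_keys[of i "bracket j k"] by (simp add: algebra_simps)
      ultimately show ?thesis using push[OF ij] by (simp add: lin_add[OF lr] algebra_simps)
    qed
    have jac: "bracket i (bracket j k) - bracket j (bracket i k) = bracket (bracket i j) k"
      using jacobi[of i j k] bracket_antisym[of k i] bracket_antisym[of "bracket i j" k]
      by (simp add: lin_minus[OF bracket_linear_right] algebra_simps)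
    have "rho i (rho j (unit_vec M)) - rho j (rho i (unit_vec M)) =
      rho k (rho i (rho j (unit_vec N)) - rho j (rho i (unit_vec N))) +
      rho (bracket i (bracket j k) - bracket j (bracket i k)) (unit_vec N)"
      using expand[OF B(3,4) ki kj(1)] expand[OF B(4,3) kj ki(1)]
      by (simp add: lin_diff[OF lr] lin_diff[OF ll])
    also have "\<dots> = rho (bracket i j) (unit_vec M)"
      using N_keys[of "bracket i j" k] unfolding N_keys[of i j] jac uM by (simp add: algebra_simps)
    finally show ?thesis .
  qed
qed

section \<open>Injectivity of the inclusion of g\<close>

definition poly_B :: "('g multiset \<Rightarrow>\<^sub>0 'k) set" where
  "poly_B = {p. Poly_Mapping.keys p \<subseteq> {M. set_mset M \<subseteq> B}}"

lemma subspace_poly_B: "subspace_of pm_scale poly_B"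
  unfolding poly_B_def by (rule subspace_keys)

lemma rho_poly_B:
  assumes "p \<in> poly_B"
  shows "rho x p \<in> poly_B"
  unfolding rho_def pm_lin_eq
proof (rule lin_ext_in_subspace[OF vector_space_pm_scale subspace_poly_B])
  fix M assume "M \<in> Poly_Mapping.keys p"
  then have "set_mset M \<subseteq> B" using assms by (auto simp: poly_B_def)
  then have "act b M \<in> poly_B" if "b \<in> B" for b
    using act_in_span[OF _ that] unfolding poly_B_def by blast
  then show "basis_lin (\<lambda>i. act i M) pm_scale x \<in> poly_B"
    unfolding basis_lin_def
    by (intro subsp_sum[OF vector_space_pm_scale subspace_poly_B] subsp_scale[OF vector_space_pm_scale subspace_poly_B])
      (use representation_ne_zero in auto)
qed

lemma linear_foldr_rho: "is_linear pm_scale pm_scale (foldr rho w)"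
proof (induction w)
  case Nil
  show ?case using lin_id_fun[OF vector_space_pm_scale] by (simp add: id_def)
next
  case (Cons x w)
  show ?case using lin_comp[OF Cons linear_rho[of x]] by (simp add: comp_def)
qed

text \<open>Letting words act on the monomial 1 gives a linear map that vanishes on
  \<open>J\<close>, since \<open>rho\<close> satisfies the bracket relation on polynomials in
  \<open>B\<close>.\<close>

lemma rho_J:
  assumes "t \<in> J"
  shows "lin_ext pm_scale (\<lambda>w. foldr rho w (unit_vec {#})) t = 0"
proof -
  let ?F = "lin_ext pm_scale (\<lambda>w. foldr rho w (unit_vec {#}))"
  note F = linear_lin_ext[OF vector_space_pm_scale, of "\<lambda>w. foldr rho w (unit_vec {#})"]
  have poly: "foldr rho v (unit_vec {#}) \<in> poly_B" for v
  proof (induction v)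
    case Nil
    show ?case by (simp add: poly_B_def del: single_one)
  qed (auto intro: rho_poly_B)
  have "J \<subseteq> {t. ?F t \<in> {0}}"
  proof (rule J_subset)
    show "subspace_of pm_scale {t. ?F t \<in> {0}}"
      by (rule subspace_vimage[OF F subspace_zero[OF vector_space_pm_scale]])
  next
    fix u v x y
    have "rho x (rho y p) - rho y (rho x p) = rho (bracket x y) p" if "p \<in> poly_B" for p
    proof (rule rho_bracket_extend)
      fix N i j assume "N \<in> Poly_Mapping.keys p" "i \<in> B" "j \<in> B"
      then show "rho i (rho j (unit_vec N)) - rho j (rho i (unit_vec N)) = rho (bracket i j) (unit_vec N)"
        using that by (intro rho_bracket_basis) (auto simp: poly_B_def)
    qed
    then have "foldr rho u (rho x (rho y (foldr rho v (unit_vec {#})))) - foldr rho u (rho y (rho x (foldr rho v (unit_vec {#})))) =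
        foldr rho u (rho (bracket x y) (foldr rho v (unit_vec {#})))"
      unfolding lin_diff[OF linear_foldr_rho, symmetric] using poly[of v] by simp
    then show "unit_vec (u @ x # y # v) - unit_vec (u @ y # x # v) - unit_vec (u @ bracket x y # v) \<in> {t. ?F t \<in> {0}}"
      by (simp add: lin_diff[OF F] lin_ext_unit[OF vector_space_pm_scale] del: single_one)
  qed (simp_all add: lin_diff[OF F] lin_scale[OF F] lin_ext_unit[OF vector_space_pm_scale] lin_add[OF linear_rho_left]
      lin_scale[OF linear_rho_left] lin_add[OF linear_foldr_rho] lin_scale[OF linear_foldr_rho] del: pm_scale_single single_one)
  then show ?thesis using assms by auto
qed

lemma iota_eqD:
  assumes "\<iota> x = \<iota> y"
  shows "x = y"
proof -
  \<comment> \<open>The action of \<open>z\<close> on 1 is \<open>z\<close> itself, as a polynomial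
    of degree one; its coefficients are the coordinates of \<open>z\<close>.\<close>
  have coeff: "Poly_Mapping.lookup (rho z (unit_vec {#})) {#b#} = coord z b" for z b
  proof -
    have "rho z (unit_vec {#}) = basis_lin (\<lambda>i. unit_vec {#i#}) pm_scale z"
      by (simp add: rho_unit act_below below_def del: single_one)
    then show ?thesis
      by (simp add: basis_lin_def lookup_sum lookup_single when_def finite_representation del: single_one)
  qed
  have "unit_vec [x] - unit_vec [y] \<in> J" using assms by (simp add: iota_eq cls_eq_iff)
  from rho_J[OF this] have "rho x (unit_vec {#}) = rho y (unit_vec {#})"
    by (simp add: lin_diff[OF linear_lin_ext[OF vector_space_pm_scale]] lin_ext_unit[OF vector_space_pm_scale] del: single_one)
  then have "coord x = coord y" unfolding fun_eq_iff by (metis coeff)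
  then show ?thesis using basis_expansion[of x] basis_expansion[of y] by simp
qed

end

lemma (in lie_algebra) inj_iota: "inj \<iota>"
proof (rule injI)
  fix x y assume eq: "\<iota> x = \<iota> y"
  obtain B where "independent B" "UNIV \<subseteq> span B" using maximal_independent_subset[of UNIV] by auto
  moreover obtain r :: "('g \<times> 'g) set" where "well_order_on UNIV r" using well_order_on[of UNIV] by auto
  ultimately interpret pbw scale bracket B r
    by unfold_locales (auto simp: well_order_on_def)
  show "x = y" using eq by (rule iota_eqD)
qed

subsection \<open>Derivations of words and the action of words\<close>

text \<open>\<open>F\<close> after the derivation of words that extends \<open>p x\<close>. It
  operates on functions of words, so that no formal sums of words appear.\<close>

definition dsum :: "('x \<Rightarrow> 'x \<Rightarrow> 'x) \<Rightarrow> 'x \<Rightarrow> ('x list \<Rightarrow> 'v) \<Rightarrow> 'x list \<Rightarrow> 'v::ab_group_add" where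
  "dsum p x F xs = (\<Sum>i<length xs. F (xs[i := p x (xs ! i)]))"

lemma dsum_Nil [simp]: "dsum p x F [] = 0"
  by (simp add: dsum_def)

lemma dsum_Cons: "dsum p x F (y # ys) = F (p x y # ys) + dsum p x (\<lambda>zs. F (y # zs)) ys"
  by (simp add: dsum_def sum.lessThan_Suc_shift del: sum.lessThan_Suc)

lemma dsum_append: "dsum p x F (us @ vs) = dsum p x (\<lambda>zs. F (zs @ vs)) us + dsum p x (\<lambda>zs. F (us @ zs)) vs"
  by (induction us arbitrary: F) (simp_all add: dsum_Cons)

lemma dsum_add: "dsum p x (\<lambda>zs. F zs + G zs) xs = dsum p x F xs + dsum p x G xs"
  by (simp add: dsum_def sum.distrib)

lemma dsum_diff: "dsum p x (\<lambda>zs. F zs - G zs) xs = dsum p x F xs - dsum p x G xs"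
  by (simp add: dsum_def sum_subtractf)

lemma dsum_cong: "(\<And>zs. length zs = length xs \<Longrightarrow> F zs = G zs) \<Longrightarrow> dsum p x F xs = dsum p x G xs"
  by (simp add: dsum_def)

lemma dsum_linear: "is_linear s s' f \<Longrightarrow> f (dsum p x F xs) = dsum p x (\<lambda>zs. f (F zs)) xs"
  by (simp add: dsum_def lin_sum)

lemma ssum_diff: "ssum xs (\<lambda>u v. G u v - H u v) = ssum xs G - ssum xs H"
  by (induction xs arbitrary: G H) (simp_all add: add_diff_add)

text \<open>The derivation is also a coderivation of the unshuffle coproduct.\<close>

lemma dsum_ssum:
  "dsum p x (\<lambda>ys. ssum ys G) xs = ssum xs (\<lambda>u v. dsum p x (\<lambda>u. G u v) u + dsum p x (\<lambda>v. G u v) v)"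
  by (induction xs arbitrary: G) (simp_all add: dsum_Cons dsum_add ssum_add algebra_simps)

text \<open>The Guin-Oudom recursion for an arbitrary action \<open>L\<close> of letters. The
  parameter \<open>L\<close> lets the same recursion act on g, on the free algebra and on its tensor
  square, and be transported along linear maps.\<close>

function wact :: "('x \<Rightarrow> 'x \<Rightarrow> 'x) \<Rightarrow> ('x \<Rightarrow> 'v \<Rightarrow> 'v) \<Rightarrow> 'x list \<Rightarrow> 'v \<Rightarrow> 'v::ab_group_add" where
  "wact p L [] v = v"
| "wact p L (x # xs) v = L x (wact p L xs v) - (\<Sum>i<length xs. wact p L (xs[i := p x (xs ! i)]) v)"
  by pat_completeness auto
termination by (relation "measure (\<lambda>(p, L, xs, v). length xs)") auto

lemma wact_Cons: "wact p L (x # xs) v = L x (wact p L xs v) - dsum p x (\<lambda>zs. wact p L zs v) xs"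
  by (simp add: dsum_def)

declare wact.simps(2) [simp del]

text \<open>The recursion of \<open>wact\<close> changes letters of the tail and keeps its length,
  so the induction hypothesis has to cover all words of that length.\<close>

lemma length_induct_list [case_names Nil Cons]:
  assumes "P []" "\<And>x xs. (\<And>ys. length ys = length xs \<Longrightarrow> P ys) \<Longrightarrow> P (x # xs)"
  shows "P xs"
proof (induction "length xs" arbitrary: xs)
  case (Suc n)
  then show ?case by (cases xs) (auto intro: assms(2))
qed (use assms(1) in simp)

lemma wact_linear:
  assumes "vector_space s" "\<And>x. is_linear s s (L x)"
  shows "is_linear s s (wact p L xs)"
proof (induction xs rule: length_induct_list)
  case Nil
  then show ?case using lin_id_fun[OF assms(1)] by simp
next
  case (Cons x xs)
  have "is_linear s s (\<lambda>v. \<Sum>i<length xs. wact p L (xs[i := p x (xs ! i)]) v)"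
    by (intro lin_sum_fun assms(1) Cons.IH) simp
  from lin_minus_fun[OF lin_comp[OF Cons.IH[OF refl] assms(2)] this] show ?case
    by (simp add: wact.simps(2))
qed

lemma wact_intertwine:
  assumes \<phi>: "is_linear s s' \<phi>" "\<And>x v. \<phi> (L x v) = L' x (\<phi> v)"
  shows "\<phi> (wact p L xs v) = wact p L' xs (\<phi> v)"
proof (induction xs rule: length_induct_list)
  case (Cons x xs)
  show ?case
    unfolding wact_Cons lin_diff[OF \<phi>(1)] \<phi>(2) Cons.IH[OF refl] dsum_linear[OF \<phi>(1)]
    by (simp add: Cons.IH cong: dsum_cong)
qed simp

text \<open>If single letters act on \<open>\<beta>\<close> by the Leibniz rule, words act through
  their unshuffles, because \<open>dsum\<close> is a coderivation. With \<open>\<beta>\<close> the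
  product or the tensor product this yields (D4) or (D3).\<close>

lemma wact_bilinear:
  assumes \<beta>: "\<And>z. is_linear s1 s3 (\<lambda>y. \<beta> y z)" "\<And>y. is_linear s2 s3 (\<beta> y)"
    and L3: "\<And>x. is_linear s3 s3 (L3 x)"
    and L: "\<And>x y z. L3 x (\<beta> y z) = \<beta> (L1 x y) z + \<beta> y (L2 x z)"
  shows "wact p L3 xs (\<beta> y z) = ssum xs (\<lambda>u v. \<beta> (wact p L1 u y) (wact p L2 v z))"
proof (induction xs rule: length_induct_list)
  case (Cons x xs)
  define G where "G = (\<lambda>u v. \<beta> (wact p L1 u y) (wact p L2 v z))"
  have G: "G (x # u) v + G u (x # v) = L3 x (G u v) - (dsum p x (\<lambda>u. G u v) u + dsum p x (\<lambda>v. G u v) v)" for u v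
    by (simp add: G_def wact_Cons lin_diff[OF \<beta>(1)] lin_diff[OF \<beta>(2)] L dsum_linear[OF \<beta>(1)] dsum_linear[OF \<beta>(2)])
  have "wact p L3 (x # xs) (\<beta> y z) = L3 x (ssum xs G) - dsum p x (\<lambda>zs. ssum zs G) xs"
    unfolding wact_Cons Cons.IH[OF refl]
    by (simp add: Cons.IH G_def cong: dsum_cong)
  also have "\<dots> = ssum xs (\<lambda>u v. L3 x (G u v)) - ssum xs (\<lambda>u v. dsum p x (\<lambda>u. G u v) u + dsum p x (\<lambda>v. G u v) v)"
    by (simp only: dsum_ssum ssum_linear[OF L3])
  also have "\<dots> = ssum xs (\<lambda>u v. G (x # u) v + G u (x # v))"
    unfolding G ssum_diff ..
  finally show ?case by (simp add: ssum_add G_def)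
qed simp

subsection \<open>Post-Lie algebras\<close>

context lie_algebra
begin

text \<open>The functions on words that induce a linear map on \<open>U(g)\<close>.\<close>

definition lieform :: "('k \<Rightarrow> 'v \<Rightarrow> 'v) \<Rightarrow> ('g list \<Rightarrow> 'v::ab_group_add) \<Rightarrow> bool" where
  "lieform s F \<longleftrightarrow> (\<forall>us vs. is_linear scale s (\<lambda>y. F (us @ y # vs))) \<and>
     (\<forall>us vs a b. F (us @ a # b # vs) - F (us @ b # a # vs) = F (us @ bracket a b # vs))"

lemma lieformD:
  assumes "lieform s F"
  shows "is_linear scale s (\<lambda>y. F (us @ y # vs))"
    and "F (us @ bracket a b # vs) = F (us @ a # b # vs) - F (us @ b # a # vs)"
  using assms by (simp_all add: lieform_def)

lemma lieform_vs: "lieform s F \<Longrightarrow> vector_space s"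
  using lin_vs2[OF lieformD(1)] by blast

lemma lieform_J:
  assumes F: "lieform s F" and "t \<in> J"
  shows "lin_ext s F t = 0"
proof -
  note l = linear_lin_ext[OF lieform_vs[OF F], of F]
  have "J \<subseteq> {t. lin_ext s F t \<in> {0}}"
    by (rule J_subset)
      (simp_all add: subspace_vimage[OF l subspace_zero[OF lieform_vs[OF F]], simplified]
        lin_diff[OF l] lin_scale[OF l] lieform_vs[OF F] lieformD[OF F] lin_add[OF lieformD(1)[OF F]]
        lin_scale[OF lieformD(1)[OF F]] del: pm_scale_single)
  then show ?thesis using assms(2) by auto
qed

text \<open>The projection turns congruences modulo \<open>J\<close> into equations.\<close>

lemma projection_exists:
  "\<exists>\<pi>. is_linear pm_scale pm_scale \<pi> \<and> (\<forall>t\<in>J. \<pi> t = 0) \<and> (\<forall>t. t - \<pi> t \<in> J)"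
proof -
  obtain C where C: "C \<subseteq> J" "pm.independent C" "J \<subseteq> pm.span C"
    using pm.maximal_independent_subset[of J] by blast
  let ?E = "pm.extend_basis C"
  interpret pair: vector_space_pair "pm_scale :: 'k \<Rightarrow> ('g list \<Rightarrow>\<^sub>0 'k) \<Rightarrow> _" "pm_scale :: 'k \<Rightarrow> ('g list \<Rightarrow>\<^sub>0 'k) \<Rightarrow> _"
    by unfold_locales
  have E: "pm.independent ?E" "C \<subseteq> ?E" "pm.span ?E = UNIV"
    using pm.independent_extend_basis[OF C(2)] pm.extend_basis_superset[OF C(2)] pm.span_extend_basis[OF C(2)] by auto
  obtain \<pi> where \<pi>: "is_linear pm_scale pm_scale \<pi>" "\<forall>x\<in>?E. \<pi> x = (if x \<in> C then 0 else x)"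
    using pair.linear_independent_extend[OF E(1), of "\<lambda>x. if x \<in> C then 0 else x"] by blast
  have "C \<subseteq> {t. \<pi> t \<in> {0}}"
    using bspec[OF \<pi>(2) subsetD[OF E(2)]] by auto
  then have "J \<subseteq> {t. \<pi> t \<in> {0}}"
    using C(3) span_subset_subspace[OF subspace_vimage[OF \<pi>(1) subspace_zero[OF vector_space_pm_scale]], of C] by blast
  moreover have "pm.span ?E \<subseteq> {t. t - \<pi> t \<in> J}"
    by (rule span_subset_subspace[OF subspace_vimage[OF lin_minus_fun[OF lin_id_fun[OF vector_space_pm_scale] \<pi>(1)] subspace_J]])
      (use \<pi>(2) C(1) J_closed in auto)
  ultimately show ?thesis using \<pi>(1) E(3) by auto
qed

definition pi :: "('g list \<Rightarrow>\<^sub>0 'k) \<Rightarrow> ('g list \<Rightarrow>\<^sub>0 'k)" where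
  "pi = (SOME \<pi>. is_linear pm_scale pm_scale \<pi> \<and> (\<forall>t\<in>J. \<pi> t = 0) \<and> (\<forall>t. t - \<pi> t \<in> J))"

lemma linear_pi: "is_linear pm_scale pm_scale pi" and pi_J: "t \<in> J \<Longrightarrow> pi t = 0" and diff_pi: "t - pi t \<in> J"
  using someI_ex[OF projection_exists] unfolding pi_def[symmetric] by blast+

lemma pi_eq_iff: "pi x = pi y \<longleftrightarrow> x - y \<in> J"
proof
  assume "pi x = pi y"
  then have "x - y = (x - pi x) - (y - pi y)" by simp
  also have "\<dots> \<in> J" by (intro J_closed diff_pi)
  finally show "x - y \<in> J" .
next
  assume "x - y \<in> J"
  then show "pi x = pi y" using pi_J[of "x - y"] by (simp add: lin_diff[OF linear_pi])
qed

lemma cls_eq_pi_iff: "cls x = cls y \<longleftrightarrow> pi x = pi y"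
  by (simp add: cls_eq_iff pi_eq_iff)

text \<open>The universal example: a word goes to its class in U(g), represented through
  \<open>pi\<close>.\<close>

lemma lieform_pi: "lieform pm_scale (\<lambda>w. pi (unit_vec w))"
  unfolding lieform_def
proof (intro conjI allI linI[OF vs vector_space_pm_scale])
  fix us vs :: "'g list" and x y c
  have "tmul (unit_vec us) (tmul (unit_vec [x + y] - unit_vec [x] - unit_vec [y]) (unit_vec vs)) \<in> J"
    by (intro J_mult gens_J)
  then have "unit_vec (us @ (x + y) # vs) - unit_vec (us @ x # vs) - unit_vec (us @ y # vs) \<in> J"
    by (simp add: lin_diff[OF linear_conv_left] lin_diff[OF linear_conv_right])
  then show "pi (unit_vec (us @ (x + y) # vs)) = pi (unit_vec (us @ x # vs)) + pi (unit_vec (us @ y # vs))"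
    by (simp add: pi_eq_iff diff_diff_eq flip: lin_add[OF linear_pi])
  have "tmul (unit_vec us) (tmul (unit_vec [scale c x] - pm_scale c (unit_vec [x])) (unit_vec vs)) \<in> J"
    using gens_J(2)[of c x] by (intro J_mult) simp
  then show "pi (unit_vec (us @ scale c x # vs)) = pm_scale c (pi (unit_vec (us @ x # vs)))"
    by (simp add: lin_diff[OF linear_conv_left] lin_diff[OF linear_conv_right] lin_scale[OF linear_conv_left]
      lin_scale[OF linear_conv_right] pi_eq_iff del: pm_scale_single flip: lin_scale[OF linear_pi])
  have "tmul (unit_vec us) (tmul (unit_vec [x, y] - unit_vec [y, x] - unit_vec [bracket x y]) (unit_vec vs)) \<in> J"
    by (intro J_mult gens_J)
  then show "pi (unit_vec (us @ x # y # vs)) - pi (unit_vec (us @ y # x # vs)) = pi (unit_vec (us @ bracket x y # vs))"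
    by (simp add: lin_diff[OF linear_conv_left] lin_diff[OF linear_conv_right] pi_eq_iff flip: lin_diff[OF linear_pi])
qed

end

locale post_lie = lie_algebra scale bracket
  for scale :: "'k::field \<Rightarrow> 'g::ab_group_add \<Rightarrow> 'g" and bracket +
  fixes p :: "'g \<Rightarrow> 'g \<Rightarrow> 'g"
  assumes p_linear_left: "is_linear scale scale (\<lambda>x. p x y)"
    and p_linear_right: "is_linear scale scale (p x)"
    and p_bracket: "p x (bracket y z) = bracket (p x y) z + bracket y (p x z)"
    and bracket_p: "p (bracket x y) z = (p x (p y z) - p (p x y) z) - (p y (p x z) - p (p y x) z)"
begin

abbreviation "ds \<equiv> dsum p"

lemma dsum_linear_left:
  assumes "\<And>us vs. is_linear scale s (\<lambda>y. F (us @ y # vs))"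
  shows "is_linear scale s (\<lambda>x. ds x F xs)"
  using assms
proof (induction xs arbitrary: F)
  case Nil
  show ?case using lin_zero_fun[OF vs lin_vs2[OF Nil]] by simp
next
  case (Cons y ys)
  have "is_linear scale s (\<lambda>x. F (p x y # ys))"
    using lin_comp[OF p_linear_left Cons.prems[of "[]"]] by simp
  moreover have "is_linear scale s (\<lambda>x. ds x (\<lambda>zs. F (y # zs)) ys)"
    by (rule Cons.IH) (use Cons.prems[of "y # _"] in simp)
  ultimately show ?case unfolding dsum_Cons by (rule lin_plus)
qed

text \<open>The identity \<open>bracket_p\<close> for derivations of words; the terms in which
  \<open>a\<close> and \<open>b\<close> act on different letters cancel. Since \<open>ds\<close>
  operates on functions, \<open>ds b (ds a F)\<close> lets \<open>b\<close> act on the word before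
  \<open>a\<close>.\<close>

lemma dsum_comm:
  assumes "\<And>us vs. is_linear scale s (\<lambda>y. F (us @ y # vs))"
  shows "ds (bracket a b) F xs = (ds b (ds a F) xs - ds (p a b) F xs) - (ds a (ds b F) xs - ds (p b a) F xs)"
  using assms
proof (induction xs arbitrary: F)
  case (Cons y ys)
  note F = Cons.prems[of "[]" ys, simplified]
  have IH: "ds (bracket a b) (\<lambda>zs. F (y # zs)) ys = (ds b (ds a (\<lambda>zs. F (y # zs))) ys - ds (p a b) (\<lambda>zs. F (y # zs)) ys)
     - (ds a (ds b (\<lambda>zs. F (y # zs))) ys - ds (p b a) (\<lambda>zs. F (y # zs)) ys)"
    by (rule Cons.IH) (use Cons.prems[of "y # _"] in simp)
  have "F (p (bracket a b) y # ys) = (F (p a (p b y) # ys) - F (p (p a b) y # ys)) - (F (p b (p a y) # ys) - F (p (p b a) y # ys))"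
    by (simp only: bracket_p lin_diff[OF F])
  with IH show ?case
    by (simp add: dsum_Cons dsum_add algebra_simps)
qed simp

text \<open>\<open>p x\<close> is a derivation of the bracket, so precomposition with the derivation
  of words respects the relations of U(g).\<close>

lemma lieform_dsum:
  assumes F: "lieform s F"
  shows "lieform s (ds x F)"
proof -
  note lF = lieformD(1)[OF F] and bF = lieformD(2)[OF F]
  have eq: "ds x F (us @ y # vs) = ds x (\<lambda>zs. F (zs @ y # vs)) us + (F (us @ p x y # vs) + ds x (\<lambda>zs. F (us @ y # zs)) vs)" for us y vs
    by (simp add: dsum_append dsum_Cons)
  have "is_linear scale s (\<lambda>y. ds x F (us @ y # vs))" for us vs
    unfolding eq unfolding dsum_def
    by (intro lin_plus lin_sum_fun lF lin_comp[OF p_linear_right lF] vs lieform_vs[OF F])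
  moreover have "ds x F (us @ a # b # vs) - ds x F (us @ b # a # vs) = ds x F (us @ bracket a b # vs)" for us vs a b
    using bF[of us "p x a" b vs] bF[of us a "p x b" vs]
    by (simp add: dsum_append dsum_Cons bF dsum_diff p_bracket lin_add[OF lF] algebra_simps)
  ultimately show ?thesis by (simp add: lieform_def)
qed

end

text \<open>\<open>L_bracket\<close> is \<open>bracket_p\<close> with the element acted upon taken
  from another space. The instances are g itself and the free algebra read modulo
  \<open>J\<close>.\<close>

locale post_lie_action = post_lie scale bracket p
  for scale :: "'k::field \<Rightarrow> 'g::ab_group_add \<Rightarrow> 'g" and bracket p +
  fixes s :: "'k \<Rightarrow> 'v::ab_group_add \<Rightarrow> 'v" and L :: "'g \<Rightarrow> 'v \<Rightarrow> 'v"
  assumes L_linear_left: "is_linear scale s (\<lambda>x. L x v)"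
    and L_linear_right: "is_linear s s (L x)"
    and L_bracket: "L (bracket x y) v = (L x (L y v) - L (p x y) v) - (L y (L x v) - L (p y x) v)"
begin

lemma vs_s: "vector_space s"
  by (rule lin_vs2[OF L_linear_left])

abbreviation "act_on \<equiv> wact p L"

text \<open>The recursion moves the chosen letter into arbitrary positions of shorter words, so the
  induction is on the number of the other letters.\<close>

lemma linear_wact_word: "is_linear scale s (\<lambda>y. act_on (us @ y # vs) v)"
proof (induction "length us + length vs" arbitrary: us vs)
  case 0
  then show ?case using L_linear_left by (simp add: wact_Cons)
next
  case (Suc n)
  note vsp = vs vs_s
  show ?case
  proof (cases us)
    case Nil
    have IH: "is_linear scale s (\<lambda>y. act_on (us' @ y # vs') v)" if "length us' + length vs' = n" for us' vs'
      by (rule Suc.hyps(1)) (simp add: that)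
    have upd: "vs[i := z] = take i vs @ z # drop (Suc i) vs" if "i < length vs" for i z
      using that by (rule upd_conv_take_nth_drop)
    have "is_linear scale s (\<lambda>y. ds y (\<lambda>zs. act_on zs v) vs)"
      unfolding dsum_def
    proof (intro lin_sum_fun vsp)
      fix i assume i: "i \<in> {..<length vs}"
      then have "is_linear scale s (\<lambda>y. act_on (take i vs @ p y (vs ! i) # drop (Suc i) vs) v)"
        using Suc.hyps(2) Nil by (intro lin_comp[OF p_linear_left IH]) auto
      then show "is_linear scale s (\<lambda>y. act_on (vs[i := p y (vs ! i)]) v)"
        using i by (simp add: upd)
    qed
    from lin_minus_fun[OF L_linear_left this] show ?thesis by (simp add: Nil wact_Cons)
  next
    case (Cons x us')
    have n: "n = length us' + length vs" using Suc.hyps(2) Cons by simp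
    have IH: "is_linear scale s (\<lambda>y. act_on (us'' @ y # vs'') v)" if "length us'' + length vs'' = n" for us'' vs''
      by (rule Suc.hyps(1)) (simp add: that)
    have "is_linear scale s (\<lambda>y. ds x (\<lambda>zs. act_on zs v) (us' @ y # vs))"
      unfolding dsum_append dsum_Cons unfolding dsum_def
      by (intro lin_plus lin_sum_fun vsp lin_comp[OF p_linear_right] IH) (simp_all add: n)
    from lin_minus_fun[OF lin_comp[OF IH[OF n[symmetric]] L_linear_right] this] show ?thesis
      by (simp add: Cons wact_Cons)
  qed
qed

text \<open>Unfolding two letters produces mixed terms, in which one letter acts on the value and
  the other on the word; together they are symmetric in \<open>a\<close> and \<open>b\<close> and
  cancel. The rest is \<open>L_bracket\<close> and \<open>dsum_comm\<close>.\<close>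

lemma wact_bracket_Nil:
  "act_on (a # b # vs) v - act_on (b # a # vs) v = act_on (bracket a b # vs) v"
proof -
  let ?F = "\<lambda>zs. act_on zs v"
  have *: "act_on (a # b # vs) v = L a (L b (?F vs)) - L a (ds b ?F vs) - (L (p a b) (?F vs) - ds (p a b) ?F vs)
    - (ds a (\<lambda>zs. L b (?F zs)) vs - ds a (ds b ?F) vs)" for a b
    by (simp add: wact_Cons[of p L a] dsum_Cons wact_Cons[of p L b] wact_Cons[of p L "p a b"] lin_diff[OF L_linear_right] dsum_diff algebra_simps)
  have L_ds: "L a (ds b ?F vs) = ds b (\<lambda>zs. L a (?F zs)) vs" for a b
    by (rule dsum_linear[OF L_linear_right])
  show ?thesis
    unfolding * wact_Cons[of p L "bracket a b"] L_bracket dsum_comm[OF linear_wact_word] L_ds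
    by (simp add: algebra_simps)
qed

text \<open>For a further letter \<open>x\<close> in front, the derivation by \<open>x\<close> meets
  \<open>us\<close>, \<open>vs\<close>, \<open>a\<close> or \<open>b\<close>; in the last two cases
  \<open>p_bracket\<close> recombines the terms.\<close>

lemma wact_bracket: "act_on (us @ a # b # vs) v - act_on (us @ b # a # vs) v = act_on (us @ bracket a b # vs) v"
proof (induction us arbitrary: a b vs rule: length_induct_list)
  case Nil
  then show ?case using wact_bracket_Nil by simp
next
  case (Cons x us)
  let ?F = "\<lambda>zs. act_on zs v"
  have "ds x (\<lambda>zs. ?F (zs @ a # b # vs) - ?F (zs @ b # a # vs)) us = ds x (\<lambda>zs. ?F (zs @ bracket a b # vs)) us"
    by (rule dsum_cong) (rule Cons.IH)
  moreover have "ds x (\<lambda>zs. ?F (us @ a # b # zs) - ?F (us @ b # a # zs)) vs = ds x (\<lambda>zs. ?F (us @ bracket a b # zs)) vs"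
    by (rule dsum_cong) (rule Cons.IH[OF refl])
  moreover have "L x (?F (us @ bracket a b # vs)) = L x (?F (us @ a # b # vs)) - L x (?F (us @ b # a # vs))"
    unfolding Cons.IH[OF refl, symmetric] by (rule lin_diff[OF L_linear_right])
  ultimately show ?case
    using Cons.IH[OF refl, of "p x a" b vs] Cons.IH[OF refl, of a "p x b" vs]
    by (simp add: wact_Cons dsum_append dsum_Cons dsum_diff p_bracket lin_add[OF linear_wact_word] algebra_simps)
qed

lemma lieform_wact: "lieform s (\<lambda>xs. act_on xs v)"
  by (simp add: lieform_def linear_wact_word wact_bracket)

end

subsection \<open>The D-bialgebra of a post-Lie algebra\<close>

context post_lie
begin

text \<open>The derivation of the free algebra that extends \<open>p x\<close> on letters. Letters
  are not additive in the free algebra, so \<open>der x\<close> becomes linear in \<open>x\<close>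
  after passing to the quotient by \<open>J\<close>.\<close>

definition der :: "'g \<Rightarrow> ('g list \<Rightarrow>\<^sub>0 'k) \<Rightarrow> ('g list \<Rightarrow>\<^sub>0 'k)" where
  "der x = pm_lin (\<lambda>w. ds x unit_vec w)"

lemma linear_der: "is_linear pm_scale pm_scale (der x)"
  unfolding der_def by (rule linear_pm_lin)

lemma der_unit: "der x (unit_vec w) = ds x unit_vec w"
  by (simp add: der_def pm_lin_unit)

lemma der_mult: "der x (tmul y z) = tmul (der x y) z + tmul y (der x z)"
proof (rule linear_pm_eqI[where t=y and F="\<lambda>y. der x (tmul y z)"])
  fix u
  show "der x (tmul (unit_vec u) z) = tmul (der x (unit_vec u)) z + tmul (unit_vec u) (der x z)"
  proof (rule linear_pm_eqI[where t=z and F="\<lambda>z. der x (tmul (unit_vec u) z)"])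
    fix v
    show "der x (tmul (unit_vec u) (unit_vec v)) = tmul (der x (unit_vec u)) (unit_vec v) + tmul (unit_vec u) (der x (unit_vec v))"
      by (simp add: der_unit dsum_append dsum_linear[OF linear_conv_left] dsum_linear[OF linear_conv_right])
  qed (rule lin_plus lin_comp[OF linear_conv_right linear_der] lin_comp[OF linear_der linear_conv_right] linear_conv_right)+
qed (rule lin_plus lin_comp[OF linear_conv_left linear_der] lin_comp[OF linear_der linear_conv_left] linear_conv_left)+

lemma pi_der: "pi (der x t) = lin_ext pm_scale (ds x (\<lambda>w. pi (unit_vec w))) t"
  unfolding der_def pm_lin_eq linear_lin_ext_comp[OF linear_pi] dsum_linear[OF linear_pi] ..

lemma der_J: "t \<in> J \<Longrightarrow> der x t \<in> J"
proof -
  assume "t \<in> J"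
  then have "pi (der x t) = pi 0"
    unfolding pi_der by (simp add: lieform_J[OF lieform_dsum[OF lieform_pi]] lin_0[OF linear_pi])
  then show ?thesis by (simp only: pi_eq_iff diff_0_right)
qed

lemma pi_der_pi: "pi (der x (pi t)) = pi (der x t)"
  unfolding pi_eq_iff lin_diff[OF linear_der, symmetric]
  by (rule der_J) (use J_closed(4)[OF diff_pi[of t]] in simp)

sublocale free: post_lie_action scale bracket p pm_scale "\<lambda>x t. pi (der x t)"
proof (intro post_lie_action.intro post_lie_action_axioms.intro post_lie_axioms)
  let ?P = "\<lambda>w. pi (unit_vec w)"
  note P = lieformD(1)[OF lieform_pi]
  show "is_linear scale pm_scale (\<lambda>x. pi (der x v))" for v
    unfolding pi_der by (intro linear_lin_ext_param vs vector_space_pm_scale dsum_linear_left P)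
  show "is_linear pm_scale pm_scale (\<lambda>t. pi (der x t))" for x
    by (rule lin_comp[OF linear_der linear_pi])
  show "pi (der (bracket x y) v) = (pi (der x (pi (der y v))) - pi (der (p x y) v)) - (pi (der y (pi (der x v))) - pi (der (p y x) v))" for x y v
    unfolding pi_der_pi
  proof (rule linear_pm_eqI[where t=v and F="\<lambda>v. pi (der (bracket x y) v)"])
    fix w
    have 1: "pi (der a (unit_vec w)) = ds a ?P w" for a
      by (simp add: pi_der lin_ext_unit[OF vector_space_pm_scale])
    have 2: "pi (der a (der b (unit_vec w))) = ds b (ds a ?P) w" for a b
      unfolding der_unit dsum_linear[OF lin_comp[OF linear_der linear_pi]]
      by (simp add: der_unit dsum_linear[OF linear_pi])
    show "pi (der (bracket x y) (unit_vec w)) = (pi (der x (der y (unit_vec w))) - pi (der (p x y) (unit_vec w)))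
        - (pi (der y (der x (unit_vec w))) - pi (der (p y x) (unit_vec w)))"
      unfolding 1 2 using dsum_comm[OF P, of x y w] by simp
  qed (rule lin_minus_fun lin_comp[OF linear_der linear_pi] lin_comp[OF lin_comp[OF linear_der linear_der] linear_pi])+
qed

text \<open>The recursion without projection, for which the product and coproduct rules are
  equations of words; \<open>pi_wder\<close> links it with the projected action.\<close>

abbreviation wder :: "'g list \<Rightarrow> ('g list \<Rightarrow>\<^sub>0 'k) \<Rightarrow> ('g list \<Rightarrow>\<^sub>0 'k)" where
  "wder \<equiv> wact p der"

lemma linear_wder: "is_linear pm_scale pm_scale (wder w)"
  by (rule wact_linear[OF vector_space_pm_scale linear_der])

lemma pi_wder: "pi (wder w t) = free.act_on w (pi t)"
  by (rule wact_intertwine[OF linear_pi]) (simp add: pi_der_pi)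

definition triT :: "('g list \<Rightarrow>\<^sub>0 'k) \<Rightarrow> ('g list \<Rightarrow>\<^sub>0 'k) \<Rightarrow> ('g list \<Rightarrow>\<^sub>0 'k)" where
  "triT x y = pm_lin (\<lambda>w. wder w y) x"

lemma triT_unit: "triT (unit_vec w) y = wder w y"
  by (simp add: triT_def pm_lin_unit)

lemma linear_triT_left: "is_linear pm_scale pm_scale (\<lambda>x. triT x y)"
  unfolding triT_def by (rule linear_pm_lin)

lemma linear_triT_right: "is_linear pm_scale pm_scale (triT x)"
  unfolding triT_def[abs_def] pm_lin_eq
  by (intro linear_lin_ext_param vector_space_pm_scale linear_wder)

lemma triT_J: "x \<in> J \<Longrightarrow> triT x y \<in> J" "y \<in> J \<Longrightarrow> triT x y \<in> J"
proof -
  have "pi (triT x y) = lin_ext pm_scale (\<lambda>w. free.act_on w (pi y)) x"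
    unfolding triT_def pm_lin_eq linear_lin_ext_comp[OF linear_pi] pi_wder ..
  moreover have "lin_ext pm_scale (\<lambda>w. free.act_on w (pi y)) x = 0" if "x \<in> J"
    using lieform_J[OF free.lieform_wact that] .
  moreover have "lin_ext pm_scale (\<lambda>w. free.act_on w (pi y)) x = 0" if "y \<in> J"
    unfolding pi_J[OF that] lin_ext_def lin_0[OF wact_linear[OF vector_space_pm_scale free.L_linear_right]]
    by (simp add: vs_zero_right[OF vector_space_pm_scale])
  ultimately have "x \<in> J \<or> y \<in> J \<Longrightarrow> pi (triT x y) = pi 0" by (auto simp: lin_0[OF linear_pi])
  then show "x \<in> J \<Longrightarrow> triT x y \<in> J" "y \<in> J \<Longrightarrow> triT x y \<in> J" by (simp_all add: pi_eq_iff)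
qed

lemma cls_triT_cong: "cls x = cls x' \<Longrightarrow> cls y = cls y' \<Longrightarrow> cls (triT x y) = cls (triT x' y')"
  using J_closed(2)[OF triT_J(1)[of "x - x'" y] triT_J(2)[of "y - y'" x']]
  by (simp add: cls_eq_iff lin_diff[OF linear_triT_left] lin_diff[OF linear_triT_right])

text \<open>Well defined by \<open>cls_triT_cong\<close>; the restriction to the carrier makes the
  product extensional.\<close>

definition tri where
  "tri = (\<lambda>X\<in>carrier D. \<lambda>Y\<in>carrier D. cls (triT (SOME x. X = cls x) (SOME y. Y = cls y)))"

lemma tri_cls: "tri (cls x) (cls y) = cls (triT x y)"
proof -
  have "cls x = cls (SOME x'. cls x = cls x')" "cls y = cls (SOME y'. cls y = cls y')"
    by (rule someI[where x=x], rule refl) (rule someI[where x=y], rule refl)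
  from cls_triT_cong[OF this] show ?thesis unfolding tri_def by simp
qed

lemma tri_PiE: "tri \<in> carrier D \<rightarrow>\<^sub>E (carrier D \<rightarrow>\<^sub>E carrier D)"
  by (simp add: tri_def)

lemma tri_linear: "X \<in> carrier D \<Longrightarrow> tri X \<in> linear_maps D D" "Y \<in> carrier D \<Longrightarrow> (\<lambda>X. tri X Y) \<in> linear_maps D D"
  unfolding linear_maps_def
  by (auto simp: carrier_D tri_cls lin_add[OF linear_triT_left] lin_add[OF linear_triT_right]
      lin_scale[OF linear_triT_left] lin_scale[OF linear_triT_right] simp flip: cls_add cls_scale)

lemma tri_bilin: "bilin D D D tri"
  using tri_linear by (auto simp: bilin_def)

text \<open>The recursion defining \<open>wder\<close> is axiom (D5).\<close>

lemma triT_Cons: "triT (tmul (unit_vec [x]) t) s = triT (unit_vec [x]) (triT t s) - triT (triT (unit_vec [x]) t) s"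
proof (rule linear_pm_eqI[where t=t and F="\<lambda>t. triT (tmul (unit_vec [x]) t) s"])
  fix w
  have "triT (ds x unit_vec w) s = ds x (\<lambda>zs. wder zs s) w"
    by (simp add: dsum_linear[OF linear_triT_left] triT_unit)
  then show "triT (tmul (unit_vec [x]) (unit_vec w)) s = triT (unit_vec [x]) (triT (unit_vec w) s) - triT (triT (unit_vec [x]) (unit_vec w)) s"
    by (simp add: triT_unit wact_Cons[of p der x] der_unit)
qed (rule lin_minus_fun lin_comp[OF linear_conv_right linear_triT_left] lin_comp[OF linear_triT_left linear_triT_right]
    lin_comp[OF linear_triT_right linear_triT_left])+

lemma wder_mult: "wder w (tmul y z) = ssum w (\<lambda>u v. tmul (wder u y) (wder v z))"
  by (rule wact_bilinear[where \<beta>=tmul, OF linear_conv_left linear_conv_right linear_der der_mult])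

lemma wder_one: "wder w (unit_vec []) = (if w = [] then unit_vec [] else 0)"
proof (induction w rule: length_induct_list)
  case (Cons x w)
  have "ds x (\<lambda>zs. wder zs (unit_vec [])) w = 0"
  proof (cases w)
    case (Cons y ys)
    have "ds x (\<lambda>zs. wder zs (unit_vec [])) w = ds x (\<lambda>zs. 0) w"
      by (rule dsum_cong) (use Cons.IH Cons in auto)
    then show ?thesis by (simp add: dsum_def)
  qed simp
  then show ?case
    by (simp add: wact_Cons Cons.IH der_unit lin_0[OF linear_der])
qed simp

lemma triT_one: "triT t (unit_vec []) = pm_scale (Poly_Mapping.lookup t []) (unit_vec [])"
proof (rule linear_pm_eqI[where t=t and F="\<lambda>t. triT t (unit_vec [])", OF linear_triT_left])
  show "is_linear pm_scale pm_scale (\<lambda>t. pm_scale (Poly_Mapping.lookup t []) (unit_vec []))"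
    by (rule linI[OF vector_space_pm_scale vector_space_pm_scale]) (simp_all add: lookup_add single_add)
qed (simp add: triT_unit wder_one lookup_single)

section \<open>Compatibility of the product with the coproduct\<close>

definition der2 :: "'g \<Rightarrow> ('g list \<times> 'g list \<Rightarrow>\<^sub>0 'k) \<Rightarrow> ('g list \<times> 'g list \<Rightarrow>\<^sub>0 'k)" where
  "der2 x = pm_lin (\<lambda>(u, v). ds x (\<lambda>u. unit_vec (u, v)) u + ds x (\<lambda>v. unit_vec (u, v)) v)"

lemma linear_der2: "is_linear pm_scale pm_scale (der2 x)"
  unfolding der2_def by (rule linear_pm_lin)

lemma delta_der: "delta (der x t) = der2 x (delta t)"
proof (rule linear_pm_eqI[where t=t and F="\<lambda>t. delta (der x t)"])
  fix w :: "'g list"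
  show "delta (der x (unit_vec w)) = der2 x (delta (unit_vec w))"
    unfolding der_unit dsum_linear[OF linear_delta] delta_unit dsum_ssum ssum_linear[OF linear_der2]
    by (simp add: der2_def pm_lin_unit)
qed (rule lin_comp[OF linear_der linear_delta] lin_comp[OF linear_delta linear_der2])+

text \<open>Pure tensors of combinations of words, before passing to classes.\<close>

definition box :: "('g list \<Rightarrow>\<^sub>0 'k) \<Rightarrow> ('g list \<Rightarrow>\<^sub>0 'k) \<Rightarrow> ('g list \<times> 'g list \<Rightarrow>\<^sub>0 'k)" where
  "box x y = pm_lin (\<lambda>u. pm_lin (\<lambda>v. unit_vec (u, v)) y) x"

lemma linear_box_left: "is_linear pm_scale pm_scale (\<lambda>x. box x y)"
  unfolding box_def by (rule linear_pm_lin)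

lemma linear_box_right: "is_linear pm_scale pm_scale (box x)"
  unfolding box_def[abs_def] pm_lin_eq
  by (rule linear_lin_ext_param) (auto intro: vector_space_pm_scale linear_lin_ext)

lemma box_unit: "box (unit_vec u) (unit_vec v) = unit_vec (u, v)"
  by (simp add: box_def pm_lin_unit)

lemma der2_box: "der2 x (box y z) = box (der x y) z + box y (der x z)"
proof (rule linear_pm_eqI[where t=y and F="\<lambda>y. der2 x (box y z)"])
  fix u
  show "der2 x (box (unit_vec u) z) = box (der x (unit_vec u)) z + box (unit_vec u) (der x z)"
  proof (rule linear_pm_eqI[where t=z and F="\<lambda>z. der2 x (box (unit_vec u) z)"])
    fix v
    show "der2 x (box (unit_vec u) (unit_vec v)) = box (der x (unit_vec u)) (unit_vec v) + box (unit_vec u) (der x (unit_vec v))"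
      unfolding der_unit dsum_linear[OF linear_box_left] dsum_linear[OF linear_box_right] box_unit
      by (simp add: der2_def pm_lin_unit)
  qed (rule lin_plus lin_comp[OF linear_box_right linear_der2] lin_comp[OF linear_der linear_box_right] linear_box_right)+
qed (rule lin_plus lin_comp[OF linear_box_left linear_der2] lin_comp[OF linear_der linear_box_left] linear_box_left)+

lemma delta_wder: "delta (wder w t) = wact p der2 w (delta t)"
  by (rule wact_intertwine[where \<phi>=delta and L=der and L'=der2, OF linear_delta delta_der])

lemma wact_der2_box: "wact p der2 w (box y z) = ssum w (\<lambda>u v. box (wder u y) (wder v z))"
  by (rule wact_bilinear[where \<beta>=box, OF linear_box_left linear_box_right linear_der2 der2_box])

text \<open>(D3) for words: \<open>delta\<close> intertwines \<open>der\<close> with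
  \<open>der2\<close>, and \<open>der2\<close> satisfies the Leibniz rule for pairs, so
  \<open>wact_bilinear\<close> applies.\<close>

lemma delta_triT:
  "delta (triT t s) = pm_lin (\<lambda>p. pm_lin (\<lambda>q. box (wder (fst p) (unit_vec (fst q))) (wder (snd p) (unit_vec (snd q)))) (delta s)) (delta t)"
proof (rule linear_pm_eqI[where t=t and F="\<lambda>t. delta (triT t s)"])
  fix w
  note lw = wact_linear[OF vector_space_pm_scale linear_der2]
  have "delta (triT (unit_vec w) s) = wact p der2 w (delta s)"
    by (simp add: triT_unit delta_wder)
  also have "\<dots> = pm_lin (\<lambda>q. wact p der2 w (unit_vec q)) (delta s)"
    unfolding pm_lin_eq by (rule linear_eq_lin_ext[OF lw])
  also have "\<dots> = pm_lin (\<lambda>q. ssum w (\<lambda>u v. box (wder u (unit_vec (fst q))) (wder v (unit_vec (snd q))))) (delta s)"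
    by (simp flip: wact_der2_box add: box_unit)
  also have "\<dots> = ssum w (\<lambda>u v. pm_lin (\<lambda>q. box (wder u (unit_vec (fst q))) (wder v (unit_vec (snd q)))) (delta s))"
    (is "pm_lin (\<lambda>q. ssum w (\<lambda>u v. ?g u v q)) ?d = _")
  proof -
    have "pm_lin (\<lambda>q. ssum xs (\<lambda>u v. g u v q)) z = ssum xs (\<lambda>u v. pm_lin (g u v) z)"
      for xs :: "'g list" and g :: "'g list \<Rightarrow> 'g list \<Rightarrow> 'g list \<times> 'g list \<Rightarrow> ('g list \<times> 'g list \<Rightarrow>\<^sub>0 'k)" and z
      by (induction xs arbitrary: g) (simp_all add: pm_lin_eq lin_ext_plus[OF vector_space_pm_scale])
    then show ?thesis .
  qed
  also have "\<dots> = pm_lin (\<lambda>p. pm_lin (\<lambda>q. box (wder (fst p) (unit_vec (fst q))) (wder (snd p) (unit_vec (snd q)))) (delta s)) (delta (unit_vec w))"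
    by (simp add: pm_lin_delta_unit)
  finally show "delta (triT (unit_vec w) s) = \<dots>" .
qed (rule lin_comp[OF linear_triT_left linear_delta] lin_comp[OF linear_delta linear_pm_lin])+

lemma tcls_scale: "tcls (pm_scale c z) = c \<odot>\<^bsub>DD.TP\<^esub> tcls z"
  by (simp add: tcls_def DD.TP.flin_scale)

lemma tcls_box: "tcls (box x y) = DD.pure (cls x) (cls y)"
proof -
  note B = DD.bilin_pure
  have 1: "tcls (box (unit_vec u) y) = DD.pure (wcls u) (cls y)" for u
  proof -
    have "tcls (box (unit_vec u) y) = DD.TP.flin (\<lambda>v. tcls (box (unit_vec u) (unit_vec v))) y"
      by (rule DD.TP.flin_unique[where F="\<lambda>y. tcls (box (unit_vec u) y)"])
        (simp_all add: lin_add[OF linear_box_right] lin_scale[OF linear_box_right] tcls_add tcls_scale)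
    also have "\<dots> = DD.TP.flin (\<lambda>v. DD.pure (wcls u) (wcls v)) y"
      by (simp add: box_unit tcls_unit)
    also have "\<dots> = DD.pure (wcls u) (cls y)"
      unfolding cls_flin[of y] by (rule flin_linear_maps[symmetric, OF U.module DD.TP.module]) (use B in \<open>auto simp: bilin_def\<close>)
    finally show ?thesis .
  qed
  have "tcls (box x y) = DD.TP.flin (\<lambda>u. tcls (box (unit_vec u) y)) x"
    by (rule DD.TP.flin_unique[where F="\<lambda>x. tcls (box x y)"])
      (simp_all add: lin_add[OF linear_box_left] lin_scale[OF linear_box_left] tcls_add tcls_scale)
  also have "\<dots> = DD.TP.flin (\<lambda>u. DD.pure (wcls u) (cls y)) x"
    by (simp add: 1)
  also have "\<dots> = DD.pure (cls x) (cls y)"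
    unfolding cls_flin[of x] by (rule flin_linear_maps[symmetric, OF U.module DD.TP.module, where g="\<lambda>X. DD.pure X (cls y)"])
      (use B in \<open>auto simp: bilin_def\<close>)
  finally show ?thesis .
qed

lemma comult_tri:
  assumes "X \<in> carrier D" "Y \<in> carrier D"
  shows "comult D (tri X Y) = sweedler D DD.TP (\<lambda>x1 x2. sweedler D DD.TP (\<lambda>y1 y2. DD.pure (tri x1 y1) (tri x2 y2)) Y) X"
proof -
  obtain t s where t: "X = cls t" "Y = cls s" using assms by (auto simp: carrier_D)
  note B = DD.bilin_pure
  have b1: "bilin D D DD.TP (\<lambda>y1 y2. DD.pure (tri x1 y1) (tri x2 y2))" if "x1 \<in> carrier D" "x2 \<in> carrier D" for x1 x2
    by (rule bilin_comp_left[OF bilin_comp_right[OF B]]) (use tri_linear that in auto)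
  have s1: "sweedler D DD.TP (\<lambda>y1 y2. DD.pure (tri x1 y1) (tri x2 y2)) (cls s)
      = DD.TP.flin (\<lambda>q. DD.pure (tri x1 (wcls (fst q))) (tri x2 (wcls (snd q)))) (delta s)" if "x1 \<in> carrier D" "x2 \<in> carrier D" for x1 x2
    by (rule sweedler_cls[OF DD.TP.module b1[OF that]])
  have tri_closed: "tri x y \<in> carrier D" if "x \<in> carrier D" "y \<in> carrier D" for x y
    using bilinD(1)[OF tri_bilin that] .
  have b2: "bilin D D DD.TP (\<lambda>x1 x2. sweedler D DD.TP (\<lambda>y1 y2. DD.pure (tri x1 y1) (tri x2 y2)) (cls s))"
    by (rule bilinI)
      (simp_all add: s1 tri_closed bilinD[OF tri_bilin] bilinD[OF B] DD.TP.flin_plus DD.TP.flin_smult)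
  have "sweedler D DD.TP (\<lambda>x1 x2. sweedler D DD.TP (\<lambda>y1 y2. DD.pure (tri x1 y1) (tri x2 y2)) Y) X =
    DD.TP.flin (\<lambda>p. DD.TP.flin (\<lambda>q. DD.pure (tri (wcls (fst p)) (wcls (fst q))) (tri (wcls (snd p)) (wcls (snd q)))) (delta s)) (delta t)"
    unfolding t sweedler_cls[OF DD.TP.module b2] by (simp add: s1)
  also have "\<dots> = comult D (tri X Y)"
    unfolding t tri_cls comult_cls delta_triT
    by (simp add: tri_cls triT_unit tcls_box[symmetric] flin_tcls)
  finally show ?thesis ..
qed

lemma tri_mult:
  assumes "X \<in> carrier D" "Y \<in> carrier D" "Z \<in> carrier D"
  shows "tri X (Y \<otimes>\<^bsub>D\<^esub> Z) = sweedler D D (\<lambda>x1 x2. tri x1 Y \<otimes>\<^bsub>D\<^esub> tri x2 Z) X"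
proof -
  obtain t y z where t: "X = cls t" "Y = cls y" "Z = cls z" using assms by (auto simp: carrier_D)
  have b: "bilin D D D (\<lambda>x1 x2. tri x1 Y \<otimes>\<^bsub>D\<^esub> tri x2 Z)"
    by (rule bilin_comp_left[OF bilin_comp_right[OF bilin_mult]]) (use tri_linear assms in auto)
  have "sweedler D D (\<lambda>x1 x2. tri x1 Y \<otimes>\<^bsub>D\<^esub> tri x2 Z) X
    = cls (pm_lin (\<lambda>p. tmul (wder (fst p) y) (wder (snd p) z)) (delta t))"
    unfolding t by (rule sweedler_D[OF b[unfolded t]]) (simp add: tri_cls triT_unit cls_mult)
  also have "pm_lin (\<lambda>p. tmul (wder (fst p) y) (wder (snd p) z)) (delta t) = triT t (tmul y z)"
    by (rule linear_pm_eqI[where t=t, OF lin_comp[OF linear_delta linear_pm_lin] linear_triT_left])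
      (simp add: pm_lin_delta_unit triT_unit wder_mult)
  finally show ?thesis by (simp add: t tri_cls flip: cls_mult)
qed

sublocale g: post_lie_action scale bracket p scale p
  by (intro post_lie_action.intro post_lie_action_axioms.intro post_lie_axioms p_linear_left p_linear_right bracket_p)

abbreviation W :: "'g list \<Rightarrow> 'g \<Rightarrow> 'g" where "W \<equiv> wact p p"

text \<open>Sending x to the one-letter word intertwines \<open>p\<close> with the action on the
  free algebra modulo \<open>J\<close>, so the product of U(g) restricts to the recursion on
  g.\<close>

lemma tri_wcls_iota: "tri (wcls xs) (\<iota> y) = \<iota> (W xs y)"
proof -
  have "pi (wder xs (unit_vec [y])) = free.act_on xs (pi (unit_vec [y]))" by (rule pi_wder)
  also have "\<dots> = pi (unit_vec [W xs y])"
    by (rule wact_intertwine[where \<phi>="\<lambda>z. pi (unit_vec [z])", symmetric])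
      (use lieformD(1)[OF lieform_pi, of "[]" "[]"] in \<open>simp_all add: pi_der_pi der_unit dsum_Cons\<close>)
  finally show ?thesis by (simp add: iota_eq tri_cls triT_unit cls_eq_pi_iff)
qed

end

locale post_lie_char_0 = post_lie scale bracket p + lie_algebra_char_0 scale bracket
  for scale :: "'k::field_char_0 \<Rightarrow> 'g::ab_group_add \<Rightarrow> 'g" and bracket p
begin

lemma D_bialgebra_tri: "D_bialgebra D Flt tri"
proof (rule D_bialgebra.intro)
  fix X Y Z assume X: "X \<in> carrier D" and Y: "Y \<in> carrier D" and Z: "Z \<in> carrier D"
  show "(\<lambda>Y. tri X Y) \<in> linear_maps D D" "(\<lambda>X. tri X Y) \<in> linear_maps D D"
    using tri_linear X Y by auto
  obtain t where t: "X = cls t" using X by (rule D_E)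
  show "tri \<one>\<^bsub>D\<^esub> X = X" by (simp add: t tri_cls triT_unit flip: cls_one)
  show "tri X \<one>\<^bsub>D\<^esub> = counit D X \<odot>\<^bsub>D\<^esub> \<one>\<^bsub>D\<^esub>"
    by (simp add: t tri_cls triT_one counit_cls del: pm_scale_single flip: cls_one cls_scale)
  show "comult D (tri X Y) = sweedler D DD.TP (\<lambda>x1 x2. sweedler D DD.TP (\<lambda>y1 y2. DD.pure (tri x1 y1) (tri x2 y2)) Y) X"
    by (rule comult_tri[OF X Y])
  show "tri X (Y \<otimes>\<^bsub>D\<^esub> Z) = sweedler D D (\<lambda>x1 x2. tri x1 Y \<otimes>\<^bsub>D\<^esub> tri x2 Z) X"
    by (rule tri_mult[OF X Y Z])
next
  show "bialgebra D" by (rule bialgebra_D)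
  show "algebra_filtration D Flt" by (rule filtration_D)
  show "degree_one D Flt = primitives D" by (simp add: degree_one_D primitives_D)
  show "generates_algebra D (degree_one D Flt)" unfolding degree_one_D by (rule generates_D)
next
  fix x y X assume "x \<in> degree_one D Flt" "y \<in> degree_one D Flt" "X \<in> carrier D"
  then obtain a b t where "x = \<iota> a" "y = \<iota> b" "X = cls t" by (auto simp: degree_one_D carrier_D)
  then show "tri (x \<otimes>\<^bsub>D\<^esub> X) y = tri x (tri X y) \<ominus>\<^bsub>D\<^esub> tri (tri x X) y"
    by (simp add: iota_eq tri_cls triT_Cons flip: cls_mult cls_diff)
next
  fix x y assume "x \<in> degree_one D Flt" "y \<in> degree_one D Flt"
  then show "x \<otimes>\<^bsub>D\<^esub> y \<ominus>\<^bsub>D\<^esub> y \<otimes>\<^bsub>D\<^esub> x \<in> degree_one D Flt"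
    by (auto simp: degree_one_D iota_bracket[symmetric])
qed

end

subsection \<open>The post-Lie algebra of a D-bialgebra\<close>

context lie_algebra_char_0
begin

lemma iota_diff: "\<iota> (x - y) = \<iota> x \<ominus>\<^bsub>D\<^esub> \<iota> y"
proof -
  have "\<iota> (x - y) \<oplus>\<^bsub>D\<^esub> \<iota> y = \<iota> x" by (simp flip: iota_add)
  then show ?thesis
    by (metis U.add.m_assoc U.minus_eq U.r_neg U.r_zero iota_in_D U.a_inv_closed)
qed

lemma iota_zero: "\<iota> 0 = \<zero>\<^bsub>D\<^esub>"
  using iota_scale[of 0 0] by (simp add: U.smult_zero_left)

lemma linear_maps_eqI:
  assumes "f \<in> linear_maps D D" "g \<in> linear_maps D D" "\<And>w. f (wcls w) = g (wcls w)"
  shows "f (cls t) = g (cls t)"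
  unfolding cls_flin[of t]
  using flin_linear_maps[OF U.module U.module assms(1), of wcls t] flin_linear_maps[OF U.module U.module assms(2), of wcls t] assms(3)
  by simp

lemma sweedler_iota:
  assumes M: "module scalars M" and h: "bilin D D M h"
  shows "sweedler D M h (\<iota> a) = h (\<iota> a) \<one>\<^bsub>D\<^esub> \<oplus>\<^bsub>M\<^esub> h \<one>\<^bsub>D\<^esub> (\<iota> a)"
proof -
  interpret carrier_space M by (rule carrier_space.intro[OF M])
  show ?thesis
    unfolding iota_eq sweedler_cls[OF M h]
    by (simp add: delta_unit bilinD[OF h] flin_add cls_one)
qed

end

locale D_bialg_on_uea = lie_algebra_char_0 scale bracket
  for scale :: "'k::field_char_0 \<Rightarrow> 'g::ab_group_add \<Rightarrow> 'g" and bracket +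
  fixes tr
  assumes D_bialg: "D_bialgebra D Flt tr"
begin

lemmas tr_linear = D_bialgebra.tri_linear_right[OF D_bialg] D_bialgebra.tri_linear_left[OF D_bialg]

lemma tr_bilin: "bilin D D D tr"
  using tr_linear unfolding bilin_def by auto

lemmas tr_simps [simp] = bilinD(1)[OF tr_bilin]

lemma one_tr: "X \<in> carrier D \<Longrightarrow> tr \<one>\<^bsub>D\<^esub> X = X" and tr_one: "X \<in> carrier D \<Longrightarrow> tr X \<one>\<^bsub>D\<^esub> = counit D X \<odot>\<^bsub>D\<^esub> \<one>\<^bsub>D\<^esub>"
  by (rule D_bialgebra.one_tri[OF D_bialg] D_bialgebra.tri_one[OF D_bialg]; assumption)+

lemma iota_tr_one: "tr (\<iota> x) \<one>\<^bsub>D\<^esub> = \<zero>\<^bsub>D\<^esub>"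
  by (simp add: tr_one) (simp add: iota_eq counit_cls lookup_single U.smult_zero_left)

text \<open>By (D3) the coproduct of x |> y has four terms; the two mixed ones contain x |> 1 = 0,
  so x |> y is primitive and hence lies in g.\<close>

lemma tr_iota_iota: "tr (\<iota> x) (\<iota> y) \<in> range \<iota>"
proof -
  note B = DD.bilin_pure
  let ?h = "\<lambda>x1 x2 y1 y2. DD.pure (tr x1 y1) (tr x2 y2)"
  have b1: "bilin D D DD.TP (?h x1 x2)" if "x1 \<in> carrier D" "x2 \<in> carrier D" for x1 x2
    by (rule bilin_comp_left[OF bilin_comp_right[OF B]]) (use tr_linear that in auto)
  have s: "sweedler D DD.TP (?h x1 x2) (\<iota> y) = ?h x1 x2 (\<iota> y) \<one>\<^bsub>D\<^esub> \<oplus>\<^bsub>DD.TP\<^esub> ?h x1 x2 \<one>\<^bsub>D\<^esub> (\<iota> y)"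
    if "x1 \<in> carrier D" "x2 \<in> carrier D" for x1 x2
    by (rule sweedler_iota[OF DD.TP.module b1[OF that]])
  have b2: "bilin D D DD.TP (\<lambda>x1 x2. sweedler D DD.TP (?h x1 x2) (\<iota> y))"
    by (rule bilinI) (simp_all add: s bilinD[OF tr_bilin] bilinD[OF B] DD.TP.smult_add_right DD.TP.a_ac)
  have z: "DD.pure \<zero>\<^bsub>D\<^esub> u = \<zero>\<^bsub>DD.TP\<^esub>" "DD.pure u \<zero>\<^bsub>D\<^esub> = \<zero>\<^bsub>DD.TP\<^esub>" if "u \<in> carrier D" for u
    using bilinD(4)[OF B that that, of 0] bilinD(5)[OF B that that, of 0] that
    by (simp_all add: U.smult_zero_left DD.TP.smult_zero_left)
  have "comult D (tr (\<iota> x) (\<iota> y)) = sweedler D DD.TP (\<lambda>x1 x2. sweedler D DD.TP (?h x1 x2) (\<iota> y)) (\<iota> x)"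
    by (rule D_bialgebra.comult_tri[OF D_bialg]) simp_all
  also have "\<dots> = DD.pure (tr (\<iota> x) (\<iota> y)) \<one>\<^bsub>D\<^esub> \<oplus>\<^bsub>DD.TP\<^esub> DD.pure \<one>\<^bsub>D\<^esub> (tr (\<iota> x) (\<iota> y))"
    by (simp add: sweedler_iota[OF DD.TP.module b2] s one_tr iota_tr_one z)
  finally show ?thesis by (simp add: primitives_D[symmetric] primitives_def)
qed

definition pl :: "'g \<Rightarrow> 'g \<Rightarrow> 'g" where
  "pl x y = inv_into UNIV \<iota> (tr (\<iota> x) (\<iota> y))"

lemma iota_pl: "\<iota> (pl x y) = tr (\<iota> x) (\<iota> y)"
  unfolding pl_def by (rule f_inv_into_f[OF tr_iota_iota])

lemmas iota_inject = inj_eq[OF inj_iota]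

lemma tr_mult_iota:
  assumes "Y \<in> carrier D" "Z \<in> carrier D"
  shows "tr (\<iota> x) (Y \<otimes>\<^bsub>D\<^esub> Z) = tr (\<iota> x) Y \<otimes>\<^bsub>D\<^esub> Z \<oplus>\<^bsub>D\<^esub> Y \<otimes>\<^bsub>D\<^esub> tr (\<iota> x) Z"
proof -
  have b: "bilin D D D (\<lambda>x1 x2. tr x1 Y \<otimes>\<^bsub>D\<^esub> tr x2 Z)"
    by (rule bilin_comp_left[OF bilin_comp_right[OF bilin_mult]]) (use tr_linear assms in auto)
  show ?thesis
    using D_bialgebra.tri_mult[OF D_bialg _ assms, of "\<iota> x"] assms
    by (simp add: sweedler_iota[OF U.module b] one_tr)
qed

lemma tr_Cons: "X \<in> carrier D \<Longrightarrow> tr (\<iota> x \<otimes>\<^bsub>D\<^esub> X) (\<iota> y) = tr (\<iota> x) (tr X (\<iota> y)) \<ominus>\<^bsub>D\<^esub> tr (tr (\<iota> x) X) (\<iota> y)"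
  by (rule D_bialgebra.mult_tri[OF D_bialg]) (simp_all add: degree_one_D)

lemma tr_minus:
  assumes "X \<in> carrier D" "Y \<in> carrier D" "Z \<in> carrier D"
  shows "tr X (Y \<ominus>\<^bsub>D\<^esub> Z) = tr X Y \<ominus>\<^bsub>D\<^esub> tr X Z" "tr (Y \<ominus>\<^bsub>D\<^esub> Z) X = tr Y X \<ominus>\<^bsub>D\<^esub> tr Z X"
proof -
  have m: "\<ominus>\<^bsub>D\<^esub> V = (-1) \<odot>\<^bsub>D\<^esub> V" if "V \<in> carrier D" for V
  proof (rule U.minus_equality)
    show "(-1) \<odot>\<^bsub>D\<^esub> V \<oplus>\<^bsub>D\<^esub> V = \<zero>\<^bsub>D\<^esub>"
      using U.smult_add_left[OF that, of "-1" 1] that by (simp add: U.smult_1 U.smult_zero_left)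
  qed (use that in simp_all)
  show "tr X (Y \<ominus>\<^bsub>D\<^esub> Z) = tr X Y \<ominus>\<^bsub>D\<^esub> tr X Z" "tr (Y \<ominus>\<^bsub>D\<^esub> Z) X = tr Y X \<ominus>\<^bsub>D\<^esub> tr Z X"
    using assms by (simp_all add: U.minus_eq m bilinD[OF tr_bilin])
qed

text \<open>The derivation rule is (D4) for a primitive left argument. (D5) gives (x y) |> z, and
  its antisymmetrization in x and y is the other identity. Both are equations in U(g), read in g by
  injectivity.\<close>

lemma post_lie_pl: "post_lie scale bracket pl"
proof (intro post_lie.intro post_lie_axioms.intro lie_algebra_axioms)
  fix x y z :: 'g
  have "\<iota> (pl x (bracket y z)) = \<iota> (bracket (pl x y) z + bracket y (pl x z))"
    by (simp add: iota_pl iota_bracket iota_add tr_minus tr_mult_iota) (simp add: U.minus_eq U.minus_add U.a_ac)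
  then show "pl x (bracket y z) = bracket (pl x y) z + bracket y (pl x z)" by (simp only: iota_inject)
  have "\<iota> (pl (bracket x y) z) = \<iota> ((pl x (pl y z) - pl (pl x y) z) - (pl y (pl x z) - pl (pl y x) z))"
    by (simp add: iota_pl iota_bracket iota_diff tr_minus tr_Cons)
  then show "pl (bracket x y) z = (pl x (pl y z) - pl (pl x y) z) - (pl y (pl x z) - pl (pl y x) z)"
    by (simp only: iota_inject)
next
  fix x y :: 'g
  show "is_linear scale scale (\<lambda>x. pl x y)" "is_linear scale scale (pl x)"
    by (rule linI[OF vs vs]; rule iota_inject[THEN iffD1]; simp add: iota_pl iota_add iota_scale bilinD[OF tr_bilin])+
qed

end

text \<open>Uniqueness: a D-bialgebra product is compared with the one constructed from the post-Lie
  product that it induces on g.\<close>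

locale D_bialg_pl = D_bialg_on_uea scale bracket tr + post_lie_char_0 scale bracket p
  for scale :: "'k::field_char_0 \<Rightarrow> 'g::ab_group_add \<Rightarrow> 'g" and bracket tr p +
  assumes tr_p: "tr (\<iota> x) (\<iota> y) = \<iota> (p x y)"
begin

lemma tr_iota_wcls: "tr (\<iota> x) (wcls w) = cls (ds x unit_vec w)"
proof (induction w)
  case Nil
  then show ?case using iota_tr_one by (simp add: cls_one cls_zero)
next
  case (Cons y w)
  have "cls (ds x unit_vec (y # w)) = \<iota> (p x y) \<otimes>\<^bsub>D\<^esub> wcls w \<oplus>\<^bsub>D\<^esub> \<iota> y \<otimes>\<^bsub>D\<^esub> cls (ds x unit_vec w)"
    unfolding iota_eq cls_mult[symmetric] cls_add[symmetric]
    by (simp add: dsum_Cons dsum_linear[OF linear_conv_right])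
  then show ?case by (simp add: wcls_Cons tr_mult_iota Cons.IH tr_p)
qed

lemma tr_cls_sum:
  assumes "finite A" "\<And>i. i \<in> A \<Longrightarrow> tr (wcls (w i)) Y = \<iota> (g i)" "Y \<in> carrier D"
  shows "tr (cls (\<Sum>i\<in>A. unit_vec (w i))) Y = \<iota> (\<Sum>i\<in>A. g i)"
  using assms(1,2)
proof (induction A)
  case empty
  have "tr (0 \<odot>\<^bsub>D\<^esub> Y) Y = \<zero>\<^bsub>D\<^esub>" using assms(3) bilinD(4)[OF tr_bilin assms(3,3), of 0] by (simp add: U.smult_zero_left)
  then show ?case using assms(3) by (simp add: cls_zero iota_zero U.smult_zero_left)
qed (simp add: cls_add bilinD[OF tr_bilin] assms(3) iota_add)

lemma tr_wcls_iota: "tr (wcls xs) (\<iota> y) = \<iota> (W xs y)"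
proof (induction xs rule: length_induct_list)
  case Nil
  then show ?case by (simp add: cls_one one_tr)
next
  case (Cons x xs)
  have "tr (cls (ds x unit_vec xs)) (\<iota> y) = \<iota> (ds x (\<lambda>zs. W zs y) xs)"
    unfolding dsum_def by (rule tr_cls_sum) (simp_all add: Cons.IH)
  then show ?case
    by (simp add: wcls_Cons tr_Cons Cons.IH tr_p tr_iota_wcls wact_Cons iota_diff)
qed

text \<open>(D4) reduces the right word to single letters, on which both products are given by the
  recursion; the empty word is (D1).\<close>

lemma tr_wcls_wcls: "tr (wcls xs) (wcls ys) = tri (wcls xs) (wcls ys)"
proof (induction ys arbitrary: xs)
  case Nil
  have "tri (wcls xs) (wcls []) = counit D (wcls xs) \<odot>\<^bsub>D\<^esub> \<one>\<^bsub>D\<^esub>"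
    by (simp add: tri_cls triT_one counit_cls del: pm_scale_single flip: cls_one cls_scale)
  then show ?case by (simp add: cls_one tr_one)
next
  case (Cons y ys)
  have c: "\<iota> y \<in> carrier D" "wcls ys \<in> carrier D" by simp_all
  have b: "bilin D D D (\<lambda>x1 x2. tr x1 (\<iota> y) \<otimes>\<^bsub>D\<^esub> tr x2 (wcls ys))"
    by (rule bilin_comp_left[OF bilin_comp_right[OF bilin_mult]]) (use tr_linear in auto)
  have b': "bilin D D D (\<lambda>x1 x2. tri x1 (\<iota> y) \<otimes>\<^bsub>D\<^esub> tri x2 (wcls ys))"
    by (rule bilin_comp_left[OF bilin_comp_right[OF bilin_mult]]) (use tri_linear in auto)
  show ?case
    unfolding wcls_Cons D_bialgebra.tri_mult[OF D_bialg cls_in_D c] tri_mult[OF cls_in_D c]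
      sweedler_cls[OF U.module b] sweedler_cls[OF U.module b']
    by (simp add: Cons.IH tr_wcls_iota tri_wcls_iota)
qed

lemma tr_eq_tri:
  assumes "X \<in> carrier D" "Y \<in> carrier D"
  shows "tr X Y = tri X Y"
proof -
  obtain t s where t: "X = cls t" "Y = cls s" using assms by (auto simp: carrier_D)
  have "tr (wcls xs) (cls s) = tri (wcls xs) (cls s)" for xs
  proof -
    have l: "tr (wcls xs) \<in> linear_maps D D" "tri (wcls xs) \<in> linear_maps D D"
      by (rule tr_linear(1) tri_linear(1), rule cls_in_D)+
    show ?thesis by (rule linear_maps_eqI[OF l tr_wcls_wcls])
  qed
  note eq = this
  have l: "(\<lambda>X. tr X (cls s)) \<in> linear_maps D D" "(\<lambda>X. tri X (cls s)) \<in> linear_maps D D"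
    by (rule tr_linear(2) tri_linear(2), rule cls_in_D)+
  show ?thesis unfolding t by (rule linear_maps_eqI[OF l eq])
qed

end

subsection \<open>Partially labeled trees\<close>

fun labels :: "'l ptree \<Rightarrow> 'l list" where
  "labels (Node l us) = (case l of None \<Rightarrow> [] | Some i \<Rightarrow> [i]) @ concat (map labels us)"

fun fully_labeled :: "'l ptree \<Rightarrow> bool" where
  "fully_labeled (Node l us) \<longleftrightarrow> l \<noteq> None \<and> (\<forall>u\<in>set us. fully_labeled u)"

text \<open>Conditions (b) and (c) on unlabeled vertices as a recursion. Fully labeled trees and
  trees with unlabeled root are covered together: a labeled root forces all vertices to be
  labeled.\<close>

fun lw_tree :: "'l ptree \<Rightarrow> bool" where
  "lw_tree (Node l us) \<longleftrightarrow>
    (if l = None then length us = 2 \<and> (\<forall>u\<in>set us. lw_tree u) else (\<forall>u\<in>set us. fully_labeled u))"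

lemma fully_labeled_lw_tree: "fully_labeled t \<Longrightarrow> lw_tree t"
  by (cases t) (simp del: not_None_eq)

lemma lw_tree_root_labeled: "lw_tree t \<Longrightarrow> lab t \<noteq> None \<Longrightarrow> fully_labeled t"
  by (cases t) (auto split: if_splits)

lemma set_labels: "set (labels t) = set_ptree t"
  by (induction t) (auto split: option.splits)

lemma labels_map_ptree: "labels (map_ptree f t) = map f (labels t)"
  by (induction t) (auto simp: map_concat split: option.splits intro!: arg_cong[where f=concat])

lemma fully_labeled_map_ptree [simp]: "fully_labeled (map_ptree f t) = fully_labeled t"
  by (induction t) auto

lemma lw_tree_map_ptree [simp]: "lw_tree (map_ptree f t) = lw_tree t"
  by (induction t) auto

lemma verts_Nil [simp]: "[] \<in> verts t"
  by (cases t) simp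

lemma unlabeled_Node: "unlabeled (Node l us) = (if l = None then {[]} else {}) \<union> (\<Union>j<length us. (#) j ` unlabeled (us ! j))"
  by (auto simp: unlabeled_def)

lemma unlabeled_Cons: "j # p \<in> unlabeled (Node l us) \<longleftrightarrow> j < length us \<and> p \<in> unlabeled (us ! j)"
  by (auto simp: unlabeled_def)

lemma Nil_unlabeled: "[] \<in> unlabeled t \<longleftrightarrow> lab t = None"
  by (simp add: unlabeled_def)

lemma unlabeled_empty_iff: "unlabeled t = {} \<longleftrightarrow> fully_labeled t"
proof (induction t)
  case (Node l us)
  have "unlabeled (Node l us) = {} \<longleftrightarrow> l \<noteq> None \<and> (\<forall>j<length us. unlabeled (us ! j) = {})"
    by (auto simp: unlabeled_Node)
  also have "\<dots> \<longleftrightarrow> fully_labeled (Node l us)"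
    using Node by (auto simp: all_set_conv_all_nth)
  finally show ?case .
qed

lemma finite_verts: "finite (verts t)"
  by (induction t) auto

lemma finite_unlabeled: "finite (unlabeled t)"
  by (simp add: unlabeled_def finite_verts)

lemma lw_tree_iff:
  "lw_tree t \<longleftrightarrow> (\<forall>p\<in>unlabeled t. p \<noteq> [] \<longrightarrow> butlast p \<in> unlabeled t) \<and>
     (\<forall>p\<in>unlabeled t. length (kids (subtree t p)) = 2)" (is "_ \<longleftrightarrow> ?c t \<and> ?k t")
proof (induction t)
  case (Node l us)
  \<comment> \<open>An unlabeled address of minimal length has no unlabeled parent, so it would have
    to be the root.\<close>
  have empty: "unlabeled t = {}" if "?c t" "[] \<notin> unlabeled t" for t :: "'a ptree"
  proof (rule ccontr)
    assume "unlabeled t \<noteq> {}"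
    then obtain q0 where "q0 \<in> unlabeled t" by blast
    from ex_has_least_nat[of "\<lambda>q. q \<in> unlabeled t", OF this, of length]
    obtain q where q: "q \<in> unlabeled t" "\<And>r. r \<in> unlabeled t \<Longrightarrow> length q \<le> length r" by blast
    then have "q \<noteq> []" using that(2) by auto
    then have "butlast q \<in> unlabeled t" using that(1) q(1) by auto
    from q(2)[OF this] \<open>q \<noteq> []\<close> show False by (cases q rule: rev_cases) auto
  qed
  show ?case
  proof (cases l)
    case None
    have "?c (Node l us) \<longleftrightarrow> (\<forall>j<length us. ?c (us ! j))"
    proof (intro iffI allI impI ballI)
      fix j q assume c: "?c (Node l us)" and j: "j < length us" and q: "q \<in> unlabeled (us ! j)" "q \<noteq> []"
      then have "butlast (j # q) \<in> unlabeled (Node l us)" using unlabeled_Cons[of j q l us] by blast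
      then show "butlast q \<in> unlabeled (us ! j)" using q(2) by (simp add: unlabeled_Cons)
    next
      fix q assume c: "\<forall>j<length us. ?c (us ! j)" and q: "q \<in> unlabeled (Node l us)" "q \<noteq> []"
      then obtain j r where r: "q = j # r" "j < length us" "r \<in> unlabeled (us ! j)"
        by (cases q) (auto simp: unlabeled_Cons)
      show "butlast q \<in> unlabeled (Node l us)"
      proof (cases "r = []")
        case True
        then show ?thesis by (simp add: r None Nil_unlabeled)
      next
        case False
        then have "butlast r \<in> unlabeled (us ! j)" using c r by blast
        then show ?thesis using False r by (simp add: unlabeled_Cons)
      qed
    qed
    moreover have "?k (Node l us) \<longleftrightarrow> length us = 2 \<and> (\<forall>j<length us. ?k (us ! j))"
      unfolding None unlabeled_Node by auto
    ultimately show ?thesis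
      using Node None by (auto simp: all_set_conv_all_nth)
  next
    case (Some i)
    have "unlabeled (Node l us) = {}" if "?c (Node l us)"
      by (rule empty[OF that]) (simp add: Nil_unlabeled Some)
    then have "?c (Node l us) \<and> ?k (Node l us) \<longleftrightarrow> unlabeled (Node l us) = {}" by auto
    then show ?thesis unfolding unlabeled_empty_iff using Some by simp
  qed
qed

text \<open>Addresses in the order in which \<open>labels\<close> lists the labels; this turns the
  bijection in \<open>partially_labeled\<close> into distinctness of a list.\<close>

fun labeled_verts :: "'l ptree \<Rightarrow> nat list list" where
  "labeled_verts (Node l us) = (if l = None then [] else [[]]) @
     concat (map (\<lambda>j. map ((#) j) (map labeled_verts us ! j)) [0..<length us])"

lemma set_labeled_verts: "set (labeled_verts t) = verts t - unlabeled t"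
proof (induction t)
  case (Node l us)
  then have "set (labeled_verts (us ! j)) = verts (us ! j) - unlabeled (us ! j)" if "j < length us" for j
    using that by auto
  then show ?case by (auto simp: unlabeled_def)
qed

lemma distinct_concat_upt:
  assumes "\<And>j. j < n \<Longrightarrow> distinct (g j)" "\<And>j k. j < k \<Longrightarrow> k < n \<Longrightarrow> set (g j) \<inter> set (g k) = {}"
  shows "distinct (concat (map g [0..<n]))"
  using assms by (induction n) (fastforce simp: less_Suc_eq)+

lemma distinct_labeled_verts: "distinct (labeled_verts t)"
proof (induction t)
  case (Node l us)
  have "distinct (concat (map (\<lambda>j. map ((#) j) (map labeled_verts us ! j)) [0..<length us]))"
    using Node by (intro distinct_concat_upt) (auto simp: distinct_map)
  then show ?case by auto
qed

lemma map_labeled_verts: "map (\<lambda>q. the (lab (subtree t q))) (labeled_verts t) = labels t"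
proof (induction t)
  case (Node l us)
  have "map (\<lambda>q. the (lab (subtree (Node l us) q))) (concat (map (\<lambda>j. map ((#) j) (map labeled_verts us ! j)) [0..<length us]))
    = concat (map (\<lambda>j. labels (us ! j)) [0..<length us])"
    unfolding map_concat map_map
    by (intro arg_cong[where f=concat] map_cong refl) (use Node in \<open>auto simp: comp_def\<close>)
  also have "map (\<lambda>j. labels (us ! j)) [0..<length us] = map labels us"
    by (rule nth_equalityI) auto
  finally show ?case by (auto split: option.splits)
qed

lemma bij_betw_labels_iff:
  "bij_betw (\<lambda>p. the (lab (subtree t p))) (verts t - unlabeled t) S \<longleftrightarrow> distinct (labels t) \<and> set (labels t) = S"
proof -
  have "inj_on (\<lambda>p. the (lab (subtree t p))) (set (labeled_verts t)) \<longleftrightarrow> distinct (labels t)"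
    using distinct_labeled_verts[of t] by (simp add: distinct_map flip: map_labeled_verts)
  moreover have "(\<lambda>p. the (lab (subtree t p))) ` set (labeled_verts t) = set (labels t)"
    by (simp flip: map_labeled_verts)
  ultimately show ?thesis by (simp add: bij_betw_def set_labeled_verts)
qed

lemma partially_labeled_iff: "t \<in> partially_labeled n \<longleftrightarrow> distinct (labels t) \<and> set (labels t) = {1..n}"
  by (simp add: partially_labeled_def bij_betw_labels_iff)

lemma L_trees_iff: "t \<in> L_trees n \<longleftrightarrow> fully_labeled t \<and> distinct (labels t) \<and> set (labels t) = {1..n}"
  by (auto simp: L_trees_def partially_labeled_iff unlabeled_empty_iff)

lemma W_trees_iff: "t \<in> W_trees n \<longleftrightarrow> lab t = None \<and> lw_tree t \<and> distinct (labels t) \<and> set (labels t) = {1..n}"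
  unfolding W_trees_def partially_labeled_iff lw_tree_iff Nil_unlabeled by blast

lemma labels_nonempty: "lw_tree t \<Longrightarrow> labels t \<noteq> []"
proof (induction t)
  case (Node l us)
  then show ?case by (cases us) (auto split: option.splits if_splits)
qed

text \<open>The case distinction on the arity disappears: a tree with an unlabeled root has two
  subtrees, each of which carries a label.\<close>

lemma LW_trees_iff:
  assumes "1 \<le> n"
  shows "t \<in> LW_trees n \<longleftrightarrow> lw_tree t \<and> distinct (labels t) \<and> set (labels t) = {1..n}"
proof -
  have "n \<noteq> 1" if t: "t \<in> W_trees n"
  proof -
    obtain a b where ab: "t = Node None [a, b]" "lw_tree a" "lw_tree b"
      using t by (cases t) (auto simp: W_trees_iff length_Suc_conv numeral_2_eq_2)
    have "1 \<le> length (labels a)" "1 \<le> length (labels b)" using ab labels_nonempty by (auto simp: Suc_le_eq)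
    moreover have "length (labels t) = n"
      using t distinct_card[of "labels t"] by (auto simp: W_trees_iff)
    ultimately show ?thesis by (simp add: ab)
  qed
  then have "t \<in> LW_trees n \<longleftrightarrow> t \<in> L_trees n \<or> t \<in> W_trees n"
    using assms by (auto simp: LW_trees_def)
  then show ?thesis
    unfolding L_trees_iff W_trees_iff using fully_labeled_lw_tree lw_tree_root_labeled by blast
qed

text \<open>Swaps and graftings rearrange the list of labels, so multisets are easier to
  follow.\<close>

lemma LW_trees_mset_iff:
  assumes "1 \<le> n"
  shows "t \<in> LW_trees n \<longleftrightarrow> lw_tree t \<and> mset (labels t) = mset_set {1..n}"
proof -
  have "distinct xs \<and> set xs = {1..n} \<longleftrightarrow> mset xs = mset_set {1..n}" for xs
  proof
    assume "distinct xs \<and> set xs = {1..n}"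
    then show "mset xs = mset_set {1..n}" using mset_set_set[of xs] by simp
  next
    assume m: "mset xs = mset_set {1..n}"
    have "set xs = {1..n}" using arg_cong[OF m, of set_mset] by simp
    moreover have "distinct xs" unfolding distinct_count_atmost_1 m using calculation by (auto simp: count_mset_set')
    ultimately show "distinct xs \<and> set xs = {1..n}" by simp
  qed
  then show ?thesis by (simp add: LW_trees_iff[OF assms])
qed

section \<open>The vertex with a given label and induction along its path\<close>

lemma ex1_vertex:
  assumes "distinct (labels t)" "i \<in> set (labels t)"
  shows "\<exists>!p. p \<in> verts t \<and> lab (subtree t p) = Some i"
proof -
  let ?f = "\<lambda>p. the (lab (subtree t p))"
  have bij: "bij_betw ?f (verts t - unlabeled t) (set (labels t))"
    using assms(1) by (simp add: bij_betw_labels_iff)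
  have iff: "p \<in> verts t \<and> lab (subtree t p) = Some i \<longleftrightarrow> p \<in> verts t - unlabeled t \<and> ?f p = i" for p
    by (auto simp: unlabeled_def)
  have "i \<in> ?f ` (verts t - unlabeled t)" using bij assms(2) by (simp add: bij_betw_def)
  then obtain q where "q \<in> verts t - unlabeled t" "?f q = i" by blast
  then show ?thesis
    unfolding iff using bij by (auto simp: bij_betw_def inj_on_def)
qed

lemma vertex_eqI:
  assumes "distinct (labels t)" "p \<in> verts t" "lab (subtree t p) = Some i" "i \<in> set (labels t)"
  shows "vertex t i = p"
  unfolding vertex_def using the1_equality[OF ex1_vertex[OF assms(1,4)]] assms(2,3) by blast

lemma vertex_mem:
  assumes "distinct (labels t)" "i \<in> set (labels t)"
  shows "vertex t i \<in> verts t" "lab (subtree t (vertex t i)) = Some i"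
  using theI'[OF ex1_vertex[OF assms]] unfolding vertex_def by auto

lemma distinct_labels_kid: "distinct (labels (Node l us)) \<Longrightarrow> u \<in> set us \<Longrightarrow> distinct (labels u)"
  by (auto simp: distinct_concat_iff)

lemma distinct_labels_kids_disjoint:
  assumes "distinct (labels (Node l us))" "j < length us" "j' < length us" "j \<noteq> j'"
  shows "set (labels (us ! j)) \<inter> set (labels (us ! j')) = {}"
proof -
  have "distinct (concat (map labels us))" using assms(1) by auto
  then show ?thesis using assms(2-)
  proof (induction us arbitrary: j j')
    case (Cons u us)
    have "set (labels u) \<inter> set (labels (us ! k)) = {}" if "k < length us" for k
      using Cons.prems(1) nth_mem[OF that] by fastforce
    then show ?case
      using Cons by (cases j; cases j') auto
  qed simp
qed

lemma vertex_root: "distinct (labels (Node (Some i) us)) \<Longrightarrow> vertex (Node (Some i) us) i = []"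
  by (rule vertex_eqI) auto

lemma vertex_kid:
  assumes "distinct (labels (Node l us))" "j < length us" "i \<in> set (labels (us ! j))"
  shows "vertex (Node l us) i = j # vertex (us ! j) i"
proof (rule vertex_eqI[OF assms(1)])
  have "distinct (labels (us ! j))" using distinct_labels_kid[OF assms(1)] assms(2) by auto
  from vertex_mem[OF this assms(3)] assms(2)
  show "j # vertex (us ! j) i \<in> verts (Node l us)" "lab (subtree (Node l us) (j # vertex (us ! j) i)) = Some i"
    by auto
  show "i \<in> set (labels (Node l us))" using assms(2,3) by auto
qed

text \<open>Address-free form of the list of subtrees above the vertex labeled \<open>i\<close>.
  With distinct labels at most one vertex contributes to the concatenation.\<close>

fun kids_at :: "'l \<Rightarrow> 'l ptree \<Rightarrow> 'l ptree list" where
  "kids_at i (Node l us) = (if l = Some i then us else concat (map (kids_at i) us))"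

lemma kids_at_empty: "i \<notin> set (labels t) \<Longrightarrow> kids_at i t = []"
  by (induction t) auto

lemma replace_vertex_id: "i \<notin> set (labels t) \<Longrightarrow> replace_vertex i f t = t"
  by (induction t) (auto intro: map_idI)

text \<open>Induction along the path from the root to the vertex labeled \<open>i\<close>; the other
  subtrees do not contain \<open>i\<close> and stay fixed under
  \<open>replace_vertex\<close>.\<close>

lemma path_induct [consumes 2, case_names root kid]:
  assumes "distinct (labels t)" "i \<in> set (labels t)"
    and root: "\<And>us. distinct (labels (Node (Some i) us)) \<Longrightarrow> P (Node (Some i) us)"
    and kid: "\<And>l us j. distinct (labels (Node l us)) \<Longrightarrow> l \<noteq> Some i \<Longrightarrow> j < length us \<Longrightarrow>
      i \<in> set (labels (us ! j)) \<Longrightarrow> (\<And>j'. j' < length us \<Longrightarrow> j' \<noteq> j \<Longrightarrow> i \<notin> set (labels (us ! j'))) \<Longrightarrow>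
      P (us ! j) \<Longrightarrow> P (Node l us)"
  shows "P t"
  using assms(1,2)
proof (induction t)
  case (Node l us)
  show ?case
  proof (cases "l = Some i")
    case True
    then show ?thesis using root Node.prems by simp
  next
    case False
    then obtain u where "u \<in> set us" "i \<in> set (labels u)" using Node.prems by (auto split: option.splits)
    then obtain j where j: "j < length us" "i \<in> set (labels (us ! j))" by (auto simp: in_set_conv_nth)
    have "P (us ! j)"
      using Node.IH[of "us ! j"] j distinct_labels_kid[OF Node.prems(1)] by simp
    moreover have "i \<notin> set (labels (us ! j'))" if "j' < length us" "j' \<noteq> j" for j'
      using distinct_labels_kids_disjoint[OF Node.prems(1) j(1) that(1)] that(2) j(2) by blast
    ultimately show ?thesis using kid[OF Node.prems(1) False j] by blast
  qed
qed

lemma concat_map_single: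
  assumes "j < length us" "\<And>j'. j' < length us \<Longrightarrow> j' \<noteq> j \<Longrightarrow> f (us ! j') = []"
  shows "concat (map f us) = f (us ! j)"
  using assms
proof (induction us arbitrary: j)
  case (Cons u us)
  show ?case
  proof (cases j)
    case 0
    have "f v = []" if "v \<in> set us" for v
      using that Cons.prems(2)[of "Suc _"] 0 by (auto simp: in_set_conv_nth)
    then show ?thesis by (simp add: 0)
  next
    case (Suc k)
    have "concat (map f us) = f (us ! k)"
      by (rule Cons.IH) (use Cons.prems(1) Cons.prems(2)[of "Suc _"] Suc in auto)
    then show ?thesis using Cons.prems(2)[of 0] Suc by simp
  qed
qed simp

lemma kids_at_kid:
  assumes "l \<noteq> Some i" "j < length us" "\<And>j'. j' < length us \<Longrightarrow> j' \<noteq> j \<Longrightarrow> i \<notin> set (labels (us ! j'))"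
  shows "kids_at i (Node l us) = kids_at i (us ! j)"
  using assms(1) by (simp add: concat_map_single[OF assms(2)] kids_at_empty[OF assms(3)])

lemma replace_vertex_kid:
  assumes "l \<noteq> Some i" "j < length us" "\<And>j'. j' < length us \<Longrightarrow> j' \<noteq> j \<Longrightarrow> i \<notin> set (labels (us ! j'))"
  shows "replace_vertex i f (Node l us) = Node l (us[j := replace_vertex i f (us ! j)])"
  using assms by (auto intro!: nth_equalityI simp: nth_list_update replace_vertex_id)

lemma kids_at_vertex:
  assumes "distinct (labels t)" "i \<in> set (labels t)"
  shows "kids (subtree t (vertex t i)) = kids_at i t"
  using assms
proof (induction rule: path_induct)
  case (root us)
  then show ?case by (simp add: vertex_root)
next
  case (kid l us j)
  then show ?case by (simp add: vertex_kid kids_at_kid del: kids_at.simps)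
qed

lemma mset_concat_labels: "mset (labels (Node l us)) = (case l of None \<Rightarrow> {#} | Some i \<Rightarrow> {#i#}) + (\<Sum>u\<leftarrow>us. mset (labels u))"
  by (simp add: mset_concat comp_def split: option.splits)

text \<open>A balance equation, since subtraction of multisets is truncated.\<close>

lemma mset_replace_vertex:
  assumes "distinct (labels t)" "i \<in> set (labels t)"
  shows "mset (labels (replace_vertex i f t)) + add_mset i (\<Sum>u\<leftarrow>kids_at i t. mset (labels u)) =
    mset (labels t) + mset (labels (f (kids_at i t)))"
  using assms
proof (induction rule: path_induct)
  case (root us)
  then show ?case by (simp add: mset_concat comp_def)
next
  case (kid l us j)
  let ?M = "\<lambda>us. \<Sum>u\<leftarrow>us. mset (labels u)"
  have upd: "?M (us[j := v]) = ?M (take j us) + (mset (labels v) + ?M (drop (Suc j) us))" for v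
    using kid(3) by (simp add: upd_conv_take_nth_drop)
  have us: "?M us = ?M (take j us) + (mset (labels (us ! j)) + ?M (drop (Suc j) us))"
    using upd[of "us ! j"] by simp
  have r: "replace_vertex i f (Node l us) = Node l (us[j := replace_vertex i f (us ! j)])"
    by (rule replace_vertex_kid) (use kid in auto)
  have k: "kids_at i (Node l us) = kids_at i (us ! j)"
    by (rule kids_at_kid) (use kid in auto)
  show ?case
    unfolding r k mset_concat_labels upd us using kid(6) by (simp add: ac_simps)
qed

text \<open>As \<open>path_induct\<close>, but it stops one vertex earlier, at the labeled parent of
  \<open>i\<close>, with which an inserted unlabeled root is merged.\<close>

lemma parent_induct [consumes 4, case_names base step]:
  assumes "distinct (labels t)" "i \<in> set (labels t)" "vertex t i \<noteq> []" "butlast (vertex t i) \<notin> unlabeled t"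
    and base: "\<And>a us j ws. distinct (labels (Node (Some a) us)) \<Longrightarrow> a \<noteq> i \<Longrightarrow> j < length us \<Longrightarrow>
      us ! j = Node (Some i) ws \<Longrightarrow> (\<And>j'. j' < length us \<Longrightarrow> j' \<noteq> j \<Longrightarrow> i \<notin> set (labels (us ! j'))) \<Longrightarrow>
      P (Node (Some a) us)"
    and step: "\<And>l us j. distinct (labels (Node l us)) \<Longrightarrow> l \<noteq> Some i \<Longrightarrow> j < length us \<Longrightarrow>
      i \<in> set (labels (us ! j)) \<Longrightarrow> (\<And>j'. j' < length us \<Longrightarrow> j' \<noteq> j \<Longrightarrow> i \<notin> set (labels (us ! j'))) \<Longrightarrow>
      vertex (us ! j) i \<noteq> [] \<Longrightarrow> butlast (vertex (us ! j) i) \<notin> unlabeled (us ! j) \<Longrightarrow> P (us ! j) \<Longrightarrow> P (Node l us)"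
  shows "P t"
  using assms(1-4)
proof (induction rule: path_induct)
  case (root us)
  then show ?case by (simp add: vertex_root)
next
  case (kid l us j)
  note v = vertex_kid[OF kid(1,3,4)]
  show ?case
  proof (cases "vertex (us ! j) i = []")
    case True
    have "distinct (labels (us ! j))" using kid(1,3) distinct_labels_kid by fastforce
    from vertex_mem(2)[OF this kid(4)] obtain ws where ws: "us ! j = Node (Some i) ws"
      unfolding True by (cases "us ! j") simp
    have "l \<noteq> None" using kid.prems(2) by (simp add: v True Nil_unlabeled)
    then obtain a where "l = Some a" by blast
    then show ?thesis using base[of a us j ws] kid(1-5) ws by auto
  next
    case False
    then have "butlast (vertex (us ! j) i) \<notin> unlabeled (us ! j)"
      using kid.prems(2) kid(3) by (simp add: v unlabeled_Cons)
    then show ?thesis using step[OF kid(1-5) False] kid.IH False by blast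
  qed
qed

subsection \<open>Grafting, contraction and swaps\<close>

lemma fully_labeled_graft:
  "fully_labeled t \<Longrightarrow> (\<And>w u. (w, u) \<in> set gs \<Longrightarrow> fully_labeled u) \<Longrightarrow> fully_labeled (graft gs t)"
  by (induction t) auto

lemma lw_tree_graft:
  "lw_tree t \<Longrightarrow> (\<And>w u. (w, u) \<in> set gs \<Longrightarrow> fully_labeled u) \<Longrightarrow> lw_tree (graft gs t)"
  by (induction t) (auto intro: fully_labeled_graft split: if_splits)

lemma mset_graft_aux:
  "mset (labels (graft gs t)) = mset (labels t) +
    (\<Sum>r\<leftarrow>labels t. \<Sum>u\<leftarrow>map snd (filter (\<lambda>(w, u). r = w) gs). mset (labels u))"
proof (induction t)
  case (Node l us)
  let ?att = "\<lambda>r. \<Sum>u\<leftarrow>map snd (filter (\<lambda>(w, u). r = w) gs). mset (labels u)"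
  have "(\<Sum>u\<leftarrow>us. mset (labels (graft gs u))) = (\<Sum>u\<leftarrow>us. mset (labels u) + (\<Sum>r\<leftarrow>labels u. ?att r))"
    by (intro arg_cong[where f=sum_list] map_cong refl Node.IH)
  also have "\<dots> = (\<Sum>u\<leftarrow>us. mset (labels u)) + (\<Sum>r\<leftarrow>concat (map labels us). ?att r)"
    by (induction us) (simp_all add: ac_simps)
  finally have us: "(\<Sum>u\<leftarrow>us. mset (labels (graft gs u))) = \<dots>" .
  have "(\<Sum>u\<leftarrow>map snd (filter (\<lambda>(w, u). l = Some w) gs) @ map (graft gs) us. mset (labels u))
    = (case l of None \<Rightarrow> {#} | Some r \<Rightarrow> ?att r) + (\<Sum>u\<leftarrow>us. mset (labels (graft gs u)))"
    by (cases l) (simp_all add: comp_def)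
  then show ?case
    unfolding graft.simps mset_concat_labels us
    by (cases l) (simp_all add: ac_simps)
qed

text \<open>With distinct labels each subtree is grafted exactly once, namely onto the vertex chosen
  by \<open>\<phi>\<close>.\<close>

lemma mset_graft:
  assumes "distinct (labels t)" "length \<phi> = length us" "set \<phi> \<subseteq> set (labels t)"
  shows "mset (labels (graft (zip \<phi> us) t)) = mset (labels t) + (\<Sum>u\<leftarrow>us. mset (labels u))"
proof -
  have "(\<Sum>r\<leftarrow>labels t. \<Sum>u\<leftarrow>map snd (filter (\<lambda>(w, u). r = w) (zip \<phi> us)). mset (labels u))
    = (\<Sum>r\<in>set (labels t). \<Sum>u\<leftarrow>map snd (filter (\<lambda>(w, u). r = w) (zip \<phi> us)). mset (labels u))"
    using assms(1) by (simp add: sum_list_distinct_conv_sum_set)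
  also have "\<dots> = (\<Sum>u\<leftarrow>us. mset (labels u))"
    using assms(2,3)
  proof (induction \<phi> us rule: list_induct2)
    case (Cons w \<phi> u us)
    have "(\<Sum>r\<in>set (labels t). \<Sum>u\<leftarrow>map snd (filter (\<lambda>(w, u). r = w) (zip (w # \<phi>) (u # us))). mset (labels u))
      = (\<Sum>r\<in>set (labels t). (if r = w then mset (labels u) else {#}) + (\<Sum>u\<leftarrow>map snd (filter (\<lambda>(w, u). r = w) (zip \<phi> us)). mset (labels u)))"
      by (intro sum.cong) auto
    also have "\<dots> = mset (labels u) + (\<Sum>u\<leftarrow>us. mset (labels u))"
      using Cons by (simp add: sum.distrib)
    finally show ?case by simp
  qed simp
  finally show ?thesis by (simp only: mset_graft_aux)
qed

lemma fully_labeled_kids_at: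
  assumes "distinct (labels t)" "i \<in> set (labels t)" "lw_tree t" "u \<in> set (kids_at i t)"
  shows "fully_labeled u"
  using assms
proof (induction rule: path_induct)
  case (kid l us j)
  have "lw_tree (us ! j)"
    using kid(3) kid.prems by (cases "l = None") (auto intro: fully_labeled_lw_tree)
  moreover have "kids_at i (Node l us) = kids_at i (us ! j)"
    by (rule kids_at_kid) (use kid in auto)
  ultimately show ?case using kid by simp
qed auto

lemma set_list_update: "j < length us \<Longrightarrow> set (us[j := v]) \<subseteq> insert v (set us)"
  by (rule set_update_subset_insert)

lemma replace_vertex_fully_labeled:
  assumes "distinct (labels t)" "i \<in> set (labels t)" "fully_labeled (f (kids_at i t))"
  shows "(lw_tree t \<longrightarrow> lw_tree (replace_vertex i f t)) \<and> (fully_labeled t \<longrightarrow> fully_labeled (replace_vertex i f t))"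
  using assms
proof (induction rule: path_induct)
  case (root us)
  then show ?case by (auto intro: fully_labeled_lw_tree)
next
  case (kid l us j)
  have k: "kids_at i (Node l us) = kids_at i (us ! j)"
    by (rule kids_at_kid) (use kid in auto)
  have r: "replace_vertex i f (Node l us) = Node l (us[j := replace_vertex i f (us ! j)])"
    by (rule replace_vertex_kid) (use kid in auto)
  have mem: "us ! j \<in> set us" using kid(3) by simp
  note IH = kid.IH[OF kid.prems[unfolded k]]
  show ?case
    unfolding r using IH mem set_list_update[OF kid(3), of "replace_vertex i f (us ! j)"]
    by (cases l) auto
qed

text \<open>By the assumption on the parent, all vertices between the root and \<open>i\<close> are
  unlabeled, so a tree with unlabeled root may be inserted there.\<close>

lemma replace_vertex_lw_tree:
  assumes "distinct (labels t)" "i \<in> set (labels t)" "lw_tree t" "lw_tree (f (kids_at i t))"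
    and "vertex t i = [] \<or> butlast (vertex t i) \<in> unlabeled t"
  shows "lw_tree (replace_vertex i f t)"
  using assms
proof (induction rule: path_induct)
  case (kid l us j)
  have k: "kids_at i (Node l us) = kids_at i (us ! j)"
    by (rule kids_at_kid) (use kid in auto)
  have r: "replace_vertex i f (Node l us) = Node l (us[j := replace_vertex i f (us ! j)])"
    by (rule replace_vertex_kid) (use kid in auto)
  note v = vertex_kid[OF kid(1,3,4)]
  have parent: "vertex (us ! j) i = [] \<or> butlast (vertex (us ! j) i) \<in> unlabeled (us ! j)"
    using kid.prems(3) kid(3) by (auto simp: v unlabeled_Cons split: if_splits)
  have None: "l = None"
  proof (rule ccontr)
    assume "l \<noteq> None"
    then have "unlabeled (Node l us) = {}"
      unfolding unlabeled_empty_iff using lw_tree_root_labeled[OF kid.prems(1)] by simp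
    then show False using kid.prems(3) by (simp add: v)
  qed
  have "lw_tree (replace_vertex i f (us ! j))"
    by (rule kid.IH) (use kid.prems k parent None kid(3) in auto)
  then show ?case
    unfolding r using kid.prems(1) None set_list_update[OF kid(3), of "replace_vertex i f (us ! j)"] by auto
qed simp

lemma contract_at_Cons: "q \<noteq> [] \<Longrightarrow> j < length us \<Longrightarrow> contract_at (j # q) (Node l us) = Node l (us[j := contract_at q (us ! j)])"
  by (cases q) auto

text \<open>After contraction the subtrees of the inserted tree take the place of the vertex
  \<open>i\<close> among the subtrees above \<open>a\<close>.\<close>

lemma contract_replace_base:
  assumes "distinct (labels (Node (Some a) us))" "a \<noteq> i" "j < length us" "us ! j = Node (Some i) ws"
    and "\<And>j'. j' < length us \<Longrightarrow> j' \<noteq> j \<Longrightarrow> i \<notin> set (labels (us ! j'))"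
  shows "contract_at (vertex (Node (Some a) us) i) (replace_vertex i f (Node (Some a) us))
      = Node (Some a) (take j us @ kids (f ws) @ drop (Suc j) us)"
    and "replace_vertex i f (Node (Some a) us) = Node (Some a) (us[j := f ws])"
    and "kids_at i (Node (Some a) us) = ws"
proof -
  have d: "distinct (labels (us ! j))" using distinct_labels_kid[OF assms(1)] assms(3) by auto
  have v: "vertex (Node (Some a) us) i = [j]"
    by (subst vertex_kid[OF assms(1,3)]) (use assms(4) d in \<open>simp_all add: vertex_root\<close>)
  show r: "replace_vertex i f (Node (Some a) us) = Node (Some a) (us[j := f ws])"
    by (subst replace_vertex_kid) (use assms in auto)
  show "kids_at i (Node (Some a) us) = ws"
    by (subst kids_at_kid) (use assms in auto)
  show "contract_at (vertex (Node (Some a) us) i) (replace_vertex i f (Node (Some a) us))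
      = Node (Some a) (take j us @ kids (f ws) @ drop (Suc j) us)"
    unfolding v r using assms(3) by simp
qed

lemma contract_replace_step:
  assumes "distinct (labels (Node l us))" "l \<noteq> Some i" "j < length us" "i \<in> set (labels (us ! j))"
    and "\<And>j'. j' < length us \<Longrightarrow> j' \<noteq> j \<Longrightarrow> i \<notin> set (labels (us ! j'))" "vertex (us ! j) i \<noteq> []"
  shows "contract_at (vertex (Node l us) i) (replace_vertex i f (Node l us))
      = Node l (us[j := contract_at (vertex (us ! j) i) (replace_vertex i f (us ! j))])"
    and "replace_vertex i f (Node l us) = Node l (us[j := replace_vertex i f (us ! j)])"
    and "kids_at i (Node l us) = kids_at i (us ! j)"
proof -
  show r: "replace_vertex i f (Node l us) = Node l (us[j := replace_vertex i f (us ! j)])"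
    by (rule replace_vertex_kid) (use assms in auto)
  show "kids_at i (Node l us) = kids_at i (us ! j)"
    by (rule kids_at_kid) (use assms in auto)
  show "contract_at (vertex (Node l us) i) (replace_vertex i f (Node l us))
      = Node l (us[j := contract_at (vertex (us ! j) i) (replace_vertex i f (us ! j))])"
    unfolding r vertex_kid[OF assms(1,3,4)] using assms(3,6) by (simp add: contract_at_Cons)
qed

text \<open>The contracted vertex is unlabeled, and contraction keeps the planar order, so even the
  list of labels is unchanged.\<close>

lemma contract_replace_labels:
  assumes "distinct (labels t)" "i \<in> set (labels t)" "vertex t i \<noteq> []" "butlast (vertex t i) \<notin> unlabeled t"
    and "lab (f (kids_at i t)) = None"
  shows "labels (contract_at (vertex t i) (replace_vertex i f t)) = labels (replace_vertex i f t)"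
  using assms
proof (induction rule: parent_induct)
  case (base a us j ws)
  have b: "contract_at (vertex (Node (Some a) us) i) (replace_vertex i f (Node (Some a) us))
      = Node (Some a) (take j us @ kids (f ws) @ drop (Suc j) us)"
    "replace_vertex i f (Node (Some a) us) = Node (Some a) (us[j := f ws])"
    "kids_at i (Node (Some a) us) = ws"
    by (rule contract_replace_base; use base in blast)+
  have "labels (f ws) = concat (map labels (kids (f ws)))"
    using base.prems unfolding b(3) by (cases "f ws") simp
  then show ?case unfolding b(1) unfolding b(2) using base(3) by (simp add: upd_conv_take_nth_drop)
next
  case (step l us j)
  have s: "contract_at (vertex (Node l us) i) (replace_vertex i f (Node l us))
      = Node l (us[j := contract_at (vertex (us ! j) i) (replace_vertex i f (us ! j))])"
    "replace_vertex i f (Node l us) = Node l (us[j := replace_vertex i f (us ! j)])"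
    "kids_at i (Node l us) = kids_at i (us ! j)"
    by (rule contract_replace_step; use step in blast)+
  show ?case
    unfolding s(1) unfolding s(2) using step.IH[OF step.prems[unfolded s(3)]] step(3)
    by (simp add: upd_conv_take_nth_drop)
qed

lemma contract_replace_lw_tree:
  assumes "distinct (labels t)" "i \<in> set (labels t)" "vertex t i \<noteq> []" "butlast (vertex t i) \<notin> unlabeled t"
    and "\<And>u. u \<in> set (kids (f (kids_at i t))) \<Longrightarrow> fully_labeled u"
  shows "(lw_tree t \<longrightarrow> lw_tree (contract_at (vertex t i) (replace_vertex i f t))) \<and>
    (fully_labeled t \<longrightarrow> fully_labeled (contract_at (vertex t i) (replace_vertex i f t)))"
  using assms
proof (induction rule: parent_induct)
  case (base a us j ws)
  have b: "contract_at (vertex (Node (Some a) us) i) (replace_vertex i f (Node (Some a) us))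
      = Node (Some a) (take j us @ kids (f ws) @ drop (Suc j) us)"
    "replace_vertex i f (Node (Some a) us) = Node (Some a) (us[j := f ws])"
    "kids_at i (Node (Some a) us) = ws"
    by (rule contract_replace_base; use base in blast)+
  show ?case
    unfolding b(1) using base.prems[unfolded b(3)] by (auto dest: in_set_takeD in_set_dropD)
next
  case (step l us j)
  have s: "contract_at (vertex (Node l us) i) (replace_vertex i f (Node l us))
      = Node l (us[j := contract_at (vertex (us ! j) i) (replace_vertex i f (us ! j))])"
    "replace_vertex i f (Node l us) = Node l (us[j := replace_vertex i f (us ! j)])"
    "kids_at i (Node l us) = kids_at i (us ! j)"
    by (rule contract_replace_step; use step in blast)+
  have mem: "us ! j \<in> set us" using step(3) by simp
  show ?case
    unfolding s(1) using step.IH[OF step.prems[unfolded s(3)]] mem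
      set_list_update[OF step(3), of "contract_at (vertex (us ! j) i) (replace_vertex i f (us ! j))"]
    by (cases l) auto
qed

text \<open>The maximal subtrees with a labeled root, from left to right. On a tree of W,
  \<open>con\<close> leaves a single unlabeled vertex with these subtrees above it.\<close>

fun forest :: "'l ptree \<Rightarrow> 'l ptree list" where
  "forest (Node l us) = (if l = None then concat (map forest us) else [Node l us])"

lemma con_fully_labeled: "fully_labeled t \<Longrightarrow> con t = t"
proof (induction t)
  case (Node l us)
  then have "map con us = us" by (intro map_idI) auto
  moreover have "concat (map (\<lambda>v. [v]) us) = us" by (induction us) auto
  ultimately show ?case using Node.prems by (cases l) auto
qed

lemma con_lw_tree: "lw_tree t \<Longrightarrow> lab t = None \<Longrightarrow> con t = Node None (forest t)"
proof (induction t)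
  case (Node l us)
  have "(if lab (con u) = None then kids (con u) else [con u]) = forest u" if u: "u \<in> set us" for u
  proof (cases "lab u = None")
    case True
    then show ?thesis using Node u by auto
  next
    case False
    then have "fully_labeled u" using Node.prems u lw_tree_root_labeled by auto
    then have c: "con u = u" by (rule con_fully_labeled)
    show ?thesis unfolding c using False by (cases u) auto
  qed
  then show ?case using Node.prems by (auto simp: comp_def intro!: arg_cong[where f=concat])
qed

lemma labels_forest: "concat (map labels (forest t)) = labels t"
proof (induction t)
  case (Node l us)
  have "concat (map labels (concat (map forest us))) = concat (map labels us)"
    using Node by (induction us) auto
  then show ?case by (cases l) auto
qed

lemma fully_labeled_forest: "lw_tree t \<Longrightarrow> u \<in> set (forest t) \<Longrightarrow> fully_labeled u"
  by (induction t) (auto split: if_splits)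

lemma forest_map_ptree: "forest (map_ptree f t) = map (map_ptree f) (forest t)"
  by (induction t) (auto simp: map_concat intro!: arg_cong[where f=concat])

lemma swap_at_Node:
  "swap_at (Node l us) A = Node l ((if [] \<in> A then rev else id) (map (\<lambda>j. swap_at (us ! j) {p. j # p \<in> A}) [0..<length us]))"
proof -
  have "map (\<lambda>(j, s). s {p. j # p \<in> A}) (List.enumerate 0 (map swap_at us)) = map (\<lambda>j. swap_at (us ! j) {p. j # p \<in> A}) [0..<length us]"
    by (rule nth_equalityI) (auto simp: nth_enumerate_eq)
  then show ?thesis by (simp add: Let_def)
qed

declare swap_at.simps [simp del]

lemma swap_at_empty: "swap_at t {} = t"
proof (induction t)
  case (Node l us)
  have "map (\<lambda>j. swap_at (us ! j) {}) [0..<length us] = us"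
    by (rule nth_equalityI) (auto simp: Node)
  then show ?case by (simp add: swap_at_Node)
qed

lemma lab_swap_at [simp]: "lab (swap_at t A) = lab t"
  by (cases t) (simp add: swap_at_Node)

lemma swap_at_cherry:
  "swap_at (Node None [a, b]) A =
    Node None (if [] \<in> A then [swap_at b {p. 1 # p \<in> A}, swap_at a {p. 0 # p \<in> A}]
      else [swap_at a {p. 0 # p \<in> A}, swap_at b {p. 1 # p \<in> A}])"
  by (simp add: swap_at_Node)

lemma lw_tree_induct [consumes 1, case_names labeled cherry]:
  assumes "lw_tree t" and "\<And>t. fully_labeled t \<Longrightarrow> P t"
    and "\<And>a b. lw_tree a \<Longrightarrow> lw_tree b \<Longrightarrow> P a \<Longrightarrow> P b \<Longrightarrow> P (Node None [a, b])"
  shows "P t"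
  using assms(1)
proof (induction t)
  case (Node l us)
  show ?case
  proof (cases l)
    case None
    then obtain a b where "us = [a, b]" using Node.prems by (auto simp: length_Suc_conv numeral_2_eq_2)
    then show ?thesis using Node None assms(3) by auto
  next
    case (Some i)
    then show ?thesis using Node.prems by (intro assms(2)) simp
  qed
qed

lemma swap_at_lw_tree:
  assumes "lw_tree t" "A \<subseteq> unlabeled t"
  shows "lw_tree (swap_at t A) \<and> mset (labels (swap_at t A)) = mset (labels t)"
  using assms
proof (induction arbitrary: A rule: lw_tree_induct)
  case (labeled t)
  then have "A = {}" using unlabeled_empty_iff by blast
  then show ?case using labeled by (simp add: swap_at_empty fully_labeled_lw_tree)
next
  case (cherry a b)
  have "{p. 0 # p \<in> A} \<subseteq> unlabeled a" "{p. 1 # p \<in> A} \<subseteq> unlabeled b"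
    using cherry.prems unlabeled_Cons[of 0 _ None "[a, b]"] unlabeled_Cons[of 1 _ None "[a, b]"] by auto
  note IH = cherry.IH(1)[OF this(1)] cherry.IH(2)[OF this(2)]
  then show ?case by (simp add: swap_at_cherry)
qed

lemma swap_at_map_ptree: "swap_at (map_ptree f t) A = map_ptree f (swap_at t A)"
proof (induction t arbitrary: A)
  case (Node l us)
  have "map (\<lambda>j. swap_at (map (map_ptree f) us ! j) {p. j # p \<in> A}) [0..<length us] =
    map (map_ptree f) (map (\<lambda>j. swap_at (us ! j) {p. j # p \<in> A}) [0..<length us])"
    by (rule nth_equalityI) (auto simp: Node)
  then show ?case by (simp add: swap_at_Node rev_map)
qed

lemma unlabeled_map_ptree: "unlabeled (map_ptree f t) = unlabeled t"
  by (induction t) (auto simp: unlabeled_Node)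

lemma vertex_map_ptree:
  assumes "distinct (labels t)" "i \<in> set (labels t)" "inj_on f (set (labels t))"
  shows "vertex (map_ptree f t) (f i) = vertex t i"
  using assms
proof (induction rule: path_induct)
  case (root us)
  have "distinct (labels (map_ptree f (Node (Some i) us)))"
    unfolding labels_map_ptree using root by (simp add: distinct_map del: labels.simps)
  then show ?case using root(1) by (simp add: vertex_root)
next
  case (kid l us j)
  have d: "distinct (labels (map_ptree f (Node l us)))"
    unfolding labels_map_ptree using kid.prems kid(1) by (simp add: distinct_map del: labels.simps)
  have "set (labels (us ! j)) \<subseteq> set (labels (Node l us))" using kid(3) by auto
  then have "inj_on f (set (labels (us ! j)))" using kid.prems inj_on_subset by blast
  then have IH: "vertex (map_ptree f (us ! j)) (f i) = vertex (us ! j) i" by (rule kid.IH)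
  have "vertex (map_ptree f (Node l us)) (f i) = j # vertex (map (map_ptree f) us ! j) (f i)"
    using d kid(3,4) by (simp only: ptree.map) (rule vertex_kid, simp_all add: labels_map_ptree)
  then show ?case using kid(1,3,4) IH vertex_kid by simp
qed

lemma kids_at_map_ptree: "inj_on f (insert i (set (labels t))) \<Longrightarrow> kids_at (f i) (map_ptree f t) = map (map_ptree f) (kids_at i t)"
proof (induction t)
  case (Node l us)
  have sub: "inj_on f (insert i (set (labels u)))" if "u \<in> set us" for u
    by (rule inj_on_subset[OF Node.prems]) (use that in auto)
  show ?case
  proof (cases "l = Some i")
    case False
    have "map_option f l \<noteq> Some (f i)"
      using False Node.prems by (cases l) (auto simp: inj_on_def)
    moreover have "kids_at (f i) (map_ptree f u) = map (map_ptree f) (kids_at i u)" if "u \<in> set us" for u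
      by (rule Node.IH[OF that sub[OF that]])
    then have "concat (map (kids_at (f i) \<circ> map_ptree f) us) = concat (map (map (map_ptree f) \<circ> kids_at i) us)"
      by (intro arg_cong[where f=concat] map_cong refl) simp
    ultimately show ?thesis using False by (cases l) (auto simp: map_concat)
  qed simp
qed

subsection \<open>Partial compositions of trees\<close>

definition shift_above :: "nat \<Rightarrow> nat \<Rightarrow> nat \<Rightarrow> nat" where
  "shift_above i n j = (if i < j then j + n - 1 else j)"

definition shift_by :: "nat \<Rightarrow> nat \<Rightarrow> nat" where
  "shift_by i j = j + i - 1"

locale tree_composition =
  fixes m n i :: nat and T R :: "nat ptree"
  assumes m: "1 \<le> m" and n: "1 \<le> n" and i: "1 \<le> i" "i \<le> m"
    and T: "T \<in> LW_trees m" and R: "R \<in> LW_trees n"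
begin

abbreviation "sT \<equiv> shift_above i n"
abbreviation "sR \<equiv> shift_by i"
abbreviation "T' \<equiv> map_ptree sT T"

lemma T_props: "lw_tree T" "distinct (labels T)" "set (labels T) = {1..m}"
  using T LW_trees_iff[OF m] by auto

lemma R_props: "lw_tree R" "distinct (labels R)" "set (labels R) = {1..n}"
  using R LW_trees_iff[OF n] by auto

lemma inj_sT: "inj_on sT S"
  using n by (auto simp: inj_on_def shift_above_def split: if_splits)

lemma sT_i [simp]: "sT i = i"
  by (simp add: shift_above_def)

lemma inj_sR: "inj_on sR {1..}"
  using i by (auto simp: inj_on_def shift_by_def)

lemma T'_props: "lw_tree T'" "distinct (labels T')" "set (labels T') = sT ` {1..m}" "i \<in> set (labels T')"
proof -
  show "lw_tree T'" using T_props by simp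
  show "distinct (labels T')" using T_props inj_sT by (simp add: labels_map_ptree distinct_map)
  show "set (labels T') = sT ` {1..m}" using T_props by (simp add: labels_map_ptree)
  then show "i \<in> set (labels T')" using i by (auto intro!: rev_image_eqI[of i])
qed

lemma vertex_T': "vertex T' i = vertex T i"
  using vertex_map_ptree[of T i sT] T_props i inj_sT by simp

lemma kids_at_T': "kids_at i T' = map (map_ptree sT) (kids_at i T)"
  using kids_at_map_ptree[of sT i T, OF inj_sT] by (simp only: sT_i)

lemma length_kids: "length (kids (subtree T (vertex T i))) = length (kids_at i T')"
  using kids_at_vertex[of T i] T_props i by (simp add: kids_at_T')

definition graftings :: "nat ptree \<Rightarrow> nat list set" where
  "graftings S = {\<phi>. length \<phi> = length (kids_at i T') \<and> set \<phi> \<subseteq> set (labels (map_ptree sR S))}"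

definition insert_tree :: "nat ptree \<Rightarrow> nat list \<Rightarrow> nat ptree" where
  "insert_tree S \<phi> = replace_vertex i (\<lambda>us. graft (zip \<phi> us) (map_ptree sR S)) T'"

lemma pt_comp_eq: "pt_comp n i T S = (\<Sum>\<phi>\<in>graftings S. unit_vec (insert_tree S \<phi>))"
  unfolding pt_comp_def Let_def insert_tree_def graftings_def length_kids
  by (simp add: set_labels shift_above_def[abs_def] shift_by_def[abs_def])

text \<open>The label \<open>i\<close> occurs in the shifted \<open>T\<close> and again, as the
  image of 1, in the shifted \<open>R\<close>; once it is removed from the former, the two sets of
  labels partition the range.\<close>

lemma image_labels: "insert i (sT ` {1..m}) = sT ` {1..m}" "sT ` {1..m} \<inter> sR ` {1..n} = {i}"
  "(sT ` {1..m} - {i}) \<union> sR ` {1..n} = {1..m + n - 1}"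
proof -
  have 1: "sT ` {1..m} = {1..i} \<union> {i + n..m + n - 1}"
  proof (intro Set.set_eqI iffI)
    fix x assume "x \<in> {1..i} \<union> {i + n..m + n - 1}"
    then show "x \<in> sT ` {1..m}"
    proof
      assume "x \<in> {i + n..m + n - 1}"
      then have "x = sT (x + 1 - n)" "x + 1 - n \<in> {1..m}" using n i by (auto simp: shift_above_def)
      then show ?thesis by blast
    qed (use i in \<open>auto simp: shift_above_def intro!: rev_image_eqI[of x]\<close>)
  qed (use i n in \<open>auto simp: shift_above_def\<close>)
  have 2: "sR ` {1..n} = {i..i + n - 1}"
  proof (intro Set.set_eqI iffI)
    fix x assume "x \<in> {i..i + n - 1}"
    then have "x = sR (x + 1 - i)" "x + 1 - i \<in> {1..n}" using i by (auto simp: shift_by_def)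
    then show "x \<in> sR ` {1..n}" by blast
  qed (use i in \<open>auto simp: shift_by_def\<close>)
  show "insert i (sT ` {1..m}) = sT ` {1..m}" "sT ` {1..m} \<inter> sR ` {1..n} = {i}"
    "(sT ` {1..m} - {i}) \<union> sR ` {1..n} = {1..m + n - 1}"
    unfolding 1 2 using i n by auto
qed

text \<open>Stated for every \<open>S\<close> with the labels of \<open>R\<close>, so that it
  applies to the swapped and contracted forms of \<open>R\<close>.\<close>

lemma mset_insert_tree:
  assumes S: "mset (labels S) = mset (labels R)" and \<phi>: "\<phi> \<in> graftings S"
  shows "mset (labels (insert_tree S \<phi>)) = mset_set {1..m + n - 1}"
proof -
  let ?us = "kids_at i T'" and ?S = "map_ptree sR S"
  have dS: "distinct (labels S)" "set (labels S) = {1..n}"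
    using mset_eq_imp_distinct_iff[OF S] mset_eq_setD[OF S] R_props by simp_all
  have "distinct (labels ?S)"
    using dS inj_on_subset[OF inj_sR] by (simp add: labels_map_ptree distinct_map)
  then have "mset (labels (graft (zip \<phi> ?us) ?S)) = mset (labels ?S) + (\<Sum>u\<leftarrow>?us. mset (labels u))"
    using \<phi> by (intro mset_graft) (auto simp: graftings_def)
  then have "mset (labels (insert_tree S \<phi>)) + {#i#} = mset (labels T') + mset (labels ?S)"
    using mset_replace_vertex[OF T'_props(2,4), of "\<lambda>us. graft (zip \<phi> us) ?S"]
    by (simp add: insert_tree_def)
  moreover have "mset (labels T') = mset_set (sT ` {1..m})"
    using mset_set_set[OF T'_props(2)] T'_props(3) by simp
  moreover have "mset (labels ?S) = mset_set (sR ` {1..n})"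
    using mset_set_set[OF \<open>distinct (labels ?S)\<close>] dS by (simp add: labels_map_ptree)
  moreover have "mset_set (sT ` {1..m}) = add_mset i (mset_set (sT ` {1..m} - {i}))"
    using image_labels(1) by (metis finite_atLeastAtMost finite_imageI insertI1 mset_set.remove)
  moreover have "mset_set {1..m + n - 1} = mset_set (sT ` {1..m} - {i}) + mset_set (sR ` {1..n})"
    unfolding image_labels(3)[symmetric] using image_labels(2) by (intro mset_set_Union) auto
  ultimately show ?thesis by simp
qed

lemma kids_T'_fully_labeled: "(w, u) \<in> set (zip \<phi> (kids_at i T')) \<Longrightarrow> fully_labeled u"
  using fully_labeled_kids_at[OF T'_props(2,4,1)] by (auto dest: set_zip_rightD)

definition contracted :: bool where
  "contracted \<longleftrightarrow> R \<in> W_trees n \<and> vertex T i \<noteq> [] \<and> butlast (vertex T i) \<notin> unlabeled T"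

lemma insert_tree_LW:
  assumes \<phi>: "\<phi> \<in> graftings R" and c: "\<not> contracted"
  shows "insert_tree R \<phi> \<in> LW_trees (m + n - 1)"
proof -
  let ?f = "\<lambda>us. graft (zip \<phi> us) (map_ptree sR R)"
  have "lw_tree (insert_tree R \<phi>)"
  proof (cases "fully_labeled R")
    case True
    then have "fully_labeled (?f (kids_at i T'))"
      by (intro fully_labeled_graft) (auto intro: kids_T'_fully_labeled)
    from replace_vertex_fully_labeled[where f="?f", OF T'_props(2,4) this] T'_props(1)
    show ?thesis unfolding insert_tree_def by simp
  next
    case False
    then have "lab R = None" using R_props lw_tree_root_labeled by blast
    then have "R \<in> W_trees n" using R_props by (simp add: W_trees_iff)
    then have v: "vertex T' i = [] \<or> butlast (vertex T' i) \<in> unlabeled T'"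
      using c by (auto simp: contracted_def vertex_T' unlabeled_map_ptree)
    have "lw_tree (?f (kids_at i T'))"
      using R_props(1) by (intro lw_tree_graft) (auto intro: kids_T'_fully_labeled)
    from replace_vertex_lw_tree[where f="?f", OF T'_props(2,4,1) this v]
    show ?thesis unfolding insert_tree_def .
  qed
  moreover have "1 \<le> m + n - 1" using m n by simp
  ultimately show ?thesis
    using mset_insert_tree[OF refl \<phi>] by (simp add: LW_trees_mset_iff)
qed

lemma con_swap:
  assumes "R \<in> W_trees n" "A \<subseteq> unlabeled R"
  shows "con (swap_at R A) = Node None (forest (swap_at R A))"
    and "mset (labels (con (swap_at R A))) = mset (labels R)"
    and "u \<in> set (forest (swap_at R A)) \<Longrightarrow> fully_labeled u"
proof -
  have lw: "lw_tree (swap_at R A)" "mset (labels (swap_at R A)) = mset (labels R)" "lab (swap_at R A) = None"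
    using swap_at_lw_tree[OF _ assms(2)] assms(1) by (simp_all add: W_trees_iff)
  show c: "con (swap_at R A) = Node None (forest (swap_at R A))"
    by (rule con_lw_tree[OF lw(1,3)])
  show "mset (labels (con (swap_at R A))) = mset (labels R)"
    unfolding c by (simp add: labels_forest lw(2))
  show "u \<in> set (forest (swap_at R A)) \<Longrightarrow> fully_labeled u"
    by (rule fully_labeled_forest[OF lw(1)])
qed

lemma contracted_tree_LW:
  assumes c: contracted and A: "A \<subseteq> unlabeled R" and \<phi>: "\<phi> \<in> graftings (con (swap_at R A))"
  shows "contract_at (vertex T i) (insert_tree (con (swap_at R A)) \<phi>) \<in> LW_trees (m + n - 1)"
proof -
  let ?S = "con (swap_at R A)"
  let ?f = "\<lambda>us. graft (zip \<phi> us) (map_ptree sR ?S)"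
  have W: "R \<in> W_trees n" and v: "vertex T' i \<noteq> []" "butlast (vertex T' i) \<notin> unlabeled T'"
    using c by (auto simp: contracted_def vertex_T' unlabeled_map_ptree)
  note S = con_swap[OF W A]
  have k: "fully_labeled u" if "u \<in> set (kids (?f (kids_at i T')))" for u
    using that S(3) by (auto simp: S(1) intro!: fully_labeled_graft intro: kids_T'_fully_labeled)
  have "lw_tree (contract_at (vertex T' i) (replace_vertex i ?f T'))"
    using contract_replace_lw_tree[where f="?f", OF T'_props(2,4) v k] T'_props(1) by simp
  moreover have "labels (contract_at (vertex T' i) (replace_vertex i ?f T')) = labels (insert_tree ?S \<phi>)"
    unfolding insert_tree_def by (rule contract_replace_labels[OF T'_props(2,4) v]) (simp add: S(1))
  moreover have "1 \<le> m + n - 1" using m n by simp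
  ultimately show ?thesis
    using mset_insert_tree[OF S(2) \<phi>] by (simp add: LW_trees_mset_iff vertex_T' insert_tree_def)
qed

lemma LW_tree_comp_eq:
  "LW_tree_comp n i T R = (if contracted
     then \<Sum>A\<in>Pow (unlabeled R). pm_scale ((-1) ^ card A)
       (\<Sum>\<phi>\<in>graftings (con (swap_at R A)). unit_vec (contract_at (vertex T i) (insert_tree (con (swap_at R A)) \<phi>)))
     else \<Sum>\<phi>\<in>graftings R. unit_vec (insert_tree R \<phi>))"
  unfolding LW_tree_comp_def Let_def contracted_def pt_comp_eq
  by (simp add: lin_sum[OF linear_pm_lin] pm_lin_unit)

lemma keys_LW_tree_comp:
  "Poly_Mapping.keys (LW_tree_comp n i T R :: nat ptree \<Rightarrow>\<^sub>0 'k::field) \<subseteq> LW_trees (m + n - 1)"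
proof -
  note S = subspace_keys[of "LW_trees (m + n - 1)"]
  note cl = subsp_sum[OF vector_space_pm_scale S] subsp_scale[OF vector_space_pm_scale S]
  have "(LW_tree_comp n i T R :: nat ptree \<Rightarrow>\<^sub>0 'k) \<in> {x. Poly_Mapping.keys x \<subseteq> LW_trees (m + n - 1)}"
  proof (cases contracted)
    case True
    have "(unit_vec (contract_at (vertex T i) (insert_tree (con (swap_at R A)) \<phi>)) :: nat ptree \<Rightarrow>\<^sub>0 'k)
        \<in> {x. Poly_Mapping.keys x \<subseteq> LW_trees (m + n - 1)}"
      if "A \<in> Pow (unlabeled R)" "\<phi> \<in> graftings (con (swap_at R A))" for A \<phi>
      using contracted_tree_LW[OF True, of A \<phi>] that by simp
    then show ?thesis unfolding LW_tree_comp_eq if_P[OF True] by (intro cl)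
  next
    case False
    then show ?thesis unfolding LW_tree_comp_eq if_not_P[OF False]
      by (intro cl) (use insert_tree_LW in auto)
  qed
  then show ?thesis by simp
qed

end

subsection \<open>Evaluation of trees in a post-Lie algebra\<close>

text \<open>The grafting \<open>\<phi>\<close> as a family of lists indexed by labels, the form in
  which \<open>evg\<close> takes it.\<close>

definition attached :: "'l list \<Rightarrow> 'x list \<Rightarrow> 'l \<Rightarrow> 'x list" where
  "attached \<phi> us l = map snd (filter (\<lambda>(w, u). w = l) (zip \<phi> us))"

lemma attached_Nil [simp]: "attached [] us = (\<lambda>l. [])" "attached \<phi> [] = (\<lambda>l. [])"
  by (simp_all add: fun_eq_iff attached_def)

lemma attached_Cons: "attached (w # \<phi>) (u # us) = (attached \<phi> us)(w := u # attached \<phi> us w)"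
  by (auto simp: fun_eq_iff attached_def)

lemma attached_map: "attached \<phi> (map f us) l = map f (attached \<phi> us l)"
  by (induction \<phi> us arbitrary: l rule: list_induct2') (simp_all add: attached_Cons)

lemma sum_words_Suc:
  assumes "finite S"
  shows "(\<Sum>\<phi> | length \<phi> = Suc n \<and> set \<phi> \<subseteq> S. f \<phi>) = (\<Sum>\<phi> | length \<phi> = n \<and> set \<phi> \<subseteq> S. \<Sum>l\<in>S. f (l # \<phi>))"
proof -
  have words: "{\<phi>. length \<phi> = Suc n \<and> set \<phi> \<subseteq> S} = (\<lambda>x. snd x # fst x) ` ({\<phi>. length \<phi> = n \<and> set \<phi> \<subseteq> S} \<times> S)"
    by (auto simp: length_Suc_conv image_iff)
  have inj: "inj_on (\<lambda>x. snd x # fst x) ({\<phi>. length \<phi> = n \<and> set \<phi> \<subseteq> S} \<times> S)"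
    by (auto simp: inj_on_def)
  show ?thesis
    unfolding words sum.reindex[OF inj] by (simp add: sum.cartesian_product case_prod_beta)
qed

context post_lie
begin

text \<open>A labeled vertex lets the values above it act by the recursion, an unlabeled one takes
  their bracket. The default 0 for a wrong number of subtrees keeps the value linear in each
  argument.\<close>

definition node_val :: "('l \<Rightarrow> 'g list) \<Rightarrow> ('l \<Rightarrow> 'g) \<Rightarrow> 'l option \<Rightarrow> 'g list \<Rightarrow> 'g" where
  "node_val G e l zs = (case l of Some i \<Rightarrow> W (G i @ zs) (e i)
     | None \<Rightarrow> (case zs of [a, b] \<Rightarrow> bracket a b | _ \<Rightarrow> 0))"

text \<open>\<open>evg G e t\<close> is the value of the tree \<open>t\<close> with the elements of \<open>G i\<close> grafted to the left onto the vertex \<open>i\<close>.\<close>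

primrec evg :: "('l \<Rightarrow> 'g list) \<Rightarrow> ('l \<Rightarrow> 'g) \<Rightarrow> 'l ptree \<Rightarrow> 'g" where
  "evg G e (Node l us) = node_val G e l (map (evg G e) us)"

abbreviation ev :: "('l \<Rightarrow> 'g) \<Rightarrow> 'l ptree \<Rightarrow> 'g" where
  "ev \<equiv> evg (\<lambda>_. [])"

lemma evg_cong:
  "(\<And>l. l \<in> set (labels t) \<Longrightarrow> G l = G' l \<and> e l = e' l) \<Longrightarrow> evg G e t = evg G' e' t"
proof (induction t)
  case (Node l us)
  have "map (evg G e) us = map (evg G' e') us"
    using Node by (intro map_cong refl Node.IH) auto
  moreover have "node_val G e l zs = node_val G' e' l zs" for zs
    using Node.prems by (auto simp: node_val_def split: option.splits)
  ultimately show ?case by (simp only: evg.simps)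
qed

lemma ev_map_ptree: "ev e (map_ptree f t) = ev (\<lambda>l. e (f l)) t"
proof (induction t)
  case (Node l us)
  have "map (\<lambda>u. ev e (map_ptree f u)) us = map (ev (\<lambda>l. e (f l))) us"
    using Node by simp
  moreover have "node_val (\<lambda>_. []) e (map_option f l) zs = node_val (\<lambda>_. []) (\<lambda>l. e (f l)) l zs" for zs
    by (cases l) (simp_all add: node_val_def)
  ultimately show ?case by (simp only: ptree.map evg.simps map_map comp_def)
qed

lemma evg_graft: "ev e (graft (zip \<phi> us) t) = evg (attached \<phi> (map (ev e) us)) e t"
proof (induction t)
  case (Node l ts)
  have "map (\<lambda>t. ev e (graft (zip \<phi> us) t)) ts = map (evg (attached \<phi> (map (ev e) us)) e) ts"
    using Node by simp
  note m = this
  have f: "filter (\<lambda>(w, u). i = w) gs = filter (\<lambda>(w, u). w = i) gs" for i :: 'a and gs :: "('a \<times> 'a ptree) list"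
    by (intro filter_cong) auto
  have nv: "node_val (\<lambda>_. []) e l (map (ev e) (map snd (filter (\<lambda>(w, u). l = Some w) (zip \<phi> us))) @ zs) =
      node_val (attached \<phi> (map (ev e) us)) e l zs" for zs
  proof (cases l)
    case (Some i)
    then show ?thesis by (simp add: node_val_def attached_map f) (simp add: attached_def)
  qed (simp add: node_val_def)
  have "ev e (graft (zip \<phi> us) (Node l ts)) = node_val (\<lambda>_. []) e l
      (map (ev e) (map snd (filter (\<lambda>(w, u). l = Some w) (zip \<phi> us))) @ map (\<lambda>t. ev e (graft (zip \<phi> us) t)) ts)"
    by (simp add: comp_def)
  then show ?case by (simp only: m nv evg.simps)
qed

lemma linear_node_val: "is_linear scale scale (\<lambda>z. node_val G e l (us @ z # vs))"
proof (cases l)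
  case (Some i)
  then show ?thesis
    using g.linear_wact_word[of "G i @ us" vs "e i"] by (simp add: node_val_def)
next
  case None
  consider (1) v where "us = []" "vs = [v]" | (2) u where "us = [u]" "vs = []" | (3) "length us + length vs \<noteq> 1"
    by (cases us; cases vs) (auto simp: length_Suc_conv)
  then show ?thesis
  proof cases
    case 3
    then have "node_val G e l (us @ z # vs) = 0" for z
      using None by (auto simp: node_val_def split: list.splits simp: append_eq_Cons_conv)
    then show ?thesis using lin_zero_fun[OF vs vs] by simp
  qed (use None bracket_linear_left bracket_linear_right in \<open>simp_all add: node_val_def\<close>)
qed

lemma linear_node_val_update:
  assumes "j < length zs"
  shows "is_linear scale scale (\<lambda>z. node_val G e l (zs[j := z]))"
  using linear_node_val assms by (simp add: upd_conv_take_nth_drop)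

text \<open>The two ways in which the derivation \<open>x \<triangleright>\<close> acts on the list attached to a vertex.\<close>

definition push :: "'g \<Rightarrow> 'g list \<Rightarrow> ('g list \<Rightarrow> 'g) \<Rightarrow> 'g" where
  "push x zs h = h (x # zs) + ds x h zs"

lemma push_linear: "is_linear scale scale f \<Longrightarrow> f (push x zs h) = push x zs (\<lambda>ys. f (h ys))"
  by (simp add: push_def lin_add dsum_linear)

text \<open>Leibniz rule at one vertex. At a labeled vertex it is the recursion for \<open>x\<close>
  in front of the list, solved for \<open>p x\<close>; at an unlabeled one it is
  \<open>p_bracket\<close>.\<close>

lemma node_val_der:
  "p x (node_val G e l zs) = (case l of None \<Rightarrow> 0 | Some i \<Rightarrow> push x (G i) (\<lambda>ys. node_val (G(i := ys)) e l zs))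
     + (\<Sum>j<length zs. node_val G e l (zs[j := p x (zs ! j)]))"
proof (cases l)
  case (Some i)
  have "p x (W ys (e i)) = W (x # ys) (e i) + ds x (\<lambda>ys. W ys (e i)) ys" for ys
    by (simp add: wact_Cons)
  then show ?thesis
    by (simp add: Some node_val_def push_def dsum_append add.assoc) (simp add: dsum_def)
next
  case None
  consider (1) a b where "zs = [a, b]" | (2) "length zs \<noteq> 2"
    by (cases "length zs = 2") (auto simp: length_Suc_conv numeral_2_eq_2)
  then show ?thesis
  proof cases
    case 1
    then show ?thesis
      by (simp add: None node_val_def p_bracket numeral_2_eq_2)
  next
    case 2
    then have "node_val G e l ys = 0" if "length ys = length zs" for ys
      using that None by (auto simp: node_val_def split: list.splits)
    then show ?thesis by (simp add: None lin_0[OF p_linear_right])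
  qed
qed

text \<open>Leibniz rule for a whole tree: \<open>p x\<close> passes from each vertex to the
  subtrees above it; at every labeled vertex \<open>x\<close> is either grafted or acts on a value
  already attached there.\<close>

lemma der_evg:
  assumes "distinct (labels t)"
  shows "p x (evg G e t) = (\<Sum>l\<in>set (labels t). push x (G l) (\<lambda>zs. evg (G(l := zs)) e t))"
  using assms
proof (induction t)
  case (Node r us)
  let ?f = "evg G e"
  let ?L = "\<lambda>j. set (labels (us ! j))"
  have kid: "(\<Sum>l\<in>?L j. push x (G l) (\<lambda>zs. evg (G(l := zs)) e (Node r us))) =
      node_val G e r ((map ?f us)[j := p x (?f (us ! j))])" if j: "j < length us" for j
  proof -
    have eq: "evg (G(l := zs)) e (Node r us) = node_val G e r ((map ?f us)[j := evg (G(l := zs)) e (us ! j)])"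
      if l: "l \<in> ?L j" for l zs
    proof -
      have "map (evg (G(l := zs)) e) us = (map ?f us)[j := evg (G(l := zs)) e (us ! j)]"
      proof (rule nth_equalityI)
        fix k assume "k < length (map (evg (G(l := zs)) e) us)"
        then have k: "k < length us" by simp
        show "map (evg (G(l := zs)) e) us ! k = (map ?f us)[j := evg (G(l := zs)) e (us ! j)] ! k"
        proof (cases "k = j")
          case False
          then have "l \<notin> ?L k" using distinct_labels_kids_disjoint[OF Node.prems j k] l by auto
          then have "evg (G(l := zs)) e (us ! k) = ?f (us ! k)" by (intro evg_cong) auto
          then show ?thesis using k False by simp
        qed (use k in simp)
      qed simp
      moreover have "r \<noteq> Some l"
        using Node.prems j l by auto
      then have "node_val (G(l := zs)) e r ys = node_val G e r ys" for ys
        by (auto simp: node_val_def split: option.splits)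
      ultimately show ?thesis by simp
    qed
    let ?N = "\<lambda>z. node_val G e r ((map ?f us)[j := z])"
    have N: "is_linear scale scale ?N" by (rule linear_node_val_update) (simp add: j)
    have "(\<Sum>l\<in>?L j. push x (G l) (\<lambda>zs. evg (G(l := zs)) e (Node r us)))
      = (\<Sum>l\<in>?L j. ?N (push x (G l) (\<lambda>zs. evg (G(l := zs)) e (us ! j))))"
      by (intro sum.cong refl) (simp only: push_linear[OF N] eq)
    also have "\<dots> = ?N (\<Sum>l\<in>?L j. push x (G l) (\<lambda>zs. evg (G(l := zs)) e (us ! j)))"
      by (simp only: lin_sum[OF N])
    also have "(\<Sum>l\<in>?L j. push x (G l) (\<lambda>zs. evg (G(l := zs)) e (us ! j))) = p x (?f (us ! j))"
      by (rule Node.IH[symmetric]) (use j distinct_labels_kid[OF Node.prems] in auto)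
    finally show ?thesis .
  qed
  have disj: "?L j \<inter> ?L k = {}" if "j < length us" "k < length us" "j \<noteq> k" for j k
    by (rule distinct_labels_kids_disjoint[OF Node.prems that])
  have kids: "(\<Sum>l\<in>(\<Union>j<length us. ?L j). push x (G l) (\<lambda>zs. evg (G(l := zs)) e (Node r us))) =
      (\<Sum>j<length us. node_val G e r ((map ?f us)[j := p x (?f (us ! j))]))"
    by (subst sum.UNION_disjoint) (use disj kid in auto)
  have U: "(\<Union>j<length us. ?L j) = (\<Union>u\<in>set us. set (labels u))" by (auto simp: set_conv_nth)
  have root: "evg (G(i := zs)) e (Node r us) = node_val (G(i := zs)) e r (map ?f us)" if "r = Some i" for i zs
  proof -
    have "i \<notin> set (labels u)" if "u \<in> set us" for u using Node.prems \<open>r = Some i\<close> that by auto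
    then have "map (evg (G(i := zs)) e) us = map ?f us"
      by (intro map_cong refl evg_cong) auto
    then show ?thesis by (simp only: evg.simps)
  qed
  show ?case
  proof (cases r)
    case None
    then have "set (labels (Node r us)) = (\<Union>j<length us. ?L j)" unfolding U by simp
    then show ?thesis unfolding evg.simps node_val_der using kids None by simp
  next
    case (Some i)
    then have labels: "set (labels (Node r us)) = insert i (\<Union>j<length us. ?L j)" unfolding U by simp
    have "i \<notin> (\<Union>j<length us. ?L j)" unfolding U using Node.prems Some by auto
    moreover have "finite (\<Union>j<length us. ?L j)" by simp
    ultimately have "(\<Sum>l\<in>set (labels (Node r us)). push x (G l) (\<lambda>zs. evg (G(l := zs)) e (Node r us)))
      = push x (G i) (\<lambda>zs. evg (G(i := zs)) e (Node r us)) + (\<Sum>l\<in>(\<Union>j<length us. ?L j). push x (G l) (\<lambda>zs. evg (G(l := zs)) e (Node r us)))"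
      unfolding labels by (intro sum.insert)
    also note kids
    finally have "(\<Sum>l\<in>set (labels (Node r us)). push x (G l) (\<lambda>zs. evg (G(l := zs)) e (Node r us)))
      = push x (G i) (\<lambda>zs. evg (G(i := zs)) e (Node r us)) + (\<Sum>j<length us. node_val G e r ((map ?f us)[j := p x (?f (us ! j))]))" .
    moreover have "p x (evg G e (Node r us)) = push x (G i) (\<lambda>ys. node_val (G(i := ys)) e r (map ?f us))
        + (\<Sum>j<length us. node_val G e r ((map ?f us)[j := p x (?f (us ! j))]))"
      unfolding evg.simps node_val_der by (simp add: Some)
    ultimately show ?thesis by (simp only: root[OF Some])
  qed
qed

text \<open>Acting on one entry of \<open>us\<close> is acting on one entry of the list at the
  vertex that receives it.\<close>

lemma dsum_attached:
  assumes "length \<phi> = length us" "set \<phi> \<subseteq> S" "finite S"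
  shows "ds x (\<lambda>vs. h (attached \<phi> vs)) us = (\<Sum>l\<in>S. ds x (\<lambda>zs. h ((attached \<phi> us)(l := zs))) (attached \<phi> us l))"
  using assms
proof (induction \<phi> us arbitrary: h rule: list_induct2)
  case (Cons w \<phi> u us)
  let ?G = "attached \<phi> us"
  let ?h = "\<lambda>G. h (G(w := u # G w))"
  have w: "w \<in> S" and fin: "finite S" using Cons.prems by auto
  have "ds x (\<lambda>vs. h (attached (w # \<phi>) vs)) (u # us) = h (?G(w := p x u # ?G w)) + ds x (\<lambda>vs. ?h (attached \<phi> vs)) us"
    by (simp add: dsum_Cons attached_Cons)
  also have "ds x (\<lambda>vs. ?h (attached \<phi> vs)) us = (\<Sum>l\<in>S. ds x (\<lambda>zs. ?h (?G(l := zs))) (?G l))"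
    by (rule Cons.IH) (use Cons.prems in auto)
  also have "\<dots> = ds x (\<lambda>zs. h (?G(w := u # zs))) (?G w) + (\<Sum>l\<in>S - {w}. ds x (\<lambda>zs. ?h (?G(l := zs))) (?G l))"
    by (simp add: sum.remove[OF fin w])
  also have "(\<Sum>l\<in>S - {w}. ds x (\<lambda>zs. ?h (?G(l := zs))) (?G l))
    = (\<Sum>l\<in>S - {w}. ds x (\<lambda>zs. h ((attached (w # \<phi>) (u # us))(l := zs))) (attached (w # \<phi>) (u # us) l))"
  proof (intro sum.cong refl)
    fix l assume "l \<in> S - {w}"
    then have "w \<noteq> l" by auto
    then show "ds x (\<lambda>zs. ?h (?G(l := zs))) (?G l) =
        ds x (\<lambda>zs. h ((attached (w # \<phi>) (u # us))(l := zs))) (attached (w # \<phi>) (u # us) l)"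
      by (simp add: attached_Cons fun_upd_twist[of w l])
  qed
  also have "h (?G(w := p x u # ?G w)) + (ds x (\<lambda>zs. h (?G(w := u # zs))) (?G w) + \<dots>) =
    (\<Sum>l\<in>S. ds x (\<lambda>zs. h ((attached (w # \<phi>) (u # us))(l := zs))) (attached (w # \<phi>) (u # us) l))"
    by (simp add: sum.remove[OF fin w] attached_Cons dsum_Cons add.assoc)
  finally show ?case .
qed simp

text \<open>The link between the recursion and operadic composition: a word acts on the value of a
  tree by all graftings of its letters. The terms of \<open>der_evg\<close> in which
  \<open>x\<close> acts on an attached value cancel against the subtracted terms of the
  recursion.\<close>

lemma W_ev:
  assumes "distinct (labels t)"
  shows "W us (ev e t) = (\<Sum>\<phi> | length \<phi> = length us \<and> set \<phi> \<subseteq> set (labels t). evg (attached \<phi> us) e t)"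
proof (induction us rule: length_induct_list)
  case Nil
  have "{\<phi>. length \<phi> = length [] \<and> set \<phi> \<subseteq> set (labels t)} = {[]}" by auto
  then show ?case by simp
next
  case (Cons x us)
  let ?L = "set (labels t)" and ?\<Phi> = "{\<phi>. length \<phi> = length us \<and> set \<phi> \<subseteq> set (labels t)}"
  have "ds x (\<lambda>zs. W zs (ev e t)) us = ds x (\<lambda>zs. \<Sum>\<phi>\<in>?\<Phi>. evg (attached \<phi> zs) e t) us"
    by (rule dsum_cong) (simp add: Cons.IH)
  also have "\<dots> = (\<Sum>\<phi>\<in>?\<Phi>. ds x (\<lambda>zs. evg (attached \<phi> zs) e t) us)"
    unfolding dsum_def by (rule sum.swap)
  finally have ds: "ds x (\<lambda>zs. W zs (ev e t)) us = \<dots>" .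
  have "p x (W us (ev e t)) = (\<Sum>\<phi>\<in>?\<Phi>. p x (evg (attached \<phi> us) e t))"
    by (simp add: Cons.IH[OF refl] lin_sum[OF p_linear_right])
  also have "\<dots> = (\<Sum>\<phi>\<in>?\<Phi>. (\<Sum>l\<in>?L. evg (attached (l # \<phi>) (x # us)) e t) + ds x (\<lambda>zs. evg (attached \<phi> zs) e t) us)"
  proof (intro sum.cong refl)
    fix \<phi> assume "\<phi> \<in> ?\<Phi>"
    then have "ds x (\<lambda>zs. evg (attached \<phi> zs) e t) us = (\<Sum>l\<in>?L. ds x (\<lambda>zs. evg ((attached \<phi> us)(l := zs)) e t) (attached \<phi> us l))"
      by (intro dsum_attached[where h="\<lambda>G. evg G e t"]) auto
    then show "p x (evg (attached \<phi> us) e t) = (\<Sum>l\<in>?L. evg (attached (l # \<phi>) (x # us)) e t) + ds x (\<lambda>zs. evg (attached \<phi> zs) e t) us"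
      by (simp add: der_evg[OF assms] push_def sum.distrib attached_Cons)
  qed
  finally have "W (x # us) (ev e t) = (\<Sum>\<phi>\<in>?\<Phi>. \<Sum>l\<in>?L. evg (attached (l # \<phi>) (x # us)) e t)"
    by (simp add: wact_Cons ds sum.distrib)
  also have "\<dots> = (\<Sum>\<phi> | length \<phi> = Suc (length us) \<and> set \<phi> \<subseteq> ?L. evg (attached \<phi> (x # us)) e t)"
    by (rule sum_words_Suc[symmetric]) simp
  finally show ?case by simp
qed

section \<open>The value of a tree as a function of one vertex\<close>

lemma ev_kids_update:
  assumes "j < length us"
  shows "ev e (Node l (us[j := t])) = node_val (\<lambda>_. []) e l ((map (ev e) us)[j := ev e t])"
  by (simp add: map_update)

lemma ev_upd_kid:
  assumes "l \<noteq> Some i" "j < length us" "\<And>j'. j' < length us \<Longrightarrow> j' \<noteq> j \<Longrightarrow> i \<notin> set (labels (us ! j'))"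
  shows "ev (e(i := y)) (Node l us) = node_val (\<lambda>_. []) e l ((map (ev e) us)[j := ev (e(i := y)) (us ! j)])"
proof -
  have "map (ev (e(i := y))) us = (map (ev e) us)[j := ev (e(i := y)) (us ! j)]"
  proof (rule nth_equalityI)
    fix k assume "k < length (map (ev (e(i := y))) us)"
    then have k: "k < length us" by simp
    show "map (ev (e(i := y))) us ! k = (map (ev e) us)[j := ev (e(i := y)) (us ! j)] ! k"
    proof (cases "k = j")
      case False
      then have "ev (e(i := y)) (us ! k) = ev e (us ! k)" using assms(3)[OF k] by (intro evg_cong) auto
      then show ?thesis using k False by simp
    qed (use k in simp)
  qed simp
  moreover have "node_val (\<lambda>_. []) (e(i := y)) l zs = node_val (\<lambda>_. []) e l zs" for zs
    using assms(1) by (auto simp: node_val_def split: option.splits)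
  ultimately show ?thesis by simp
qed

text \<open>One linear context \<open>C\<close> describes both sides of a composition: a tree
  inserted at \<open>i\<close>, and a value \<open>y\<close> given to the label \<open>i\<close>. In
  the latter case the subtrees above \<open>i\<close> act on \<open>y\<close>.\<close>

lemma context_exists:
  assumes "distinct (labels t)" "i \<in> set (labels t)"
  shows "\<exists>C. is_linear scale scale C \<and> (\<forall>f. ev e (replace_vertex i f t) = C (ev e (f (kids_at i t)))) \<and>
    (\<forall>y. ev (e(i := y)) t = C (W (map (ev e) (kids_at i t)) y))"
  using assms
proof (induction rule: path_induct)
  case (root us)
  have "ev (e(i := y)) (Node (Some i) us) = W (map (ev e) us) y" for y
  proof -
    have "i \<notin> set (labels u)" if "u \<in> set us" for u using root that by auto
    then have "map (ev (e(i := y))) us = map (ev e) us" by (intro map_cong refl evg_cong) auto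
    then show ?thesis by (simp only: evg.simps) (simp add: node_val_def)
  qed
  note root_ev = this
  show ?case
    by (intro exI[of _ "\<lambda>z. z"] conjI allI lin_id_fun vs) (simp_all only: root_ev replace_vertex.simps kids_at.simps if_True simp_thms)
next
  case (kid l us j)
  then obtain C where C: "is_linear scale scale C" "\<And>f. ev e (replace_vertex i f (us ! j)) = C (ev e (f (kids_at i (us ! j))))"
    "\<And>y. ev (e(i := y)) (us ! j) = C (W (map (ev e) (kids_at i (us ! j))) y)" by blast
  let ?N = "\<lambda>z. node_val (\<lambda>_. []) e l ((map (ev e) us)[j := z])"
  have N: "is_linear scale scale ?N" by (rule linear_node_val_update) (simp add: kid(3))
  have r: "replace_vertex i f (Node l us) = Node l (us[j := replace_vertex i f (us ! j)])" for f
    by (rule replace_vertex_kid) (use kid in auto)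
  have k: "kids_at i (Node l us) = kids_at i (us ! j)"
    by (rule kids_at_kid) (use kid in auto)
  have u: "ev (e(i := y)) (Node l us) = ?N (ev (e(i := y)) (us ! j))" for y
    by (rule ev_upd_kid) (use kid in auto)
  show ?case
    unfolding r k u ev_kids_update[OF kid(3)] C(2,3)
    by (intro exI[of _ "\<lambda>z. ?N (C z)"]) (simp add: lin_comp[OF C(1) N])
qed

lemma lieform_comp:
  assumes K: "lieform s K" and f: "is_linear s s' f"
  shows "lieform s' (\<lambda>zs. f (K zs))"
  unfolding lieform_def
  using lin_comp[OF lieformD(1)[OF K] f] by (simp add: lieformD(2)[OF K] lin_diff[OF f])

lemma lieform_shift:
  assumes "lieform s K"
  shows "lieform s (\<lambda>zs. K (us @ zs @ vs))"
proof -
  have "is_linear s' s (\<lambda>y. K (us @ (us' @ y # vs') @ vs))" if "s' = scale" for us' vs' s'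
    using lieformD(1)[OF assms, of "us @ us'" "vs' @ vs"] that by simp
  moreover have "K (us @ (us' @ a # b # vs') @ vs) - K (us @ (us' @ b # a # vs') @ vs) = K (us @ (us' @ bracket a b # vs') @ vs)" for us' vs' a b
    using lieformD(2)[OF assms, of "us @ us'" a b "vs' @ vs"] by simp
  ultimately show ?thesis unfolding lieform_def by blast
qed

text \<open>Above a labeled vertex the context takes a list of values, placed side by side by the
  contraction. As part of the word acting at that vertex it is a Lie form, which makes the signed
  sum over swaps computable.\<close>

lemma parent_context_exists:
  assumes "distinct (labels t)" "i \<in> set (labels t)" "vertex t i \<noteq> []" "butlast (vertex t i) \<notin> unlabeled t"
  shows "\<exists>K. lieform scale K \<and>
    (\<forall>f. ev e (contract_at (vertex t i) (replace_vertex i f t)) = K (map (ev e) (kids (f (kids_at i t))))) \<and>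
    (\<forall>y. ev (e(i := y)) t = K [W (map (ev e) (kids_at i t)) y])"
  using assms
proof (induction rule: parent_induct)
  case (base a us j ws)
  let ?pre = "map (ev e) (take j us)" and ?post = "map (ev e) (drop (Suc j) us)"
  let ?K = "\<lambda>zs. W (?pre @ zs @ ?post) (e a)"
  have c: "contract_at (vertex (Node (Some a) us) i) (replace_vertex i f (Node (Some a) us))
      = Node (Some a) (take j us @ kids (f ws) @ drop (Suc j) us)" for f
    by (rule contract_replace_base; use base in blast)
  have k: "kids_at i (Node (Some a) us) = ws"
    by (rule contract_replace_base; use base in blast)
  have "distinct (labels (us ! j))" using distinct_labels_kid[OF base(1)] base(3) by auto
  then have "i \<notin> set (labels w)" if "w \<in> set ws" for w using base(4) that by auto
  then have ws: "map (ev (e(i := y))) ws = map (ev e) ws" for y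
    by (intro map_cong refl evg_cong) auto
  have "ev (e(i := y)) (Node (Some a) us) = node_val (\<lambda>_. []) e (Some a) ((map (ev e) us)[j := ev (e(i := y)) (us ! j)])" for y
    by (rule ev_upd_kid) (use base in auto)
  then have u: "ev (e(i := y)) (Node (Some a) us) = ?K [W (map (ev e) ws) y]" for y
    using base(3) ws by (simp add: base(4) node_val_def upd_conv_take_nth_drop take_map drop_map)
  show ?case
    unfolding c k u
    by (intro exI[of _ ?K] conjI allI lieform_shift g.lieform_wact) (simp_all add: node_val_def)
next
  case (step l us j)
  then obtain K where K: "lieform scale K"
    "\<And>f. ev e (contract_at (vertex (us ! j) i) (replace_vertex i f (us ! j))) = K (map (ev e) (kids (f (kids_at i (us ! j)))))"
    "\<And>y. ev (e(i := y)) (us ! j) = K [W (map (ev e) (kids_at i (us ! j))) y]" by blast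
  let ?N = "\<lambda>z. node_val (\<lambda>_. []) e l ((map (ev e) us)[j := z])"
  have N: "is_linear scale scale ?N" by (rule linear_node_val_update) (simp add: step(3))
  have c: "contract_at (vertex (Node l us) i) (replace_vertex i f (Node l us))
      = Node l (us[j := contract_at (vertex (us ! j) i) (replace_vertex i f (us ! j))])" for f
    by (rule contract_replace_step; use step in blast)
  have k: "kids_at i (Node l us) = kids_at i (us ! j)"
    by (rule contract_replace_step; use step in blast)
  have u: "ev (e(i := y)) (Node l us) = ?N (ev (e(i := y)) (us ! j))" for y
    by (rule ev_upd_kid) (use step in auto)
  show ?case
    unfolding c k u ev_kids_update[OF step(3)] K(2,3)
    by (intro exI[of _ "\<lambda>zs. ?N (K zs)"]) (simp add: lieform_comp[OF K(1) N])
qed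

text \<open>The swap at the root of a cherry, with its sign, turns K into its value on a b minus its
  value on b a, which is its value on the bracket. The swaps inside \<open>a\<close> and
  \<open>b\<close> are summed by induction, with the other subtree as part of the surrounding
  word.\<close>

lemma sum_swaps:
  assumes "lw_tree t" and K: "lieform scale K"
  shows "(\<Sum>A\<in>Pow (unlabeled t). scale ((-1) ^ card A) (K (us @ map (evg G e) (forest (swap_at t A)) @ vs))) = K (us @ [evg G e t] @ vs)"
  using assms(1)
proof (induction arbitrary: us vs rule: lw_tree_induct)
  case (labeled t)
  then have "unlabeled t = {}" by (simp add: unlabeled_empty_iff)
  moreover have "forest t = [t]" using labeled by (cases t) auto
  ultimately show ?case by (simp add: swap_at_empty)
next
  case (cherry a b)
  let ?f = "evg G e"
  let ?t = "Node None [a, b]"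
  \<comment> \<open>A set of vertices to be swapped amounts to a choice at the root and one set in
    each subtree.\<close>
  define g where "g = (\<lambda>(c, A, B). (if c then {[]} else {}) \<union> (#) (0 :: nat) ` A \<union> (#) 1 ` B)"
  let ?I = "(UNIV :: bool set) \<times> Pow (unlabeled a) \<times> Pow (unlabeled b)"
  have unl: "unlabeled ?t = {[]} \<union> (#) 0 ` unlabeled a \<union> (#) 1 ` unlabeled b"
    by (auto simp: unlabeled_Node less_Suc_eq numeral_2_eq_2)
  have parts: "{q. 0 # q \<in> g (c, A, B)} = A" "{q. 1 # q \<in> g (c, A, B)} = B" "[] \<in> g (c, A, B) \<longleftrightarrow> c" for c A B
    by (auto simp: g_def)
  have bij: "bij_betw g ?I (Pow (unlabeled ?t))"
  proof (rule bij_betw_imageI)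
    show "inj_on g ?I"
    proof (rule inj_onI)
      fix x y assume eq: "g x = g y"
      obtain c A B c' A' B' where xy: "x = (c, A, B)" "y = (c', A', B')" by (cases x, cases y) auto
      have "A = A'" using arg_cong[OF eq, of "\<lambda>S. {q. 0 # q \<in> S}"] unfolding xy parts .
      moreover have "B = B'" using arg_cong[OF eq, of "\<lambda>S. {q. 1 # q \<in> S}"] unfolding xy parts .
      moreover have "c = c'" using arg_cong[OF eq, of "\<lambda>S. [] \<in> S"] unfolding xy parts .
      ultimately show "x = y" by (simp add: xy)
    qed
    show "g ` ?I = Pow (unlabeled ?t)"
    proof (rule Set.set_eqI, rule iffI)
      fix A assume A: "A \<in> Pow (unlabeled ?t)"
      let ?x = "([] \<in> A, {q. 0 # q \<in> A}, {q. 1 # q \<in> A})"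
      have "g ?x = A" using A unfolding g_def unl by (auto split: if_splits)
      moreover have "?x \<in> ?I" using A unfolding unl by auto
      ultimately show "A \<in> g ` ?I" by (intro image_eqI[of A g ?x]) simp_all
    qed (auto simp: g_def unl split: if_splits)
  qed
  have card: "card (g (c, A, B)) = (if c then 1 else 0) + card A + card B"
    if "A \<in> Pow (unlabeled a)" "B \<in> Pow (unlabeled b)" for c A B
  proof -
    have fin: "finite A" "finite B" using that finite_unlabeled finite_subset by blast+
    then have "card ((#) (0 :: nat) ` A \<union> (#) 1 ` B) = card A + card B"
      by (subst card_Un_disjoint) (auto simp: card_image)
    then show ?thesis using fin unfolding g_def by (auto simp: insert_is_Un[symmetric] card_insert_if)
  qed
  let ?h = "\<lambda>A. scale ((-1) ^ card A) (K (us @ map ?f (forest (swap_at ?t A)) @ vs))"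
  let ?fa = "\<lambda>A. map ?f (forest (swap_at a A))" and ?fb = "\<lambda>B. map ?f (forest (swap_at b B))"
  have "(\<Sum>A\<in>Pow (unlabeled ?t). ?h A) = (\<Sum>x\<in>?I. ?h (g x))"
    by (rule sum.reindex_bij_betw[OF bij, symmetric])
  also have "\<dots> = (\<Sum>c\<in>UNIV. \<Sum>A\<in>Pow (unlabeled a). \<Sum>B\<in>Pow (unlabeled b). ?h (g (c, A, B)))"
    by (simp add: sum.cartesian_product)
  also have "\<dots> = (\<Sum>c\<in>UNIV. \<Sum>A\<in>Pow (unlabeled a). \<Sum>B\<in>Pow (unlabeled b).
      scale ((-1) ^ card A) (scale ((-1) ^ card B) (if c then - K (us @ ?fb B @ ?fa A @ vs) else K (us @ ?fa A @ ?fb B @ vs))))"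
    by (intro sum.cong refl) (simp add: card swap_at_cherry parts[simplified] power_add)
  also have "\<dots> = (\<Sum>A\<in>Pow (unlabeled a). scale ((-1) ^ card A) (\<Sum>B\<in>Pow (unlabeled b). scale ((-1) ^ card B) (K (us @ ?fa A @ ?fb B @ vs))))
      - (\<Sum>A\<in>Pow (unlabeled a). scale ((-1) ^ card A) (\<Sum>B\<in>Pow (unlabeled b). scale ((-1) ^ card B) (K (us @ ?fb B @ ?fa A @ vs))))"
    by (simp add: UNIV_bool scale_sum_right sum_negf)
  also have "\<dots> = (\<Sum>A\<in>Pow (unlabeled a). scale ((-1) ^ card A) (K (us @ ?fa A @ [?f b] @ vs)))
      - (\<Sum>A\<in>Pow (unlabeled a). scale ((-1) ^ card A) (K (us @ [?f b] @ ?fa A @ vs)))"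
    using cherry.IH(2)[of "us @ ?fa _" vs] cherry.IH(2)[of us "?fa _ @ vs"] by simp
  also have "\<dots> = K (us @ [?f a] @ [?f b] @ vs) - K (us @ [?f b] @ [?f a] @ vs)"
    using cherry.IH(1)[of us "[?f b] @ vs"] cherry.IH(1)[of "us @ [?f b]" vs] by simp
  also have "\<dots> = K (us @ [?f ?t] @ vs)"
    by (simp add: lieformD(2)[OF K] node_val_def)
  finally show ?case .
qed

text \<open>Without contraction, \<open>W_ev\<close> expands the value inside a linear context. With
  contraction, the sum over graftings is pulled out, and for each of them \<open>sum_swaps\<close>
  replaces the forest by the value of the whole inserted tree.\<close>

lemma ev_LW_tree_comp:
  assumes "tree_composition m n i T R"
  shows "lin_ext scale (ev e) (LW_tree_comp n i T R) =
    ev (\<lambda>j. if j = i then ev (\<lambda>k. e (shift_by i k)) R else e (shift_above i n j)) T"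
proof -
  interpret tree_composition m n i T R by fact
  note le = linear_lin_ext[OF vs, of "ev e"]
  let ?us = "kids_at i T'" and ?R = "map_ptree sR R"
  let ?y = "W (map (ev e) ?us) (ev e ?R)"
  have inj: "inj_on sR (set (labels R))"
    by (rule inj_on_subset[OF inj_sR]) (use R_props in auto)
  have dR: "distinct (labels ?R)" using R_props inj by (simp add: labels_map_ptree distinct_map)
  have y: "?y = (\<Sum>\<phi>\<in>graftings R. evg (attached \<phi> (map (ev e) ?us)) e ?R)"
    using W_ev[OF dR, of "map (ev e) ?us" e] by (simp add: graftings_def)
  have rhs: "ev (\<lambda>j. if j = i then ev (\<lambda>k. e (sR k)) R else e (sT j)) T = ev (e(i := ev e ?R)) T'"
  proof -
    have "sT j = i \<longleftrightarrow> j = i" for j using inj_sT[of UNIV] sT_i by (auto simp: inj_on_def)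
    then show ?thesis by (simp add: ev_map_ptree fun_upd_def cong: if_cong)
  qed
  show ?thesis
  proof (cases contracted)
    case False
    obtain C where C: "is_linear scale scale C" "\<And>f. ev e (replace_vertex i f T') = C (ev e (f ?us))"
      "\<And>y. ev (e(i := y)) T' = C (W (map (ev e) ?us) y)"
      using context_exists[OF T'_props(2,4), of e] by blast
    have "lin_ext scale (ev e) (LW_tree_comp n i T R) = (\<Sum>\<phi>\<in>graftings R. C (evg (attached \<phi> (map (ev e) ?us)) e ?R))"
      by (simp add: LW_tree_comp_eq False lin_sum[OF le] vs insert_tree_def C(2) evg_graft)
    also have "\<dots> = C ?y" by (simp add: y lin_sum[OF C(1)])
    finally show ?thesis unfolding rhs C(3) .
  next
    case True
    then have W: "R \<in> W_trees n" and v: "vertex T' i \<noteq> []" "butlast (vertex T' i) \<notin> unlabeled T'"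
      by (auto simp: contracted_def vertex_T' unlabeled_map_ptree)
    obtain K where K: "lieform scale K"
      "\<And>f. ev e (contract_at (vertex T' i) (replace_vertex i f T')) = K (map (ev e) (kids (f ?us)))"
      "\<And>y. ev (e(i := y)) T' = K [W (map (ev e) ?us) y]"
      using parent_context_exists[OF T'_props(2,4) v, of e] by blast
    have K1: "is_linear scale scale (\<lambda>z. K [z])" using lieformD(1)[OF K(1), of "[]" "[]"] by simp
    \<comment> \<open>Swaps and contraction keep the set of labels, so the sums over swaps and over
      graftings can be exchanged.\<close>
    have gr: "graftings (con (swap_at R A)) = graftings R" if "A \<in> Pow (unlabeled R)" for A
    proof -
      have "set (labels (con (swap_at R A))) = set (labels R)"
        using mset_eq_setD[OF con_swap(2)[OF W]] that by simp
      then show ?thesis by (simp add: graftings_def labels_map_ptree)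
    qed
    have ev_tree: "ev e (contract_at (vertex T i) (insert_tree (con (swap_at R A)) \<phi>)) =
        K (map (evg (attached \<phi> (map (ev e) ?us)) e) (forest (swap_at ?R A)))" if "A \<in> Pow (unlabeled R)" for A \<phi>
    proof -
      have c: "con (swap_at R A) = Node None (forest (swap_at R A))" using con_swap(1)[OF W] that by simp
      have "kids (graft gs (map_ptree sR (con (swap_at R A)))) = map (graft gs) (forest (swap_at ?R A))" for gs
        unfolding c by (simp add: swap_at_map_ptree forest_map_ptree)
      then show ?thesis
        unfolding insert_tree_def vertex_T'[symmetric] K(2) by (simp add: comp_def evg_graft)
    qed
    have "lin_ext scale (ev e) (LW_tree_comp n i T R) =
      (\<Sum>A\<in>Pow (unlabeled R). scale ((-1) ^ card A) (\<Sum>\<phi>\<in>graftings R. K (map (evg (attached \<phi> (map (ev e) ?us)) e) (forest (swap_at ?R A)))))"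
      by (simp add: LW_tree_comp_eq True lin_sum[OF le] lin_scale[OF le] vs gr ev_tree cong: sum.cong del: Pow_iff)
    also have "\<dots> = (\<Sum>\<phi>\<in>graftings R. \<Sum>A\<in>Pow (unlabeled ?R). scale ((-1) ^ card A) (K (map (evg (attached \<phi> (map (ev e) ?us)) e) (forest (swap_at ?R A)))))"
      unfolding scale_sum_right unlabeled_map_ptree by (rule sum.swap)
    also have "\<dots> = (\<Sum>\<phi>\<in>graftings R. K [evg (attached \<phi> (map (ev e) ?us)) e ?R])"
      using sum_swaps[OF _ K(1), of ?R "[]" _ e "[]"] R_props(1) by simp
    also have "\<dots> = K [?y]" by (simp add: y lin_sum[OF K1])
    finally show ?thesis unfolding rhs K(3) .
  qed
qed

end

subsection \<open>The operads \<open>LW\<close> and \<open>PSB\<close>\<close>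

lemma LW_simps:
  "op_space LW n = free_space (LW_trees n)"
  "op_act LW n \<sigma> = pm_lin (\<lambda>t. unit_vec (map_ptree \<sigma> t))"
  "op_unit LW = unit_vec (leaf 1)"
  "op_comp LW m n i x y = pm_lin (\<lambda>T. pm_lin (\<lambda>R. LW_tree_comp n i T R) y) x"
  by (simp_all add: LW_def)

abbreviation LW_space :: "nat \<Rightarrow> (nat ptree \<Rightarrow>\<^sub>0 'k::field) set" where
  "LW_space n \<equiv> {x. Poly_Mapping.keys x \<subseteq> LW_trees n}"

lemma map_ptree_LW:
  assumes "1 \<le> n" "\<sigma> permutes {1..n}" "t \<in> LW_trees n"
  shows "map_ptree \<sigma> t \<in> LW_trees n"
proof -
  have "inj_on \<sigma> (set (labels t))" using permutes_inj[OF assms(2)] by (simp add: inj_on_def)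
  then show ?thesis
    using assms permutes_image[OF assms(2)] by (simp add: LW_trees_iff labels_map_ptree distinct_map)
qed

lemma op_act_LW_closed:
  assumes "1 \<le> n" "\<sigma> permutes {1..n}" "x \<in> LW_space n"
  shows "op_act LW n \<sigma> x \<in> LW_space n"
  unfolding LW_simps pm_lin_eq
  by (rule lin_ext_in_subspace[OF vector_space_pm_scale subspace_keys]) (use assms map_ptree_LW in auto)

lemma tree_compositionI:
  "1 \<le> m \<Longrightarrow> 1 \<le> n \<Longrightarrow> i \<in> {1..m} \<Longrightarrow> T \<in> LW_trees m \<Longrightarrow> R \<in> LW_trees n \<Longrightarrow> tree_composition m n i T R"
  by unfold_locales auto

lemma op_comp_LW_closed:
  assumes "1 \<le> m" "1 \<le> n" "i \<in> {1..m}" "x \<in> LW_space m" "y \<in> LW_space n"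
  shows "op_comp LW m n i x y \<in> LW_space (m + n - 1)"
  unfolding LW_simps pm_lin_eq
proof (intro lin_ext_in_subspace vector_space_pm_scale subspace_keys)
  fix T R assume "T \<in> Poly_Mapping.keys x" "R \<in> Poly_Mapping.keys y"
  then interpret tree_composition m n i T R using assms by (intro tree_compositionI) auto
  show "LW_tree_comp n i T R \<in> LW_space (m + n - 1)" using keys_LW_tree_comp by simp
qed

lemma linear_op_comp_left: "is_linear pm_scale pm_scale (\<lambda>x. op_comp LW m n i x y)"
  unfolding LW_simps by (rule linear_pm_lin)

lemma linear_op_comp_right: "is_linear pm_scale pm_scale (op_comp LW m n i x)"
  unfolding LW_simps[abs_def] pm_lin_eq
  by (rule linear_lin_ext_param) (auto intro: vector_space_pm_scale linear_lin_ext)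

lemma linear_op_act: "is_linear pm_scale pm_scale (op_act LW n \<sigma>)"
  unfolding LW_simps by (rule linear_pm_lin)

lemma leaf_LW: "leaf 1 \<in> LW_trees 1"
  by (simp add: LW_trees_iff)

lemma cherry_LW: "cherry (leaf 1) (leaf 2) \<in> LW_trees 2" "cherry (leaf 2) (leaf 1) \<in> LW_trees 2"
  by (auto simp: LW_trees_iff)

lemma corolla_LW: "corolla n \<in> LW_trees (n + 1)"
proof -
  have "concat (map (\<lambda>i. [i]) xs) = xs" for xs :: "nat list" by (induction xs) auto
  then have "labels (corolla n) = 1 # [2..<n + 2]" by (simp add: corolla_def comp_def)
  moreover have "fully_labeled (corolla n)" by (simp add: corolla_def)
  ultimately show ?thesis by (auto simp: LW_trees_iff fully_labeled_lw_tree)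
qed

lemma PSB_relations_LW: "PSB_relations n \<subseteq> LW_space n"
proof -
  have 3: "{1..3} = {1, 2, 3 :: nat}" by auto
  have "cherry (leaf 1) (cherry (leaf 2) (leaf 3)) \<in> LW_trees 3" "cherry (cherry (leaf 1) (leaf 2)) (leaf 3) \<in> LW_trees 3"
    "cherry (leaf 2) (cherry (leaf 1) (leaf 3)) \<in> LW_trees 3"
    by (auto simp: LW_trees_iff 3)
  then show ?thesis
    using cherry_LW unfolding PSB_relations_def
    by (auto dest!: keys_add[THEN subsetD] keys_diff[THEN subsetD] split: if_splits)
qed

section \<open>The operadic ideal and its quotient\<close>

lemma operad_idealD:
  assumes "operad_ideal P I"
  shows "1 \<le> n \<Longrightarrow> linear_subspace (op_space P n) (I n)"
    and "1 \<le> n \<Longrightarrow> \<sigma> permutes {1..n} \<Longrightarrow> x \<in> I n \<Longrightarrow> op_act P n \<sigma> x \<in> I n"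
    and "1 \<le> m \<Longrightarrow> 1 \<le> n \<Longrightarrow> i \<in> {1..m} \<Longrightarrow> x \<in> carrier (op_space P m) \<Longrightarrow> y \<in> carrier (op_space P n) \<Longrightarrow>
      x \<in> I m \<or> y \<in> I n \<Longrightarrow> op_comp P m n i x y \<in> I (m + n - 1)"
  using assms unfolding operad_ideal_def by blast+

lemma subspace_Inter: "(\<And>S. S \<in> \<S> \<Longrightarrow> subspace_of s S) \<Longrightarrow> subspace_of s (\<Inter>\<S>)"
  by (auto simp: subspace_of_def)

lemma operad_ideal_LW_space: "operad_ideal LW (\<lambda>n. LW_space n :: (_ \<Rightarrow>\<^sub>0 'k::field) set)"
  unfolding operad_ideal_def
proof (intro conjI allI impI ballI)
  show "linear_subspace (op_space LW n) (LW_space n)" for n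
    by (simp add: LW_simps linear_subspace_free_space_iff subspace_keys)
next
  fix n :: nat and \<sigma> and x :: "nat ptree \<Rightarrow>\<^sub>0 'k"
  assume "1 \<le> n" "\<sigma> permutes {1..n}" "x \<in> LW_space n"
  then show "op_act LW n \<sigma> x \<in> LW_space n" by (rule op_act_LW_closed)
next
  fix m n i :: nat and x y :: "nat ptree \<Rightarrow>\<^sub>0 'k"
  assume "1 \<le> m" "1 \<le> n" "i \<in> {1..m}" "x \<in> carrier (op_space LW m)" "y \<in> carrier (op_space LW n)"
  then show "op_comp LW m n i x y \<in> LW_space (m + n - 1)"
    by (intro op_comp_LW_closed) (simp_all add: LW_simps(1))
qed

lemma PSB_ideal_eq: "PSB_ideal n = \<Inter>{I n | I. operad_ideal LW I \<and> (\<forall>k\<ge>1. PSB_relations k \<subseteq> I k)}"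
  by (simp add: PSB_ideal_def generated_operad_ideal_def)

lemma PSB_ideal_subset: "operad_ideal LW I \<Longrightarrow> (\<And>k. 1 \<le> k \<Longrightarrow> PSB_relations k \<subseteq> I k) \<Longrightarrow> PSB_ideal n \<subseteq> I n"
  unfolding PSB_ideal_eq by blast

lemma PSB_ideal_LW: "PSB_ideal n \<subseteq> LW_space n"
  by (rule PSB_ideal_subset[OF operad_ideal_LW_space PSB_relations_LW])

lemma PSB_ideal_mem: "x \<in> PSB_ideal n \<longleftrightarrow> (\<forall>I. operad_ideal LW I \<and> (\<forall>k\<ge>1. PSB_relations k \<subseteq> I k) \<longrightarrow> x \<in> I n)"
  unfolding PSB_ideal_eq by blast

lemma operad_ideal_PSB_ideal: "operad_ideal LW (PSB_ideal :: nat \<Rightarrow> (nat ptree \<Rightarrow>\<^sub>0 'k::field) set)"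
  unfolding operad_ideal_def
proof (intro conjI allI impI ballI)
  fix n :: nat assume n: "1 \<le> n"
  have "linear_subspace (op_space LW n) (I n)" if "operad_ideal LW I" for I :: "nat \<Rightarrow> (nat ptree \<Rightarrow>\<^sub>0 'k) set"
    using that n by (simp add: operad_ideal_def)
  then have "subspace_of pm_scale (I n)" if "operad_ideal LW I" for I :: "nat \<Rightarrow> (nat ptree \<Rightarrow>\<^sub>0 'k) set"
    using that by (simp add: LW_simps linear_subspace_free_space_iff)
  then have "subspace_of pm_scale (PSB_ideal n :: (nat ptree \<Rightarrow>\<^sub>0 'k) set)"
    unfolding PSB_ideal_eq by (intro subspace_Inter) auto
  then show "linear_subspace (op_space LW n) (PSB_ideal n :: (nat ptree \<Rightarrow>\<^sub>0 'k) set)"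
    using PSB_ideal_LW by (simp add: LW_simps linear_subspace_free_space_iff)
  fix \<sigma> and x :: "nat ptree \<Rightarrow>\<^sub>0 'k" assume "\<sigma> permutes {1..n}" "x \<in> PSB_ideal n"
  then show "op_act LW n \<sigma> x \<in> PSB_ideal n"
    using n unfolding PSB_ideal_mem operad_ideal_def by blast
next
  fix m n i :: nat and x y :: "nat ptree \<Rightarrow>\<^sub>0 'k"
  assume mn: "1 \<le> m" "1 \<le> n" "i \<in> {1..m}" and xy: "x \<in> carrier (op_space LW m)" "y \<in> carrier (op_space LW n)"
    and xyI: "x \<in> PSB_ideal m \<or> y \<in> PSB_ideal n"
  have "op_comp LW m n i x y \<in> I (m + n - 1)"
    if I: "operad_ideal LW I" "\<forall>k\<ge>1. PSB_relations k \<subseteq> I k" for I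
  proof (rule operad_idealD(3)[OF I(1) mn xy])
    show "x \<in> I m \<or> y \<in> I n" using xyI PSB_ideal_subset[OF I(1)] I(2) by blast
  qed
  then show "op_comp LW m n i x y \<in> PSB_ideal (m + n - 1)" by (subst PSB_ideal_mem) blast
qed

abbreviation psb_coset :: "nat \<Rightarrow> (nat ptree \<Rightarrow>\<^sub>0 'k::field) \<Rightarrow> (nat ptree \<Rightarrow>\<^sub>0 'k) set" where
  "psb_coset n x \<equiv> PSB_ideal n +>\<^bsub>(free_space (LW_trees n) :: ('k, nat ptree \<Rightarrow>\<^sub>0 'k) module)\<^esub> x"

lemma PSB_class_eq: "PSB_class n t = psb_coset n (unit_vec t)"
  by (simp add: PSB_class_def LW_simps)

lemma pm_quotient_PSB: "1 \<le> n \<Longrightarrow> pm_quotient (free_space (LW_trees n)) (PSB_ideal n)"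
  by (rule pm_quotient_free_space, rule operad_idealD(1)[OF operad_ideal_PSB_ideal, unfolded LW_simps])

lemma PSB_simps:
  "op_space PSB n = quotient (free_space (LW_trees n)) (PSB_ideal n)"
  "op_act PSB n \<sigma> X = (\<Union>x\<in>X. psb_coset n (op_act LW n \<sigma> x))"
  "op_unit PSB = psb_coset 1 (op_unit LW)"
  "op_comp PSB m n i X Y = (\<Union>x\<in>X. \<Union>y\<in>Y. psb_coset (m + n - 1) (op_comp LW m n i x y))"
  by (simp_all add: PSB_def quotient_operad_def LW_simps(1))

lemma carrier_PSB:
  assumes "1 \<le> n"
  shows "carrier (op_space PSB n) = psb_coset n ` LW_space n"
proof -
  interpret pm_quotient "free_space (LW_trees n)" "PSB_ideal n" by (rule pm_quotient_PSB[OF assms])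
  show ?thesis by (simp add: PSB_simps carrier_Q)
qed

lemma op_act_PSB:
  fixes x :: "nat ptree \<Rightarrow>\<^sub>0 'k::field"
  assumes "1 \<le> n" "\<sigma> permutes {1..n}" "x \<in> LW_space n"
  shows "op_act PSB n \<sigma> (psb_coset n x) = psb_coset n (op_act LW n \<sigma> x)"
proof -
  interpret pm_quotient "free_space (LW_trees n)" "PSB_ideal n :: (nat ptree \<Rightarrow>\<^sub>0 'k) set" by (rule pm_quotient_PSB[OF assms(1)])
  have "psb_coset n (op_act LW n \<sigma> y) = psb_coset n (op_act LW n \<sigma> x)" if "y \<in> psb_coset n x" for y
  proof -
    have "op_act LW n \<sigma> (y - x) \<in> PSB_ideal n"
      using that assms(1,2) by (intro operad_idealD(2)[OF operad_ideal_PSB_ideal]) (simp_all only: mem_coset)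
    then show ?thesis by (simp add: coset_eq_iff lin_diff[OF linear_op_act])
  qed
  then have "(\<Union>y\<in>psb_coset n x. psb_coset n (op_act LW n \<sigma> y)) = (\<Union>y\<in>psb_coset n x. psb_coset n (op_act LW n \<sigma> x))" by simp
  then show ?thesis using self_mem_coset[of x] by (auto simp: PSB_simps)
qed

lemma op_comp_PSB:
  fixes x y :: "nat ptree \<Rightarrow>\<^sub>0 'k::field"
  assumes mn: "1 \<le> m" "1 \<le> n" "i \<in> {1..m}" and xy: "x \<in> LW_space m" "y \<in> LW_space n"
  shows "op_comp PSB m n i (psb_coset m x) (psb_coset n y) = psb_coset (m + n - 1) (op_comp LW m n i x y)"
proof -
  interpret m: pm_quotient "free_space (LW_trees m)" "PSB_ideal m :: (nat ptree \<Rightarrow>\<^sub>0 'k) set" by (rule pm_quotient_PSB[OF mn(1)])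
  interpret n: pm_quotient "free_space (LW_trees n)" "PSB_ideal n :: (nat ptree \<Rightarrow>\<^sub>0 'k) set" by (rule pm_quotient_PSB[OF mn(2)])
  interpret mn: pm_quotient "free_space (LW_trees (m + n - 1))" "PSB_ideal (m + n - 1) :: (nat ptree \<Rightarrow>\<^sub>0 'k) set"
    by (rule pm_quotient_PSB) (use mn(1,2) in linarith)
  have id: "op_comp LW m n i u v \<in> PSB_ideal (m + n - 1)"
    if "u \<in> LW_space m" "v \<in> LW_space n" "u \<in> PSB_ideal m \<or> v \<in> PSB_ideal n" for u v :: "nat ptree \<Rightarrow>\<^sub>0 'k"
    using that mn by (intro operad_idealD(3)[OF operad_ideal_PSB_ideal]) (simp_all add: LW_simps(1))
  have eq: "psb_coset (m + n - 1) (op_comp LW m n i u v) = psb_coset (m + n - 1) (op_comp LW m n i x y)"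
    if uv: "u \<in> psb_coset m x" "v \<in> psb_coset n y" for u v
  proof -
    have d: "u - x \<in> PSB_ideal m" "v - y \<in> PSB_ideal n" using uv by (simp_all add: m.mem_coset n.mem_coset)
    then have d': "u - x \<in> LW_space m" "v - y \<in> LW_space n" using PSB_ideal_LW by blast+
    have "v \<in> LW_space n" using n.M_closed(2)[of "v - y" y] d' xy by simp
    \<comment> \<open>The difference of the two composites, changed in one argument at a
      time.\<close>
    then have "op_comp LW m n i (u - x) v + op_comp LW m n i x (v - y) \<in> PSB_ideal (m + n - 1)"
      using d d' xy by (intro mn.I_closed id) auto
    then show ?thesis
      by (simp only: mn.coset_eq_iff) (simp add: lin_diff[OF linear_op_comp_left] lin_diff[OF linear_op_comp_right])
  qed
  have "op_comp PSB m n i (psb_coset m x) (psb_coset n y) =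
    (\<Union>u\<in>psb_coset m x. \<Union>v\<in>psb_coset n y. psb_coset (m + n - 1) (op_comp LW m n i x y))"
    unfolding PSB_simps using eq by simp
  then show ?thesis using m.self_mem_coset[of x] n.self_mem_coset[of y] by auto
qed

lemma end_simps:
  "carrier (op_space (end_operad scale) n) = {f. (\<forall>vs. length vs \<noteq> n \<longrightarrow> f vs = 0) \<and>
           (\<forall>vs j. length vs = n \<longrightarrow> j < n \<longrightarrow> is_linear scale scale (\<lambda>v. f (vs[j := v])))}"
  "zero (op_space (end_operad scale) n) = (\<lambda>vs. 0)" "add (op_space (end_operad scale) n) = (\<lambda>f g vs. f vs + g vs)"
  "smult (op_space (end_operad scale) n) = (\<lambda>c f vs. scale c (f vs))"
  "op_act (end_operad scale) n \<sigma> f = (\<lambda>vs. if length vs = n then f (map (\<lambda>j. vs ! (\<sigma> j - 1)) [1..<n + 1]) else 0)"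
  "op_unit (end_operad scale) = (\<lambda>vs. if length vs = 1 then hd vs else 0)"
  "op_comp (end_operad scale) m n i f g = (\<lambda>vs. if length vs = m + n - 1
        then f (take (i - 1) vs @ [g (take n (drop (i - 1) vs))] @ drop (i - 1 + n) vs) else 0)"
  by (simp_all add: end_operad_def fun_eq_iff)

text \<open>A morphism from \<open>LW\<close> to an endomorphism operad that kills the relations factors through \<open>PSB\<close>.\<close>

locale LW_algebra = lie_algebra scale bracket
  for scale :: "'k::field \<Rightarrow> 'g::ab_group_add \<Rightarrow> 'g" and bracket +
  fixes F :: "nat \<Rightarrow> (nat ptree \<Rightarrow>\<^sub>0 'k) \<Rightarrow> 'g list \<Rightarrow> 'g"
  assumes F_linear: "1 \<le> n \<Longrightarrow> F n \<in> linear_maps (op_space LW n) (op_space (end_operad scale) n)"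
    and F_act: "1 \<le> n \<Longrightarrow> \<sigma> permutes {1..n} \<Longrightarrow> x \<in> LW_space n \<Longrightarrow> F n (op_act LW n \<sigma> x) = op_act (end_operad scale) n \<sigma> (F n x)"
    and F_unit: "F 1 (op_unit LW) = op_unit (end_operad scale)"
    and F_comp: "1 \<le> m \<Longrightarrow> 1 \<le> n \<Longrightarrow> i \<in> {1..m} \<Longrightarrow> x \<in> LW_space m \<Longrightarrow> y \<in> LW_space n \<Longrightarrow>
      F (m + n - 1) (op_comp LW m n i x y) = op_comp (end_operad scale) m n i (F m x) (F n y)"
    and F_relations: "1 \<le> n \<Longrightarrow> x \<in> PSB_relations n \<Longrightarrow> F n x = (\<lambda>vs. 0)"
begin

lemma F_closed:
  assumes "1 \<le> n" "x \<in> LW_space n"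
  shows "F n x \<in> carrier (op_space (end_operad scale) n)"
  using F_linear[OF assms(1)] assms(2) by (auto simp: linear_maps_def LW_simps(1))

lemma F_add: "1 \<le> n \<Longrightarrow> x \<in> LW_space n \<Longrightarrow> y \<in> LW_space n \<Longrightarrow> F n (x + y) = (\<lambda>vs. F n x vs + F n y vs)"
  and F_scale: "1 \<le> n \<Longrightarrow> x \<in> LW_space n \<Longrightarrow> F n (pm_scale c x) = (\<lambda>vs. scale c (F n x vs))"
  using F_linear[of n] by (simp_all add: linear_maps_def LW_simps(1) end_simps)

lemma F_zero: "1 \<le> n \<Longrightarrow> F n 0 = (\<lambda>vs. 0)"
  using F_scale[of n 0 0] by simp

text \<open>Together with \<open>F_relations\<close> this places the generated ideal in the kernel,
  so that \<open>F\<close> descends to the quotient.\<close>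

lemma F_kernel: "operad_ideal LW (\<lambda>n. {x \<in> LW_space n. F n x = (\<lambda>vs. 0)})"
  unfolding operad_ideal_def
proof (intro conjI allI impI ballI)
  fix n :: nat assume n: "1 \<le> n"
  have "subspace_of pm_scale {x \<in> LW_space n. F n x = (\<lambda>vs. 0)}"
  proof -
    have "subspace_of pm_scale (LW_space n :: (nat ptree \<Rightarrow>\<^sub>0 'k) set)" by (rule subspace_keys)
    then show ?thesis
      using F_add[OF n] F_scale[OF n] F_zero[OF n] by (auto simp: subspace_of_def)
  qed
  then show "linear_subspace (op_space LW n) {x \<in> LW_space n. F n x = (\<lambda>vs. 0)}"
    by (auto simp: LW_simps linear_subspace_free_space_iff)
  fix \<sigma> x assume \<sigma>: "\<sigma> permutes {1..n}" and "x \<in> {x \<in> LW_space n. F n x = (\<lambda>vs. 0)}"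
  then have x: "x \<in> LW_space n" "F n x = (\<lambda>vs. 0)" by auto
  have "F n (op_act LW n \<sigma> x) = (\<lambda>vs. 0)" unfolding F_act[OF n \<sigma> x(1)] by (auto simp: end_simps x(2))
  with op_act_LW_closed[OF n \<sigma> x(1)] show "op_act LW n \<sigma> x \<in> {x \<in> LW_space n. F n x = (\<lambda>vs. 0)}"
    by (intro CollectI conjI) auto
next
  fix m n i :: nat and x y :: "nat ptree \<Rightarrow>\<^sub>0 'k"
  assume mn: "1 \<le> m" "1 \<le> n" "i \<in> {1..m}"
    and xy: "x \<in> carrier (op_space LW m)" "y \<in> carrier (op_space LW n)"
    and z: "x \<in> {x \<in> LW_space m. F m x = (\<lambda>vs. 0)} \<or> y \<in> {x \<in> LW_space n. F n x = (\<lambda>vs. 0)}"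
  have xy': "x \<in> LW_space m" "y \<in> LW_space n" using xy by (simp_all add: LW_simps)
  have "F m x (take (i - 1) vs @ [F n y (take n (drop (i - 1) vs))] @ drop (i - 1 + n) vs) = 0" if len: "length vs = m + n - 1" for vs
  proof (cases "F m x = (\<lambda>vs. 0)")
    case False
    then have y0: "F n y = (\<lambda>vs. 0)" using z by auto
    \<comment> \<open>If the inserted operation is zero, the multilinear map \<open>F m x\<close>
      receives the argument 0 in position \<open>i\<close>.\<close>
    let ?ws = "take (i - 1) vs @ [0] @ drop (i - 1 + n) vs"
    have "length ?ws = m" using len mn by auto
    moreover have "i - 1 < m" using mn by auto
    ultimately have "is_linear scale scale (\<lambda>v. F m x (?ws[i - 1 := v]))"
      using F_closed[OF mn(1) xy'(1)] by (auto simp: end_simps)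
    from lin_0[OF this] have "F m x (?ws[i - 1 := 0]) = 0" .
    moreover have "?ws[i - 1 := 0] = ?ws" using mn len by (auto simp: list_update_append)
    ultimately show ?thesis by (simp add: y0)
  qed simp
  then have "F (m + n - 1) (op_comp LW m n i x y) = (\<lambda>vs. 0)"
    unfolding F_comp[OF mn xy'] by (auto simp: end_simps)
  then show "op_comp LW m n i x y \<in> {x \<in> LW_space (m + n - 1). F (m + n - 1) x = (\<lambda>vs. 0)}"
    using op_comp_LW_closed[OF mn xy'] by simp
qed

lemma F_PSB_ideal: "1 \<le> n \<Longrightarrow> x \<in> PSB_ideal n \<Longrightarrow> F n x = (\<lambda>vs. 0)"
  using PSB_ideal_subset[OF F_kernel, of n] PSB_relations_LW F_relations by blast

definition gam :: "nat \<Rightarrow> (nat ptree \<Rightarrow>\<^sub>0 'k) set \<Rightarrow> 'g list \<Rightarrow> 'g" where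
  "gam = (\<lambda>n\<in>{1..}. \<lambda>X\<in>carrier (op_space PSB n). F n (SOME x. x \<in> LW_space n \<and> X = psb_coset n x))"

lemma gam_coset:
  assumes "1 \<le> n" "x \<in> LW_space n"
  shows "gam n (psb_coset n x) = F n x"
proof -
  interpret pm_quotient "free_space (LW_trees n)" "PSB_ideal n :: (nat ptree \<Rightarrow>\<^sub>0 'k) set" by (rule pm_quotient_PSB[OF assms(1)])
  define y where "y = (SOME y. y \<in> LW_space n \<and> psb_coset n x = psb_coset n y)"
  have "y \<in> LW_space n \<and> psb_coset n x = psb_coset n y"
    unfolding y_def by (rule someI[of _ x]) (use assms(2) in simp)
  then have y: "y \<in> LW_space n" "x - y \<in> PSB_ideal n" by (simp_all add: coset_eq_iff)
  have "F n x = (\<lambda>vs. F n (x - y) vs + F n y vs)"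
    using F_add[OF assms(1), of "x - y" y] y PSB_ideal_LW by fastforce
  then have "F n x = F n y" by (simp add: F_PSB_ideal[OF assms(1) y(2)])
  moreover have "psb_coset n x \<in> carrier (op_space PSB n)" using assms carrier_PSB by blast
  ultimately show ?thesis using assms(1) by (simp add: gam_def y_def)
qed

lemma gam_hom: "gam \<in> operad_homs PSB (end_operad scale)"
  unfolding operad_homs_def
proof (intro CollectI conjI allI impI ballI)
  show "gam \<in> extensional {1..}" by (simp add: gam_def)
  fix n :: nat assume n: "1 \<le> n"
  interpret pm_quotient "free_space (LW_trees n)" "PSB_ideal n :: (nat ptree \<Rightarrow>\<^sub>0 'k) set" by (rule pm_quotient_PSB[OF n])
  note Mc = M_closed[simplified]
  have ext: "gam n \<in> extensional (carrier (op_space PSB n))" using n by (simp add: gam_def)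
  have "gam n \<in> linear_maps (op_space PSB n) (op_space (end_operad scale) n)"
    unfolding linear_maps_def carrier_PSB[OF n]
    using F_closed[OF n] Mc F_add[OF n] F_scale[OF n]
    by (auto simp: gam_coset[OF n] PSB_simps(1) add_Q smult_Q end_simps(3,4))
  with ext show "gam n \<in> extensional (carrier (op_space PSB n)) \<inter> linear_maps (op_space PSB n) (op_space (end_operad scale) n)"
    by blast
  fix \<sigma> and X :: "(nat ptree \<Rightarrow>\<^sub>0 'k) set" assume \<sigma>: "\<sigma> permutes {1..n}" and "X \<in> carrier (op_space PSB n)"
  then obtain x where x: "x \<in> LW_space n" "X = psb_coset n x" by (auto simp: carrier_PSB[OF n])
  then show "gam n (op_act PSB n \<sigma> X) = op_act (end_operad scale) n \<sigma> (gam n X)"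
    using op_act_LW_closed[OF n \<sigma>, of x] by (simp add: op_act_PSB[OF n \<sigma>] gam_coset[OF n] F_act[OF n \<sigma>])
next
  have u: "op_unit LW \<in> (LW_space 1 :: (nat ptree \<Rightarrow>\<^sub>0 'k) set)" using leaf_LW by (simp add: LW_simps(3))
  show "gam 1 (op_unit PSB) = op_unit (end_operad scale)"
    unfolding PSB_simps(3) gam_coset[OF order_refl u] by (rule F_unit)
next
  fix m n i :: nat and X Y :: "(nat ptree \<Rightarrow>\<^sub>0 'k) set"
  assume mn: "1 \<le> m" "1 \<le> n" "i \<in> {1..m}" and "X \<in> carrier (op_space PSB m)" "Y \<in> carrier (op_space PSB n)"
  then obtain x y where xy: "x \<in> LW_space m" "y \<in> LW_space n" "X = psb_coset m x" "Y = psb_coset n y"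
    by (auto simp: carrier_PSB)
  have "1 \<le> m + n - 1" using mn(1,2) by linarith
  then show "gam (m + n - 1) (op_comp PSB m n i X Y) = op_comp (end_operad scale) m n i (gam m X) (gam n Y)"
    unfolding xy(3,4) op_comp_PSB[OF mn xy(1,2)]
    by (simp only: gam_coset[OF _ op_comp_LW_closed[OF mn xy(1,2)]] gam_coset[OF mn(1) xy(1)] gam_coset[OF mn(2) xy(2)] F_comp[OF mn xy(1,2)])
qed

end

subsection \<open>The \<open>PSB\<close>-algebra of a post-Lie algebra\<close>

text \<open>Labels are counted from 1, positions in a list from 0.\<close>

abbreviation env :: "'g list \<Rightarrow> nat \<Rightarrow> 'g" where
  "env vs j \<equiv> vs ! (j - 1)"

context post_lie
begin

definition tree_op :: "nat \<Rightarrow> (nat ptree \<Rightarrow>\<^sub>0 'k) \<Rightarrow> 'g list \<Rightarrow> 'g" where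
  "tree_op n x vs = (if length vs = n then lin_ext scale (ev (env vs)) x else 0)"

lemma linear_ev_env:
  assumes n: "1 \<le> n" and t: "t \<in> LW_trees n" and len: "length vs = n" "k < n"
  shows "is_linear scale scale (\<lambda>v. ev (env (vs[k := v])) t)"
proof -
  let ?e = "env vs"
  have d: "distinct (labels t)" "Suc k \<in> set (labels t)" using t len(2) by (auto simp: LW_trees_iff[OF n])
  obtain C where C: "is_linear scale scale C" "\<And>y. ev (?e(Suc k := y)) t = C (W (map (ev ?e) (kids_at (Suc k) t)) y)"
    using context_exists[OF d, of ?e] by blast
  have "ev (env (vs[k := v])) t = ev (?e(Suc k := v)) t" for v
    by (rule evg_cong) (use t len in \<open>auto simp: LW_trees_iff[OF n] nth_list_update\<close>)
  moreover have "is_linear scale scale (\<lambda>v. C (W us v))" for us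
    by (rule lin_comp[OF wact_linear[where L=p and p=p and s=scale, OF vs p_linear_right] C(1)])
  ultimately show ?thesis by (simp only: C(2))
qed

text \<open>\<open>ev_LW_tree_comp\<close> read with lists: the labels below \<open>i\<close> keep
  their position, \<open>i\<close> receives the value of the second tree, and the labels above it
  read the arguments that follow those used by that tree.\<close>

lemma tree_op_comp:
  assumes mn: "1 \<le> m" "1 \<le> n" "i \<in> {1..m}" and xy: "x \<in> LW_space m" "y \<in> LW_space n"
  shows "tree_op (m + n - 1) (op_comp LW m n i x y) = op_comp (end_operad scale) m n i (tree_op m x) (tree_op n y)"
proof (rule HOL.ext)
  fix us
  show "tree_op (m + n - 1) (op_comp LW m n i x y) us = op_comp (end_operad scale) m n i (tree_op m x) (tree_op n y) us"
  proof (cases "length us = m + n - 1")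
    case True
    let ?ws = "take n (drop (i - 1) us)"
    let ?us = "\<lambda>z. take (i - 1) us @ [z] @ drop (i - 1 + n) us"
    have len: "length ?ws = n" "length (?us z) = m" for z using True mn by auto
    have upd: "(?us 0)[i - 1 := z] = ?us z" for z
      using True mn by (auto simp: list_update_append)
    have lin: "is_linear scale scale (\<lambda>z. ev (env (?us z)) T)" if "T \<in> LW_trees m" for T
      using linear_ev_env[OF mn(1) that len(2)[of 0], of "i - 1"] mn(3) unfolding upd by fastforce
    have pair: "lin_ext scale (ev (env us)) (LW_tree_comp n i T R) = ev (env (?us (ev (env ?ws) R))) T"
      if T: "T \<in> LW_trees m" and R: "R \<in> LW_trees n" for T R
    proof -
      have R': "ev (\<lambda>k. env us (shift_by i k)) R = ev (env ?ws) R"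
        by (rule evg_cong) (use R mn True in \<open>auto simp: LW_trees_iff[OF mn(2)] shift_by_def add.commute\<close>)
      have "ev (\<lambda>j. if j = i then ev (env ?ws) R else env us (shift_above i n j)) T = ev (env (?us (ev (env ?ws) R))) T"
      proof (rule evg_cong, rule conjI, rule refl)
        fix j assume "j \<in> set (labels T)"
        then have j: "1 \<le> j" "j \<le> m" using T by (auto simp: LW_trees_iff[OF mn(1)])
        have i1: "length (take (i - 1) us) = i - 1" using True mn by auto
        consider "j < i" | "j = i" | "i < j" by linarith
        then show "(if j = i then ev (env ?ws) R else env us (shift_above i n j)) = env (?us (ev (env ?ws) R)) j"
        proof cases
          case 1
          then have "j - 1 < i - 1" using j by linarith
          then show ?thesis using 1 i1 by (simp add: shift_above_def nth_append)
        next
          case 2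
          then show ?thesis using i1 by (simp add: nth_append)
        next
          case 3
          then have "\<not> j - 1 < i - 1" "j - 1 - (i - 1) = Suc (j - 1 - i)" using mn by auto
          then have "env (?us z) j = drop (i - 1 + n) us ! (j - 1 - i)" for z
            using 3 by (simp only: nth_append i1 if_False length_Cons list.size less_Suc0 nat.distinct nth_Cons_Suc append_Cons append_Nil)
          moreover have "i - 1 + n \<le> length us" using True mn by auto
          ultimately have "env (?us z) j = us ! (i - 1 + n + (j - 1 - i))" for z
            by (simp only: nth_drop)
          moreover have "i - 1 + n + (j - 1 - i) = shift_above i n j - 1"
            using 3 mn by (auto simp: shift_above_def)
          ultimately show ?thesis using 3 by simp
        qed
      qed
      then show ?thesis
        unfolding ev_LW_tree_comp[OF tree_compositionI[OF mn T R]] R' .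
    qed
    have "tree_op (m + n - 1) (op_comp LW m n i x y) us = lin_ext scale (\<lambda>T. lin_ext scale (\<lambda>R. lin_ext scale (ev (env us)) (LW_tree_comp n i T R)) y) x"
      using True by (simp add: tree_op_def LW_simps lin_ext_pm_lin[OF vs])
    also have "\<dots> = lin_ext scale (\<lambda>T. ev (env (?us (lin_ext scale (ev (env ?ws)) y))) T) x"
    proof (rule lin_ext_cong)
      fix T assume "T \<in> Poly_Mapping.keys x"
      then have T: "T \<in> LW_trees m" using xy by auto
      have "lin_ext scale (\<lambda>R. lin_ext scale (ev (env us)) (LW_tree_comp n i T R)) y = lin_ext scale (\<lambda>R. ev (env (?us (ev (env ?ws) R))) T) y"
        by (rule lin_ext_cong) (use pair[OF T] xy in blast)
      also have "\<dots> = ev (env (?us (lin_ext scale (ev (env ?ws)) y))) T"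
        by (rule linear_lin_ext_comp[OF lin[OF T], symmetric])
      finally show "lin_ext scale (\<lambda>R. lin_ext scale (ev (env us)) (LW_tree_comp n i T R)) y = \<dots>" .
    qed
    also have "\<dots> = op_comp (end_operad scale) m n i (tree_op m x) (tree_op n y) us"
      using True len by (simp add: end_simps tree_op_def)
    finally show ?thesis .
  qed (simp add: tree_op_def end_simps)
qed

sublocale LW_algebra scale bracket tree_op
proof (intro LW_algebra.intro LW_algebra_axioms.intro lie_algebra_axioms)
  fix n :: nat assume n: "1 \<le> n"
  note l = linear_lin_ext[OF vs]
  have "is_linear scale scale (\<lambda>v. tree_op n x (us[j := v]))" if "x \<in> LW_space n" "length us = n" "j < n" for x us j
  proof -
    have "is_linear scale scale (\<lambda>v. lin_ext scale (ev (env (us[j := v]))) x)"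
      unfolding lin_ext_def
      by (intro lin_sum_fun lin_scale_fun vs linear_ev_env[OF n]) (use that in auto)
    then show ?thesis using that by (simp add: tree_op_def)
  qed
  then show "tree_op n \<in> linear_maps (op_space LW n) (op_space (end_operad scale) n)"
    by (auto simp: linear_maps_def LW_simps(1) end_simps tree_op_def lin_add[OF l] lin_scale[OF l])
  fix \<sigma> and x :: "nat ptree \<Rightarrow>\<^sub>0 'k" assume \<sigma>: "\<sigma> permutes {1..n}" and x: "x \<in> LW_space n"
  show "tree_op n (op_act LW n \<sigma> x) = op_act (end_operad scale) n \<sigma> (tree_op n x)"
  proof (rule HOL.ext)
    fix us :: "'g list"
    show "tree_op n (op_act LW n \<sigma> x) us = op_act (end_operad scale) n \<sigma> (tree_op n x) us"
    proof (cases "length us = n")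
      case True
      let ?us = "map (\<lambda>j. us ! (\<sigma> j - 1)) [1..<n + 1]"
      have "ev (env us) (map_ptree \<sigma> t) = ev (env ?us) t" if "t \<in> LW_trees n" for t
        unfolding ev_map_ptree
      proof (rule evg_cong, rule conjI, rule refl)
        fix j assume "j \<in> set (labels t)"
        then have j: "1 \<le> j" "j \<le> n" using that by (auto simp: LW_trees_iff[OF n])
        then have "[1..<n + 1] ! (j - 1) = j" by (subst nth_upt) auto
        then show "us ! (\<sigma> j - 1) = ?us ! (j - 1)" using j by (subst nth_map) (simp_all del: upt_Suc)
      qed
      then show ?thesis
        using True x by (simp add: tree_op_def end_simps LW_simps lin_ext_pm_lin[OF vs] vs del: upt_Suc)
          (intro lin_ext_cong, blast)
    qed (simp add: tree_op_def end_simps)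
  qed
next
  show "tree_op 1 (op_unit LW) = op_unit (end_operad scale)"
    by (auto simp: fun_eq_iff tree_op_def end_simps LW_simps vs node_val_def length_Suc_conv)
next
  show "tree_op (m + n - 1) (op_comp LW m n i x y) = op_comp (end_operad scale) m n i (tree_op m x) (tree_op n y)"
    if "1 \<le> m" "1 \<le> n" "i \<in> {1..m}" "x \<in> LW_space m" "y \<in> LW_space n" for m n i x y
    by (rule tree_op_comp[OF that])
next
  fix n and x :: "nat ptree \<Rightarrow>\<^sub>0 'k" assume "x \<in> PSB_relations n"
  note l = linear_lin_ext[OF vs]
  have jac: "bracket a (bracket b c) - bracket (bracket a b) c - bracket b (bracket a c) = 0" for a b c
    using jacobi[of a b c] bracket_antisym[of c a] bracket_antisym[of "bracket a b" c]
    by (simp add: lin_minus[OF bracket_linear_right] algebra_simps)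
  have n: "n = 2 \<or> n = 3" using \<open>x \<in> PSB_relations n\<close> by (auto simp: PSB_relations_def split: if_splits)
  have "lin_ext scale (ev (env us)) x = 0" for us
    using n
  proof
    assume "n = 2"
    then have "x = unit_vec (cherry (leaf 1) (leaf 2)) + unit_vec (cherry (leaf 2) (leaf 1))"
      using \<open>x \<in> PSB_relations n\<close> by (simp add: PSB_relations_def)
    then show ?thesis
      using bracket_antisym[of "us ! 0" "us ! 1"] by (simp add: lin_add[OF l] vs node_val_def)
  next
    assume "n = 3"
    then have "x = unit_vec (cherry (leaf 1) (cherry (leaf 2) (leaf 3))) - unit_vec (cherry (cherry (leaf 1) (leaf 2)) (leaf 3))
        - unit_vec (cherry (leaf 2) (cherry (leaf 1) (leaf 3)))"
      using \<open>x \<in> PSB_relations n\<close> by (simp add: PSB_relations_def)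
    then show ?thesis
      using jac[of "us ! 0" "us ! 1" "us ! 2"] by (simp add: lin_diff[OF l] vs node_val_def)
  qed
  then show "tree_op n x = (\<lambda>vs. 0)" by (simp add: tree_op_def fun_eq_iff)
qed

lemma gam_class:
  "1 \<le> n \<Longrightarrow> t \<in> LW_trees n \<Longrightarrow> length us = n \<Longrightarrow> gam n (PSB_class n t) us = ev (env us) t"
  by (simp add: PSB_class_eq gam_coset tree_op_def vs)

lemma gam_PSB_structure: "gam \<in> PSB_structures scale bracket"
  unfolding PSB_structures_def
  using gam_hom gam_class[OF _ cherry_LW(1)] by (simp add: node_val_def)

lemma gam_corolla_1: "gam 2 (PSB_class 2 (corolla 1)) [y, x] = p x y"
  using gam_class[of 2 "corolla 1" "[y, x]"] corolla_LW[of 1]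
  by (simp add: corolla_def node_val_def wact_Cons numeral_2_eq_2)

end

subsection \<open>The post-Lie algebra of a \<open>PSB\<close>-algebra\<close>

text \<open>\<open>std k t\<close> has the shape of \<open>t\<close>, with labels \<open>k, k + 1, \<dots>\<close> in preorder.\<close>

fun std :: "nat \<Rightarrow> 'l ptree \<Rightarrow> nat ptree" and stds :: "nat \<Rightarrow> 'l ptree list \<Rightarrow> nat ptree list" where
  "std k (Node l us) = Node (map_option (\<lambda>_. k) l) (stds (if l = None then k else Suc k) us)"
| "stds k [] = []"
| "stds k (u # us) = std k u # stds (k + length (labels u)) us"

lemma length_stds [simp]: "length (stds k us) = length us"
  by (induction us arbitrary: k) auto

lemma stds_append: "stds k (us @ vs) = stds k us @ stds (k + length (concat (map labels us))) vs"
  by (induction us arbitrary: k) (simp_all add: add.assoc)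

lemma upt_add: "[k..<k + (a + b)] = [k..<k + a] @ [k + a..<k + (a + b)]"
  using upt_add_eq_append[of k "k + a" b] by (simp add: add.assoc)

lemma labels_std:
  fixes t :: "'l ptree" and us :: "'l ptree list"
  shows "labels (std k t) = [k..<k + length (labels t)]"
    and "concat (map labels (stds k us)) = [k..<k + length (concat (map labels us))]"
  by (induction k t and k us rule: std_stds.induct)
    (auto split: option.splits simp: upt_conv_Cons add.assoc upt_add[symmetric] simp del: upt_Suc)

lemma fully_labeled_std:
  fixes t :: "'l ptree" and us :: "'l ptree list"
  shows "fully_labeled (std k t) = fully_labeled t"
    and "(\<forall>u\<in>set (stds k us). fully_labeled u) = (\<forall>u\<in>set us. fully_labeled u)"
  by (induction k t and k us rule: std_stds.induct) auto

lemma lw_tree_std: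
  fixes t :: "'l ptree" and us :: "'l ptree list"
  shows "lw_tree (std k t) = lw_tree t"
    and "(\<forall>u\<in>set (stds k us). lw_tree u) = (\<forall>u\<in>set us. lw_tree u)"
  by (induction k t and k us rule: std_stds.induct) (auto simp: fully_labeled_std)

lemma std_map_ptree:
  fixes t :: "'l ptree" and us :: "'l ptree list"
  shows "std k (map_ptree f t) = std k t"
    and "stds k (map (map_ptree f) us) = stds k us"
  by (induction k t and k us rule: std_stds.induct) (simp_all add: labels_map_ptree option.map_comp comp_def)

lemma map_ptree_std:
  fixes t :: "'l ptree" and us :: "'l ptree list"
  shows "map f [k..<k + length (labels t)] = labels t \<Longrightarrow> map_ptree f (std k t) = t"
    and "map f [k..<k + length (concat (map labels us))] = concat (map labels us) \<Longrightarrow> map (map_ptree f) (stds k us) = us"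
proof (induction k t and k us rule: std_stds.induct)
  case (1 k l us)
  then show ?case by (cases l) (simp_all add: upt_conv_Cons del: upt_Suc)
next
  case (3 k u us)
  have "[k..<k + length (concat (map labels (u # us)))] =
      [k..<k + length (labels u)] @ [k + length (labels u)..<k + length (labels u) + length (concat (map labels us))]"
    using upt_add[of k "length (labels u)" "length (concat (map labels us))"] by (simp add: add.assoc)
  with 3(3) have "map f [k..<k + length (labels u)] = labels u"
    "map f [k + length (labels u)..<k + length (labels u) + length (concat (map labels us))] = concat (map labels us)"
    by (simp_all del: upt_Suc)
  then show ?case using 3(1,2) by simp
qed simp

text \<open>The equation \<open>f j + k = j + k'\<close> states a shift by k' - k without truncated
  subtraction, so it covers shifts in both directions.\<close>

lemma shift_std:
  fixes t :: "'l ptree" and us :: "'l ptree list"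
  shows "(\<And>j. k \<le> j \<Longrightarrow> j < k + length (labels t) \<Longrightarrow> f j + k = j + k') \<Longrightarrow> map_ptree f (std k t) = std k' t"
    and "(\<And>j. k \<le> j \<Longrightarrow> j < k + length (concat (map labels us)) \<Longrightarrow> f j + k = j + k') \<Longrightarrow> map (map_ptree f) (stds k us) = stds k' us"
proof (induction k t and k us arbitrary: k' and k' rule: std_stds.induct)
  case (1 k l us)
  show ?case
  proof (cases l)
    case None
    then show ?thesis using 1(1)[of k'] 1(2) by simp
  next
    case (Some a)
    then have "map (map_ptree f) (stds (Suc k) us) = stds (Suc k') us"
      using 1(1)[of "Suc k'"] 1(2) by simp
    then show ?thesis using 1(2)[of k] Some by simp
  qed
next
  case (3 k u us)
  have "map_ptree f (std k u) = std k' u" by (rule 3(1)) (use 3(3) in simp)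
  moreover have "map (map_ptree f) (stds (k + length (labels u)) us) = stds (k' + length (labels u)) us"
  proof (rule 3(2))
    fix j assume "k + length (labels u) \<le> j" "j < k + length (labels u) + length (concat (map labels us))"
    then have "f j + k = j + k'" by (intro 3(3)) simp_all
    then show "f j + (k + length (labels u)) = j + (k' + length (labels u))" by simp
  qed
  ultimately show ?case by simp
qed simp

lemma std_LW:
  assumes "lw_tree t"
  shows "std 1 t \<in> LW_trees (length (labels t))"
proof -
  have "1 \<le> length (labels t)" using labels_nonempty[OF assms] by (simp add: Suc_le_eq)
  then show ?thesis
    using assms by (auto simp: LW_trees_iff lw_tree_std labels_std atLeastLessThanSuc_atLeastAtMost simp del: upt_Suc)
qed

lemma graft_Nil [simp]: "graft [] t = t"
  by (induction t) (simp add: map_idI)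

text \<open>Replacing a subtree \<open>u\<close> above the root by a leaf and composing there with
  \<open>u\<close> gives the tree back; \<open>i\<close> is the preorder number of the leaf. The
  leaf has no incoming edges, so there is a single grafting.\<close>

lemma LW_tree_comp_std:
  fixes a :: 'l
  assumes lw: "lw_tree (Node l (us @ u # vs))"
  defines "i \<equiv> (if l = None then 1 else 2) + length (concat (map labels us))"
  defines "T \<equiv> std 1 (Node l (us @ Node (Some a) [] # vs))"
  shows "T \<in> LW_trees (length (labels (Node l (us @ Node (Some a) [] # vs))))"
    and "i \<in> {1..length (labels (Node l (us @ Node (Some a) [] # vs)))}"
    and "LW_tree_comp (length (labels u)) i T (std 1 u) = unit_vec (std 1 (Node l (us @ u # vs)))"
proof -
  let ?s = "Node l (us @ Node (Some a) [] # vs)"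
  let ?m = "length (labels ?s)" and ?n = "length (labels u)"
  let ?k = "if l = None then 1 else Suc 1"
  have lwu: "lw_tree u" and lws: "lw_tree ?s"
    using lw by (auto simp: fully_labeled_lw_tree split: if_splits)
  show T: "T \<in> LW_trees ?m" unfolding T_def by (rule std_LW[OF lws])
  have R: "std 1 u \<in> LW_trees ?n" by (rule std_LW[OF lwu])
  show i: "i \<in> {1..?m}" by (auto simp: i_def split: option.splits)
  have T_eq: "T = Node (map_option (\<lambda>_. 1) l) (stds ?k us @ leaf i # stds (Suc i) vs)"
    by (simp add: T_def i_def stds_append del: One_nat_def)
  have n: "1 \<le> ?n" and m: "1 \<le> ?m" using labels_nonempty[OF lwu] i by (auto simp: Suc_le_eq)
  interpret tree_composition ?m ?n i T "std 1 u" by (rule tree_compositionI[OF m n i T R])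
  have l: "map_option (\<lambda>_. 1) l \<noteq> Some i" by (auto simp: i_def)
  let ?us = "stds ?k us @ leaf i # stds (Suc i) vs"
  have j: "length us < length ?us" "i \<in> set (labels (?us ! length us))" by (simp_all add: nth_append)
  have v: "vertex T i = [length us]"
    using vertex_kid[OF T_props(2)[unfolded T_eq] j] vertex_root[of i "[]"] by (simp add: T_eq nth_append)
  \<comment> \<open>Contraction would require an unlabeled root of \<open>u\<close> above a labeled
    vertex, which \<open>lw_tree\<close> excludes.\<close>
  have nc: "\<not> contracted"
  proof
    assume c: contracted
    then have "lab (std 1 u) = None" unfolding contracted_def W_trees_iff by blast
    then have "lab u = None" by (cases u) simp
    then have "\<not> fully_labeled u" by (cases u) simp
    then have "l = None" using lw by (simp split: if_splits)
    then have "[] \<in> unlabeled T" by (simp add: T_eq Nil_unlabeled)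
    then show False using c unfolding contracted_def v by simp
  qed
  have T': "T' = Node (map_option (\<lambda>_. 1) l) (stds ?k us @ leaf i # stds (i + ?n) vs)"
  proof -
    have "map (map_ptree sT) (stds ?k us) = stds ?k us"
      by (rule shift_std) (auto simp: shift_above_def i_def split: if_splits)
    moreover have "map (map_ptree sT) (stds (Suc i) vs) = stds (i + ?n) vs"
      by (rule shift_std) (use n in \<open>auto simp: shift_above_def\<close>)
    moreover have "map_option sT (map_option (\<lambda>_. 1) l) = map_option (\<lambda>_. 1) l"
      by (cases l) (auto simp: shift_above_def i_def)
    ultimately show ?thesis by (simp add: T_eq del: option.map_comp)
  qed
  have R': "map_ptree sR (std 1 u) = std i u"
    by (rule shift_std) (auto simp: shift_by_def)
  let ?us' = "stds ?k us @ leaf i # stds (i + ?n) vs"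
  have other: "i \<notin> set (labels (?us' ! j'))" if "j' < length ?us'" "j' \<noteq> length us" for j'
    using distinct_labels_kids_disjoint[OF T'_props(2)[unfolded T'], of "length us" j'] that by (auto simp: nth_append)
  have "kids_at i T' = kids_at i (leaf i)"
    unfolding T' using kids_at_kid[OF l, of "length us" ?us'] other by (simp add: nth_append)
  then have kids: "kids_at i T' = []" by simp
  have S: "std 1 (Node l (us @ u # vs)) = Node (map_option (\<lambda>_. 1) l) (stds ?k us @ std i u # stds (i + ?n) vs)"
    by (simp add: i_def stds_append del: One_nat_def)
  have "replace_vertex i f T' = Node (map_option (\<lambda>_. 1) l) (stds ?k us @ f [] # stds (i + ?n) vs)" for f
    unfolding T' using replace_vertex_kid[OF l, of "length us" ?us' f] other by (simp add: nth_append list_update_append)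
  then have ins: "insert_tree (std 1 u) [] = std 1 (Node l (us @ u # vs))"
    unfolding insert_tree_def R' S by simp
  have gr: "graftings (std 1 u) = {[]}" by (auto simp: graftings_def kids)
  show "LW_tree_comp ?n i T (std 1 u) = unit_vec (std 1 (Node l (us @ u # vs)))"
    unfolding LW_tree_comp_eq if_not_P[OF nc] gr
    by (simp only: sum.insert finite.emptyI sum.empty empty_iff not_False_eq_True add_0_right ins)
qed

section \<open>Values of trees under a \<open>PSB\<close> structure\<close>

locale PSB_algebra = lie_algebra scale bracket
  for scale :: "'k::field \<Rightarrow> 'g::ab_group_add \<Rightarrow> 'g" and bracket +
  fixes \<gamma> :: "nat \<Rightarrow> (nat ptree \<Rightarrow>\<^sub>0 'k) set \<Rightarrow> 'g list \<Rightarrow> 'g"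
  assumes PSB_structure: "\<gamma> \<in> PSB_structures scale bracket"
begin

definition val :: "nat \<Rightarrow> nat ptree \<Rightarrow> 'g list \<Rightarrow> 'g" where
  "val n t = \<gamma> n (PSB_class n t)"

definition corolla_val :: "'g list \<Rightarrow> 'g \<Rightarrow> 'g" where
  "corolla_val xs y = val (length xs + 1) (corolla (length xs)) (y # xs)"

lemma hom: "\<gamma> \<in> operad_homs PSB (end_operad scale)"
  and val_cherry: "val 2 (cherry (leaf 1) (leaf 2)) [x, y] = bracket x y"
  using PSB_structure by (simp_all add: PSB_structures_def val_def)

lemma hom_linear: "1 \<le> n \<Longrightarrow> \<gamma> n \<in> linear_maps (op_space PSB n) (op_space (end_operad scale) n)"
  and hom_act: "1 \<le> n \<Longrightarrow> \<sigma> permutes {1..n} \<Longrightarrow> X \<in> carrier (op_space PSB n) \<Longrightarrow>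
    \<gamma> n (op_act PSB n \<sigma> X) = op_act (end_operad scale) n \<sigma> (\<gamma> n X)"
  and hom_unit: "\<gamma> 1 (op_unit PSB) = op_unit (end_operad scale)"
  and hom_comp: "1 \<le> m \<Longrightarrow> 1 \<le> n \<Longrightarrow> i \<in> {1..m} \<Longrightarrow> X \<in> carrier (op_space PSB m) \<Longrightarrow> Y \<in> carrier (op_space PSB n) \<Longrightarrow>
    \<gamma> (m + n - 1) (op_comp PSB m n i X Y) = op_comp (end_operad scale) m n i (\<gamma> m X) (\<gamma> n Y)"
  using hom unfolding operad_homs_def by blast+

lemma psb_coset_closed: "1 \<le> n \<Longrightarrow> x \<in> LW_space n \<Longrightarrow> psb_coset n x \<in> carrier (op_space PSB n)"
  by (simp add: carrier_PSB)

lemma hom_closed: "1 \<le> n \<Longrightarrow> x \<in> LW_space n \<Longrightarrow> \<gamma> n (psb_coset n x) \<in> carrier (op_space (end_operad scale) n)"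
  using hom_linear[of n] psb_coset_closed[of n x] by (auto simp: linear_maps_def)

lemma hom_add: "1 \<le> n \<Longrightarrow> x \<in> LW_space n \<Longrightarrow> y \<in> LW_space n \<Longrightarrow>
    \<gamma> n (psb_coset n (x + y)) us = \<gamma> n (psb_coset n x) us + \<gamma> n (psb_coset n y) us"
  and hom_scale: "1 \<le> n \<Longrightarrow> x \<in> LW_space n \<Longrightarrow> \<gamma> n (psb_coset n (pm_scale c x)) us = scale c (\<gamma> n (psb_coset n x) us)"
proof -
  assume n: "1 \<le> n" and x: "x \<in> LW_space n"
  interpret pm_quotient "free_space (LW_trees n)" "PSB_ideal n :: (nat ptree \<Rightarrow>\<^sub>0 'k) set" by (rule pm_quotient_PSB[OF n])
  note h = hom_linear[OF n] psb_coset_closed[OF n x]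
  show "\<gamma> n (psb_coset n (pm_scale c x)) us = scale c (\<gamma> n (psb_coset n x) us)"
    using h x by (simp add: linear_maps_def smult_Q[symmetric] end_simps PSB_simps(1))
  assume y: "y \<in> LW_space n"
  show "\<gamma> n (psb_coset n (x + y)) us = \<gamma> n (psb_coset n x) us + \<gamma> n (psb_coset n y) us"
    using h x y psb_coset_closed[OF n y] by (simp add: linear_maps_def add_Q[symmetric] end_simps PSB_simps(1))
qed

lemma hom_eq_lin_ext:
  assumes n: "1 \<le> n" and x: "x \<in> LW_space n"
  shows "\<gamma> n (psb_coset n x) us = lin_ext scale (\<lambda>t. val n t us) x"
proof -
  have c: "(\<Sum>b\<in>A. pm_scale (c b) (unit_vec b)) \<in> (LW_space n :: (nat ptree \<Rightarrow>\<^sub>0 'k) set)" if "A \<subseteq> LW_trees n" for A c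
    by (intro subsp_sum[OF vector_space_pm_scale subspace_keys] subsp_scale[OF vector_space_pm_scale subspace_keys]) (use that in auto)
  have "\<gamma> n (psb_coset n (\<Sum>b\<in>A. pm_scale (c b) (unit_vec b))) us = (\<Sum>b\<in>A. scale (c b) (val n b us))"
    if "finite A" "A \<subseteq> LW_trees n" for A c
    using that
  proof (induction A rule: finite_induct)
    case empty
    show ?case using hom_scale[OF n, of 0 0 us] by simp
  next
    case (insert a A)
    then have a: "unit_vec a \<in> (LW_space n :: (nat ptree \<Rightarrow>\<^sub>0 'k) set)" by simp
    have ca: "pm_scale (c a) (unit_vec a) \<in> (LW_space n :: (nat ptree \<Rightarrow>\<^sub>0 'k) set)"
      by (rule subsp_scale[OF vector_space_pm_scale subspace_keys a])
    have "\<gamma> n (psb_coset n (\<Sum>b\<in>insert a A. pm_scale (c b) (unit_vec b))) us =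
        \<gamma> n (psb_coset n (pm_scale (c a) (unit_vec a) + (\<Sum>b\<in>A. pm_scale (c b) (unit_vec b)))) us"
      by (simp only: sum.insert[OF insert.hyps])
    also have "\<dots> = scale (c a) (val n a us) + \<gamma> n (psb_coset n (\<Sum>b\<in>A. pm_scale (c b) (unit_vec b))) us"
      using insert.prems by (simp only: hom_add[OF n ca c] hom_scale[OF n a] val_def PSB_class_eq insert_subset)
    also have "\<gamma> n (psb_coset n (\<Sum>b\<in>A. pm_scale (c b) (unit_vec b))) us = (\<Sum>b\<in>A. scale (c b) (val n b us))"
      by (rule insert.IH) (use insert.prems in simp)
    finally show ?case by (simp only: sum.insert[OF insert.hyps])
  qed
  from this[of "Poly_Mapping.keys x" "Poly_Mapping.lookup x"] x show ?thesis
    using lin_ext_unit_vec[of x] by (simp add: lin_ext_def)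
qed

lemma val_linear:
  assumes "1 \<le> n" "t \<in> LW_trees n" "length us = n" "j < n"
  shows "is_linear scale scale (\<lambda>v. val n t (us[j := v]))"
  using hom_closed[OF assms(1), of "unit_vec t"] assms by (simp add: end_simps val_def PSB_class_eq)

lemma val_act:
  assumes "1 \<le> n" "\<sigma> permutes {1..n}" "t \<in> LW_trees n" "length us = n"
  shows "val n (map_ptree \<sigma> t) us = val n t (map (\<lambda>j. us ! (\<sigma> j - 1)) [1..<n + 1])"
proof -
  have "unit_vec t \<in> (LW_space n :: (nat ptree \<Rightarrow>\<^sub>0 'k) set)" using assms by simp
  from hom_act[OF assms(1,2) psb_coset_closed[OF assms(1) this]] op_act_PSB[OF assms(1,2) this]
  show ?thesis
    using assms(4) by (simp add: val_def PSB_class_eq LW_simps pm_lin_unit end_simps fun_eq_iff del: upt_Suc)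
qed

lemma val_comp:
  assumes mn: "1 \<le> m" "1 \<le> n" "i \<in> {1..m}" and TR: "T \<in> LW_trees m" "R \<in> LW_trees n"
    and us: "length us = m + n - 1"
  shows "lin_ext scale (\<lambda>t. val (m + n - 1) t us) (LW_tree_comp n i T R) =
    val m T (take (i - 1) us @ [val n R (take n (drop (i - 1) us))] @ drop (i - 1 + n) us)"
proof -
  have u: "unit_vec T \<in> (LW_space m :: (nat ptree \<Rightarrow>\<^sub>0 'k) set)" "unit_vec R \<in> (LW_space n :: (nat ptree \<Rightarrow>\<^sub>0 'k) set)"
    using TR by simp_all
  interpret tree_composition m n i T R by (rule tree_compositionI[OF mn TR])
  have c: "op_comp LW m n i (unit_vec T) (unit_vec R) = (LW_tree_comp n i T R :: nat ptree \<Rightarrow>\<^sub>0 'k)"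
    by (simp add: LW_simps pm_lin_unit)
  have "lin_ext scale (\<lambda>t. val (m + n - 1) t us) (LW_tree_comp n i T R) = \<gamma> (m + n - 1) (psb_coset (m + n - 1) (LW_tree_comp n i T R)) us"
    by (rule hom_eq_lin_ext[symmetric]) (use mn(1,2) keys_LW_tree_comp in auto)
  also have "\<dots> = op_comp (end_operad scale) m n i (\<gamma> m (psb_coset m (unit_vec T))) (\<gamma> n (psb_coset n (unit_vec R))) us"
    using hom_comp[OF mn psb_coset_closed[OF mn(1) u(1)] psb_coset_closed[OF mn(2) u(2)]] op_comp_PSB[OF mn u] by (simp only: c)
  finally show ?thesis using us by (simp add: end_simps val_def PSB_class_eq)
qed

text \<open>Counterpart of \<open>ev\<close> with the given corolla values in place of the
  recursion; the arguments are the labels of the tree.\<close>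

primrec corolla_ev :: "'g ptree \<Rightarrow> 'g" where
  "corolla_ev (Node l us) = (case l of Some y \<Rightarrow> corolla_val (map corolla_ev us) y
     | None \<Rightarrow> (case map corolla_ev us of [a, b] \<Rightarrow> bracket a b | _ \<Rightarrow> 0))"

lemma corolla_val_Nil: "corolla_val [] y = y"
  using hom_unit by (simp add: corolla_val_def val_def PSB_class_eq PSB_simps LW_simps corolla_def end_simps)

lemma std_corolla: "std 1 (Node (Some y) (map (\<lambda>x. Node (Some x) []) xs)) = corolla (length xs)"
proof -
  have "stds k (map (\<lambda>x. Node (Some x) []) xs) = map leaf [k..<k + length xs]" for k
    by (induction xs arbitrary: k) (simp_all add: upt_conv_Cons del: upt_Suc)
  then show ?thesis by (simp add: corolla_def numeral_2_eq_2 del: upt_Suc)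
qed

text \<open>A tree with a subtree \<open>u\<close> above its root that is not a leaf is the composition of a smaller tree
  and \<open>u\<close>, so that its value is determined by those of the corollas and of the cherry.\<close>

lemma val_std: "lw_tree t \<Longrightarrow> val (length (labels t)) (std 1 t) (labels t) = corolla_ev t"
proof (induction "size t" arbitrary: t rule: less_induct)
  case less
  obtain l us where t: "t = Node l us" by (cases t)
  let ?leaf = "\<lambda>x. Node (Some x) []"
  show ?case
  proof (cases "\<forall>u\<in>set us. \<exists>x. u = ?leaf x")
    case True
    then obtain xs where us: "us = map ?leaf xs"
      by (metis (no_types, lifting) ex_map_conv)
    have ev: "map corolla_ev us = xs" by (simp add: us comp_def corolla_val_Nil)
    have labels: "concat (map labels us) = xs" by (simp add: us comp_def)
    show ?thesis
    proof (cases l)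
      case None
      then obtain a b where "xs = [a, b]"
        using less.prems by (auto simp: t us length_Suc_conv numeral_2_eq_2)
      then show ?thesis using val_cherry by (simp add: t us None corolla_val_Nil numeral_2_eq_2)
    next
      case (Some y)
      then have "labels t = y # xs" "corolla_ev t = corolla_val xs y" using ev labels by (simp_all add: t)
      then show ?thesis unfolding corolla_val_def by (simp add: t Some us std_corolla[unfolded One_nat_def] del: std.simps)
    qed
  next
    case False
    then obtain u where "u \<in> set us" and nleaf: "\<And>x. u \<noteq> ?leaf x" by blast
    then obtain pre post where us: "us = pre @ u # post" by (auto simp: in_set_conv_decomp)
    let ?z = "corolla_ev u"
    let ?t = "Node l (pre @ ?leaf ?z # post)"
    let ?m = "length (labels ?t)" and ?n = "length (labels u)"
    define i where "i = (if l = None then 1 else 2) + length (concat (map labels pre))"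
    note lw = less.prems[unfolded t us]
    have lwu: "lw_tree u" "lw_tree ?t"
      using lw by (auto simp: fully_labeled_lw_tree split: if_splits)
    \<comment> \<open>Not being a leaf, \<open>u\<close> has a vertex above its root, so replacing
      it by a leaf makes the tree smaller.\<close>
    have size_u: "size (?leaf ?z) < size u"
    proof -
      obtain k ks where u: "u = Node k ks" by (cases u)
      have "ks \<noteq> []" using lwu(1) nleaf by (cases k) (auto simp: u)
      then show ?thesis by (cases ks; cases k) (simp_all add: u)
    qed
    have "size ?t < size t" "size u < size t" using size_u by (simp_all add: t us)
    note IH = less.hyps[OF this(1) lwu(2)] less.hyps[OF this(2) lwu(1)]
    note comp = LW_tree_comp_std[where a = ?z, OF lw, folded i_def]
    have mn: "1 \<le> ?m" "1 \<le> ?n" using labels_nonempty lwu by (auto simp: Suc_le_eq)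
    define A where "A = (case l of None \<Rightarrow> [] | Some y \<Rightarrow> [y]) @ concat (map labels pre)"
    define B where "B = concat (map labels post)"
    have labs: "labels t = A @ labels u @ B" "labels ?t = A @ [?z] @ B" "length A = i - 1"
      by (auto simp: A_def B_def t us i_def split: option.splits)
    have len: "length (labels t) = ?m + ?n - 1" by (simp add: labs(1,2) del: labels.simps)
    have "val (?m + ?n - 1) (std 1 t) (labels t) =
      val ?m (std 1 ?t) (take (i - 1) (labels t) @ [val ?n (std 1 u) (take ?n (drop (i - 1) (labels t)))] @ drop (i - 1 + ?n) (labels t))"
      using val_comp[OF mn comp(2,1) std_LW[OF lwu(1)] len] unfolding comp(3) t[unfolded us, symmetric] lin_ext_unit[OF vs] .
    also have "\<dots> = val ?m (std 1 ?t) (labels ?t)"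
      using IH(2) by (simp add: labs del: std.simps labels.simps)
    also have "\<dots> = corolla_ev t" unfolding IH(1) t us
      by (simp only: corolla_ev.simps map_append list.map option.case corolla_val_Nil)
    finally show ?thesis unfolding len .
  qed
qed

text \<open>Equivariance reduces an arbitrary labeling to the preorder labeling:
  \<open>\<sigma>\<close> sends the preorder number of a vertex to its label.\<close>

lemma val_eq:
  assumes n: "1 \<le> n" and t: "t \<in> LW_trees n" and us: "length us = n"
  shows "val n t us = corolla_ev (map_ptree (env us) t)"
proof -
  have t': "lw_tree t" "distinct (labels t)" "set (labels t) = {1..n}" using t by (simp_all add: LW_trees_iff[OF n])
  have len: "length (labels t) = n" using distinct_card[OF t'(2)] t'(3) by simp
  define \<sigma> where "\<sigma> = (\<lambda>j. if j \<in> {1..n} then labels t ! (j - 1) else j)"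
  have "map \<sigma> [1..<n + 1] = labels t"
    by (rule nth_equalityI) (auto simp: len \<sigma>_def simp del: upt_Suc)
  then have \<sigma>: "map \<sigma> [1..<1 + length (labels t)] = labels t" by (simp add: len del: upt_Suc)
  have "\<sigma> ` {1..n} = {1..n}"
    using arg_cong[OF \<sigma>, of set] t'(3) by (simp add: len atLeastLessThanSuc_atLeastAtMost del: upt_Suc)
  then have "bij_betw \<sigma> {1..n} {1..n}" by (simp add: bij_betw_def eq_card_imp_inj_on)
  then have perm: "\<sigma> permutes {1..n}" by (rule bij_imp_permutes) (auto simp: \<sigma>_def)
  have "map (\<lambda>j. us ! (\<sigma> j - 1)) [1..<n + 1] = map (env us) (map \<sigma> [1..<1 + length (labels t)])"
    by (simp add: len del: upt_Suc)
  also have "\<dots> = labels (map_ptree (env us) t)" unfolding \<sigma> by (simp add: labels_map_ptree)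
  finally have "val n (map_ptree \<sigma> (std 1 t)) us = val n (std 1 t) (labels (map_ptree (env us) t))"
    using val_act[OF n perm, of "std 1 t"] std_LW[OF t'(1)] us len by simp
  also have "\<dots> = corolla_ev (map_ptree (env us) t)"
    using val_std[of "map_ptree (env us) t"] t'(1) by (simp add: labels_map_ptree std_map_ptree len)
  finally show ?thesis using map_ptree_std(1)[OF \<sigma>] by simp
qed

lemma corolla_ev_comp:
  assumes mn: "1 \<le> m" "1 \<le> n" "i \<in> {1..m}" and TR: "T \<in> LW_trees m" "R \<in> LW_trees n"
    and us: "length us = m + n - 1"
  shows "lin_ext scale (\<lambda>t. corolla_ev (map_ptree (env us) t)) (LW_tree_comp n i T R) =
    corolla_ev (map_ptree (env (take (i - 1) us @ [corolla_ev (map_ptree (env (take n (drop (i - 1) us))) R)] @ drop (i - 1 + n) us)) T)"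
proof -
  interpret tree_composition m n i T R by (rule tree_compositionI[OF mn TR])
  have "lin_ext scale (\<lambda>t. val (m + n - 1) t us) (LW_tree_comp n i T R)
    = lin_ext scale (\<lambda>t. corolla_ev (map_ptree (env us) t)) (LW_tree_comp n i T R)"
  proof (rule lin_ext_cong)
    fix t assume "t \<in> Poly_Mapping.keys (LW_tree_comp n i T R :: nat ptree \<Rightarrow>\<^sub>0 'k)"
    then have t: "t \<in> LW_trees (m + n - 1)" using keys_LW_tree_comp by blast
    show "val (m + n - 1) t us = corolla_ev (map_ptree (env us) t)"
      by (rule val_eq[OF _ t us]) (use mn(1,2) in linarith)
  qed
  moreover have "length (take n (drop (i - 1) us)) = n" using us mn by auto
  then have "val n R (take n (drop (i - 1) us)) = corolla_ev (map_ptree (env (take n (drop (i - 1) us))) R)"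
    by (rule val_eq[OF mn(2) TR(2)])
  moreover have "length (take (i - 1) us @ [z] @ drop (i - 1 + n) us) = m" for z using us mn by auto
  then have "val m T (take (i - 1) us @ [z] @ drop (i - 1 + n) us) = corolla_ev (map_ptree (env (take (i - 1) us @ [z] @ drop (i - 1 + n) us)) T)" for z
    by (rule val_eq[OF mn(1) TR(1)])
  ultimately show ?thesis using val_comp[OF mn TR us] by simp
qed

end

section \<open>The post-Lie product of a \<open>PSB\<close> structure\<close>

context PSB_algebra
begin

definition pl :: "'g \<Rightarrow> 'g \<Rightarrow> 'g" where
  "pl x y = corolla_val [x] y"

lemma corolla_1: "corolla 1 = Node (Some 1) [leaf 2]"
  by (simp add: corolla_def numeral_2_eq_2)

text \<open>The corolla with two vertices is composed at its root with a larger corolla: the leaf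
  \<open>x\<close> is grafted onto the root, where it becomes the first leaf, or onto a leaf of the
  larger corolla, on whose value it then acts.\<close>

lemma pl_corolla_val: "pl x (corolla_val xs y) = corolla_val (x # xs) y + dsum pl x (\<lambda>zs. corolla_val zs y) xs"
proof -
  let ?k = "length xs"
  let ?us = "y # xs @ [x]"
  have T: "corolla 1 \<in> LW_trees 2" and R: "corolla ?k \<in> LW_trees (?k + 1)"
    using corolla_LW[of 1] corolla_LW[of ?k] by (simp_all add: numeral_2_eq_2)
  interpret tree_composition 2 "?k + 1" 1 "corolla 1" "corolla ?k"
    by (rule tree_compositionI[OF _ _ _ T R]) auto
  have v: "vertex (corolla 1) 1 = []" unfolding corolla_1 by (rule vertex_root) simp
  have nc: "\<not> contracted" unfolding contracted_def v by simp
  have "sT 2 = ?k + 2" by (simp add: shift_above_def)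
  then have T': "T' = Node (Some 1) [leaf (?k + 2)]" by (simp only: corolla_1 ptree.map list.map option.map sT_i)
  have "sR = (\<lambda>j. j)" by (simp add: shift_by_def fun_eq_iff)
  then have R': "map_ptree sR t = t" for t by (simp add: ptree.map_ident)
  have ins: "insert_tree (corolla ?k) [l] = graft [(l, leaf (?k + 2))] (corolla ?k)" for l
    by (simp only: insert_tree_def R' T' replace_vertex.simps simp_thms if_True zip_Cons_Cons zip_Nil)
  have gr: "graftings (corolla ?k) = (\<lambda>l. [l]) ` {1..?k + 1}"
    unfolding graftings_def R' T' R_props(3) by (auto simp: length_Suc_conv)
  have inj: "inj_on (\<lambda>l. [l]) {1..?k + 1}" by (simp add: inj_on_def)
  \<comment> \<open>Value of the summand in which \<open>x\<close>, carrying the label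
    \<open>?k + 2\<close>, is grafted onto the vertex \<open>l\<close>; \<open>l = 1\<close> is the
    root.\<close>
  define G where "G = (\<lambda>l. corolla_ev (map_ptree (env ?us) (graft [(l, leaf (?k + 2))] (corolla ?k))))"
  have xk: "env ?us (?k + 2) = x" by (simp add: nth_append)
  have ek: "env ?us j = xs ! (j - 2)" if "2 \<le> j" "j < ?k + 2" for j
  proof -
    have "j - 1 = Suc (j - 2)" "j - 2 < ?k" using that by simp_all
    then show ?thesis by (simp add: nth_append)
  qed
  have G: "G l = corolla_val ((if l = 1 then [x] else []) @ map (\<lambda>j. if j = l then pl x (env ?us j) else env ?us j) [2..<?k + 2]) y" for l
  proof -
    have "corolla_ev (map_ptree (env ?us) (graft [(l, leaf (?k + 2))] (leaf j))) = (if j = l then pl x (env ?us j) else env ?us j)" for j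
      using xk by (simp add: corolla_val_Nil pl_def del: nth_Cons_Suc)
    then have m: "map (\<lambda>j. corolla_ev (map_ptree (env ?us) (graft [(l, leaf (?k + 2))] (leaf j)))) [2..<?k + 2]
      = map (\<lambda>j. if j = l then pl x (env ?us j) else env ?us j) [2..<?k + 2]" by simp
    have "G l = corolla_val (map corolla_ev (map (map_ptree (env ?us)) (map snd (filter (\<lambda>(w, u). Some 1 = Some w) [(l, leaf (?k + 2))])))
        @ map (\<lambda>j. corolla_ev (map_ptree (env ?us) (graft [(l, leaf (?k + 2))] (leaf j)))) [2..<?k + 2]) (env ?us 1)"
      unfolding G_def corolla_def by (simp only: graft.simps ptree.map corolla_ev.simps option.map option.case map_append map_map comp_def)
    then show ?thesis
      unfolding m using xk by (simp add: corolla_val_Nil del: upt_Suc nth_Cons_Suc)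
  qed
  have G1: "G 1 = corolla_val (x # xs) y"
  proof -
    have "map (\<lambda>j. if j = 1 then pl x (env ?us j) else env ?us j) [2..<?k + 2] = xs"
    proof (rule nth_equalityI)
      fix j assume "j < length (map (\<lambda>j. if j = 1 then pl x (env ?us j) else env ?us j) [2..<?k + 2])"
      then have j: "j < ?k" "[2..<?k + 2] ! j = j + 2" by (simp_all del: upt_Suc)
      show "map (\<lambda>j. if j = 1 then pl x (env ?us j) else env ?us j) [2..<?k + 2] ! j = xs ! j"
        using j ek[of "j + 2"] by (simp add: nth_map del: upt_Suc nth_Cons_Suc)
    qed (simp del: upt_Suc)
    then show ?thesis unfolding G by simp
  qed
  have G2: "G (i + 2) = corolla_val (xs[i := pl x (xs ! i)]) y" if i: "i < ?k" for i
  proof -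
    have "map (\<lambda>j. if j = i + 2 then pl x (env ?us j) else env ?us j) [2..<?k + 2] = xs[i := pl x (xs ! i)]"
    proof (rule nth_equalityI)
      fix j assume "j < length (map (\<lambda>j. if j = i + 2 then pl x (env ?us j) else env ?us j) [2..<?k + 2])"
      then have j: "j < ?k" "[2..<?k + 2] ! j = j + 2" by (simp_all del: upt_Suc)
      show "map (\<lambda>j. if j = i + 2 then pl x (env ?us j) else env ?us j) [2..<?k + 2] ! j = xs[i := pl x (xs ! i)] ! j"
        using j i ek[of "j + 2"] by (simp add: nth_map nth_list_update del: upt_Suc nth_Cons_Suc)
    qed (simp del: upt_Suc)
    then show ?thesis unfolding G by simp
  qed
  have "lin_ext scale (\<lambda>t. corolla_ev (map_ptree (env ?us) t)) (LW_tree_comp (?k + 1) 1 (corolla 1) (corolla ?k)) = (\<Sum>l\<in>{1..?k + 1}. G l)"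
    unfolding LW_tree_comp_eq if_not_P[OF nc] gr
    by (simp only: sum.reindex[OF inj] comp_def lin_sum[OF linear_lin_ext[OF vs]] lin_ext_unit[OF vs] ins G_def)
  also have "{1..?k + 1} = insert 1 ((\<lambda>i. i + 2) ` {..<?k})"
  proof (rule Set.set_eqI)
    fix j show "j \<in> {1..?k + 1} \<longleftrightarrow> j \<in> insert 1 ((\<lambda>i. i + 2) ` {..<?k})"
      by (auto simp: image_iff intro!: bexI[of _ "j - 2"])
  qed
  also have "(\<Sum>l\<in>\<dots>. G l) = corolla_val (x # xs) y + dsum pl x (\<lambda>zs. corolla_val zs y) xs"
    using G1 G2 by (simp add: sum.reindex inj_on_def dsum_def image_iff)
  finally have "lin_ext scale (\<lambda>t. corolla_ev (map_ptree (env ?us) t)) (LW_tree_comp (?k + 1) 1 (corolla 1) (corolla ?k)) = \<dots>" .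
  moreover have "corolla_ev (map_ptree (env (y # xs)) (corolla ?k)) = corolla_val xs y"
  proof -
    have "map (env (y # xs)) [2..<?k + 2] = xs"
      by (rule nth_equalityI) (simp_all del: upt_Suc)
    then show ?thesis by (simp add: corolla_def comp_def corolla_val_Nil del: upt_Suc)
  qed
  moreover have "corolla_ev (map_ptree (env [z, x]) (corolla 1)) = pl x z" for z
    by (simp add: corolla_1[simplified] corolla_val_Nil pl_def)
  ultimately show ?thesis
    using corolla_ev_comp[OF _ _ _ T R, of 1 ?us] by simp
qed

text \<open>\<open>pl_corolla_val\<close>, solved for the longer corolla, is the recursion of
  \<open>wact\<close>.\<close>

lemma corolla_val_eq_wact: "corolla_val xs y = wact pl pl xs y"
proof (induction xs rule: length_induct_list)
  case (Cons x xs)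
  have "dsum pl x (\<lambda>zs. corolla_val zs y) xs = dsum pl x (\<lambda>zs. wact pl pl zs y) xs"
    by (rule dsum_cong) (rule Cons)
  then show ?case
    using pl_corolla_val[of x xs y] Cons[of xs] by (simp add: wact_Cons)
qed (simp add: corolla_val_Nil)

text \<open>Composition of the two-vertex corolla with the cherry at the root: \<open>x\<close> is
  grafted onto either leaf of the cherry.\<close>

lemma pl_bracket: "pl x (bracket y z) = bracket (pl x y) z + bracket y (pl x z)"
proof -
  have T: "corolla 1 \<in> LW_trees 2" using corolla_LW[of 1] by (simp add: numeral_2_eq_2)
  let ?R = "cherry (leaf 1) (leaf 2)" and ?us = "[y, z, x]"
  interpret tree_composition 2 2 1 "corolla 1" ?R
    by (rule tree_compositionI[OF _ _ _ T cherry_LW(1)]) auto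
  have v: "vertex (corolla 1) 1 = []" unfolding corolla_1 by (rule vertex_root) simp
  have nc: "\<not> contracted" unfolding contracted_def v by simp
  have "sT 2 = 3" by (simp add: shift_above_def)
  then have T': "T' = Node (Some 1) [leaf 3]" by (simp only: corolla_1 ptree.map list.map option.map sT_i)
  have "sR = (\<lambda>j. j)" by (simp add: shift_by_def fun_eq_iff)
  then have R': "map_ptree sR t = t" for t by (simp add: ptree.map_ident)
  have ins: "insert_tree ?R [l] = graft [(l, leaf 3)] ?R" for l
    by (simp only: insert_tree_def R' T' replace_vertex.simps simp_thms if_True zip_Cons_Cons zip_Nil)
  have gr: "graftings ?R = {[1], [2]}"
    unfolding graftings_def R' T' R_props(3) by (auto simp: length_Suc_conv)
  have "lin_ext scale (\<lambda>t. corolla_ev (map_ptree (env ?us) t)) (LW_tree_comp 2 1 (corolla 1) ?R) = bracket (pl x y) z + bracket y (pl x z)"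
    unfolding LW_tree_comp_eq if_not_P[OF nc] gr
    using ins by (simp add: lin_add[OF linear_lin_ext[OF vs]] vs corolla_val_Nil pl_def)
  moreover have "corolla_ev (map_ptree (env [w, x]) (corolla 1)) = pl x w" for w
    by (simp add: corolla_1[simplified] corolla_val_Nil pl_def)
  ultimately show ?thesis
    using corolla_ev_comp[OF _ _ _ T cherry_LW(1), of 1 ?us] by (simp add: corolla_val_Nil)
qed

text \<open>Composition with the cherry at the leaf, whose parent is labeled: the contraction and
  the two swaps produce the signed difference of corollas with two leaves.\<close>

lemma bracket_pl: "pl (bracket a b) z = corolla_val [a, b] z - corolla_val [b, a] z"
proof -
  have T: "corolla 1 \<in> LW_trees 2" using corolla_LW[of 1] by (simp add: numeral_2_eq_2)
  let ?R = "cherry (leaf 1) (leaf 2)" and ?us = "[z, a, b]"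
  interpret tree_composition 2 2 2 "corolla 1" ?R
    by (rule tree_compositionI[OF _ _ _ T cherry_LW(1)]) auto
  have v: "vertex (corolla 1) 2 = [0]"
    unfolding corolla_1 using vertex_kid[of "Some 1" "[leaf 2]" 0 2] vertex_root[of 2 "[]"] by simp
  have c: contracted
    unfolding contracted_def v using R_props by (simp add: W_trees_iff corolla_1[simplified] Nil_unlabeled)
  have T': "T' = Node (Some 1) [leaf 2]" by (simp add: corolla_1[simplified] shift_above_def)
  have unl: "unlabeled ?R = {[]}" by (auto simp: unlabeled_Node less_Suc_eq numeral_2_eq_2)
  have gr: "graftings S = {[]}" for S unfolding graftings_def T' by auto
  have con: "con (swap_at ?R {}) = ?R" "con (swap_at ?R {[]}) = cherry (leaf 2) (leaf 1)"
    by (simp_all add: swap_at_Node)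
  have "insert_tree (cherry (leaf i) (leaf j)) [] = Node (Some 1) [cherry (leaf (Suc i)) (leaf (Suc j))]" for i j
    unfolding insert_tree_def T' by (simp add: shift_by_def)
  then have ins: "contract_at [0] (insert_tree (cherry (leaf i) (leaf j)) []) = Node (Some 1) [leaf (Suc i), leaf (Suc j)]" for i j
    by simp
  have "lin_ext scale (\<lambda>t. corolla_ev (map_ptree (env ?us) t)) (LW_tree_comp 2 2 (corolla 1) ?R) = corolla_val [a, b] z - corolla_val [b, a] z"
  proof -
    have e: "corolla_ev (map_ptree (env ?us) (Node (Some 1) [leaf (Suc i), leaf (Suc j)])) = corolla_val [?us ! i, ?us ! j] z" for i j
      by (simp add: corolla_val_Nil)
    have eq: "LW_tree_comp 2 2 (corolla 1) ?R = pm_scale ((-1) ^ card ({} :: nat list set)) (unit_vec (Node (Some 1) [leaf (Suc 1), leaf (Suc 2)])) +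
      (pm_scale ((-1) ^ card {[] :: nat list}) (unit_vec (Node (Some 1) [leaf (Suc 2), leaf (Suc 1)])) :: nat ptree \<Rightarrow>\<^sub>0 'k)"
      unfolding LW_tree_comp_eq if_P[OF c] unl gr v Pow_insert Pow_empty
      by (simp add: con[simplified] ins[simplified])
    show ?thesis
      unfolding eq lin_add[OF linear_lin_ext[OF vs]] lin_scale[OF linear_lin_ext[OF vs]] lin_ext_unit[OF vs] e by simp
  qed
  moreover have "corolla_ev (map_ptree (env [z, w]) (corolla 1)) = pl w z" for w
    by (simp add: corolla_1[simplified] corolla_val_Nil pl_def)
  ultimately show ?thesis
    using corolla_ev_comp[OF _ _ _ T cherry_LW(1), of 2 ?us] by (simp add: corolla_val_Nil)
qed

lemma pl_eq: "pl x y = val 2 (corolla 1) [y, x]"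
  by (simp add: pl_def corolla_val_def numeral_2_eq_2)

sublocale post_lie scale bracket pl
proof (intro post_lie.intro post_lie_axioms.intro lie_algebra_axioms pl_bracket)
  have T: "corolla 1 \<in> LW_trees 2" using corolla_LW[of 1] by (simp add: numeral_2_eq_2)
  show "is_linear scale scale (\<lambda>x. pl x y)" for y
    using val_linear[OF _ T, of "[y, 0]" 1] by (simp add: pl_eq)
  have "pl x = (\<lambda>y. val 2 (corolla 1) [y, x])" for x by (simp add: pl_eq fun_eq_iff)
  then show "is_linear scale scale (pl x)" for x
    using val_linear[OF _ T, of "[0, x]" 0] by simp
  show "pl (bracket x y) z = (pl x (pl y z) - pl (pl x y) z) - (pl y (pl x z) - pl (pl y x) z)" for x y z
    by (simp add: bracket_pl corolla_val_eq_wact wact_Cons dsum_Cons)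
qed

end

text \<open>The product \<open>pl\<close> determines the corollas by the recursion; together with
  the common bracket these determine all trees, hence the structure, whose functions are
  extensional.\<close>

lemma PSB_algebra_eqI:
  fixes \<gamma> \<gamma>' :: "nat \<Rightarrow> (nat ptree \<Rightarrow>\<^sub>0 'k::field) set \<Rightarrow> 'g::ab_group_add list \<Rightarrow> 'g"
  assumes "PSB_algebra scale bracket \<gamma>" "PSB_algebra scale bracket \<gamma>'"
    and pl: "PSB_algebra.pl \<gamma> = PSB_algebra.pl \<gamma>'"
  shows "\<gamma> = \<gamma>'"
proof -
  interpret a: PSB_algebra scale bracket \<gamma> by fact
  interpret b: PSB_algebra scale bracket \<gamma>' by fact
  have c: "a.corolla_val = b.corolla_val"
    by (intro HOL.ext) (simp only: a.corolla_val_eq_wact b.corolla_val_eq_wact pl)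
  have e: "a.corolla_ev t = b.corolla_ev t" for t
  proof (induction t)
    case (Node l us)
    then have "map a.corolla_ev us = map b.corolla_ev us" by simp
    then show ?case by (simp only: a.corolla_ev.simps b.corolla_ev.simps c)
  qed
  have val: "a.val n t us = b.val n t us" if "1 \<le> n" "t \<in> LW_trees n" for n t us
  proof (cases "length us = n")
    case True
    then show ?thesis using that by (simp only: a.val_eq b.val_eq e)
  next
    case False
    have "unit_vec t \<in> (LW_space n :: (nat ptree \<Rightarrow>\<^sub>0 'k) set)" using that by simp
    then show ?thesis
      using a.hom_closed[OF that(1)] b.hom_closed[OF that(1)] False
      by (simp add: end_simps a.val_def b.val_def PSB_class_eq that)
  qed
  have n: "\<gamma> n = \<gamma>' n" if n: "1 \<le> n" for n
  proof (rule extensionalityI)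
    show "\<gamma> n \<in> extensional (carrier (op_space PSB n))" "\<gamma>' n \<in> extensional (carrier (op_space PSB n))"
      using a.hom b.hom n by (simp_all add: operad_homs_def)
    fix X :: "(nat ptree \<Rightarrow>\<^sub>0 'k) set" assume "X \<in> carrier (op_space PSB n)"
    then obtain x where x: "x \<in> LW_space n" "X = psb_coset n x" by (auto simp: carrier_PSB[OF n])
    have "\<gamma> n X us = \<gamma>' n X us" for us
      unfolding x(2) a.hom_eq_lin_ext[OF n x(1)] b.hom_eq_lin_ext[OF n x(1)]
      by (rule lin_ext_cong) (use val[OF n] x(1) in blast)
    then show "\<gamma> n X = \<gamma>' n X" by (rule HOL.ext)
  qed
  show ?thesis
  proof (rule extensionalityI)
    show "\<gamma> \<in> extensional {1..}" "\<gamma>' \<in> extensional {1..}"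
      using a.hom b.hom by (simp_all add: operad_homs_def)
  qed (use n in simp)
qed

subsection \<open>The correspondence\<close>

definition D_product :: "('k::field \<Rightarrow> 'g::ab_group_add \<Rightarrow> 'g) \<Rightarrow> ('g \<Rightarrow> 'g \<Rightarrow> 'g)
     \<Rightarrow> (nat \<Rightarrow> (nat ptree \<Rightarrow>\<^sub>0 'k) set \<Rightarrow> 'g list \<Rightarrow> 'g)
     \<Rightarrow> (('g list \<Rightarrow>\<^sub>0 'k) set \<Rightarrow> ('g list \<Rightarrow>\<^sub>0 'k) set \<Rightarrow> ('g list \<Rightarrow>\<^sub>0 'k) set)" where
  "D_product scale bracket \<gamma> = post_lie.tri scale bracket (PSB_algebra.pl \<gamma>)"

context lie_algebra_char_0
begin

lemma D_product_structure:
  assumes "\<gamma> \<in> PSB_structures scale bracket"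
  shows "D_product scale bracket \<gamma> \<in> D_bialgebra_structures_uea scale bracket"
    and "corresponds scale bracket \<gamma> (D_product scale bracket \<gamma>)"
proof -
  interpret a: PSB_algebra scale bracket \<gamma> by unfold_locales (rule assms)
  interpret a: post_lie_char_0 scale bracket a.pl by unfold_locales
  show "D_product scale bracket \<gamma> \<in> D_bialgebra_structures_uea scale bracket"
    using a.tri_PiE a.D_bialgebra_tri by (simp add: D_bialgebra_structures_uea_def D_product_def)
  show "corresponds scale bracket \<gamma> (D_product scale bracket \<gamma>)"
    unfolding corresponds_def Let_def D_product_def foldr_iota a.tri_wcls_iota
    by (simp only: a.corolla_val_eq_wact[symmetric] a.corolla_val_def a.val_def simp_thms)
qed

lemma D_product_iota:
  assumes "\<gamma> \<in> PSB_structures scale bracket"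
  shows "D_product scale bracket \<gamma> (\<iota> x) (\<iota> y) = \<iota> (PSB_algebra.pl \<gamma> x y)"
proof -
  interpret a: PSB_algebra scale bracket \<gamma> by unfold_locales (rule assms)
  show ?thesis using a.tri_wcls_iota[of "[x]" y] by (simp add: D_product_def wact_Cons iota_eq)
qed

text \<open>Restricting |> to g recovers \<open>pl\<close>, because \<open>\<iota>\<close> is
  injective.\<close>

lemma inj_on_D_product: "inj_on (D_product scale bracket) (PSB_structures scale bracket)"
proof (rule inj_onI)
  fix \<gamma> \<gamma>' assume g: "\<gamma> \<in> PSB_structures scale bracket" "\<gamma>' \<in> PSB_structures scale bracket"
    and eq: "D_product scale bracket \<gamma> = D_product scale bracket \<gamma>'"
  have "\<iota> (PSB_algebra.pl \<gamma> x y) = \<iota> (PSB_algebra.pl \<gamma>' x y)" for x y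
    unfolding D_product_iota[OF g(1), symmetric] D_product_iota[OF g(2), symmetric] eq ..
  then have "PSB_algebra.pl \<gamma> = PSB_algebra.pl \<gamma>'"
    using inj_iota by (auto simp: inj_def fun_eq_iff)
  moreover have "PSB_algebra scale bracket \<gamma>" "PSB_algebra scale bracket \<gamma>'"
    by (intro PSB_algebra.intro PSB_algebra_axioms.intro lie_algebra_axioms g)+
  ultimately show "\<gamma> = \<gamma>'" by (intro PSB_algebra_eqI)
qed

text \<open>The post-Lie product extracted from \<open>tr\<close> yields a \<open>PSB\<close>
  structure by evaluation of trees. Its two-vertex corolla is that product again, so uniqueness
  identifies \<open>tr\<close> with the product built from it.\<close>

lemma D_product_surj:
  assumes "tr \<in> D_bialgebra_structures_uea scale bracket"
  shows "tr \<in> D_product scale bracket ` PSB_structures scale bracket"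
proof -
  have tr: "tr \<in> carrier D \<rightarrow>\<^sub>E (carrier D \<rightarrow>\<^sub>E carrier D)" "D_bialgebra D Flt tr"
    using assms by (simp_all add: D_bialgebra_structures_uea_def)
  interpret d: D_bialg_on_uea scale bracket tr by (intro D_bialg_on_uea.intro D_bialg_on_uea_axioms.intro lie_algebra_char_0_axioms tr(2))
  interpret p: post_lie scale bracket d.pl by (rule d.post_lie_pl)
  interpret p: D_bialg_pl scale bracket tr d.pl
    by unfold_locales (simp add: d.iota_pl)
  have g: "p.gam \<in> PSB_structures scale bracket" by (rule p.gam_PSB_structure)
  interpret a: PSB_algebra scale bracket p.gam by unfold_locales (rule g)
  have "a.pl = d.pl"
    by (intro HOL.ext) (simp only: a.pl_eq a.val_def p.gam_corolla_1)
  then have D: "D_product scale bracket p.gam = p.tri" by (simp add: D_product_def)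
  have "tr = p.tri"
  proof (rule PiE_ext[OF tr(1) p.tri_PiE])
    fix X assume X: "X \<in> carrier D"
    show "tr X = p.tri X"
      by (rule PiE_ext[OF PiE_mem[OF tr(1) X] PiE_mem[OF p.tri_PiE X]]) (rule p.tr_eq_tri[OF X])
  qed
  then have "tr = D_product scale bracket p.gam" by (rule trans[OF _ D[symmetric]])
  then show ?thesis by (rule image_eqI[OF _ g])
qed

end

theorem theorem21:
  fixes scale :: "'k::field_char_0 \<Rightarrow> 'g::ab_group_add \<Rightarrow> 'g"
    and bracket :: "'g \<Rightarrow> 'g \<Rightarrow> 'g"
  assumes "lie_algebra scale bracket"
  shows "\<exists>\<Phi>. bij_betw \<Phi> (PSB_structures scale bracket) (D_bialgebra_structures_uea scale bracket) \<and>
             (\<forall>\<gamma>\<in>PSB_structures scale bracket. corresponds scale bracket \<gamma> (\<Phi> \<gamma>))"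
proof -
  interpret lie_algebra scale bracket by fact
  interpret lie_algebra_char_0 scale bracket by unfold_locales
  show ?thesis
    by (intro exI[of _ "D_product scale bracket"] conjI bij_betw_imageI inj_on_D_product)
      (use D_product_structure D_product_surj in blast)+
qed

end
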